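(* Let $k$ be a field of characteristic $0$, let $X$ be a smooth projective geometrically integral curve over $k$ with function field $K$, and let $U$ be a non-empty Zariski open subset of $X$. Let $T$ be a $K$-torus. Consider the diagonal injection $$\iota_T : T(K) \to \prod_{v\in U^{(1)}}{}' \, T(K_v).$$ Then the image of $\iota_T$ is closed and discrete in $\prod'_{v\in U^{(1)}} T(K_v)$.
   Context: $U^{(1)}$ is the set of closed points of $U$. For a closed point $v$, $K_v$ is the completion of $K$ with respect to the discrete valuation defined by $v$, with ring of integers $\mathcal{O}_v$. Choose a non-empty open subset $U_0\subset U$ and a torus $\mathcal{T}$ over $U_0$ extending $T$; $\prod'_{v\in U^{(1)}} T(K_v)$ is the restricted product of the groups $T(K_v)$, $v \in U^{(1)}$, with respect to the subgroups $\mathcal{T}(\mathcal{O}_v)$, $v\in U_0^{(1)}$ (it does not depend on the choices), equipped with the restricted product topology associated with the $v$-adic topologies on the $T(K_v)$. *)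

theory Defs
  imports
    "HOL-Algebra.Algebraic_Closure_Type"
    "HOL-Algebra.QuotRing"
    "HOL-Analysis.Function_Topology"
    "HOL-Library.Poly_Mapping"
begin

section \<open>Multivariate polynomials\<close>

text \<open>Polynomials in the variables \<open>0, 1, 2, \<dots>\<close>: finitely supported functions from monomials
  (finitely supported exponent vectors) to coefficients.\<close>

type_synonym 'a mpoly = "(nat \<Rightarrow>\<^sub>0 nat) \<Rightarrow>\<^sub>0 'a"

definition mvar :: "nat \<Rightarrow> 'a::comm_ring_1 mpoly" where
  "mvar i = Poly_Mapping.single (Poly_Mapping.single i 1) 1"

definition mconst :: "'a::comm_ring_1 \<Rightarrow> 'a mpoly" where
  "mconst c = Poly_Mapping.single 0 c"

definition mpolys :: "nat \<Rightarrow> 'a::comm_ring_1 set \<Rightarrow> 'a mpoly set" where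
  "mpolys n R = {p. \<forall>m \<in> Poly_Mapping.keys p.
                      Poly_Mapping.keys m \<subseteq> {..<n} \<and> Poly_Mapping.lookup p m \<in> R}"

definition mev :: "('a::comm_ring_1 \<Rightarrow> 'b::comm_ring_1) \<Rightarrow> 'a mpoly \<Rightarrow> (nat \<Rightarrow> 'b) \<Rightarrow> 'b" where
  "mev h p x = (\<Sum>m \<in> Poly_Mapping.keys p. h (Poly_Mapping.lookup p m) *
                  (\<Prod>i \<in> Poly_Mapping.keys m. x i ^ Poly_Mapping.lookup m i))"

definition mev_ring :: "('b, 'c) ring_scheme \<Rightarrow> ('a::comm_ring_1 \<Rightarrow> 'b) \<Rightarrow> 'a mpoly \<Rightarrow> (nat \<Rightarrow> 'b) \<Rightarrow> 'b" where
  "mev_ring A h p x = finsum A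
     (\<lambda>m. h (Poly_Mapping.lookup p m) \<otimes>\<^bsub>A\<^esub>
            finprod A (\<lambda>i. x i [^]\<^bsub>A\<^esub> Poly_Mapping.lookup m i) (Poly_Mapping.keys m))
     (Poly_Mapping.keys p)"

definition msubst :: "'a::comm_ring_1 mpoly \<Rightarrow> (nat \<Rightarrow> 'a mpoly) \<Rightarrow> 'a mpoly" where
  "msubst p g = mev mconst p g"

definition mpderiv :: "nat \<Rightarrow> 'a::comm_ring_1 mpoly \<Rightarrow> 'a mpoly" where
  "mpderiv j p = (\<Sum>m \<in> Poly_Mapping.keys p. Poly_Mapping.single
     (m - Poly_Mapping.single j 1) (of_nat (Poly_Mapping.lookup m j) * Poly_Mapping.lookup p m))"

definition subring_of :: "'a::comm_ring_1 set \<Rightarrow> 'a ring" where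
  "subring_of A = ring_of_type_algebra\<lparr>carrier := A\<rparr>"

definition mideal :: "nat \<Rightarrow> 'a::comm_ring_1 set \<Rightarrow> 'a mpoly set \<Rightarrow> 'a mpoly set" where
  "mideal n R F = genideal (subring_of (mpolys n R)) F"


section \<open>Integral projective schemes with a given function field\<close>

text \<open>An integral closed subscheme of projective \<open>N\<close>-space over \<open>k\<close> with function field
  identified with \<open>K\<close> is given by the embedding of \<open>k\<close> into \<open>K\<close> and the homogeneous coordinates
  \<open>(x\<^sub>0 : \<dots> : x\<^sub>N)\<close> in \<open>K\<close> of its generic point.  Its standard affine charts are the spectra of
  \<open>k[x\<^sub>0/x\<^sub>i, \<dots>, x\<^sub>N/x\<^sub>i]\<close>, for \<open>x\<^sub>i \<noteq> 0\<close>.  As the scheme is integral and separated, a point is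
  determined by its local ring inside \<open>K\<close>, and points are represented by these local rings.\<close>

record ('k, 'a) pscheme =
  base_emb :: "'k \<Rightarrow> 'a"
  proj_dim :: nat
  hcoord :: "nat \<Rightarrow> 'a"

definition chart_index :: "('k, 'a::field) pscheme \<Rightarrow> nat set" where
  "chart_index \<X> = {i. i \<le> proj_dim \<X> \<and> hcoord \<X> i \<noteq> 0}"

definition acoord :: "('k, 'a::field) pscheme \<Rightarrow> nat \<Rightarrow> nat \<Rightarrow> 'a" where
  "acoord \<X> i j = hcoord \<X> j / hcoord \<X> i"

definition chart :: "('k::field, 'a::field) pscheme \<Rightarrow> nat \<Rightarrow> 'a set" where
  "chart \<X> i = {mev (base_emb \<X>) f (acoord \<X> i) | f. f \<in> mpolys (Suc (proj_dim \<X>)) UNIV}"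

definition chart_ideal :: "('k::field, 'a::field) pscheme \<Rightarrow> nat \<Rightarrow> 'k mpoly set" where
  "chart_ideal \<X> i = {f \<in> mpolys (Suc (proj_dim \<X>)) UNIV. mev (base_emb \<X>) f (acoord \<X> i) = 0}"

definition integral_projective :: "('k::field, 'a::field) pscheme \<Rightarrow> bool" where
  "integral_projective \<X> \<longleftrightarrow>
     base_emb \<X> \<in> ring_hom ring_of_type_algebra ring_of_type_algebra \<and>
     chart_index \<X> \<noteq> {} \<and>
     (\<forall>i \<in> chart_index \<X>. \<forall>z. \<exists>a \<in> chart \<X> i. \<exists>b \<in> chart \<X> i. b \<noteq> 0 \<and> z = a / b)"

definition localize :: "'a::field set \<Rightarrow> 'a set \<Rightarrow> 'a set" where
  "localize A p = {a / b | a b. a \<in> A \<and> b \<in> A - p}"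

definition basic_open :: "'a::field set \<Rightarrow> 'a \<Rightarrow> 'a set set" where
  "basic_open A f = {localize A p | p. primeideal p (subring_of A) \<and> f \<notin> p}"

definition spec :: "'a::field set \<Rightarrow> 'a set set" where
  "spec A = {localize A p | p. primeideal p (subring_of A)}"

definition zariski :: "('k::field, 'a::field) pscheme \<Rightarrow> 'a set topology" where
  "zariski \<X> = topology_generated_by
     {basic_open (chart \<X> i) f | i f. i \<in> chart_index \<X> \<and> f \<in> chart \<X> i}"

definition closed_points :: "('k::field, 'a::field) pscheme \<Rightarrow> 'a set set \<Rightarrow> 'a set set" where
  "closed_points \<X> U = {P \<in> U. closedin (subtopology (zariski \<X>) U) {P}}"

text \<open>For nonempty open \<open>V\<close>, the ring \<open>\<O>(V)\<close> is the intersection of the local rings at the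
  points of \<open>V\<close>.  The second condition below says that the canonical map from \<open>V\<close> to
  \<open>Spec \<O>(V)\<close> is an isomorphism; the empty set does not satisfy it.\<close>

definition sections :: "'a set set \<Rightarrow> 'a set" where
  "sections V = \<Inter>V"

definition affine_open :: "('k::field, 'a::field) pscheme \<Rightarrow> 'a set set \<Rightarrow> bool" where
  "affine_open \<X> V \<longleftrightarrow> openin (zariski \<X>) V \<and> spec (sections V) = V"

definition has_prime_chain :: "'a::field set \<Rightarrow> nat \<Rightarrow> bool" where
  "has_prime_chain A l \<longleftrightarrow> (\<exists>p. (\<forall>i \<le> l. primeideal (p i) (subring_of A)) \<and>
                                (\<forall>i < l. p i \<subset> p (Suc i)))"

definition has_dimension :: "('k::field, 'a::field) pscheme \<Rightarrow> nat \<Rightarrow> bool" where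
  "has_dimension \<X> d \<longleftrightarrow> (\<exists>i \<in> chart_index \<X>. has_prime_chain (chart \<X> i) d) \<and>
                         (\<forall>i \<in> chart_index \<X>. \<not> has_prime_chain (chart \<X> i) (Suc d))"

text \<open>Each chart of the base change to an algebraic closure of \<open>k\<close> is integral: the ideal of the
  chart extends to a prime ideal.  (The charts with \<open>x\<^sub>i = 0\<close> are empty, and the others meet
  pairwise, so this is integrality of the base change.)\<close>

definition geometrically_integral :: "('k::field, 'a::field) pscheme \<Rightarrow> bool" where
  "geometrically_integral \<X> \<longleftrightarrow> (\<forall>i \<in> chart_index \<X>.
     primeideal
       (mideal (Suc (proj_dim \<X>)) UNIV
         (Poly_Mapping.map (to_ac :: 'k \<Rightarrow> 'k alg_closure) ` chart_ideal \<X> i))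
       (subring_of (mpolys (Suc (proj_dim \<X>)) UNIV)))"

text \<open>Smoothness of relative dimension 1, by the Jacobian criterion: the chart sits in affine
  \<open>(N+1)\<close>-space, and at each of its points the differentials of some \<open>N\<close> equations are linearly
  independent over the residue field.  Independence over the residue field, the fraction field of
  \<open>A/p\<close>, is tested with coefficients from \<open>A\<close>.\<close>

definition smooth_at :: "('k::field, 'a::field) pscheme \<Rightarrow> nat \<Rightarrow> 'a set \<Rightarrow> bool" where
  "smooth_at \<X> i p \<longleftrightarrow> (\<exists>f. (\<forall>a < proj_dim \<X>. f a \<in> chart_ideal \<X> i) \<and>
     (\<forall>c. (\<forall>a < proj_dim \<X>. c a \<in> chart \<X> i) \<and>
          (\<forall>j \<le> proj_dim \<X>.
             (\<Sum>a < proj_dim \<X>. c a * mev (base_emb \<X>) (mpderiv j (f a)) (acoord \<X> i)) \<in> p)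
        \<longrightarrow> (\<forall>a < proj_dim \<X>. c a \<in> p)))"

definition smooth_projective_curve :: "('k::field, 'a::field) pscheme \<Rightarrow> bool" where
  "smooth_projective_curve \<X> \<longleftrightarrow>
     integral_projective \<X> \<and> has_dimension \<X> 1 \<and>
     (\<forall>i \<in> chart_index \<X>. \<forall>p. primeideal p (subring_of (chart \<X> i)) \<longrightarrow> smooth_at \<X> i p)"


section \<open>Completions\<close>

text \<open>Throughout this section \<open>P\<close> is a discrete valuation ring of the field.\<close>

definition max_ideal :: "'a::field set \<Rightarrow> 'a set" where
  "max_ideal P = {x \<in> P. x = 0 \<or> inverse x \<notin> P}"

definition uniformizer :: "'a::field set \<Rightarrow> 'a \<Rightarrow> bool" where
  "uniformizer P t \<longleftrightarrow> t \<noteq> 0 \<and> max_ideal P = (\<lambda>a. t * a) ` P"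

definition ord_at :: "'a::field set \<Rightarrow> 'a \<Rightarrow> int" where
  "ord_at P x = (THE n. \<exists>t u. uniformizer P t \<and> u \<in> P - max_ideal P \<and> x = u * t powi n)"

definition val_ge :: "'a::field set \<Rightarrow> int \<Rightarrow> 'a \<Rightarrow> bool" where
  "val_ge P n x \<longleftrightarrow> x = 0 \<or> n \<le> ord_at P x"

definition cauchy_seqs :: "'a::field set \<Rightarrow> (nat \<Rightarrow> 'a) ring" where
  "cauchy_seqs P =
     \<lparr>carrier = {s. \<forall>n. \<exists>N. \<forall>i \<ge> N. \<forall>j \<ge> N. val_ge P n (s i - s j)},
      monoid.mult = (\<lambda>s t i. s i * t i), one = (\<lambda>_. 1), ring.zero = (\<lambda>_. 0),
      add = (\<lambda>s t i. s i + t i)\<rparr>"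

definition null_seqs :: "'a::field set \<Rightarrow> (nat \<Rightarrow> 'a) set" where
  "null_seqs P = {s. \<forall>n. \<forall>\<^sub>F i in sequentially. val_ge P n (s i)}"

definition completion :: "'a::field set \<Rightarrow> (nat \<Rightarrow> 'a) set ring" where
  "completion P = cauchy_seqs P Quot null_seqs P"

definition to_completion :: "'a::field set \<Rightarrow> 'a \<Rightarrow> (nat \<Rightarrow> 'a) set" where
  "to_completion P x = null_seqs P +>\<^bsub>cauchy_seqs P\<^esub> (\<lambda>_. x)"

definition cval_ge :: "'a::field set \<Rightarrow> int \<Rightarrow> (nat \<Rightarrow> 'a) set \<Rightarrow> bool" where
  "cval_ge P n z \<longleftrightarrow> (\<exists>s \<in> z. \<forall>\<^sub>F i in sequentially. val_ge P n (s i))"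

definition completion_integers :: "'a::field set \<Rightarrow> (nat \<Rightarrow> 'a) set set" where
  "completion_integers P = {z \<in> carrier (completion P). cval_ge P 0 z}"

definition adic_topology :: "'a::field set \<Rightarrow> (nat \<Rightarrow> 'a) set topology" where
  "adic_topology P = topology_generated_by
     {{y \<in> carrier (completion P). cval_ge P n (y \<ominus>\<^bsub>completion P\<^esub> z)} | n z.
        z \<in> carrier (completion P)}"


section \<open>Affine group schemes of finite presentation and tori\<close>

text \<open>A closed subscheme of affine \<open>gdim\<close>-space over \<open>R\<close>, with group law given by polynomials.
  The first \<open>gdim\<close> variables of \<open>gmul\<close> are the coordinates of the first factor, the next \<open>gdim\<close>
  variables those of the second factor.\<close>

record (overloaded) 'a gscheme =
  gdim :: nat
  geqs :: "'a mpoly set"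
  gmul :: "nat \<Rightarrow> 'a mpoly"
  gone :: "nat \<Rightarrow> 'a"
  ginv :: "nat \<Rightarrow> 'a mpoly"

definition block :: "'a::comm_ring_1 gscheme \<Rightarrow> nat \<Rightarrow> nat \<Rightarrow> 'a mpoly" where
  "block T b i = mvar (b * gdim T + i)"

text \<open>The ideal of the \<open>b\<close>-fold product of \<open>T\<close> with itself.\<close>

definition gideal :: "nat \<Rightarrow> 'a::comm_ring_1 set \<Rightarrow> 'a gscheme \<Rightarrow> 'a mpoly set" where
  "gideal b R T = mideal (b * gdim T) R {msubst e (block T c) | e c. e \<in> geqs T \<and> c < b}"

definition gprod :: "'a::comm_ring_1 gscheme \<Rightarrow> (nat \<Rightarrow> 'a mpoly) \<Rightarrow> (nat \<Rightarrow> 'a mpoly) \<Rightarrow> nat \<Rightarrow> 'a mpoly" where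
  "gprod T x y i = msubst (gmul T i) (\<lambda>j. if j < gdim T then x j else y (j - gdim T))"

definition group_scheme :: "'a::comm_ring_1 set \<Rightarrow> 'a gscheme \<Rightarrow> bool" where
  "group_scheme R T \<longleftrightarrow>
     (let m = gdim T; x = block T 0; y = block T 1; z = block T 2;
          e = (\<lambda>i. mconst (gone T i)) in
      finite (geqs T) \<and> geqs T \<subseteq> mpolys m R \<and>
      (\<forall>i < m. gmul T i \<in> mpolys (2 * m) R \<and> gone T i \<in> R \<and> ginv T i \<in> mpolys m R) \<and>
      (\<forall>q \<in> geqs T. msubst q (gprod T x y) \<in> gideal 2 R T \<and>
                    mev id q (gone T) = 0 \<and>
                    msubst q (ginv T) \<in> gideal 1 R T) \<and>
      (\<forall>i < m. gprod T (gprod T x y) z i - gprod T x (gprod T y z) i \<in> gideal 3 R T \<and>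
               gprod T e x i - x i \<in> gideal 1 R T \<and>
               gprod T x e i - x i \<in> gideal 1 R T \<and>
               gprod T (ginv T) x i - e i \<in> gideal 1 R T \<and>
               gprod T x (ginv T) i - e i \<in> gideal 1 R T))"

definition gs_hom :: "'a::comm_ring_1 set \<Rightarrow> 'a gscheme \<Rightarrow> 'a gscheme \<Rightarrow> (nat \<Rightarrow> 'a mpoly) \<Rightarrow> bool" where
  "gs_hom R T T' f \<longleftrightarrow>
     (\<forall>j < gdim T'. f j \<in> mpolys (gdim T) R) \<and>
     (\<forall>q \<in> geqs T'. msubst q f \<in> gideal 1 R T) \<and>
     (\<forall>j < gdim T'.
        msubst (f j) (gprod T (block T 0) (block T 1)) -
        gprod T' (\<lambda>i. msubst (f i) (block T 0)) (\<lambda>i. msubst (f i) (block T 1)) j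
          \<in> gideal 2 R T)"

definition gs_iso :: "'a::comm_ring_1 set \<Rightarrow> 'a gscheme \<Rightarrow> 'a gscheme \<Rightarrow> (nat \<Rightarrow> 'a mpoly) \<Rightarrow> bool" where
  "gs_iso R T T' f \<longleftrightarrow> gs_hom R T T' f \<and>
     (\<exists>g. gs_hom R T' T g \<and>
          (\<forall>i < gdim T. msubst (g i) f - mvar i \<in> gideal 1 R T) \<and>
          (\<forall>j < gdim T'. msubst (f j) g - mvar j \<in> gideal 1 R T'))"

definition base_change :: "('a::comm_ring_1 \<Rightarrow> 'b::comm_ring_1) \<Rightarrow> 'a gscheme \<Rightarrow> 'b gscheme" where
  "base_change h T =
     \<lparr>gdim = gdim T, geqs = Poly_Mapping.map h ` geqs T,
      gmul = (\<lambda>i. Poly_Mapping.map h (gmul T i)),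
      gone = (\<lambda>i. h (gone T i)),
      ginv = (\<lambda>i. Poly_Mapping.map h (ginv T i))\<rparr>"

text \<open>The \<open>r\<close>-th power of the multiplicative group, with coordinates \<open>x\<^sub>0, \<dots>, x\<^sub>r\<^sub>-\<^sub>1\<close> followed by
  their inverses.\<close>

definition Gm_power :: "nat \<Rightarrow> 'a::comm_ring_1 gscheme" where
  "Gm_power r =
     \<lparr>gdim = 2 * r, geqs = {mvar i * mvar (r + i) - 1 | i. i < r},
      gmul = (\<lambda>i. mvar i * mvar (2 * r + i)),
      gone = (\<lambda>i. 1),
      ginv = (\<lambda>i. if i < r then mvar (r + i) else mvar (i - r))\<rparr>"

definition splits_over :: "('a::comm_ring_1 \<Rightarrow> 'b::comm_ring_1) \<Rightarrow> 'b set \<Rightarrow> 'a gscheme \<Rightarrow> bool" where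
  "splits_over h S T \<longleftrightarrow> (\<exists>r f. gs_iso S (base_change h T) (Gm_power r) f)"

definition torus_over_field :: "'a::field gscheme \<Rightarrow> bool" where
  "torus_over_field T \<longleftrightarrow> group_scheme UNIV T \<and>
     splits_over (to_ac :: 'a \<Rightarrow> 'a alg_closure) UNIV T"

text \<open>Flatness is stated by the equational criterion.\<close>

definition flat_over :: "('a::comm_ring_1 \<Rightarrow> 'b::comm_ring_1) \<Rightarrow> 'a set \<Rightarrow> 'b set \<Rightarrow> bool" where
  "flat_over h R S \<longleftrightarrow>
     (\<forall>(n::nat) r s. (\<forall>i < n. r i \<in> R \<and> s i \<in> S) \<and> (\<Sum>i < n. h (r i) * s i) = 0 \<longrightarrow>
        (\<exists>(l::nat) a t. (\<forall>i < n. \<forall>j < l. a i j \<in> R) \<and> (\<forall>j < l. t j \<in> S) \<and>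
           (\<forall>i < n. s i = (\<Sum>j < l. h (a i j) * t j)) \<and>
           (\<forall>j < l. (\<Sum>i < n. r i * a i j) = 0)))"

definition faithfully_flat :: "('a::comm_ring_1 \<Rightarrow> 'b::comm_ring_1) \<Rightarrow> 'a set \<Rightarrow> 'b set \<Rightarrow> bool" where
  "faithfully_flat h R S \<longleftrightarrow> subring S ring_of_type_algebra \<and> h ` R \<subseteq> S \<and> flat_over h R S \<and>
     (\<forall>p. maximalideal p (subring_of R) \<longrightarrow> genideal (subring_of S) (h ` p) \<noteq> S)"

text \<open>A torus over a normal domain \<open>R\<close> with fraction field \<open>K\<close>: a group scheme that becomes split
  over a faithfully flat extension of \<open>R\<close>.  Tori over a normal base are isotrivial (SGA 3, X.5.16),
  that is, split by a finite etale connected cover, so it loses nothing to take the extension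
  inside an algebraic closure of \<open>K\<close>.\<close>

definition torus_over_ring :: "'a::field set \<Rightarrow> 'a gscheme \<Rightarrow> bool" where
  "torus_over_ring R T \<longleftrightarrow> group_scheme R T \<and>
     (\<exists>S. faithfully_flat (to_ac :: 'a \<Rightarrow> 'a alg_closure) R S \<and> splits_over to_ac S T)"

text \<open>A torus over the open subscheme \<open>U0\<close> of \<open>\<X>\<close> extending the torus \<open>T\<close> over the function field,
  described by gluing: a finite cover \<open>C\<close> of \<open>U0\<close> by affine opens, for each \<open>V\<close> in \<open>C\<close> a torus
  \<open>G V\<close> over \<open>\<O>(V)\<close> and an isomorphism \<open>\<phi> V\<close> from its generic fibre to \<open>T\<close>, such that the
  resulting identifications of generic fibres extend to isomorphisms over the overlaps.
  (Intersections of affine opens are affine, and the extensions are unique, so the cocycle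
  condition is automatic.)\<close>

definition torus_extending ::
  "('k::field, 'a::field) pscheme \<Rightarrow> 'a set set \<Rightarrow> 'a gscheme \<Rightarrow>
   'a set set set \<Rightarrow> ('a set set \<Rightarrow> 'a gscheme) \<Rightarrow> ('a set set \<Rightarrow> nat \<Rightarrow> 'a mpoly) \<Rightarrow> bool" where
  "torus_extending \<X> U0 T C G \<phi> \<longleftrightarrow>
     finite C \<and> \<Union>C = U0 \<and>
     (\<forall>V \<in> C. affine_open \<X> V \<and> torus_over_ring (sections V) (G V) \<and> gs_iso UNIV (G V) T (\<phi> V)) \<and>
     (\<forall>V \<in> C. \<forall>W \<in> C. \<exists>f. gs_iso (sections (V \<inter> W)) (G V) (G W) f \<and>
        (\<forall>j < gdim T. msubst (\<phi> W j) f - \<phi> V j \<in> gideal 1 UNIV (G V)))"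


section \<open>Local points and the restricted product\<close>

definition gpoints :: "('b, 'c) ring_scheme \<Rightarrow> ('a::comm_ring_1 \<Rightarrow> 'b) \<Rightarrow> 'b set \<Rightarrow> 'a gscheme \<Rightarrow> (nat \<Rightarrow> 'b) set" where
  "gpoints A h D T = {x \<in> {..<gdim T} \<rightarrow>\<^sub>E D. \<forall>q \<in> geqs T. mev_ring A h q x = \<zero>\<^bsub>A\<^esub>}"

definition rational_points :: "'a::comm_ring_1 gscheme \<Rightarrow> (nat \<Rightarrow> 'a) set" where
  "rational_points T = {x \<in> {..<gdim T} \<rightarrow>\<^sub>E UNIV. \<forall>q \<in> geqs T. mev id q x = 0}"

definition local_points :: "'a::field gscheme \<Rightarrow> 'a set \<Rightarrow> (nat \<Rightarrow> (nat \<Rightarrow> 'a) set) set" where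
  "local_points T P = gpoints (completion P) (to_completion P) (carrier (completion P)) T"

definition local_topology :: "'a::field gscheme \<Rightarrow> 'a set \<Rightarrow> (nat \<Rightarrow> (nat \<Rightarrow> 'a) set) topology" where
  "local_topology T P =
     subtopology (product_topology (\<lambda>_. adic_topology P) {..<gdim T}) (local_points T P)"

text \<open>The image in \<open>T(K\<^sub>v)\<close> of the \<open>\<O>\<^sub>v\<close>-points of the torus over \<open>U0\<close>; by the gluing condition
  all \<open>V\<close> containing \<open>v\<close> contribute the same set.\<close>

definition integral_points ::
  "'a::field gscheme \<Rightarrow> 'a set set set \<Rightarrow> ('a set set \<Rightarrow> 'a gscheme) \<Rightarrow>
   ('a set set \<Rightarrow> nat \<Rightarrow> 'a mpoly) \<Rightarrow> 'a set \<Rightarrow> (nat \<Rightarrow> (nat \<Rightarrow> 'a) set) set" where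
  "integral_points T C G \<phi> P =
     {\<lambda>j\<in>{..<gdim T}. mev_ring (completion P) (to_completion P) (\<phi> V j) y | V y.
        V \<in> C \<and> P \<in> V \<and>
        y \<in> gpoints (completion P) (to_completion P) (completion_integers P) (G V)}"

text \<open>The restricted product of the spaces \<open>Y i\<close>, \<open>i \<in> I\<close>, with respect to subsets \<open>M i\<close> given for
  all but finitely many \<open>i\<close>, namely for \<open>i \<in> J\<close>.\<close>

definition restricted_product :: "'i set \<Rightarrow> ('i \<Rightarrow> 'b topology) \<Rightarrow> 'i set \<Rightarrow> ('i \<Rightarrow> 'b set) \<Rightarrow> ('i \<Rightarrow> 'b) topology" where
  "restricted_product I Y J M = topology_generated_by
     {Pi\<^sub>E I W | W. \<exists>S. finite S \<and> S \<subseteq> I \<and> I - J \<subseteq> S \<and>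
        (\<forall>i \<in> S. openin (Y i) (W i)) \<and> (\<forall>i \<in> I - S. W i = M i)}"

lemma topspace_restricted_product:
  assumes "finite (I - J)" and M: "\<And>i. i \<in> I \<inter> J \<Longrightarrow> M i \<subseteq> topspace (Y i)"
  shows "topspace (restricted_product I Y J M) =
    {x \<in> Pi\<^sub>E I (\<lambda>i. topspace (Y i)). finite {i \<in> I \<inter> J. x i \<notin> M i}}"
proof (intro Set.set_eqI iffI)
  fix x assume "x \<in> topspace (restricted_product I Y J M)"
  then obtain W S where x: "x \<in> Pi\<^sub>E I W" and S: "finite S" "S \<subseteq> I" "I - J \<subseteq> S"
      "\<forall>i\<in>S. openin (Y i) (W i)" "\<forall>i\<in>I - S. W i = M i"
    unfolding restricted_product_def topology_generated_by_topspace by blast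
  have "x i \<in> topspace (Y i)" if "i \<in> I" for i
  proof (cases "i \<in> S")
    case True
    with S x that show ?thesis using openin_subset by (fastforce simp: PiE_iff)
  next
    case False
    with S that have "W i = M i" "i \<in> I \<inter> J" by auto
    with x that M show ?thesis by (metis PiE_mem subsetD)
  qed
  moreover have "{i \<in> I \<inter> J. x i \<notin> M i} \<subseteq> S"
    using x S(5) by (auto simp: PiE_iff)
  ultimately show "x \<in> {x \<in> Pi\<^sub>E I (\<lambda>i. topspace (Y i)). finite {i \<in> I \<inter> J. x i \<notin> M i}}"
    using x S(1) by (auto simp: PiE_iff intro: finite_subset)
next
  fix x assume x: "x \<in> {x \<in> Pi\<^sub>E I (\<lambda>i. topspace (Y i)). finite {i \<in> I \<inter> J. x i \<notin> M i}}"
  define S where "S = (I - J) \<union> {i \<in> I \<inter> J. x i \<notin> M i}"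
  define W where "W = (\<lambda>i. if i \<in> S then topspace (Y i) else M i)"
  have "x \<in> Pi\<^sub>E I W" using x by (auto simp: PiE_iff W_def S_def)
  moreover have "finite S" "S \<subseteq> I" "I - J \<subseteq> S" using assms(1) x by (auto simp: S_def)
  moreover have "\<forall>i\<in>S. openin (Y i) (W i)" "\<forall>i\<in>I - S. W i = M i" by (auto simp: W_def)
  ultimately show "x \<in> topspace (restricted_product I Y J M)"
    unfolding restricted_product_def topology_generated_by_topspace by blast
qed

definition diagonal :: "'a::field gscheme \<Rightarrow> 'a set set \<Rightarrow> (nat \<Rightarrow> 'a) \<Rightarrow> 'a set \<Rightarrow> nat \<Rightarrow> (nat \<Rightarrow> 'a) set" where
  "diagonal T I x = (\<lambda>P\<in>I. \<lambda>i\<in>{..<gdim T}. to_completion P (x i))"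

text \<open>The restricted product of the \<open>T(K\<^sub>v)\<close> over the closed points \<open>v\<close> of \<open>U\<close>, with respect to
  the integral points at the closed points of \<open>U0\<close>.\<close>

definition adelic_points ::
  "('k::field, 'a::field) pscheme \<Rightarrow> 'a set set \<Rightarrow> 'a set set \<Rightarrow> 'a gscheme \<Rightarrow>
   'a set set set \<Rightarrow> ('a set set \<Rightarrow> 'a gscheme) \<Rightarrow> ('a set set \<Rightarrow> nat \<Rightarrow> 'a mpoly) \<Rightarrow>
   ('a set \<Rightarrow> nat \<Rightarrow> (nat \<Rightarrow> 'a) set) topology" where
  "adelic_points \<X> U U0 T C G \<phi> =
     restricted_product (closed_points \<X> U) (local_topology T)
       (closed_points \<X> U0) (integral_points T C G \<phi>)"

end

theory Submission
  imports Defs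
begin

text \<open>Over an algebraic closure \<open>\<Omega>\<close> of \<open>K\<close> the torus is split, so a rational point is determined
  by the values of finitely many characters, and it suffices to show that \<open>f = \<chi>(a) / \<chi>(b)\<close> equals
  \<open>1\<close> for two rational points \<open>a\<close>, \<open>b\<close> in a small adelic open set.  Places are treated as valuation
  rings \<open>W\<close> of \<open>\<Omega>\<close> containing \<open>k\<close>; each of them has a centre on the curve.  If the centre is in
  \<open>U\<close>, then \<open>f\<close> is a unit in \<open>W\<close>: at almost all closed points because \<open>a\<close> and \<open>b\<close> are integral
  there, at the remaining ones because \<open>a\<close> and \<open>b\<close> are close to each other, and at the generic point
  because \<open>W\<close> contains \<open>K\<close>.  So \<open>f\<close> has zeros and poles only above the finitely many points outside
  \<open>U\<close>, and modulo constants it lies in a group of finite rank.  Moreover \<open>f\<close> is close to \<open>1\<close> at a fixed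
  place above \<open>U\<close>.  In characteristic \<open>0\<close> a group of finite rank does not contain elements \<open>f \<noteq> 1\<close>
  arbitrarily close to \<open>1\<close> at a place: if the orders of \<open>f\<^sub>0 - 1, \<dots>, f\<^sub>N - 1\<close> increase strictly,
  there is no multiplicative relation between the \<open>f\<^sub>i\<close>.\<close>

section \<open>Subrings and valuation rings of a field\<close>

text \<open>Two rational points are compared with each other and not with the limit
  \<open>x\<close>. This is why one argument gives closedness and discreteness: every adelic point
  gets a neighbourhood containing at most one diagonal point. The obstacle is that the characters
  live over \<Omega>, that is, on covers of the curve for which no model is at hand. Valuation rings
  of \<Omega> replace the points of such a cover, and their existence alone turns "unit everywhere"
  into "algebraic over \<open>k\<close>". Divisors and normalizations do not occur. The points
  outside \<open>U\<close> enter through a finite set \<open>H\<close> of functions, chosen so that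
  a valuation ring with centre outside \<open>U\<close> has some \<open>h\<close> of
  \<open>H\<close> in its maximal ideal. Over each \<open>h\<close> there are no more order
  functions than a spanning set of \<open>L\<close> over \<open>k(h)\<close> has elements, which
  bounds the rank. The required closeness cannot be uniform in \<open>x\<close>, because the
  denominators of a character grow with the coordinates. Hence a rational point \<open>c\<close>
  near \<open>x\<close> is fixed before the exponents are chosen.\<close>

definition ring_set :: "'a::field set \<Rightarrow> bool" where
  "ring_set R \<longleftrightarrow> 1 \<in> R \<and> (\<forall>x\<in>R. \<forall>y\<in>R. x - y \<in> R \<and> x * y \<in> R)"

definition field_set :: "'a::field set \<Rightarrow> bool" where
  "field_set F \<longleftrightarrow> ring_set F \<and> (\<forall>x\<in>F. inverse x \<in> F)"

text \<open>The field itself satisfies this, so the trivial valuation is among the valuation rings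
  considered. This is intended: its centre is the generic point.\<close>

definition valuation_set :: "'a::field set \<Rightarrow> bool" where
  "valuation_set W \<longleftrightarrow> ring_set W \<and> (\<forall>x. x \<notin> W \<longrightarrow> inverse x \<in> W)"

definition units_of_set :: "'a::field set \<Rightarrow> 'a set" where
  "units_of_set W = {x \<in> W. x \<noteq> 0 \<and> inverse x \<in> W}"

context
  fixes R :: "'a::field set"
  assumes R: "ring_set R"
begin

lemma ring_set_1 [simp]: "1 \<in> R" and ring_set_0 [simp]: "0 \<in> R"
  using R unfolding ring_set_def by (auto, metis diff_self)

lemma ring_set_diff: "x \<in> R \<Longrightarrow> y \<in> R \<Longrightarrow> x - y \<in> R"
  and ring_set_mult: "x \<in> R \<Longrightarrow> y \<in> R \<Longrightarrow> x * y \<in> R"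
  using R unfolding ring_set_def by auto

lemma ring_set_uminus: "x \<in> R \<Longrightarrow> - x \<in> R"
  using ring_set_diff[of 0 x] by simp

lemma ring_set_add: "x \<in> R \<Longrightarrow> y \<in> R \<Longrightarrow> x + y \<in> R"
  using ring_set_diff[of x "- y"] ring_set_uminus by simp

lemma ring_set_power: "x \<in> R \<Longrightarrow> x ^ n \<in> R"
  by (induction n) (auto intro: ring_set_mult)

lemma ring_set_sum: "(\<And>i. i \<in> I \<Longrightarrow> f i \<in> R) \<Longrightarrow> sum f I \<in> R"
  by (induction I rule: infinite_finite_induct) (auto intro: ring_set_add)

lemma ring_set_prod: "(\<And>i. i \<in> I \<Longrightarrow> f i \<in> R) \<Longrightarrow> prod f I \<in> R"
  by (induction I rule: infinite_finite_induct) (auto intro: ring_set_mult)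

lemma ring_set_of_nat: "of_nat n \<in> R"
  by (induction n) (auto intro: ring_set_add)

lemma ring_set_poly: "(\<And>i. coeff p i \<in> R) \<Longrightarrow> x \<in> R \<Longrightarrow> poly p x \<in> R"
  unfolding poly_altdef by (intro ring_set_sum ring_set_mult ring_set_power)

lemmas ring_set_intros = ring_set_diff ring_set_mult ring_set_add ring_set_uminus
  ring_set_power ring_set_sum ring_set_prod ring_set_of_nat ring_set_poly

end

lemma field_setD: "field_set F \<Longrightarrow> ring_set F"
  and field_set_inverse: "field_set F \<Longrightarrow> x \<in> F \<Longrightarrow> inverse x \<in> F"
  by (auto simp: field_set_def)

lemma field_set_divide: "field_set F \<Longrightarrow> x \<in> F \<Longrightarrow> y \<in> F \<Longrightarrow> x / y \<in> F"
  by (simp add: divide_inverse field_set_inverse field_setD ring_set_mult)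

lemma valuation_setD: "valuation_set W \<Longrightarrow> ring_set W"
  and valuation_set_inverse: "valuation_set W \<Longrightarrow> x \<notin> W \<Longrightarrow> inverse x \<in> W"
  by (auto simp: valuation_set_def)

lemma ring_set_coeff_mult:
  assumes "ring_set R" "\<And>i. coeff p i \<in> R" "\<And>i. coeff q i \<in> R"
  shows "coeff (p * q) i \<in> R"
  unfolding coeff_mult by (intro ring_set_intros assms)

lemma max_ideal_subset: "max_ideal W \<subseteq> W"
  by (auto simp: max_ideal_def)

lemma ring_set_divide_unit:
  "ring_set R \<Longrightarrow> x \<in> R \<Longrightarrow> u \<in> R \<Longrightarrow> u \<notin> max_ideal R \<Longrightarrow> x / u \<in> R"
  by (auto simp: max_ideal_def divide_inverse ring_set_mult)

text \<open>\<open>max_ideal\<close> collects 0 and the non-units of any ring, and a factor of a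
  unit is a unit. Closure under sums is a different matter; it is proved separately for valuation
  rings and for localizations.\<close>

lemma max_ideal_mult_left:
  assumes "ring_set R" "a \<in> R" "x \<in> max_ideal R" shows "a * x \<in> max_ideal R"
proof (cases "a * x = 0")
  case False
  then have "inverse x = a * inverse (a * x)" by (simp add: field_simps)
  moreover have "inverse x \<notin> R" using assms(3) False by (auto simp: max_ideal_def)
  ultimately have "inverse (a * x) \<notin> R"
    using ring_set_mult[OF assms(1,2), of "inverse (a * x)"] by metis
  then show ?thesis using assms by (auto simp: max_ideal_def ring_set_mult)
qed (use assms in \<open>auto simp: max_ideal_def\<close>)

lemma one_notin_max_ideal [simp]: "ring_set R \<Longrightarrow> 1 \<notin> max_ideal R"
  by (simp add: max_ideal_def)

lemma zero_in_max_ideal [simp]: "ring_set R \<Longrightarrow> 0 \<in> max_ideal R"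
  by (simp add: max_ideal_def)

lemma max_ideal_mult_iff:
  assumes "ring_set R" "a \<in> R" "b \<in> R"
  shows "a * b \<in> max_ideal R \<longleftrightarrow> a \<in> max_ideal R \<or> b \<in> max_ideal R"
proof -
  have "a * b \<notin> max_ideal R" if "a \<notin> max_ideal R" "b \<notin> max_ideal R"
    using that assms by (auto simp: max_ideal_def inverse_mult_distrib ring_set_mult)
  then show ?thesis
    using max_ideal_mult_left[OF assms(1)] assms by (metis mult.commute)
qed

text \<open>One of \<open>x / y\<close> and \<open>y / x\<close> lies in \<open>W\<close>, so the
  sum is a multiple of \<open>y\<close> or of \<open>x\<close> with a factor in
  \<open>W\<close>.\<close>

lemma valuation_max_ideal_add:
  assumes "valuation_set W" "x \<in> max_ideal W" "y \<in> max_ideal W"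
  shows "x + y \<in> max_ideal W"
proof (cases "x = 0 \<or> y = 0")
  case False
  note W = valuation_setD[OF assms(1)]
  have "\<exists>z\<in>{x, y}. (x + y) / z \<in> W"
  proof (cases "x / y \<in> W")
    case True
    then have "(x + y) / y \<in> W" using False W by (simp add: add_divide_distrib ring_set_add)
    then show ?thesis by blast
  next
    case f: False
    then have "y / x \<in> W" using valuation_set_inverse[OF assms(1) f] by simp
    then have "(x + y) / x \<in> W" using False W by (simp add: add_divide_distrib ring_set_add)
    then show ?thesis by blast
  qed
  then obtain z where z: "z \<in> {x, y}" "(x + y) / z \<in> W" by blast
  have "(x + y) / z * z \<in> max_ideal W"
    by (rule max_ideal_mult_left[OF W z(2)]) (use z assms in auto)
  then show ?thesis using z False by auto
qed (use assms in auto)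

lemma valuation_max_ideal_uminus:
  "ring_set W \<Longrightarrow> x \<in> max_ideal W \<Longrightarrow> - x \<in> max_ideal W"
  using max_ideal_mult_left[of W "-1" x] by (simp add: ring_set_uminus)

lemma valuation_max_ideal_diff:
  "valuation_set W \<Longrightarrow> x \<in> max_ideal W \<Longrightarrow> y \<in> max_ideal W \<Longrightarrow> x - y \<in> max_ideal W"
  using valuation_max_ideal_add[of W x "-y"] valuation_max_ideal_uminus[of W y]
  by (simp add: valuation_setD)

lemma valuation_max_ideal_sum:
  assumes "valuation_set W" "\<And>i. i \<in> I \<Longrightarrow> f i \<in> max_ideal W"
  shows "sum f I \<in> max_ideal W"
  using assms(2) by (induction I rule: infinite_finite_induct)
    (auto intro: valuation_max_ideal_add[OF assms(1)] simp: valuation_setD[OF assms(1)])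

lemma valuation_inverse_max_ideal:
  "valuation_set W \<Longrightarrow> x \<notin> W \<Longrightarrow> inverse x \<in> max_ideal W"
  using valuation_set_inverse[of W x] by (auto simp: max_ideal_def)

lemma units_of_set_iff: "ring_set W \<Longrightarrow> x \<in> units_of_set W \<longleftrightarrow> x \<in> W - max_ideal W"
  by (auto simp: units_of_set_def max_ideal_def)

lemma units_of_set_mult:
  "ring_set W \<Longrightarrow> x \<in> units_of_set W \<Longrightarrow> y \<in> units_of_set W \<Longrightarrow> x * y \<in> units_of_set W"
  by (auto simp: units_of_set_def ring_set_mult inverse_mult_distrib)

lemma units_of_set_inverse: "x \<in> units_of_set W \<Longrightarrow> inverse x \<in> units_of_set W"
  by (auto simp: units_of_set_def)

lemma units_of_set_1 [simp]: "ring_set W \<Longrightarrow> 1 \<in> units_of_set W"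
  by (auto simp: units_of_set_def)

lemma units_of_set_power: "ring_set W \<Longrightarrow> x \<in> units_of_set W \<Longrightarrow> x ^ n \<in> units_of_set W"
  by (induction n) (auto intro: units_of_set_mult)

lemma units_of_set_power_int:
  "ring_set W \<Longrightarrow> x \<in> units_of_set W \<Longrightarrow> x powi n \<in> units_of_set W"
  by (auto simp: power_int_def units_of_set_power units_of_set_inverse)

lemma units_of_set_prod:
  assumes "ring_set W" "\<And>i. i \<in> I \<Longrightarrow> f i \<in> units_of_set W"
  shows "prod f I \<in> units_of_set W"
  using assms(2) by (induction I rule: infinite_finite_induct)
    (auto intro: units_of_set_mult[OF assms(1)] simp: assms(1))

text \<open>If \<open>x\<close> were outside \<open>W\<close>, then \<open>inverse x\<close> and
  hence \<open>inverse x ^ n\<close> would be non-units, and multiplication by \<open>x ^ n\<close>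
  would put 1 into the maximal ideal.\<close>

lemma valuation_power_in:
  assumes "valuation_set W" "x ^ n \<in> W" "n > 0" shows "x \<in> W"
proof (rule ccontr)
  assume "x \<notin> W"
  then have "inverse x \<in> max_ideal W" by (rule valuation_inverse_max_ideal[OF assms(1)])
  note x = this
  have "inverse x ^ m \<in> max_ideal W" if "m > 0" for m
    using that
    by (induction m rule: nat_induct_non_zero)
      (use max_ideal_mult_left[OF valuation_setD[OF assms(1)]] max_ideal_subset x in \<open>auto dest: subsetD\<close>)
  then have "inverse x ^ n \<in> max_ideal W" using assms(3) .
  then have "x ^ n * inverse x ^ n \<in> max_ideal W"
    by (rule max_ideal_mult_left[OF valuation_setD[OF assms(1)] assms(2)])
  moreover have "x \<noteq> 0" using \<open>x \<notin> W\<close> assms(1) valuation_setD by fastforce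
  ultimately show False using valuation_setD[OF assms(1)] by (simp flip: power_mult_distrib)
qed

subsection \<open>Existence of valuation rings\<close>

definition adjoin :: "'a::field set \<Rightarrow> 'a \<Rightarrow> 'a set" where
  "adjoin R x = {poly p x | p. \<forall>i. coeff p i \<in> R}"

lemma ring_set_adjoin:
  assumes "ring_set R" shows "ring_set (adjoin R x)"
  unfolding ring_set_def
proof (intro conjI ballI)
  show "1 \<in> adjoin R x"
    unfolding adjoin_def using assms by (intro CollectI exI[of _ "1"]) (auto simp: coeff_1)
  fix a b assume "a \<in> adjoin R x" "b \<in> adjoin R x"
  then obtain p q where "a = poly p x" "b = poly q x" "\<forall>i. coeff p i \<in> R" "\<forall>i. coeff q i \<in> R"
    unfolding adjoin_def by auto
  then have "a - b = poly (p - q) x" "a * b = poly (p * q) x"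
      "\<forall>i. coeff (p - q) i \<in> R" "\<forall>i. coeff (p * q) i \<in> R"
    using assms by (auto intro!: ring_set_coeff_mult ring_set_diff)
  then show "a - b \<in> adjoin R x" "a * b \<in> adjoin R x"
    unfolding adjoin_def by blast+
qed

lemma adjoin_superset: "ring_set R \<Longrightarrow> R \<subseteq> adjoin R x"
  unfolding adjoin_def by (force simp: coeff_pCons split: nat.splits intro: exI[of _ "[:_:]"])

lemma adjoin_self: "ring_set R \<Longrightarrow> x \<in> adjoin R x"
  unfolding adjoin_def by (force simp: coeff_pCons split: nat.splits intro: exI[of _ "[:0, 1:]"])

lemma adjoin_subset: "ring_set S \<Longrightarrow> R \<subseteq> S \<Longrightarrow> x \<in> S \<Longrightarrow> adjoin R x \<subseteq> S"
  unfolding adjoin_def by (auto intro!: ring_set_poly)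

text \<open>Chevalley's argument. Localizing \<open>V\<close> at the elements
  \<open>1 - s * a\<close> keeps \<open>s\<close> a non-unit, so by maximality these elements are
  already units. If neither \<open>x\<close> nor \<open>inverse x\<close> were in \<open>V\<close>,
  then \<open>s\<close> would become invertible in both \<open>V[x]\<close> and
  \<open>V[1/x]\<close>, and the two resulting equations lower each other's degree until one of them
  is constant.\<close>

lemma maximal_nonunit_subring_valuation:
  fixes V :: "'a::field set"
  assumes V: "ring_set V" "s \<in> V" "1 \<notin> (\<lambda>a. s * a) ` V"
    and max: "\<And>V'. ring_set V' \<Longrightarrow> V \<subseteq> V' \<Longrightarrow> 1 \<notin> (\<lambda>a. s * a) ` V' \<Longrightarrow> V' = V"
  shows "valuation_set V"
proof -
  have unit: "inverse (1 - s * a) \<in> V" if a: "a \<in> V" for a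
  proof -
    define V' where "V' = {x / (1 - s * b) ^ n | x b n. x \<in> V \<and> b \<in> V}"
    have nz: "1 - s * b \<noteq> 0" if "b \<in> V" for b using V(3) that by (auto simp: image_iff)
    have one: "\<exists>c\<in>V. (1 - s * b) ^ n = 1 - s * c" if "b \<in> V" for b n
    proof (induction n)
      case 0 then show ?case using V by (intro bexI[of _ 0]) auto
    next
      case (Suc n)
      then obtain c where c: "c \<in> V" "(1 - s * b) ^ n = 1 - s * c" by auto
      have "(1 - s * b) ^ Suc n = 1 - s * (b + c - s * b * c)"
        by (simp only: power_Suc c) (simp add: algebra_simps)
      moreover have "b + c - s * b * c \<in> V" using V c that by (intro ring_set_intros) auto
      ultimately show ?case by blast
    qed
    \<comment> \<open>The denominators are closed under products, so a single factor
      suffices.\<close>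
    have V'_alt: "V' = {x / (1 - s * b) | x b. x \<in> V \<and> b \<in> V}" (is "_ = ?V")
    proof
      show "V' \<subseteq> ?V" unfolding V'_def using one by clarsimp metis
      show "?V \<subseteq> V'" unfolding V'_def
      proof clarify
        fix x b assume "x \<in> V" "b \<in> V"
        then show "\<exists>y c n. x / (1 - s * b) = y / (1 - s * c) ^ n \<and> y \<in> V \<and> c \<in> V"
          by (intro exI[of _ x] exI[of _ b] exI[of _ 1]) simp
      qed
    qed
    have "ring_set V'" unfolding ring_set_def
    proof (intro conjI ballI)
      show "1 \<in> V'" unfolding V'_alt using V by (force intro: exI[of _ 1] exI[of _ 0])
      fix u v assume "u \<in> V'" "v \<in> V'"
      then obtain x b y c where uv: "u = x / (1 - s * b)" "v = y / (1 - s * c)"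
        and m: "x \<in> V" "b \<in> V" "y \<in> V" "c \<in> V" unfolding V'_alt by blast
      have e: "(1 - s * b) * (1 - s * c) = 1 - s * (b + c - s * b * c)" by (simp add: algebra_simps)
      have d: "b + c - s * b * c \<in> V" using V m by (intro ring_set_intros) auto
      have "u - v = (x * (1 - s * c) - y * (1 - s * b)) / (1 - s * (b + c - s * b * c))"
        unfolding e[symmetric] uv using nz m by (simp add: diff_frac_eq)
      moreover have "x * (1 - s * c) - y * (1 - s * b) \<in> V"
        using V m by (intro ring_set_intros) auto
      ultimately show "u - v \<in> V'" unfolding V'_alt using d by blast
      have "u * v = (x * y) / (1 - s * (b + c - s * b * c))"
        unfolding e[symmetric] uv by simp
      then show "u * v \<in> V'" unfolding V'_alt using d m V(1) ring_set_mult by blast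
    qed
    moreover have "V \<subseteq> V'"
      unfolding V'_alt using V(1) by (force intro: exI[of _ 0])
    moreover have "1 \<notin> (\<lambda>a. s * a) ` V'"
    proof
      assume "1 \<in> (\<lambda>a. s * a) ` V'"
      then obtain x b where xb: "x \<in> V" "b \<in> V" "1 = s * (x / (1 - s * b))"
        unfolding V'_alt by auto
      then have "1 = s * (x + b)" using nz[OF xb(2)] by (simp add: field_simps)
      then show False using V xb by (metis imageI ring_set_add)
    qed
    ultimately have "V' = V" by (rule max)
    moreover have "1 / (1 - s * a) \<in> V'" unfolding V'_alt using a V(1) by force
    ultimately show ?thesis by (simp add: divide_inverse)
  qed
  have "inverse x \<in> V" if x: "x \<notin> V" for x
  proof (rule ccontr)
    assume ix: "inverse x \<notin> V"
    have ex: "\<exists>p. (\<forall>i. coeff p i \<in> V) \<and> s * poly p y = 1" if "y \<notin> V" for y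
    proof -
      have "adjoin V y \<noteq> V" using that adjoin_self V(1) by blast
      then have "1 \<in> (\<lambda>a. s * a) ` adjoin V y"
        using max[OF ring_set_adjoin[OF V(1)] adjoin_superset[OF V(1)]] by blast
      then show ?thesis unfolding adjoin_def by (auto simp: image_iff)
    qed
    \<comment> \<open>Descent on the sum of the degrees. The situation is symmetric under exchanging
      \<open>y\<close> with its inverse, so only \<open>degree q \<le> degree p\<close> is worked
      out, in \<open>main\<close>.\<close>
    have key: False if "s * poly p y = 1" "s * poly q (inverse y) = 1" "\<forall>i. coeff p i \<in> V"
      "\<forall>i. coeff q i \<in> V" "y \<noteq> 0" for p q y
      using that
    proof (induction "degree p + degree q" arbitrary: p q y rule: less_induct)
      case less
      have main: False if le: "degree q \<le> degree p" "s * poly p y = 1" "s * poly q (inverse y) = 1"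
        "\<forall>i. coeff p i \<in> V" "\<forall>i. coeff q i \<in> V" "y \<noteq> 0"
        and IH: "\<And>p'. degree p' < degree p \<Longrightarrow> s * poly p' y = 1 \<Longrightarrow> \<forall>i. coeff p' i \<in> V \<Longrightarrow> False"
        for p q y
      proof (cases "degree p = 0")
        case True
        then obtain c where "p = [:c:]" using degree_eq_zeroE by blast
        then have "1 = s * c" "c \<in> V" using le(2,4) by (auto dest: spec[of _ 0])
        then show False using V by blast
      next
        case False
        define n m where "n = degree p" and "m = degree q"
        define w where "w = inverse (1 - s * coeff q 0)"
        have w: "w \<in> V" unfolding w_def using unit le by auto
        have wnz: "1 - s * coeff q 0 \<noteq> 0" using V(3) le by (auto simp: image_iff)
        have "poly q (inverse y) * y ^ m = poly (reflect_poly q) y"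
          using le(6) unfolding m_def by (simp add: poly_reflect_poly_nz mult.commute)
        \<comment> \<open>Multiply \<open>s * poly q (inverse y) = 1\<close> by \<open>y ^ m\<close>
          and move the top term \<open>s * coeff q 0 * y ^ m\<close> to the other side. As
          \<open>1 - s * coeff q 0\<close> is a unit, this expresses \<open>y ^ m\<close> by lower
          powers of \<open>y\<close>.\<close>
        define q' where "q' = smult (w * s) (reflect_poly q - monom (coeff q 0) m)"
        have q': "poly q' y = y ^ m"
        proof -
          have "poly q' y = w * (s * poly (reflect_poly q) y - s * coeff q 0 * y ^ m)"
            unfolding q'_def by (simp add: poly_monom algebra_simps)
          also have "s * poly (reflect_poly q) y = s * poly q (inverse y) * y ^ m"
            using le(6) unfolding m_def by (simp add: poly_reflect_poly_nz mult.commute)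
          also have "\<dots> = y ^ m" using le by simp
          also have "w * (y ^ m - s * coeff q 0 * y ^ m) = (w * (1 - s * coeff q 0)) * y ^ m"
            by (simp add: algebra_simps)
          finally show ?thesis unfolding w_def using wnz by simp
        qed
        have dq': "coeff q' i = 0" if "i \<ge> m" for i
        proof -
          have "coeff (reflect_poly q) i = (if i = m then coeff q 0 else 0)"
          proof (cases "i = m")
            case True then show ?thesis unfolding m_def by (simp add: coeff_reflect_poly)
          next
            case False
            then show ?thesis using that unfolding m_def by (simp add: coeff_reflect_poly)
          qed
          then show ?thesis unfolding q'_def by (simp add: coeff_monom)
        qed
        have q'V: "coeff q' i \<in> V" for i
          unfolding q'_def coeff_smult coeff_diff coeff_monom
          using V w le by (intro ring_set_intros) (auto simp: coeff_reflect_poly)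
        \<comment> \<open>The leading term of \<open>p\<close> is rewritten by means of
          \<open>q'\<close>: the value at \<open>y\<close> stays the same and the degree
          drops.\<close>
        define p' where "p' = p - monom (coeff p n) n + smult (coeff p n) (monom 1 (n - m) * q')"
        have "poly p' y = poly p y"
        proof -
          have "y ^ (n - m) * y ^ m = y ^ n" using le unfolding n_def m_def by (simp flip: power_add)
          then show ?thesis unfolding p'_def by (simp add: poly_monom q')
        qed
        moreover have "degree p' < degree p"
        proof -
          have "coeff p' i = 0" if "i \<ge> n" for i
          proof -
            have "i \<noteq> n \<longrightarrow> coeff p i = 0"
              using that unfolding n_def by (auto simp: coeff_eq_0)
            moreover have "coeff (monom 1 (n - m) * q') i = coeff q' (i - (n - m))"
              using that by (simp add: coeff_monom_mult)
            moreover have "coeff q' (i - (n - m)) = 0"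
              by (rule dq') (use that le in \<open>auto simp: n_def m_def\<close>)
            ultimately show ?thesis unfolding p'_def by (cases "i = n") simp_all
          qed
          then have "degree p' < n \<or> p' = 0" by (metis leading_coeff_0_iff not_less)
          then show ?thesis using False unfolding n_def by auto
        qed
        moreover have "\<forall>i. coeff p' i \<in> V"
        proof
          fix i
          have "coeff (monom 1 (n - m) * q') i \<in> V"
            using V(1) q'V by (simp add: coeff_monom_mult)
          then show "coeff p' i \<in> V"
            unfolding p'_def coeff_add coeff_diff coeff_smult coeff_monom
            using V(1) le(4) by (intro ring_set_intros) auto
        qed
        ultimately show False using IH le(2) by metis
      qed
      show False
      proof (cases "degree q \<le> degree p")
        case True
        show False
        proof (rule main[OF True less.prems])
          fix p' assume "degree p' < degree p" "s * poly p' y = 1" "\<forall>i. coeff p' i \<in> V"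
          then show False using less.prems by (intro less.hyps[of p' q y]) simp_all
        qed
      next
        case False
        show False
        proof (rule main[of p q "inverse y"])
          fix p' assume "degree p' < degree q" "s * poly p' (inverse y) = 1" "\<forall>i. coeff p' i \<in> V"
          then show False using less.prems by (intro less.hyps[of p p' y]) simp_all
        qed (use False less.prems in simp_all)
      qed
    qed
    have "x \<noteq> 0" using x V by auto
    then show False using ex[OF x] ex[OF ix] key by blast
  qed
  then show ?thesis using V by (auto simp: valuation_set_def)
qed

text \<open>Zorn's lemma on the rings above \<open>R\<close> in which \<open>s\<close> has no
  inverse. Every valuation ring with a prescribed zero \<open>s\<close> is obtained from
  here.\<close>

lemma exists_valuation_set:
  fixes R :: "'a::field set"
  assumes R: "ring_set R" "s \<in> R" "1 \<notin> (\<lambda>a. s * a) ` R"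
  obtains W where "valuation_set W" "R \<subseteq> W" "s \<in> max_ideal W"
proof -
  define \<S> where "\<S> = {V. ring_set V \<and> R \<subseteq> V \<and> 1 \<notin> (\<lambda>a. s * a) ` V}"
  have "\<exists>V\<in>\<S>. \<forall>Y1\<in>\<S>. V \<subseteq> Y1 \<longrightarrow> Y1 = V"
  proof (rule subset_Zorn)
    fix \<C> assume ch: "subset.chain \<S> \<C>"
    show "\<exists>U\<in>\<S>. \<forall>Y1\<in>\<C>. Y1 \<subseteq> U"
    proof (cases "\<C> = {}")
      case True then show ?thesis using R unfolding \<S>_def by auto
    next
      case False
      have sub: "\<C> \<subseteq> \<S>" and tot: "\<And>Y1 Y2. Y1 \<in> \<C> \<Longrightarrow> Y2 \<in> \<C> \<Longrightarrow> Y1 \<subseteq> Y2 \<or> Y2 \<subseteq> Y1"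
        using ch by (auto simp: subset_chain_def)
      have "ring_set (\<Union>\<C>)" unfolding ring_set_def
      proof (intro conjI ballI)
        obtain Y3 where "Y3 \<in> \<C>" using False by blast
        moreover from this have "ring_set Y3" using sub unfolding \<S>_def by blast
        ultimately show "1 \<in> \<Union>\<C>" by (auto simp: ring_set_def)
        fix x y assume "x \<in> \<Union>\<C>" "y \<in> \<Union>\<C>"
        then obtain Y1 where "Y1 \<in> \<C>" "x \<in> Y1" "y \<in> Y1" using tot by blast
        moreover from this have "ring_set Y1" using sub unfolding \<S>_def by blast
        ultimately have "x - y \<in> Y1" "x * y \<in> Y1" by (auto intro: ring_set_diff ring_set_mult)
        then show "x - y \<in> \<Union>\<C>" "x * y \<in> \<Union>\<C>" using \<open>Y1 \<in> \<C>\<close> by blast+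
      qed
      then have "\<Union>\<C> \<in> \<S>" using sub False unfolding \<S>_def by blast
      then show ?thesis by blast
    qed
  qed
  then obtain V where V: "V \<in> \<S>" "\<And>Y1. Y1 \<in> \<S> \<Longrightarrow> V \<subseteq> Y1 \<Longrightarrow> Y1 = V" by blast
  then have "valuation_set V"
    using R(2) by (intro maximal_nonunit_subring_valuation[of V s]) (auto simp: \<S>_def)
  moreover have "s \<in> max_ideal V"
    using V(1) R(2) unfolding \<S>_def max_ideal_def by (auto simp: image_iff)
  ultimately show ?thesis using that V(1) unfolding \<S>_def by auto
qed

subsection \<open>Linear dependence and algebraic elements\<close>

text \<open>Gaussian elimination by induction on \<open>B\<close>: an equation with an entry
  \<open>M j b \<noteq> 0\<close> is used to remove the unknown \<open>j\<close>. The coefficients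
  stay in \<open>F\<close>, so the lemma serves for subfields of \<Omega> as well as for vectors of
  rational orders.\<close>

lemma matrix_dependent:
  fixes M :: "'i \<Rightarrow> 'b \<Rightarrow> 'a::field"
  assumes F: "field_set F" and "finite B" "finite I" "card B < card I"
    and "\<And>i b. i \<in> I \<Longrightarrow> b \<in> B \<Longrightarrow> M i b \<in> F"
  shows "\<exists>c. (\<forall>i. c i \<in> F) \<and> (\<exists>i\<in>I. c i \<noteq> 0) \<and> (\<forall>b\<in>B. (\<Sum>i\<in>I. c i * M i b) = 0)"
  using assms(2-)
proof (induction B arbitrary: I M rule: finite_induct)
  case empty
  then have "I \<noteq> {}" by auto
  then show ?case using field_setD[OF F] by (intro exI[of _ "\<lambda>_. 1"]) auto
next
  case (insert b B)
  note R = field_setD[OF F]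
  show ?case
  proof (cases "\<forall>i\<in>I. M i b = 0")
    case True
    have "\<exists>c. (\<forall>i. c i \<in> F) \<and> (\<exists>i\<in>I. c i \<noteq> 0) \<and> (\<forall>b\<in>B. (\<Sum>i\<in>I. c i * M i b) = 0)"
      using insert.prems insert.hyps by (intro insert.IH) auto
    then show ?thesis using True by auto
  next
    case False
    then obtain j where j: "j \<in> I" "M j b \<noteq> 0" by blast
    define M' where "M' = (\<lambda>i d. M i d - M i b / M j b * M j d)"
    have "\<exists>c. (\<forall>i. c i \<in> F) \<and> (\<exists>i\<in>I - {j}. c i \<noteq> 0) \<and> (\<forall>d\<in>B. (\<Sum>i\<in>I - {j}. c i * M' i d) = 0)"
    proof (rule insert.IH)
      show "card B < card (I - {j})" using insert.prems insert.hyps j by simp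
      show "M' i d \<in> F" if "i \<in> I - {j}" "d \<in> B" for i d
        unfolding M'_def using insert.prems(3) j(1) that R F
        by (intro ring_set_diff ring_set_mult field_set_divide) auto
    qed (use insert.prems in auto)
    then obtain c where c: "\<forall>i. c i \<in> F" "\<exists>i\<in>I - {j}. c i \<noteq> 0"
      "\<forall>d\<in>B. (\<Sum>i\<in>I - {j}. c i * M' i d) = 0" by blast
    define e where "e = - (\<Sum>i\<in>I - {j}. c i * (M i b / M j b))"
    define c' where "c' = c(j := e)"
    have split: "(\<Sum>i\<in>I. c' i * M i d) = e * M j d + (\<Sum>i\<in>I - {j}. c i * M i d)" for d
    proof -
      have "(\<Sum>i\<in>I. c' i * M i d) = c' j * M j d + (\<Sum>i\<in>I - {j}. c' i * M i d)"
        using insert.prems j by (simp add: sum.remove)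
      also have "(\<Sum>i\<in>I - {j}. c' i * M i d) = (\<Sum>i\<in>I - {j}. c i * M i d)"
        by (intro sum.cong) (auto simp: c'_def)
      finally show ?thesis by (simp add: c'_def)
    qed
    have "(\<Sum>i\<in>I. c' i * M i d) = (\<Sum>i\<in>I - {j}. c i * M' i d)" for d
      unfolding split e_def M'_def
      by (simp add: algebra_simps sum_subtractf sum_distrib_left)
    moreover have "(\<Sum>i\<in>I - {j}. c i * M' i b) = 0" unfolding M'_def using j by simp
    moreover have "\<exists>i\<in>I. c' i \<noteq> 0" using c(2) unfolding c'_def by auto
    moreover have "e \<in> F" unfolding e_def
      using c(1) insert.prems(3) j(1) R F
      by (intro ring_set_uminus ring_set_sum ring_set_mult field_set_divide) auto
    ultimately show ?thesis using c by (intro exI[of _ c']) (auto simp: c'_def)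
  qed
qed

definition vspan :: "'a::field set \<Rightarrow> 'a set \<Rightarrow> 'a set" where
  "vspan F B = {\<Sum>b\<in>B. c b * b | c. \<forall>b\<in>B. c b \<in> F}"

definition finite_over :: "'a::field set \<Rightarrow> 'a set \<Rightarrow> bool" where
  "finite_over F L \<longleftrightarrow> (\<exists>B. finite B \<and> L \<subseteq> vspan F B)"

definition alg_over :: "'a::field set \<Rightarrow> 'a \<Rightarrow> bool" where
  "alg_over R x \<longleftrightarrow> (\<exists>p. p \<noteq> 0 \<and> (\<forall>i. coeff p i \<in> R) \<and> poly p x = 0)"

definition fracs :: "'a::field set \<Rightarrow> 'a set" where
  "fracs R = {a / b | a b. a \<in> R \<and> b \<in> R \<and> b \<noteq> 0}"

lemma vspan_add: "ring_set F \<Longrightarrow> x \<in> vspan F B \<Longrightarrow> y \<in> vspan F B \<Longrightarrow> x + y \<in> vspan F B"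
proof -
  assume F: "ring_set F" and "x \<in> vspan F B" "y \<in> vspan F B"
  then obtain c d where "\<forall>b\<in>B. c b \<in> F" "x = (\<Sum>b\<in>B. c b * b)" "\<forall>b\<in>B. d b \<in> F" "y = (\<Sum>b\<in>B. d b * b)"
    unfolding vspan_def by blast
  then show ?thesis unfolding vspan_def using F
    by (intro CollectI exI[of _ "\<lambda>b. c b + d b"])
      (auto simp: algebra_simps sum.distrib intro: ring_set_add)
qed

lemma vspan_mult: "ring_set F \<Longrightarrow> a \<in> F \<Longrightarrow> x \<in> vspan F B \<Longrightarrow> a * x \<in> vspan F B"
proof -
  assume F: "ring_set F" "a \<in> F" and "x \<in> vspan F B"
  then obtain c where "\<forall>b\<in>B. c b \<in> F" "x = (\<Sum>b\<in>B. c b * b)" unfolding vspan_def by blast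
  then show ?thesis unfolding vspan_def using F
    by (intro CollectI exI[of _ "\<lambda>b. a * c b"])
      (auto simp: sum_distrib_left mult.assoc intro: ring_set_mult)
qed

lemma vspan_0: "ring_set F \<Longrightarrow> 0 \<in> vspan F B"
  unfolding vspan_def by (intro CollectI exI[of _ "\<lambda>_. 0"]) auto

lemma vspan_base: "ring_set F \<Longrightarrow> finite B \<Longrightarrow> b \<in> B \<Longrightarrow> b \<in> vspan F B"
  unfolding vspan_def
  by (intro CollectI exI[of _ "\<lambda>d. if d = b then 1 else 0"])
    (auto simp: if_distrib[of "\<lambda>x. x * _"] cong: if_cong)

lemma vspan_sum:
  "ring_set F \<Longrightarrow> (\<And>i. i \<in> I \<Longrightarrow> f i \<in> vspan F B) \<Longrightarrow> sum f I \<in> vspan F B"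
  by (induction I rule: infinite_finite_induct) (auto intro: vspan_add simp: vspan_0)

lemma vspan_dependent:
  assumes F: "field_set F" and "finite B" "finite I" "card B < card I"
    and e: "\<And>i. i \<in> I \<Longrightarrow> e i \<in> vspan F B"
  shows "\<exists>c. (\<forall>i. c i \<in> F) \<and> (\<exists>i\<in>I. c i \<noteq> 0) \<and> (\<Sum>i\<in>I. c i * e i) = 0"
proof -
  have "\<forall>i\<in>I. \<exists>m. (\<forall>b\<in>B. m b \<in> F) \<and> e i = (\<Sum>b\<in>B. m b * b)"
    using e unfolding vspan_def by blast
  then obtain M where M: "\<And>i b. i \<in> I \<Longrightarrow> b \<in> B \<Longrightarrow> M i b \<in> F"
    "\<And>i. i \<in> I \<Longrightarrow> e i = (\<Sum>b\<in>B. M i b * b)" by metis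
  obtain c where c: "\<forall>i. c i \<in> F" "\<exists>i\<in>I. c i \<noteq> 0" "\<forall>b\<in>B. (\<Sum>i\<in>I. c i * M i b) = 0"
    using matrix_dependent[OF assms(1-4), of M] M(1) by blast
  have "(\<Sum>i\<in>I. c i * e i) = (\<Sum>i\<in>I. \<Sum>b\<in>B. c i * M i b * b)"
    by (simp add: M(2) sum_distrib_left mult.assoc)
  also have "\<dots> = (\<Sum>b\<in>B. (\<Sum>i\<in>I. c i * M i b) * b)"
    by (subst sum.swap) (simp add: sum_distrib_right)
  also have "\<dots> = 0" using c(3) by simp
  finally show ?thesis using c by blast
qed

lemma alg_over_mono: "alg_over R x \<Longrightarrow> R \<subseteq> S \<Longrightarrow> alg_over S x"
  unfolding alg_over_def by blast

lemma alg_over_self: "ring_set R \<Longrightarrow> x \<in> R \<Longrightarrow> alg_over R x"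
  unfolding alg_over_def
  by (intro exI[of _ "[:- x, 1:]"]) (auto simp: coeff_pCons ring_set_uminus split: nat.splits)

text \<open>There are more powers \<open>x ^ i\<close> with \<open>i \<le> card B\<close> than
  spanning elements, and a linear relation between them is an equation for \<open>x\<close>.\<close>

lemma finite_over_imp_alg_over:
  assumes F: "field_set F" and L: "finite_over F L" "ring_set L" "x \<in> L"
  shows "alg_over F x"
proof -
  obtain B where B: "finite B" "L \<subseteq> vspan F B" using L unfolding finite_over_def by blast
  have "\<exists>c. (\<forall>i. c i \<in> F) \<and> (\<exists>i\<in>{..card B}. c i \<noteq> 0) \<and> (\<Sum>i\<in>{..card B}. c i * x ^ i) = 0"
    using L ring_set_power B by (intro vspan_dependent[OF F B(1)]) auto
  then obtain c where c: "\<forall>i. c i \<in> F" "\<exists>i\<in>{..card B}. c i \<noteq> 0"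
    "(\<Sum>i\<in>{..card B}. c i * x ^ i) = 0" by blast
  define p where "p = (\<Sum>i\<in>{..card B}. monom (c i) i)"
  have co: "coeff p i = (if i \<le> card B then c i else 0)" for i
    unfolding p_def by (simp add: coeff_sum)
  have "p \<noteq> 0" using c(2) co by (metis atMost_iff coeff_0)
  moreover have "poly p x = 0" unfolding p_def by (simp add: poly_sum poly_monom c(3))
  ultimately show ?thesis unfolding alg_over_def using co c(1) field_setD[OF F] by (intro exI[of _ p]) auto
qed

lemma finite_over_trans:
  assumes F: "ring_set F" and "finite_over F L" "finite_over L M"
  shows "finite_over F M"
proof -
  obtain B C where B: "finite B" "L \<subseteq> vspan F B" and C: "finite C" "M \<subseteq> vspan L C"
    using assms unfolding finite_over_def by blast
  let ?D = "(\<lambda>(b, c). b * c) ` (B \<times> C)"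
  have D: "finite ?D" using B C by auto
  have "M \<subseteq> vspan F ?D"
  proof
    fix m assume "m \<in> M"
    then obtain l where l: "\<forall>c\<in>C. l c \<in> L" "m = (\<Sum>c\<in>C. l c * c)"
      using C unfolding vspan_def by blast
    have "l c * c \<in> vspan F ?D" if c: "c \<in> C" for c
    proof -
      obtain f where f: "\<forall>b\<in>B. f b \<in> F" "l c = (\<Sum>b\<in>B. f b * b)"
        using l(1) c B unfolding vspan_def by blast
      have "l c * c = (\<Sum>b\<in>B. f b * (b * c))"
        unfolding f(2) by (simp add: sum_distrib_right mult.assoc)
      also have "\<dots> \<in> vspan F ?D"
        using f(1) c F D by (intro vspan_sum vspan_mult vspan_base) auto
      finally show ?thesis .
    qed
    then show "m \<in> vspan F ?D" unfolding l(2) by (intro vspan_sum[OF F])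
  qed
  then show ?thesis unfolding finite_over_def using D by blast
qed

text \<open>After division by a power of \<open>y\<close> the equation has a constant term
  \<open>c \<noteq> 0\<close> in \<open>F\<close>, and \<open>c = - y * poly r y\<close> exhibits
  the inverse of \<open>y\<close> as a polynomial in \<open>y\<close>.\<close>

lemma alg_inverse_mem:
  assumes F: "field_set F" and L: "ring_set L" "F \<subseteq> L" "y \<in> L" and y: "alg_over F y"
  shows "inverse y \<in> L"
proof (cases "y = 0")
  case False
  obtain p where p: "p \<noteq> 0" "\<forall>i. coeff p i \<in> F" "poly p y = 0" using y unfolding alg_over_def by blast
  have "\<exists>q. coeff q 0 \<noteq> 0 \<and> (\<forall>i. coeff q i \<in> F) \<and> poly q y = 0" using p
  proof (induction p rule: pCons_induct)
    case (pCons a p)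
    show ?case
    proof (cases "a = 0")
      case True
      then have "p \<noteq> 0" "poly p y = 0" using pCons.prems False by auto
      moreover have "\<forall>i. coeff p i \<in> F" using pCons.prems(2) by (metis coeff_pCons_Suc)
      ultimately show ?thesis using pCons.IH by blast
    next
      case False
      then show ?thesis using pCons.prems by (intro exI[of _ "pCons a p"]) auto
    qed
  qed simp
  then obtain q where q: "coeff q 0 \<noteq> 0" "\<forall>i. coeff q i \<in> F" "poly q y = 0" by blast
  obtain c r where cr: "q = pCons c r" by (cases q)
  have c: "c \<noteq> 0" "c \<in> F" using q cr by (auto dest: spec[of _ 0])
  have r: "coeff r i \<in> L" for i using q(2) L(2) cr by (metis coeff_pCons_Suc subsetD)
  have "inverse y = - (inverse c * poly r y)"
    using q(3) c False cr by (simp add: field_simps) (metis add.commute add_eq_0_iff mult.commute)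
  also have "\<dots> \<in> L"
    using L r c field_set_inverse[OF F c(2)] by (intro ring_set_intros) auto
  finally show ?thesis .
qed (use L in simp)

text \<open>The span of the powers below the degree absorbs multiplication by \<open>x\<close>,
  hence contains all of \<open>adjoin L x\<close>. Every element is then algebraic over
  \<open>L\<close>, and its inverse is a polynomial in it.\<close>

lemma adjoin_alg:
  assumes L: "field_set L" and x: "alg_over L x"
  shows "finite_over L (adjoin L x)" "field_set (adjoin L x)"
proof -
  note R = field_setD[OF L]
  obtain p where p: "p \<noteq> 0" "\<forall>i. coeff p i \<in> L" "poly p x = 0" using x unfolding alg_over_def by blast
  define d where "d = degree p"
  let ?B = "(\<lambda>i. x ^ i) ` {..<d}"
  have B: "finite ?B" by simp
  have xd: "x ^ d \<in> vspan L ?B"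
  proof -
    have "0 = (\<Sum>i\<le>d. coeff p i * x ^ i)" using p(3) by (simp add: poly_altdef d_def)
    also have "{..d} = insert d {..<d}" by auto
    finally have "lead_coeff p * x ^ d = - (\<Sum>i<d. coeff p i * x ^ i)"
      by (simp add: d_def eq_neg_iff_add_eq_0)
    then have "x ^ d = - inverse (lead_coeff p) * (\<Sum>i<d. coeff p i * x ^ i)"
      using p(1) by (simp add: field_simps)
    also have "\<dots> \<in> vspan L ?B"
      using R p(2) field_set_inverse[OF L]
      by (intro vspan_mult vspan_sum vspan_base ring_set_uminus) auto
    finally show ?thesis .
  qed
  have mx: "x * v \<in> vspan L ?B" if v: "v \<in> vspan L ?B" for v
  proof -
    obtain c where c: "\<forall>b\<in>?B. c b \<in> L" "v = (\<Sum>b\<in>?B. c b * b)" using v unfolding vspan_def by blast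
    have "x * v = (\<Sum>b\<in>?B. c b * (x * b))" unfolding c(2) by (simp add: sum_distrib_left mult_ac)
    moreover have "x * b \<in> vspan L ?B" if "b \<in> ?B" for b
    proof -
      obtain i where i: "i < d" "b = x ^ i" using \<open>b \<in> ?B\<close> by blast
      show ?thesis
      proof (cases "Suc i = d")
        case True then show ?thesis using xd i by auto
      next
        case False
        then have "x ^ Suc i \<in> ?B" using i by (intro image_eqI[of _ _ "Suc i"]) auto
        then show ?thesis using vspan_base[OF R B] i by auto
      qed
    qed
    ultimately show ?thesis using c(1) by (metis (no_types, lifting) vspan_sum[OF R] vspan_mult[OF R])
  qed
  have xn: "x ^ n \<in> vspan L ?B" for n
  proof (induction n)
    case 0
    show ?case
    proof (cases "d = 0")
      case True then show ?thesis using xd by simp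
    next
      case False then show ?thesis by (intro vspan_base[OF R B] image_eqI[of _ _ 0]) auto
    qed
  qed (use mx in simp)
  have "adjoin L x \<subseteq> vspan L ?B"
    unfolding adjoin_def using R xn by (auto simp: poly_altdef intro!: vspan_sum vspan_mult)
  then show fo: "finite_over L (adjoin L x)" unfolding finite_over_def using B by blast
  show "field_set (adjoin L x)"
    unfolding field_set_def
    using alg_inverse_mem[OF L ring_set_adjoin[OF R] adjoin_superset[OF R]]
      finite_over_imp_alg_over[OF L fo ring_set_adjoin[OF R]] ring_set_adjoin[OF R] by blast
qed

lemma finite_over_self: "ring_set F \<Longrightarrow> finite_over F F"
  unfolding finite_over_def vspan_def by (intro exI[of _ "{1}"]) force

text \<open>The last clause says that \<open>L\<close> is generated by \<open>F\<close> and
  \<open>Y\<close> as a ring. It bounds \<open>L\<close> from above when the same extension is later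
  viewed over another base field.\<close>

lemma finite_alg_extension:
  assumes F: "field_set F" and Y: "finite Y" "\<And>x. x \<in> Y \<Longrightarrow> alg_over F x"
  obtains L where "field_set L" "F \<subseteq> L" "Y \<subseteq> L" "finite_over F L"
    "\<And>S. ring_set S \<Longrightarrow> F \<subseteq> S \<Longrightarrow> Y \<subseteq> S \<Longrightarrow> L \<subseteq> S"
proof -
  have "\<exists>L. field_set L \<and> F \<subseteq> L \<and> Y \<subseteq> L \<and> finite_over F L \<and>
    (\<forall>S. ring_set S \<longrightarrow> F \<subseteq> S \<longrightarrow> Y \<subseteq> S \<longrightarrow> L \<subseteq> S)" using Y
  proof (induction Y rule: finite_induct)
    case empty
    then show ?case using F finite_over_self[OF field_setD[OF F]] by (intro exI[of _ F]) auto
  next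
    case (insert x Y)
    then obtain L where L: "field_set L" "F \<subseteq> L" "Y \<subseteq> L" "finite_over F L"
      "\<forall>S. ring_set S \<longrightarrow> F \<subseteq> S \<longrightarrow> Y \<subseteq> S \<longrightarrow> L \<subseteq> S" by auto
    note R = field_setD[OF L(1)]
    have x: "alg_over L x" using insert.prems alg_over_mono L(2) by blast
    have sup: "L \<subseteq> adjoin L x" "x \<in> adjoin L x" using adjoin_superset[OF R] adjoin_self[OF R] .
    have "finite_over F (adjoin L x)"
      using finite_over_trans[OF field_setD[OF F] L(4) adjoin_alg(1)[OF L(1) x]] .
    moreover have "adjoin L x \<subseteq> S" if "ring_set S" "F \<subseteq> S" "insert x Y \<subseteq> S" for S
      using that L(5) by (intro adjoin_subset) auto
    ultimately show ?case using adjoin_alg(2)[OF L(1) x] sup L(2,3)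
      by (intro exI[of _ "adjoin L x"]) auto
  qed
  then show ?thesis using that by blast
qed

lemma alg_over_tower:
  assumes "field_set F" "field_set L" "finite_over F L" "alg_over L x" shows "alg_over F x"
  using finite_over_imp_alg_over[OF assms(1) finite_over_trans[OF field_setD[OF assms(1)] assms(3)
      adjoin_alg(1)[OF assms(2,4)]] ring_set_adjoin adjoin_self] field_setD[OF assms(2)] by blast

lemma fracs_superset: "ring_set R \<Longrightarrow> R \<subseteq> fracs R"
  unfolding fracs_def by (force intro: exI[of _ 1])

lemma field_set_fracs:
  assumes R: "ring_set R" shows "field_set (fracs R)"
  unfolding field_set_def ring_set_def
proof (intro conjI ballI)
  show "1 \<in> fracs R" using fracs_superset[OF R] R by auto
  fix x assume "x \<in> fracs R"
  then obtain a b where x: "x = a / b" "a \<in> R" "b \<in> R" "b \<noteq> 0" unfolding fracs_def by blast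
  show "inverse x \<in> fracs R"
  proof (cases "a = 0")
    case True
    then show ?thesis using x fracs_superset[OF R] R by auto
  next
    case False
    then show ?thesis using x unfolding fracs_def by (auto simp: inverse_eq_divide)
  qed
  fix y assume "y \<in> fracs R"
  then obtain c d where y: "y = c / d" "c \<in> R" "d \<in> R" "d \<noteq> 0" unfolding fracs_def by blast
  have "x - y = (a * d - c * b) / (b * d)" "x * y = (a * c) / (b * d)"
    using x y by (simp_all add: diff_frac_eq)
  moreover have "a * d - c * b \<in> R" "a * c \<in> R" "b * d \<in> R" "b * d \<noteq> 0"
    using x y R by (auto intro: ring_set_intros)
  ultimately show "x - y \<in> fracs R" "x * y \<in> fracs R" unfolding fracs_def by blast+
qed

lemma fracs_subset: "field_set F \<Longrightarrow> R \<subseteq> F \<Longrightarrow> fracs R \<subseteq> F"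
  unfolding fracs_def by (auto intro: field_set_divide)

lemma alg_over_fracs:
  assumes R: "ring_set R" and x: "alg_over (fracs R) x" shows "alg_over R x"
proof -
  obtain p where p: "p \<noteq> 0" "\<forall>i. coeff p i \<in> fracs R" "poly p x = 0" using x unfolding alg_over_def by blast
  have "\<forall>i. \<exists>b. b \<in> R \<and> b \<noteq> 0 \<and> b * coeff p i \<in> R"
  proof
    fix i
    obtain a b where "coeff p i = a / b" "a \<in> R" "b \<in> R" "b \<noteq> 0" using p(2) unfolding fracs_def by blast
    then show "\<exists>b. b \<in> R \<and> b \<noteq> 0 \<and> b * coeff p i \<in> R" by (intro exI[of _ b]) auto
  qed
  then obtain b where b: "\<And>i. b i \<in> R" "\<And>i. b i \<noteq> 0" "\<And>i. b i * coeff p i \<in> R" by metis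
  define D where "D = (\<Prod>i\<le>degree p. b i)"
  have D: "D \<noteq> 0" unfolding D_def using b(2) by simp
  have "D * coeff p i \<in> R" for i
  proof (cases "i \<le> degree p")
    case True
    then have "D * coeff p i = (\<Prod>j\<in>{..degree p} - {i}. b j) * (b i * coeff p i)"
      unfolding D_def by (subst prod.remove[of _ i]) (auto simp: mult_ac)
    also have "\<dots> \<in> R" by (rule ring_set_mult[OF R ring_set_prod[OF R b(1)] b(3)])
    finally show ?thesis .
  next
    case False then show ?thesis using R by (simp add: coeff_eq_0)
  qed
  then show ?thesis unfolding alg_over_def using D p by (intro exI[of _ "smult D p"]) auto
qed

lemma alg_over_inverse:
  assumes "alg_over R x" "0 \<in> R" "1 \<in> R" shows "alg_over R (inverse x)"
proof (cases "x = 0")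
  case True
  then show ?thesis using assms unfolding alg_over_def
    by (intro exI[of _ "[:0, 1:]"]) (auto simp: coeff_pCons split: nat.splits)
next
  case False
  obtain p where p: "p \<noteq> 0" "\<forall>i. coeff p i \<in> R" "poly p x = 0" using assms unfolding alg_over_def by blast
  have "poly (reflect_poly p) (inverse x) = 0"
    using False p(3) by (simp add: poly_reflect_poly_nz)
  then show ?thesis unfolding alg_over_def using p assms
    by (intro exI[of _ "reflect_poly p"]) (auto simp: coeff_reflect_poly)
qed

text \<open>If \<open>s = inverse f\<close> were transcendental, it would be a non-unit of the
  polynomial ring \<open>k[s]\<close>, and a valuation ring above \<open>k[s]\<close> with
  \<open>s\<close> in its maximal ideal cannot contain \<open>f\<close>. This takes the place of the
  theorem that a function without poles is constant.\<close>

lemma alg_over_of_all_valuations: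
  assumes k: "field_set k" and f: "\<And>W. valuation_set W \<Longrightarrow> k \<subseteq> W \<Longrightarrow> f \<in> W"
  shows "alg_over k f"
proof -
  note R = field_setD[OF k]
  define s where "s = inverse f"
  have "alg_over k s"
  proof (rule ccontr)
    assume s: "\<not> alg_over k s"
    have "1 \<notin> (\<lambda>a. s * a) ` adjoin k s"
    proof
      assume "1 \<in> (\<lambda>a. s * a) ` adjoin k s"
      then obtain p where p: "\<forall>i. coeff p i \<in> k" "1 = s * poly p s" unfolding adjoin_def by blast
      have "poly (pCons (- 1) p) s = 0" using p(2) by simp
      moreover have "\<forall>i. coeff (pCons (- 1) p) i \<in> k"
        using p(1) R by (auto simp: coeff_pCons ring_set_uminus split: nat.splits)
      ultimately show False using s unfolding alg_over_def by (metis one_neq_neg_one pCons_eq_0_iff neg_equal_0_iff_equal zero_neq_one)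
    qed
    then obtain W where W: "valuation_set W" "adjoin k s \<subseteq> W" "s \<in> max_ideal W"
      using exists_valuation_set[OF ring_set_adjoin[OF R] adjoin_self[OF R]] by metis
    moreover have "f \<in> W" using f W adjoin_superset[OF R] by blast
    moreover have "s \<noteq> 0" using s alg_over_self[OF R] R by auto
    ultimately show False unfolding s_def max_ideal_def by auto
  qed
  then show ?thesis using alg_over_inverse[of k s] R unfolding s_def by simp
qed

text \<open>Division of the equation by a power of \<open>x\<close> writes the leading coefficient
  as a multiple of \<open>inverse x\<close>. If \<open>x\<close> were outside \<open>W\<close>, the
  factor would lie in \<open>W\<close> and \<open>inverse x\<close> in the maximal ideal, against
  the coefficient being a unit.\<close>

lemma root_in_valuation_set:
  assumes W: "valuation_set W" and p: "\<And>i. coeff p i \<in> W" "lead_coeff p \<in> units_of_set W" "poly p x = 0"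
  shows "x \<in> W"
proof (rule ccontr)
  assume x: "x \<notin> W"
  note R = valuation_setD[OF W]
  have s: "inverse x \<in> max_ideal W" by (rule valuation_inverse_max_ideal[OF W x])
  have x0: "x \<noteq> 0" using x R by auto
  have "poly (reflect_poly p) (inverse x) = 0" using x0 p(3) by (simp add: poly_reflect_poly_nz)
  moreover obtain c r where cr: "reflect_poly p = pCons c r" by (cases "reflect_poly p")
  ultimately have "lead_coeff p + inverse x * poly r (inverse x) = 0"
    by (metis coeff_0_reflect_poly coeff_pCons_0 poly_pCons)
  then have e: "lead_coeff p = (- poly r (inverse x)) * inverse x" by (simp add: eq_neg_iff_add_eq_0 mult.commute)
  have "coeff r i \<in> W" for i
    using p(1) cr R by (metis coeff_pCons_Suc coeff_reflect_poly ring_set_0)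
  then have "- poly r (inverse x) \<in> W"
    using s max_ideal_subset R by (intro ring_set_uminus ring_set_poly) auto
  then have "lead_coeff p \<in> max_ideal W" unfolding e by (rule max_ideal_mult_left[OF R _ s])
  then show False using p(2) units_of_set_iff[OF R] by auto
qed

lemma field_set_units: "field_set k \<Longrightarrow> k \<subseteq> W \<Longrightarrow> c \<in> k \<Longrightarrow> c \<noteq> 0 \<Longrightarrow> c \<in> units_of_set W"
  unfolding units_of_set_def using field_set_inverse by blast

lemma alg_over_in_valuation_set:
  assumes "field_set k" "k \<subseteq> W" "valuation_set W" "alg_over k x" shows "x \<in> W"
proof -
  obtain p where "p \<noteq> 0" "\<forall>i. coeff p i \<in> k" "poly p x = 0" using assms unfolding alg_over_def by blast
  moreover from this have "lead_coeff p \<in> units_of_set W" by (intro field_set_units[OF assms(1,2)]) auto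
  ultimately show ?thesis
    using assms(2) by (intro root_in_valuation_set[OF assms(3), of p x]) blast+
qed

lemma alg_over_unit:
  assumes "field_set k" "k \<subseteq> W" "valuation_set W" "alg_over k x" "x \<noteq> 0" shows "x \<in> units_of_set W"
  using alg_over_in_valuation_set[OF assms(1-3)] alg_over_inverse[OF assms(4)] assms(4,5)
    field_setD[OF assms(1)] by (auto simp: units_of_set_def)

text \<open>The leading coefficient serves as \<open>a\<close>, since \<open>a * x\<close> is
  integral over \<open>P\<close>. What matters is that \<open>a\<close> does not depend on
  \<open>W\<close>.\<close>

lemma alg_over_denominator:
  assumes P: "ring_set P" and x: "alg_over P x"
  obtains a where "a \<in> P" "a \<noteq> 0" "\<And>W. valuation_set W \<Longrightarrow> P \<subseteq> W \<Longrightarrow> a * x \<in> W"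
proof -
  obtain p where p: "p \<noteq> 0" "\<forall>i. coeff p i \<in> P" "poly p x = 0" using x unfolding alg_over_def by blast
  define d a where "d = degree p" and "a = lead_coeff p"
  have a: "a \<in> P" "a \<noteq> 0" using p by (auto simp: a_def)
  have "a * x \<in> W" if W: "valuation_set W" "P \<subseteq> W" for W
  proof (rule ccontr)
    assume n: "a * x \<notin> W"
    note RW = valuation_setD[OF W(1)]
    define s where "s = inverse (a * x)"
    have s: "s \<in> max_ideal W" unfolding s_def by (rule valuation_inverse_max_ideal[OF W(1) n])
    have nz: "a * x \<noteq> 0" using n RW by auto
    have d0: "d > 0"
    proof (rule ccontr)
      assume "\<not> d > 0"
      then obtain c where "p = [:c:]" unfolding d_def using degree_eq_zeroE by blast
      then show False using p by simp
    qed
    have "0 = (\<Sum>i\<le>d. coeff p i * x ^ i)" using p(3) by (simp add: poly_altdef d_def)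
    also have "{..d} = insert d {..<d}" by auto
    finally have "a * x ^ d = - (\<Sum>i<d. coeff p i * x ^ i)"
      by (simp add: d_def a_def eq_neg_iff_add_eq_0)
    \<comment> \<open>Multiplied by \<open>a ^ (d - 1) * s ^ d\<close>, the top term becomes 1, and
      every other term keeps at least one factor \<open>s\<close> from the maximal ideal.\<close>
    then have "a ^ (d - 1) * (a * x ^ d) * s ^ d = - (\<Sum>i<d. coeff p i * x ^ i) * a ^ (d - 1) * s ^ d"
      by simp
    moreover have "a ^ (d - 1) * (a * x ^ d) * s ^ d = 1"
    proof -
      have "a ^ (d - 1) * (a * x ^ d) = (a * x) ^ d"
        using d0 by (cases d) (auto simp: power_mult_distrib)
      moreover have "(a * x) ^ d * s ^ d = 1"
        unfolding s_def using nz by (metis power_mult_distrib right_inverse power_one)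
      ultimately show ?thesis by simp
    qed
    moreover have "x ^ i * a ^ (d - 1) * s ^ d = a ^ (d - 1 - i) * s ^ (d - i)" if "i < d" for i
    proof -
      have "a ^ (d - 1) = a ^ i * a ^ (d - 1 - i)" "s ^ d = s ^ i * s ^ (d - i)"
        using that by (simp_all flip: power_add)
      then have "x ^ i * a ^ (d - 1) * s ^ d = ((a * x) * s) ^ i * (a ^ (d - 1 - i) * s ^ (d - i))"
        by (simp add: power_mult_distrib)
      moreover have "(a * x) * s = 1" unfolding s_def using nz by (rule right_inverse)
      ultimately show ?thesis by simp
    qed
    then have "(\<Sum>i<d. coeff p i * x ^ i) * a ^ (d - 1) * s ^ d
        = (\<Sum>i<d. coeff p i * (a ^ (d - 1 - i) * s ^ (d - i)))"
      unfolding sum_distrib_right by (intro sum.cong) (auto simp: mult.assoc)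
    moreover have "(\<Sum>i<d. coeff p i * (a ^ (d - 1 - i) * s ^ (d - i))) \<in> max_ideal W"
    proof (intro valuation_max_ideal_sum[OF W(1)])
      fix i assume "i \<in> {..<d}"
      then obtain j where j: "d - i = Suc j" by (metis Suc_diff_Suc lessThan_iff)
      have "coeff p i * (a ^ (d - 1 - i) * s ^ j) * s \<in> max_ideal W"
        using RW p(2) a(1) W(2) s max_ideal_subset
        by (intro max_ideal_mult_left ring_set_mult ring_set_power) auto
      then show "coeff p i * (a ^ (d - 1 - i) * s ^ (d - i)) \<in> max_ideal W"
        unfolding j by (simp add: mult_ac)
    qed
    then have "- (\<Sum>i<d. coeff p i * (a ^ (d - 1 - i) * s ^ (d - i))) \<in> max_ideal W"
      by (rule valuation_max_ideal_uminus[OF RW])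
    ultimately have "1 \<in> max_ideal W" by simp
    then show False using RW by simp
  qed
  then show ?thesis using that a by blast
qed

section \<open>Places of function fields of one variable\<close>

abbreviation ratfuns :: "'a::field set \<Rightarrow> 'a \<Rightarrow> 'a set" where
  "ratfuns k g \<equiv> fracs (adjoin k g)"

text \<open>\<open>g\<close> takes over the role of a uniformizer, up to ramification. As soon as it
  is nonzero, it is transcendental over the field \<open>k\<close>.\<close>

definition place :: "'a::field set \<Rightarrow> 'a \<Rightarrow> 'a set \<Rightarrow> bool" where
  "place k g W \<longleftrightarrow> valuation_set W \<and> k \<subseteq> W \<and> g \<in> max_ideal W"

lemma placeD:
  assumes "place k g W"
  shows "valuation_set W" "ring_set W" "k \<subseteq> W" "g \<in> max_ideal W" "g \<in> W"
  using assms max_ideal_subset by (auto simp: place_def valuation_setD)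

lemma field_set_ratfuns: "field_set k \<Longrightarrow> field_set (ratfuns k g)"
  by (intro field_set_fracs ring_set_adjoin field_setD)

lemma ratfuns_superset: "field_set k \<Longrightarrow> k \<subseteq> ratfuns k g" "field_set k \<Longrightarrow> g \<in> ratfuns k g"
  using fracs_superset[OF ring_set_adjoin[of k g]] adjoin_superset[of k g] adjoin_self[of k g] field_setD[of k]
  by blast+

lemma ratfuns_subset: "field_set L \<Longrightarrow> k \<subseteq> L \<Longrightarrow> g \<in> L \<Longrightarrow> ratfuns k g \<subseteq> L"
  by (intro fracs_subset adjoin_subset field_setD) auto

lemma valuation_dominant:
  assumes W: "valuation_set W" and "finite I" "I \<noteq> {}" "\<And>i. i \<in> I \<Longrightarrow> t i \<noteq> 0"
  shows "\<exists>j\<in>I. \<forall>i\<in>I. t i / t j \<in> W"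
  using assms(2-)
proof (induction I rule: finite_ne_induct)
  case (singleton x)
  then show ?case using valuation_setD[OF W] by simp
next
  case (insert x I)
  note R = valuation_setD[OF W]
  obtain j where j: "j \<in> I" "\<forall>i\<in>I. t i / t j \<in> W" using insert by auto
  show ?case
  proof (cases "t x / t j \<in> W")
    case True then show ?thesis using j by blast
  next
    case False
    then have *: "t j / t x \<in> W" using valuation_set_inverse[OF W False] by simp
    have "t i / t x \<in> W" if "i \<in> I" for i
    proof -
      have "t i / t x = (t i / t j) * (t j / t x)" using insert.prems j(1) by simp
      also have "\<dots> \<in> W" using j(2) that by (intro ring_set_mult[OF R _ *]) blast
      finally show ?thesis .
    qed
    moreover have "t x / t x \<in> W" using insert.prems R by simp
    ultimately show ?thesis by blast
  qed
qed

text \<open>After division by a dominant term the others sum to -1, which is not in the maximal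
  ideal, so one of them differs from the dominant term by a unit.\<close>

lemma zero_sum_associates:
  assumes W: "valuation_set W" and I: "finite I" "I \<noteq> {}" "\<And>i. i \<in> I \<Longrightarrow> t i \<noteq> 0" and s: "sum t I = 0"
  obtains i j where "i \<in> I" "j \<in> I" "i \<noteq> j" "t i / t j \<in> units_of_set W"
proof -
  note R = valuation_setD[OF W]
  have "\<exists>j\<in>I. \<forall>i\<in>I. t i / t j \<in> W" by (rule valuation_dominant[OF W I(1,2)]) (rule I(3))
  then obtain j where j: "j \<in> I" "\<forall>i\<in>I. t i / t j \<in> W" by blast
  have "\<exists>i\<in>I - {j}. t i / t j \<notin> max_ideal W"
  proof (rule ccontr)
    assume "\<not> ?thesis"
    then have "(\<Sum>i\<in>I - {j}. t i / t j) \<in> max_ideal W" by (intro valuation_max_ideal_sum[OF W]) auto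
    moreover have "(\<Sum>i\<in>I - {j}. t i / t j) = - 1"
    proof -
      have "t j + (\<Sum>i\<in>I - {j}. t i) = 0" using s I(1) j(1) by (simp add: sum.remove)
      then have "(\<Sum>i\<in>I - {j}. t i) = - t j" by (simp add: eq_neg_iff_add_eq_0 add.commute)
      then show ?thesis using I(3)[OF j(1)] by (simp flip: sum_divide_distrib)
    qed
    ultimately have "- (- 1) \<in> max_ideal W" using valuation_max_ideal_uminus[OF R, of "- 1"] by simp
    then show False using R by simp
  qed
  then show ?thesis using that j units_of_set_iff[OF R] by blast
qed

lemma poly_nonzero_const:
  fixes p :: "'a::field poly"
  assumes "poly p g \<noteq> 0" "\<And>i. coeff p i \<in> k"
  shows "\<exists>n q. poly p g = g ^ n * poly q g \<and> coeff q 0 \<noteq> 0 \<and> (\<forall>i. coeff q i \<in> k)"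
  using assms
proof (induction p rule: pCons_induct)
  case (pCons a p)
  show ?case
  proof (cases "a = 0")
    case True
    have "\<And>i. coeff p i \<in> k" using pCons.prems(2) by (metis coeff_pCons_Suc)
    moreover have "poly p g \<noteq> 0" using pCons.prems(1) True by auto
    ultimately obtain n q where "poly p g = g ^ n * poly q g" "coeff q 0 \<noteq> 0" "\<forall>i. coeff q i \<in> k"
      using pCons.IH by blast
    then show ?thesis using True by (intro exI[of _ "Suc n"] exI[of _ q]) (auto simp: mult.assoc)
  next
    case False
    then have "coeff (pCons a p) 0 \<noteq> 0" by simp
    moreover have "poly (pCons a p) g = g ^ 0 * poly (pCons a p) g" by simp
    ultimately show ?thesis using pCons.prems(2) by blast
  qed
qed simp

lemma poly_unit_at_place:
  assumes k: "field_set k" and W: "place k g W" and q: "coeff q 0 \<noteq> 0" "\<And>i. coeff q i \<in> k"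
  shows "poly q g \<in> units_of_set W"
proof -
  note P = placeD[OF W]
  obtain c r where cr: "q = pCons c r" by (cases q)
  have c: "c \<in> units_of_set W" using q(1) q(2)[of 0] cr by (auto intro: field_set_units[OF k P(3)])
  have "coeff r i \<in> W" for i using q(2) P(3) cr by (metis coeff_pCons_Suc subsetD)
  then have m: "g * poly r g \<in> max_ideal W"
    using max_ideal_mult_left[OF P(2) _ P(4), of "poly r g"] P by (simp add: mult.commute ring_set_poly)
  have "c + g * poly r g \<in> W" using c m max_ideal_subset P(2) by (intro ring_set_add) (auto simp: units_of_set_def)
  moreover have "c + g * poly r g \<notin> max_ideal W"
    using valuation_max_ideal_diff[OF P(1) _ m, of "c + g * poly r g"] c units_of_set_iff[OF P(2)] by auto
  ultimately show ?thesis unfolding cr using units_of_set_iff[OF P(2)] by simp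
qed

text \<open>Powers of \<open>g\<close> are split off numerator and denominator until the constant
  terms are nonzero. The unit \<open>u\<close> is the same for all places of \<open>g\<close>,
  because on \<open>k(g)\<close> they all induce the \<open>g\<close>-adic valuation. This is what
  later carries an estimate from one place to all the others.\<close>

lemma ratfuns_cases:
  assumes k: "field_set k" and x: "x \<in> ratfuns k g" "x \<noteq> 0" and g: "g \<noteq> 0"
  obtains n u where "x = g powi n * u" "\<And>W. place k g W \<Longrightarrow> u \<in> units_of_set W"
proof -
  obtain p q where pq: "x = poly p g / poly q g" "\<And>i. coeff p i \<in> k" "\<And>i. coeff q i \<in> k" "poly q g \<noteq> 0"
    using x(1) unfolding fracs_def adjoin_def by auto
  have "poly p g \<noteq> 0" using x(2) pq by auto
  then obtain n p' where p': "poly p g = g ^ n * poly p' g" "coeff p' 0 \<noteq> 0" "\<forall>i. coeff p' i \<in> k"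
    using poly_nonzero_const pq(2) by blast
  obtain m q' where q': "poly q g = g ^ m * poly q' g" "coeff q' 0 \<noteq> 0" "\<forall>i. coeff q' i \<in> k"
    using poly_nonzero_const pq(3,4) by blast
  show ?thesis
  proof (rule that[of "int n - int m" "poly p' g / poly q' g"])
    show "x = g powi (int n - int m) * (poly p' g / poly q' g)"
      unfolding pq(1) p' q' using g by (simp add: power_int_diff)
    show "poly p' g / poly q' g \<in> units_of_set W" if "place k g W" for W
      unfolding divide_inverse using that p' q' placeD(2)[OF that]
      by (intro units_of_set_mult units_of_set_inverse poly_unit_at_place[OF k]) auto
  qed
qed

section \<open>Powers of the parameter and rational orders at a place\<close>

lemma max_ideal_power:
  assumes "ring_set W" "g \<in> max_ideal W" and n: "n > 0" shows "g ^ n \<in> max_ideal W"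
  using n
proof (induction n rule: nat_induct_non_zero)
  case (Suc n)
  then show ?case using max_ideal_mult_left[of W g "g ^ n"] max_ideal_subset assms(1,2) by auto
qed (use assms in simp)

lemma place_powi_in_iff:
  assumes W: "place k g W" and g: "g \<noteq> 0"
  shows "g powi n \<in> W \<longleftrightarrow> n \<ge> 0"
proof
  assume n: "g powi n \<in> W"
  show "n \<ge> 0"
  proof (rule ccontr)
    assume "\<not> n \<ge> 0"
    then have "inverse (g ^ nat (- n)) \<in> W" "nat (- n) > 0" using n by (auto simp: power_int_def power_inverse)
    then show False using max_ideal_power[OF placeD(2,4)[OF W]] g by (auto simp: max_ideal_def)
  qed
next
  assume "n \<ge> 0"
  then show "g powi n \<in> W" using placeD[OF W] by (auto simp: power_int_def intro: ring_set_power)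
qed

lemma place_powi_unit:
  assumes W: "place k g W" and g: "g \<noteq> 0" and u: "g powi n \<in> units_of_set W"
  shows "n = 0"
proof -
  have "g powi n \<in> W" "g powi (- n) \<in> W" using u by (auto simp: units_of_set_def power_int_minus)
  then show ?thesis using place_powi_in_iff[OF W g, of n] place_powi_in_iff[OF W g, of "- n"] by linarith
qed

text \<open>The order of \<open>f\<close>, normalized so that \<open>g\<close> has order 1:
  \<open>f ^ e\<close> equals \<open>g powi m\<close> up to a unit. Ramification makes it rational.
  Reading it off from a power of \<open>f\<close> avoids any discreteness of the value group, which
  fails over an algebraically closed field such as \<Omega>.\<close>

definition vord :: "'a::field set \<Rightarrow> 'a \<Rightarrow> 'a \<Rightarrow> rat" where
  "vord W g f = (THE q. \<exists>e m. e > 0 \<and> f ^ e * g powi (- m) \<in> units_of_set W \<and> q = of_int m / of_nat e)"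

lemma vord_eqI:
  assumes W: "place k g W" and g: "g \<noteq> 0" and f: "e > 0" "f ^ e * g powi (- m) \<in> units_of_set W"
  shows "vord W g f = of_int m / of_nat e"
  unfolding vord_def
proof (rule the_equality)
  fix q :: rat
  assume "\<exists>e m. e > 0 \<and> f ^ e * g powi (- m) \<in> units_of_set W \<and> q = of_int m / of_nat e"
  then obtain e' m' where f': "e' > 0" "f ^ e' * g powi (- m') \<in> units_of_set W" "q = of_int m' / of_nat e'"
    by blast
  note R = placeD(2)[OF W]
  have f0: "f \<noteq> 0" using f by (auto simp: units_of_set_def zero_power)
  have "(f ^ e * g powi (- m)) ^ e' * inverse ((f ^ e' * g powi (- m')) ^ e) \<in> units_of_set W"
    by (rule units_of_set_mult[OF R units_of_set_power[OF R f(2)]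
          units_of_set_inverse[OF units_of_set_power[OF R f'(2)]]])
  also have "(f ^ e * g powi (- m)) ^ e' = f ^ (e * e') * g powi (- m * int e')"
    by (simp only: power_mult_distrib power_int_power' power_mult)
  also have "(f ^ e' * g powi (- m')) ^ e = f ^ (e' * e) * g powi (- m' * int e)"
    by (simp only: power_mult_distrib power_int_power' power_mult)
  also have "f ^ (e * e') * g powi (- m * int e') * inverse (f ^ (e' * e) * g powi (- m' * int e))
     = g powi (- m * int e') * g powi (m' * int e)"
    using f0 by (simp add: mult.commute[of e' e] power_int_minus)
  also have "\<dots> = g powi (m' * int e - m * int e')" using g by (simp flip: power_int_add)
  finally have "m' * int e - m * int e' = 0" by (rule place_powi_unit[OF W g])
  then have "(of_int (m' * int e) :: rat) = of_int (m * int e')" by simp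
  then show "q = of_int m / of_nat e" unfolding f'(3) using f(1) f'(1) by (simp add: frac_eq_eq)
qed (use f in blast)

text \<open>Two terms of an algebraic equation for \<open>f\<close> over \<open>k(g)\<close> must
  agree up to a unit. Their quotient is \<open>f ^ (i - j)\<close> times an element of
  \<open>k(g)\<close>, and the latter is a power of \<open>g\<close> up to a unit.\<close>

lemma vord_exists:
  assumes k: "field_set k" and W: "place k g W" and g: "g \<noteq> 0" and f: "alg_over (ratfuns k g) f" "f \<noteq> 0"
  obtains e m where "e > 0" "f ^ e * g powi (- m) \<in> units_of_set W"
proof -
  note P = placeD[OF W]
  obtain p where p: "p \<noteq> 0" "\<forall>i. coeff p i \<in> ratfuns k g" "poly p f = 0" using f unfolding alg_over_def by blast
  let ?I = "{i. i \<le> degree p \<and> coeff p i \<noteq> 0}"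
  have "(\<Sum>i\<in>?I. coeff p i * f ^ i) = (\<Sum>i\<le>degree p. coeff p i * f ^ i)"
    by (intro sum.mono_neutral_left) auto
  then have s: "(\<Sum>i\<in>?I. coeff p i * f ^ i) = 0" using p(3) by (simp add: poly_altdef)
  have ne: "?I \<noteq> {}" using p(1) by (auto intro: exI[of _ "degree p"])
  obtain i j where ij: "i \<in> ?I" "j \<in> ?I" "i \<noteq> j" "(coeff p i * f ^ i) / (coeff p j * f ^ j) \<in> units_of_set W"
    by (rule zero_sum_associates[OF P(1) _ ne _ s]) (use f(2) in auto)
  have main: "\<exists>e m. e > 0 \<and> f ^ e * g powi (- m) \<in> units_of_set W" if ij: "i > j" "coeff p i \<noteq> 0" "coeff p j \<noteq> 0"
    "(coeff p i * f ^ i) / (coeff p j * f ^ j) \<in> units_of_set W" for i j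
  proof -
    have "coeff p i / coeff p j \<in> ratfuns k g" "coeff p i / coeff p j \<noteq> 0"
      using p(2) ij field_set_ratfuns[OF k] by (auto intro: field_set_divide)
    then obtain n u where nu: "coeff p i / coeff p j = g powi n * u" "u \<in> units_of_set W"
      using ratfuns_cases[OF k _ _ g] W by metis
    have u0: "u \<noteq> 0" using nu by (auto simp: units_of_set_def)
    have "(coeff p i * f ^ i) / (coeff p j * f ^ j) = g powi n * u * f ^ (i - j)"
      unfolding nu(1)[symmetric] using ij f(2) by (simp add: power_diff)
    then have "(g powi n * u * f ^ (i - j)) * inverse u \<in> units_of_set W"
      using ij(4) nu(2) P(2) by (metis units_of_set_mult units_of_set_inverse)
    also have "(g powi n * u * f ^ (i - j)) * inverse u = f ^ (i - j) * g powi (- (- n))"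
      using u0 by (simp add: field_simps)
    finally have "f ^ (i - j) * g powi (- (- n)) \<in> units_of_set W" .
    then show ?thesis using ij(1) by (intro exI[of _ "i - j"] exI[of _ "- n"]) simp
  qed
  show ?thesis
  proof (cases "i > j")
    case True
    then have "\<exists>e m. e > 0 \<and> f ^ e * g powi (- m) \<in> units_of_set W"
      using ij by (intro main) auto
    then show ?thesis using that by blast
  next
    case False
    then have "j > i" using ij(3) by simp
    moreover have "(coeff p j * f ^ j) / (coeff p i * f ^ i) \<in> units_of_set W"
      using units_of_set_inverse[OF ij(4)] by (simp only: inverse_divide)
    ultimately have "\<exists>e m. e > 0 \<and> f ^ e * g powi (- m) \<in> units_of_set W"
      using ij(1,2) by (intro main) auto
    then show ?thesis using that by blast
  qed
qed

lemma vord_mult: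
  assumes k: "field_set k" and W: "place k g W" and g: "g \<noteq> 0"
    and f: "alg_over (ratfuns k g) f" "f \<noteq> 0" and h: "alg_over (ratfuns k g) h" "h \<noteq> 0"
  shows "vord W g (f * h) = vord W g f + vord W g h"
proof -
  obtain e m where em: "e > 0" "f ^ e * g powi (- m) \<in> units_of_set W" using vord_exists[OF k W g f] .
  obtain d n where dn: "d > 0" "h ^ d * g powi (- n) \<in> units_of_set W" using vord_exists[OF k W g h] .
  have "(f ^ e * g powi (- m)) ^ d * (h ^ d * g powi (- n)) ^ e \<in> units_of_set W"
    using em dn placeD(2)[OF W] by (metis units_of_set_mult units_of_set_power)
  also have "(f ^ e * g powi (- m)) ^ d = f ^ (e * d) * g powi (- m * int d)"
    by (simp only: power_mult_distrib power_int_power' power_mult)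
  also have "(h ^ d * g powi (- n)) ^ e = h ^ (d * e) * g powi (- n * int e)"
    by (simp only: power_mult_distrib power_int_power' power_mult)
  also have "f ^ (e * d) * g powi (- m * int d) * (h ^ (d * e) * g powi (- n * int e))
    = (f * h) ^ (e * d) * (g powi (- m * int d) * g powi (- n * int e))"
    unfolding mult.commute[of d e] power_mult_distrib by (simp only: mult_ac)
  also have "g powi (- m * int d) * g powi (- n * int e) = g powi (- (m * int d + n * int e))"
    using g by (simp flip: power_int_add)
  finally have "vord W g (f * h) = of_int (m * int d + n * int e) / of_nat (e * d)"
    using em dn by (intro vord_eqI[OF W g]) auto
  moreover have "vord W g f = of_int m / of_nat e" "vord W g h = of_int n / of_nat d"
    using vord_eqI[OF W g] em dn by blast+
  ultimately show ?thesis using em(1) dn(1) by (simp add: add_frac_eq)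
qed

lemma vord_inverse:
  assumes k: "field_set k" and W: "place k g W" and g: "g \<noteq> 0"
    and f: "alg_over (ratfuns k g) f" "f \<noteq> 0"
  shows "vord W g (inverse f) = - vord W g f"
proof -
  obtain e m where em: "e > 0" "f ^ e * g powi (- m) \<in> units_of_set W" using vord_exists[OF k W g f] .
  have "inverse (f ^ e * g powi (- m)) \<in> units_of_set W" using em by (intro units_of_set_inverse)
  then have "inverse f ^ e * g powi (- (- m)) \<in> units_of_set W" by (simp add: power_int_minus power_inverse)
  then have "vord W g (inverse f) = of_int (- m) / of_nat e" by (rule vord_eqI[OF W g em(1)])
  then show ?thesis using vord_eqI[OF W g em] by simp
qed

lemma vord_power:
  assumes k: "field_set k" and W: "place k g W" and g: "g \<noteq> 0"
    and f: "alg_over (ratfuns k g) f" "f \<noteq> 0"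
  shows "vord W g (f ^ n) = of_nat n * vord W g f"
proof -
  obtain e m where em: "e > 0" "f ^ e * g powi (- m) \<in> units_of_set W" using vord_exists[OF k W g f] .
  have "(f ^ e * g powi (- m)) ^ n \<in> units_of_set W" using em placeD(2)[OF W] by (intro units_of_set_power)
  also have "(f ^ e * g powi (- m)) ^ n = (f ^ n) ^ e * g powi (- (m * int n))"
    by (simp only: power_mult_distrib power_int_power' mult_minus_left flip: power_mult)
      (simp add: mult.commute)
  finally have "vord W g (f ^ n) = of_int (m * int n) / of_nat e" by (rule vord_eqI[OF W g em(1)])
  then show ?thesis using vord_eqI[OF W g em] by simp
qed

lemma vord_nonneg:
  assumes k: "field_set k" and W: "place k g W" and g: "g \<noteq> 0"
    and f: "alg_over (ratfuns k g) f" "f \<noteq> 0" "f \<in> W"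
  shows "vord W g f \<ge> 0"
proof -
  note P = placeD[OF W]
  obtain e m where em: "e > 0" "f ^ e * g powi (- m) \<in> units_of_set W" using vord_exists[OF k W g f(1,2)] .
  have "m \<ge> 0"
  proof (rule ccontr)
    assume "\<not> m \<ge> 0"
    then have "g powi (- m) \<in> max_ideal W" using max_ideal_power[OF P(2,4)] by (simp add: power_int_def)
    then have "f ^ e * g powi (- m) \<in> max_ideal W"
      using P(2) f(3) by (intro max_ideal_mult_left ring_set_power)
    then show False using em(2) units_of_set_iff[OF P(2)] by blast
  qed
  then show ?thesis using vord_eqI[OF W g em] by simp
qed

lemma vord_pos:
  assumes k: "field_set k" and W: "place k g W" and g: "g \<noteq> 0"
    and f: "alg_over (ratfuns k g) f" "f \<noteq> 0" "vord W g f > 0"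
  shows "f \<in> max_ideal W"
proof -
  note P = placeD[OF W]
  obtain e m where em: "e > 0" "f ^ e * g powi (- m) \<in> units_of_set W" using vord_exists[OF k W g f(1,2)] .
  have "m > 0" using f(3) vord_eqI[OF W g em] em(1) by (simp add: zero_less_divide_iff)
  then have "g powi m \<in> max_ideal W" using max_ideal_power[OF P(2,4)] by (simp add: power_int_def)
  then have "(f ^ e * g powi (- m)) * g powi m \<in> max_ideal W"
    using em(2) P(2) by (intro max_ideal_mult_left) (auto simp: units_of_set_def)
  also have "(f ^ e * g powi (- m)) * g powi m = f ^ e"
    using g by (simp add: mult.assoc flip: power_int_add)
  finally have fe: "f ^ e \<in> max_ideal W" .
  then have "f \<in> W" using valuation_power_in[OF P(1) _ em(1)] max_ideal_subset by blast
  moreover have "f \<notin> units_of_set W" using fe units_of_set_power[OF P(2)] units_of_set_iff[OF P(2)] by blast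
  ultimately show ?thesis using units_of_set_iff[OF P(2)] by blast
qed

lemma vord_eq_0:
  assumes k: "field_set k" and W: "place k g W" and g: "g \<noteq> 0"
    and f: "alg_over (ratfuns k g) f" "f \<noteq> 0" "vord W g f = 0"
  shows "f \<in> units_of_set W"
proof -
  note P = placeD[OF W]
  obtain e m where em: "e > 0" "f ^ e * g powi (- m) \<in> units_of_set W" using vord_exists[OF k W g f(1,2)] .
  have "m = 0" using f(3) vord_eqI[OF W g em] em(1) by simp
  then have "f ^ e \<in> W" "inverse f ^ e \<in> W" using em(2) by (auto simp: units_of_set_def power_inverse)
  then show ?thesis using valuation_power_in[OF P(1) _ em(1)] f(2) by (auto simp: units_of_set_def)
qed

subsection \<open>Finiteness of the set of places\<close>

text \<open>The elements \<open>b\<close> and \<open>b * f\<close> below lie in every valuation ring containing the coefficients, as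
  they can be written as polynomials in \<open>f\<close> and also as polynomials in \<open>1 / f\<close>.\<close>

lemma fraction_of_universal_integers:
  assumes k: "field_set k" and W: "place k g W" and g: "g \<noteq> 0"
    and L: "field_set L" "k \<subseteq> L" "g \<in> L" and f: "alg_over (ratfuns k g) f" "f \<in> L" "f \<in> W"
  obtains b where "b \<in> L" "b * f \<in> L" "\<And>V. place k g V \<Longrightarrow> b \<in> V \<and> b * f \<in> V" "b \<notin> max_ideal W"
proof -
  note P = placeD[OF W] and RL = field_setD[OF L(1)] and RF = field_setD[OF field_set_ratfuns[OF k]]
  obtain p where p: "p \<noteq> 0" "\<forall>i. coeff p i \<in> ratfuns k g" "poly p f = 0" using f unfolding alg_over_def by blast
  let ?I = "{i. i \<le> degree p \<and> coeff p i \<noteq> 0}"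
  have ne: "?I \<noteq> {}" using p(1) by (auto intro: exI[of _ "degree p"])
  \<comment> \<open>Scaling by a dominant coefficient makes all coefficients integral at
    \<open>W\<close> and one of them equal to 1.\<close>
  have "\<exists>j\<in>?I. \<forall>i\<in>?I. coeff p i / coeff p j \<in> W"
    by (rule valuation_dominant[OF P(1) _ ne, of "coeff p"]) auto
  then obtain j where j: "j \<in> ?I" "\<forall>i\<in>?I. coeff p i / coeff p j \<in> W" by blast
  define a where "a = smult (inverse (coeff p j)) p"
  have a: "coeff a i = coeff p i / coeff p j" "coeff a i \<in> ratfuns k g" "coeff a i \<in> W" for i
  proof -
    show 1: "coeff a i = coeff p i / coeff p j" unfolding a_def by (simp add: field_simps)
    show "coeff a i \<in> ratfuns k g" unfolding 1 using p(2) field_set_ratfuns[OF k] by (auto intro: field_set_divide)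
    show "coeff a i \<in> W" unfolding 1 using j(2) P(2) by (cases "i \<in> ?I") (auto simp: coeff_eq_0)
  qed
  \<comment> \<open>The coefficients lie in \<open>k(g)\<close>, where integrality at
    \<open>W\<close> is integrality at every place of \<open>g\<close>.\<close>
  have aV: "coeff a i \<in> V" if V: "place k g V" for i V
  proof (cases "coeff a i = 0")
    case False
    obtain n u where nu: "coeff a i = g powi n * u" "\<And>V. place k g V \<Longrightarrow> u \<in> units_of_set V"
      using ratfuns_cases[OF k a(2) False g] by metis
    have u: "inverse u \<in> W" "u \<noteq> 0" using nu(2)[OF W] by (auto simp: units_of_set_def)
    have "g powi n = coeff a i * inverse u" using nu(1) u by simp
    then have "g powi n \<in> W" using a(3) u P(2) by (simp add: ring_set_mult)
    then have "n \<ge> 0" using place_powi_in_iff[OF W g] by simp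
    then show ?thesis unfolding nu(1) using nu(2)[OF V] place_powi_in_iff[OF V g] placeD(2)[OF V]
      by (auto simp: units_of_set_def intro: ring_set_mult)
  qed (use placeD(2)[OF V] in simp)
  have aL: "coeff a i \<in> L" for i using a(2) ratfuns_subset[OF L] by blast
  have pf: "poly a f = 0" unfolding a_def using p(3) by simp
  have da: "degree a = degree p" "a \<noteq> 0" using j p(1) by (auto simp: a_def)
  \<comment> \<open>The last index whose coefficient is a unit at \<open>W\<close>. The tail
    \<open>b\<close> of the equation from this index on, divided by \<open>f ^ i\<close>, is then
    congruent to \<open>coeff a i\<close> modulo the maximal ideal of \<open>W\<close>.\<close>
  define i where "i = Max {i\<in>?I. coeff a i \<notin> max_ideal W}"
  have fin: "finite {i\<in>?I. coeff a i \<notin> max_ideal W}" by simp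
  have "j \<in> {i\<in>?I. coeff a i \<notin> max_ideal W}" using j P(2) a(1) by auto
  then have i: "i \<in> ?I" "coeff a i \<notin> max_ideal W"
    unfolding i_def using Max_in[OF fin] by blast+
  have up: "coeff a l \<in> max_ideal W" if "l > i" for l
  proof (rule ccontr)
    assume "coeff a l \<notin> max_ideal W"
    moreover from this have "coeff a l \<noteq> 0" using P(2) by auto
    ultimately have "l \<in> {i\<in>?I. coeff a i \<notin> max_ideal W}" using a(1) by (auto intro: le_degree)
    then have "l \<le> i" unfolding i_def using Max_ge[OF fin] by blast
    then show False using that by simp
  qed
  define d where "d = degree p"
  have id: "i \<le> d" using i by (simp add: d_def)
  define b where "b = (\<Sum>l\<in>{i..d}. coeff a l * f ^ (l - i))"
  have sum0: "(\<Sum>l<i. coeff a l * f ^ l) + (\<Sum>l\<in>{i..d}. coeff a l * f ^ l) = 0"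
  proof -
    have "{..d} = {..<i} \<union> {i..d}" using id by auto
    then have "(\<Sum>l\<le>d. coeff a l * f ^ l) = (\<Sum>l<i. coeff a l * f ^ l) + (\<Sum>l\<in>{i..d}. coeff a l * f ^ l)"
      by (subst \<open>{..d} = _\<close>, intro sum.union_disjoint) auto
    then show ?thesis using pf da d_def by (simp add: poly_altdef)
  qed
  have bi: "b * f ^ i = (\<Sum>l\<in>{i..d}. coeff a l * f ^ l)"
    unfolding b_def sum_distrib_right by (intro sum.cong) (auto simp: mult.assoc simp flip: power_add)
  have bV: "b \<in> V \<and> b * f \<in> V" if V: "place k g V" for V
  proof (cases "f \<in> V")
    case True
    then have "b \<in> V" unfolding b_def using aV[OF V] placeD(2)[OF V]
      by (intro ring_set_sum ring_set_mult ring_set_power) auto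
    then show ?thesis using True placeD(2)[OF V] by (auto intro: ring_set_mult)
  next
    case False
    then have s: "inverse f \<in> V" and f0: "f \<noteq> 0"
      using valuation_set_inverse[OF placeD(1)[OF V]] placeD(2)[OF V] by auto
    \<comment> \<open>The equation turns the tail into minus the head, and division by
      \<open>f ^ i\<close> leaves only powers of \<open>inverse f\<close>. For \<open>b * f\<close>
      one power less is available, which is enough because \<open>l < i\<close>.\<close>
    have eq: "b * f ^ i = - (\<Sum>l<i. coeff a l * f ^ l)"
      using bi sum0 by (simp add: eq_neg_iff_add_eq_0 add.commute)
    have gen: "b * f ^ m = - (\<Sum>l<i. coeff a l * inverse f ^ (i - m - l))" if "m \<le> 1" "m \<le> i" for m
    proof -
      have "b * f ^ m = (b * f ^ i) * inverse f ^ (i - m)"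
        using f0 that by (simp add: power_inverse power_diff field_simps)
      also have "\<dots> = - (\<Sum>l<i. coeff a l * (f ^ l * inverse f ^ (i - m)))"
        unfolding eq by (simp add: sum_distrib_right mult.assoc)
      also have "(\<Sum>l<i. coeff a l * (f ^ l * inverse f ^ (i - m))) = (\<Sum>l<i. coeff a l * inverse f ^ (i - m - l))"
      proof (intro sum.cong refl)
        fix l assume "l \<in> {..<i}"
        then have "i - m = l + (i - m - l)" using that by auto
        then have "inverse f ^ (i - m) = inverse f ^ l * inverse f ^ (i - m - l)" by (metis power_add)
        then show "coeff a l * (f ^ l * inverse f ^ (i - m)) = coeff a l * inverse f ^ (i - m - l)"
          using f0 by (simp add: power_inverse)
      qed
      finally show ?thesis .
    qed
    have mem: "- (\<Sum>l<i. coeff a l * inverse f ^ (i - m - l)) \<in> V" for m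
      using aV[OF V] placeD(2)[OF V] s by (intro ring_set_uminus ring_set_sum ring_set_mult ring_set_power) auto
    show ?thesis
    proof (cases "i = 0")
      case True
      then have "b = 0" using eq by simp
      then show ?thesis using placeD(2)[OF V] by simp
    next
      case False
      then have "b \<in> V" "b * f \<in> V" using gen[of 0] gen[of 1] mem[of 0] mem[of 1] by auto
      then show ?thesis by blast
    qed
  qed
  have bL: "b \<in> L" unfolding b_def using aL f(2) RL by (intro ring_set_sum ring_set_mult ring_set_power) auto
  have "b \<notin> max_ideal W"
  proof
    assume b: "b \<in> max_ideal W"
    have "{i..d} = insert i {i<..d}" using id by auto
    then have "b = coeff a i + (\<Sum>l\<in>{i<..d}. coeff a l * f ^ (l - i))" unfolding b_def by simp
    moreover have "(\<Sum>l\<in>{i<..d}. coeff a l * f ^ (l - i)) \<in> max_ideal W"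
    proof (intro valuation_max_ideal_sum[OF P(1)])
      fix l assume "l \<in> {i<..d}"
      then show "coeff a l * f ^ (l - i) \<in> max_ideal W"
        using max_ideal_mult_left[OF P(2) _ up, of "f ^ (l - i)" l] f(3) P(2)
        by (auto simp: mult.commute intro: ring_set_power)
    qed
    ultimately have "coeff a i \<in> max_ideal W"
      using valuation_max_ideal_diff[OF P(1) b] by (metis add_diff_cancel_right')
    then show False using i by simp
  qed
  then show ?thesis using that bV bL f(2) RL by (auto intro: ring_set_mult)
qed

text \<open>Infinitely many valuation rings of \<Omega> can lie above one place of \<open>L\<close>.
  Restricting the order to \<open>L\<close>, with the value 0 elsewhere, identifies them, so the
  finite set below consists of functions and not of valuation rings.\<close>

definition place_val :: "'a::field set \<Rightarrow> 'a \<Rightarrow> 'a set \<Rightarrow> 'a \<Rightarrow> rat" where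
  "place_val L g W = (\<lambda>f. if f \<in> L \<and> f \<noteq> 0 then vord W g f else 0)"

text \<open>The hypothesis \<open>sub\<close> compares the two places only on elements that are
  integral at all places of \<open>g\<close>. Writing \<open>f = (b * f) / b\<close> with such
  elements extends the comparison to \<open>W \<inter> L \<subseteq> V\<close>. Units of
  \<open>W\<close> in \<open>L\<close> are then units of \<open>V\<close>, and this fixes all
  orders.\<close>

lemma place_val_eq:
  assumes k: "field_set k" and V: "place k g V" and W: "place k g W" and g: "g \<noteq> 0"
    and L: "field_set L" "k \<subseteq> L" "g \<in> L" and alg: "\<And>f. f \<in> L \<Longrightarrow> alg_over (ratfuns k g) f"
    and sub: "\<And>b. b \<in> L \<Longrightarrow> (\<And>V. place k g V \<Longrightarrow> b \<in> V) \<Longrightarrow> b \<in> max_ideal V \<Longrightarrow> b \<in> max_ideal W"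
  shows "place_val L g V = place_val L g W"
proof -
  have WV: "f \<in> V" if f: "f \<in> L" "f \<in> W" for f
  proof -
    obtain b where b: "b \<in> L" "b * f \<in> L" "\<And>V. place k g V \<Longrightarrow> b \<in> V \<and> b * f \<in> V" "b \<notin> max_ideal W"
      using fraction_of_universal_integers[OF k W g L alg[OF f(1)] f] by metis
    then have "b \<notin> max_ideal V" using sub by blast
    then have "b * f / b \<in> V" using b(3)[OF V] placeD(2)[OF V] by (intro ring_set_divide_unit) auto
    moreover have "b \<noteq> 0" using b(4) placeD(2)[OF W] by auto
    ultimately show ?thesis by simp
  qed
  have "vord V g f = vord W g f" if f: "f \<in> L" "f \<noteq> 0" for f
  proof -
    obtain e m where em: "e > 0" "f ^ e * g powi (- m) \<in> units_of_set W"
      using vord_exists[OF k W g alg[OF f(1)] f(2)] .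
    have fL: "f ^ e * g powi (- m) \<in> L"
      using f L(3) field_setD[OF L(1)] field_set_inverse[OF L(1)]
      by (auto simp: power_int_def intro!: ring_set_mult ring_set_power)
    then have "f ^ e * g powi (- m) \<in> units_of_set V"
      using em(2) WV field_set_inverse[OF L(1) fL] by (auto simp: units_of_set_def)
    then show ?thesis using vord_eqI[OF V g em(1)] vord_eqI[OF W g em] by simp
  qed
  then show ?thesis unfolding place_val_def by auto
qed

text \<open>Elements \<open>e \<tau>\<close> that are units at \<open>W \<tau>\<close> and vanish at
  the other chosen places are linearly independent over \<open>k(g)\<close>: at the place belonging
  to a dominant coefficient all other terms would be too small to cancel. So the size of a spanning
  set of \<open>L\<close> over \<open>k(g)\<close> bounds the number of order functions.\<close>

lemma finite_place_vals:
  assumes k: "field_set k" and g: "g \<noteq> 0" and L: "field_set L" "k \<subseteq> L" "g \<in> L"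
    and fin: "finite_over (ratfuns k g) L"
  shows "finite (place_val L g ` {W. place k g W})" (is "finite ?S")
proof (rule ccontr)
  assume inf: "infinite ?S"
  note F = field_set_ratfuns[OF k, of g] and RL = field_setD[OF L(1)]
  have alg: "alg_over (ratfuns k g) f" if "f \<in> L" for f using finite_over_imp_alg_over[OF F fin RL that] .
  obtain B where B: "finite B" "L \<subseteq> vspan (ratfuns k g) B" using fin unfolding finite_over_def by blast
  obtain T where T: "T \<subseteq> ?S" "finite T" "card T = Suc (card B)"
    using infinite_arbitrarily_large[OF inf] by blast
  have "\<forall>\<tau>\<in>T. \<exists>W. place k g W \<and> place_val L g W = \<tau>" using T(1) by blast
  then obtain W where W: "\<And>\<tau>. \<tau> \<in> T \<Longrightarrow> place k g (W \<tau>)" "\<And>\<tau>. \<tau> \<in> T \<Longrightarrow> place_val L g (W \<tau>) = \<tau>" by metis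
  \<comment> \<open>\<open>place_val_eq\<close> needs only one inclusion, so distinct order
    functions are separated in both directions.\<close>
  have "\<forall>\<sigma>\<in>T. \<forall>\<tau>\<in>T. \<sigma> \<noteq> \<tau> \<longrightarrow> (\<exists>b. b \<in> L \<and> (\<forall>V. place k g V \<longrightarrow> b \<in> V) \<and>
      b \<in> max_ideal (W \<sigma>) \<and> b \<notin> max_ideal (W \<tau>))"
    using place_val_eq[OF k W(1) W(1) g L alg] W(2) by metis
  then obtain b where b: "\<And>\<sigma> \<tau>. \<sigma> \<in> T \<Longrightarrow> \<tau> \<in> T \<Longrightarrow> \<sigma> \<noteq> \<tau> \<Longrightarrow> b \<sigma> \<tau> \<in> L \<and> (\<forall>V. place k g V \<longrightarrow> b \<sigma> \<tau> \<in> V) \<and>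
      b \<sigma> \<tau> \<in> max_ideal (W \<sigma>) \<and> b \<sigma> \<tau> \<notin> max_ideal (W \<tau>)" by metis
  define e where "e \<tau> = (\<Prod>\<sigma>\<in>T - {\<tau>}. b \<sigma> \<tau>)" for \<tau>
  have eL: "e \<tau> \<in> L" if "\<tau> \<in> T" for \<tau> unfolding e_def using b that RL by (intro ring_set_prod) auto
  have e1: "e \<tau> \<in> units_of_set (W \<tau>)" if t: "\<tau> \<in> T" for \<tau>
    unfolding e_def
  proof (intro units_of_set_prod placeD(2)[OF W(1)[OF t]])
    fix \<sigma> assume "\<sigma> \<in> T - {\<tau>}"
    then show "b \<sigma> \<tau> \<in> units_of_set (W \<tau>)"
      using b[of \<sigma> \<tau>] t W(1)[OF t] units_of_set_iff[OF placeD(2)[OF W(1)[OF t]]] by auto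
  qed
  have e2: "e \<tau> \<in> max_ideal (W \<sigma>)" if t: "\<tau> \<in> T" "\<sigma> \<in> T" "\<sigma> \<noteq> \<tau>" for \<sigma> \<tau>
  proof -
    note R = placeD(2)[OF W(1)[OF t(2)]]
    have "e \<tau> = (\<Prod>\<rho>\<in>T - {\<tau>} - {\<sigma>}. b \<rho> \<tau>) * b \<sigma> \<tau>"
      unfolding e_def using t T(2) by (subst prod.remove[of _ \<sigma>]) auto
    moreover have "(\<Prod>\<rho>\<in>T - {\<tau>} - {\<sigma>}. b \<rho> \<tau>) \<in> W \<sigma>"
      using b t W(1)[OF t(2)] by (intro ring_set_prod[OF R]) auto
    ultimately show ?thesis using max_ideal_mult_left[OF R] b t by auto
  qed
  obtain c where c: "\<forall>\<tau>. c \<tau> \<in> ratfuns k g" "\<exists>\<tau>\<in>T. c \<tau> \<noteq> 0" "(\<Sum>\<tau>\<in>T. c \<tau> * e \<tau>) = 0"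
    using vspan_dependent[OF F B(1) T(2), of e] T(3) eL B(2) by auto
  let ?I = "{\<tau>\<in>T. c \<tau> \<noteq> 0}"
  obtain \<rho> where \<rho>: "\<rho> \<in> T" using c(2) by blast
  \<comment> \<open>Dominance of \<open>c j\<close> is tested at an arbitrary place
    \<open>W \<rho>\<close>. As the quotients lie in \<open>k(g)\<close>, it holds at
    \<open>W j\<close> as well.\<close>
  have "\<exists>j\<in>?I. \<forall>\<tau>\<in>?I. c \<tau> / c j \<in> W \<rho>"
    by (rule valuation_dominant[OF placeD(1)[OF W(1)[OF \<rho>]], of ?I c]) (use c(2) T(2) in auto)
  then obtain j where j: "j \<in> ?I" "\<forall>\<tau>\<in>?I. c \<tau> / c j \<in> W \<rho>" by blast
  note Wj = W(1)[of j] and Pj = placeD[OF W(1)[of j]]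
  have cj: "c \<tau> / c j \<in> W j" if t: "\<tau> \<in> T" for \<tau>
  proof (cases "c \<tau> = 0")
    case False
    have "c \<tau> / c j \<in> ratfuns k g" "c \<tau> / c j \<noteq> 0" using c(1) False j F by (auto intro: field_set_divide)
    then obtain n u where nu: "c \<tau> / c j = g powi n * u" "\<And>V. place k g V \<Longrightarrow> u \<in> units_of_set V"
      using ratfuns_cases[OF k _ _ g] by metis
    have u: "inverse u \<in> W \<rho>" "u \<noteq> 0" using nu(2)[OF W(1)[OF \<rho>]] by (auto simp: units_of_set_def)
    have "g powi n = c \<tau> / c j * inverse u" using nu(1) u by simp
    also have "\<dots> \<in> W \<rho>"
      using j(2) False t u placeD(2)[OF W(1)[OF \<rho>]] by (intro ring_set_mult) auto
    finally have "n \<ge> 0" using place_powi_in_iff[OF W(1)[OF \<rho>] g] by simp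
    moreover have "place k g (W j)" using Wj j by blast
    ultimately show ?thesis unfolding nu(1) using nu(2)[of "W j"] place_powi_in_iff[of k g "W j"] g Pj(2) j
      by (auto simp: units_of_set_def intro: ring_set_mult)
  qed (use Pj(2) j in simp)
  have jT: "j \<in> T" "c j \<noteq> 0" using j by auto
  have "(\<Sum>\<tau>\<in>T - {j}. c \<tau> / c j * e \<tau>) \<in> max_ideal (W j)"
    using cj e2 jT Pj by (intro valuation_max_ideal_sum max_ideal_mult_left) auto
  moreover have "e j = - (\<Sum>\<tau>\<in>T - {j}. c \<tau> / c j * e \<tau>)"
  proof -
    have "c j * e j + (\<Sum>\<tau>\<in>T - {j}. c \<tau> * e \<tau>) = 0" using c(3) jT T(2) by (simp add: sum.remove)
    then have "c j * e j = - (\<Sum>\<tau>\<in>T - {j}. c \<tau> * e \<tau>)" by (simp add: eq_neg_iff_add_eq_0)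
    then have "e j = - (\<Sum>\<tau>\<in>T - {j}. c \<tau> * e \<tau>) / c j" using jT by (simp add: field_simps)
    also have "\<dots> = - (\<Sum>\<tau>\<in>T - {j}. c \<tau> / c j * e \<tau>)" by (simp add: sum_divide_distrib)
    finally show ?thesis .
  qed
  ultimately have "e j \<in> max_ideal (W j)" using valuation_max_ideal_uminus[OF Pj(2)[OF jT(1)]] by metis
  then show False using e1[OF jT(1)] units_of_set_iff[OF Pj(2)[OF jT(1)]] by blast
qed

subsection \<open>Units congruent to one at a place\<close>

text \<open>The units \<open>1 + \<delta> * m\<close> with \<open>m\<close> in the maximal ideal.
  For \<open>\<delta> = 1\<close> these are the principal units, for
  \<open>\<delta> = \<sigma> j - 1\<close> the units strictly closer to 1 than
  \<open>\<sigma> j\<close>.\<close>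

definition one_units :: "'a::field set \<Rightarrow> 'a \<Rightarrow> 'a set" where
  "one_units W \<delta> = {u \<in> units_of_set W. (u - 1) / \<delta> \<in> max_ideal W}"

lemma one_units_mult:
  assumes W: "valuation_set W" and u: "u \<in> one_units W \<delta>" and v: "v \<in> one_units W \<delta>"
  shows "u * v \<in> one_units W \<delta>"
proof -
  note R = valuation_setD[OF W]
  have "v * ((u - 1) / \<delta>) + (v - 1) / \<delta> \<in> max_ideal W"
    using u v by (intro valuation_max_ideal_add[OF W] max_ideal_mult_left[OF R])
      (auto simp: one_units_def units_of_set_def)
  also have "v * ((u - 1) / \<delta>) + (v - 1) / \<delta> = (v * (u - 1) + (v - 1)) / \<delta>"
    by (simp add: add_divide_distrib)
  also have "v * (u - 1) + (v - 1) = u * v - 1" by (simp add: algebra_simps)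
  finally show ?thesis using u v by (auto simp: one_units_def units_of_set_mult[OF R])
qed

lemma one_units_1: "ring_set W \<Longrightarrow> 1 \<in> one_units W \<delta>"
  by (auto simp: one_units_def)

lemma one_units_inverse:
  assumes W: "valuation_set W" and u: "u \<in> one_units W \<delta>"
  shows "inverse u \<in> one_units W \<delta>"
proof -
  note R = valuation_setD[OF W]
  have u0: "u \<noteq> 0" using u by (auto simp: one_units_def units_of_set_def)
  have "- inverse u * ((u - 1) / \<delta>) \<in> max_ideal W"
    using u R by (intro max_ideal_mult_left ring_set_uminus) (auto simp: one_units_def units_of_set_def)
  also have "- inverse u * ((u - 1) / \<delta>) = (- inverse u * (u - 1)) / \<delta>" by simp
  also have "- inverse u * (u - 1) = inverse u - 1" using u0 by (simp add: algebra_simps)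
  finally show ?thesis using u by (auto simp: one_units_def units_of_set_inverse)
qed

lemma one_units_power: "valuation_set W \<Longrightarrow> u \<in> one_units W \<delta> \<Longrightarrow> u ^ n \<in> one_units W \<delta>"
  by (induction n) (auto intro: one_units_mult simp: one_units_1 valuation_setD)

lemma one_units_powi: "valuation_set W \<Longrightarrow> u \<in> one_units W \<delta> \<Longrightarrow> u powi n \<in> one_units W \<delta>"
  by (auto simp: power_int_def one_units_power one_units_inverse)

lemma one_units_prod:
  assumes "valuation_set W" "\<And>i. i \<in> I \<Longrightarrow> f i \<in> one_units W \<delta>"
  shows "prod f I \<in> one_units W \<delta>"
  using assms(2) by (induction I rule: infinite_finite_induct)
    (auto intro: one_units_mult[OF assms(1)] simp: one_units_1 valuation_setD[OF assms(1)])

lemma vord_powi: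
  assumes "field_set k" "place k g W" "g \<noteq> 0" "alg_over (ratfuns k g) f" "f \<noteq> 0"
  shows "vord W g (f powi n) = of_int n * vord W g f"
proof (cases "n \<ge> 0")
  case True
  then show ?thesis using vord_power[OF assms, of "nat n"] by (simp add: power_int_def)
next
  case False
  have "alg_over (ratfuns k g) (inverse f)"
    using alg_over_inverse[OF assms(4)] field_setD[OF field_set_ratfuns[OF assms(1)]] by simp
  then have "vord W g (inverse f ^ nat (- n)) = of_nat (nat (- n)) * - vord W g f"
    using vord_power[OF assms(1-3)] vord_inverse[OF assms] assms(5) by simp
  then show ?thesis using False by (simp add: power_int_def)
qed

lemma vord_prod_powi:
  assumes k: "field_set k" "place k g W" "g \<noteq> 0" and L: "field_set L" "\<And>f. f \<in> L \<Longrightarrow> alg_over (ratfuns k g) f"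
    and f: "\<And>i. i \<in> I \<Longrightarrow> f i \<in> L" "\<And>i. i \<in> I \<Longrightarrow> f i \<noteq> 0" and I: "finite I"
  shows "vord W g (\<Prod>i\<in>I. f i powi z i) = (\<Sum>i\<in>I. of_int (z i) * vord W g (f i))"
proof -
  note R = field_setD[OF L(1)]
  have mem: "f i powi z i \<in> L" if "i \<in> I" for i
    using f(1)[OF that] R field_set_inverse[OF L(1)] by (auto simp: power_int_def ring_set_power)
  show ?thesis using I f mem
  proof (induction I rule: finite_induct)
    case empty
    have "vord W g 1 = of_int 0 / of_nat 1"
      using k(2) by (intro vord_eqI[OF k(2,3)]) (auto simp: placeD)
    then show ?case by simp
  next
    case (insert i I)
    have "vord W g (f i powi z i * (\<Prod>i\<in>I. f i powi z i))
      = vord W g (f i powi z i) + vord W g (\<Prod>i\<in>I. f i powi z i)"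
      using insert R by (intro vord_mult[OF k] L(2) ring_set_prod) (auto simp: power_int_not_zero)
    also have "vord W g (f i powi z i) = of_int (z i) * vord W g (f i)"
      using insert by (intro vord_powi[OF k] L(2)) auto
    finally show ?case using insert by simp
  qed
qed

lemma rat_common_denominator:
  assumes "finite I" shows "\<exists>d z. d > 0 \<and> (\<forall>i\<in>I. of_int d * c i = (of_int (z i) :: rat))"
proof -
  define d where "d = (\<Prod>i\<in>I. snd (quotient_of (c i)))"
  have "d > 0" unfolding d_def by (intro prod_pos) (simp add: quotient_of_denom_pos')
  moreover have "\<exists>z. of_int d * c i = of_int z" if i: "i \<in> I" for i
  proof -
    have "c i = of_int (fst (quotient_of (c i))) / of_int (snd (quotient_of (c i)))"
      by (intro quotient_of_div) simp
    moreover have "snd (quotient_of (c i)) > 0" by (simp add: quotient_of_denom_pos')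
    ultimately have "of_int (snd (quotient_of (c i))) * c i = of_int (fst (quotient_of (c i)))"
      by (metis less_irrefl nonzero_mult_div_cancel_left of_int_eq_0_iff times_divide_eq_right)
    moreover have "of_int d = of_int (\<Prod>j\<in>I - {i}. snd (quotient_of (c j))) * (of_int (snd (quotient_of (c i))) :: rat)"
      unfolding d_def using i assms by (subst prod.remove[of _ i]) auto
    ultimately have "of_int d * c i = of_int ((\<Prod>j\<in>I - {i}. snd (quotient_of (c j))) * fst (quotient_of (c i)))"
      by (simp add: mult.assoc)
    then show ?thesis by blast
  qed
  ultimately show ?thesis by metis
qed

text \<open>If there were no such bound, there would be nontrivial such units \<open>f\<^sub>0, \<dots>, f\<^sub>N\<close>, \<open>N\<close> being the number of places outside
  which they are units, with strictly increasing orders of vanishing of \<open>f\<^sub>i - 1\<close> at \<open>W0\<close>.  They are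
  multiplicatively dependent modulo constants, and in a multiplicative relation the \<open>f\<^sub>i\<close> closest to
  the beginning cannot be compensated by the others, as the characteristic is zero.\<close>

theorem units_close_to_one_trivial:
  fixes k L :: "'a::field set"
  assumes char: "CHAR('a) = 0" and k: "field_set k" and L: "field_set L" "k \<subseteq> L" and H: "finite H" "H \<subseteq> L" "0 \<notin> H"
    and fin: "\<And>g. g \<in> insert t H \<Longrightarrow> \<not> alg_over k g \<Longrightarrow> finite_over (ratfuns k g) L"
    and W0: "place k t W0" "t \<noteq> 0" "t \<in> L"
  obtains n where "\<And>f. f \<in> L \<Longrightarrow> (f - 1) / t ^ n \<in> W0 \<Longrightarrow>
    (\<And>W. valuation_set W \<Longrightarrow> k \<subseteq> W \<Longrightarrow> (\<forall>h\<in>H. h \<notin> max_ideal W) \<Longrightarrow> f \<in> units_of_set W) \<Longrightarrow> f = 1"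
proof -
  note P0 = placeD[OF W0(1)] and RL = field_setD[OF L(1)]
  define Good where "Good f \<longleftrightarrow> f \<in> L \<and> f \<noteq> 1 \<and> (\<forall>W. valuation_set W \<longrightarrow> k \<subseteq> W \<longrightarrow>
    (\<forall>h\<in>H. h \<notin> max_ideal W) \<longrightarrow> f \<in> units_of_set W)" for f
  have trans: "\<not> alg_over k g" if "place k g W" "g \<noteq> 0" for g W
    using alg_over_unit[OF k placeD(3)[OF that(1)] placeD(1)[OF that(1)] _ that(2)]
      placeD(4)[OF that(1)] units_of_set_iff[OF placeD(2)[OF that(1)]] by blast
  have algL: "alg_over (ratfuns k g) f" if "g \<in> insert t H" "\<not> alg_over k g" "f \<in> L" for f g
    using finite_over_imp_alg_over[OF field_set_ratfuns[OF k] fin[OF that(1,2)] RL that(3)] .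
  have algt: "alg_over (ratfuns k t) f" if "f \<in> L" for f using algL[of t f] trans[OF W0(1,2)] that by simp
  define q where "q f = vord W0 t (f - 1)" for f
  have "\<exists>n. \<forall>f. Good f \<longrightarrow> (f - 1) / t ^ n \<notin> W0"
  proof (rule ccontr)
    assume "\<not> ?thesis"
    then have "\<forall>n. \<exists>f. Good f \<and> (f - 1) / t ^ n \<in> W0" by blast
    then obtain F where F: "\<And>n. Good (F n)" "\<And>n. (F n - 1) / t ^ n \<in> W0" by metis
    have F1: "F n - 1 \<noteq> 0" "F n - 1 \<in> L" for n
      using F(1)[of n] RL by (auto simp: Good_def intro: ring_set_diff)
    have qF: "q (F n) \<ge> of_nat n" for n
    proof -
      have tL: "t ^ n \<in> L" using W0(3) RL by (simp add: ring_set_power)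
      have yL: "(F n - 1) / t ^ n \<in> L" using F1 tL L(1) by (simp add: field_set_divide)
      have "vord W0 t t = of_int 1 / of_nat 1"
        using P0 W0 by (intro vord_eqI[OF W0(1,2)]) (auto simp: power_int_minus)
      then have "vord W0 t (t ^ n) = of_nat n" using vord_power[OF k W0(1,2) algt[OF W0(3)] W0(2)] by simp
      moreover have "vord W0 t (((F n - 1) / t ^ n) * t ^ n) = vord W0 t ((F n - 1) / t ^ n) + vord W0 t (t ^ n)"
        using F1 W0(2) by (intro vord_mult[OF k W0(1,2)] algt yL tL) auto
      moreover have "vord W0 t ((F n - 1) / t ^ n) \<ge> 0"
        using F1 W0(2) F(2) by (intro vord_nonneg[OF k W0(1,2)] algt yL) auto
      ultimately show ?thesis unfolding q_def using W0(2) by simp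
    qed
    \<comment> \<open>Each index is chosen beyond the order of the preceding \<open>f - 1\<close>,
      so the orders increase strictly. Starting from \<open>F 1\<close> and not from
      \<open>F 0\<close> keeps all exponents positive, whence \<open>\<sigma> i - 1\<close> lies in
      the maximal ideal of \<open>W0\<close>.\<close>
    define \<sigma> where "\<sigma> = rec_nat (F 1) (\<lambda>_ f. F (Suc (nat \<lceil>q f\<rceil>)))"
    have \<sigma>_Suc: "\<sigma> (Suc i) = F (Suc (nat \<lceil>q (\<sigma> i)\<rceil>))" for i unfolding \<sigma>_def by simp
    have \<sigma>F: "\<exists>n. \<sigma> i = F (Suc n)" for i by (cases i) (auto simp: \<sigma>_Suc, simp add: \<sigma>_def, metis)
    have "q (\<sigma> i) < q (\<sigma> (Suc i))" for i
    proof -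
      have "q (\<sigma> i) \<le> of_int \<lceil>q (\<sigma> i)\<rceil>" by (rule le_of_int_ceiling)
      also have "\<dots> \<le> of_int (int (nat \<lceil>q (\<sigma> i)\<rceil>))" by (simp only: of_int_le_iff)
      also have "\<dots> = of_nat (nat \<lceil>q (\<sigma> i)\<rceil>)" by (rule of_int_of_nat_eq)
      also have "\<dots> < of_nat (Suc (nat \<lceil>q (\<sigma> i)\<rceil>))" by simp
      also have "\<dots> \<le> q (\<sigma> (Suc i))" unfolding \<sigma>_Suc by (rule qF)
      finally show ?thesis .
    qed
    then have mono: "q (\<sigma> i) < q (\<sigma> j)" if "i < j" for i j
      using that lift_Suc_mono_less[of "\<lambda>i. q (\<sigma> i)"] by blast
    have \<sigma>: "Good (\<sigma> i)" "\<sigma> i \<in> L" "\<sigma> i - 1 \<noteq> 0" "\<sigma> i - 1 \<in> L" for i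
      using \<sigma>F[of i] F(1) F1 by (auto simp: Good_def)
    have \<sigma>m: "\<sigma> i - 1 \<in> max_ideal W0" for i
    proof -
      obtain n where n: "\<sigma> i = F (Suc n)" using \<sigma>F by blast
      have "(F (Suc n) - 1) / t ^ Suc n * t ^ Suc n \<in> max_ideal W0"
        by (intro max_ideal_mult_left[OF P0(2) F(2)] max_ideal_power[OF P0(2,4)]) simp
      then show ?thesis unfolding n using W0(2) by simp
    qed
    have \<sigma>u: "\<sigma> i \<in> units_of_set W0" for i
    proof -
      have "\<sigma> i = (\<sigma> i - 1) + 1" by simp
      then have "\<sigma> i \<in> W0" using \<sigma>m[of i] max_ideal_subset P0(2) by (metis ring_set_1 ring_set_add subsetD)
      moreover have "\<sigma> i \<notin> max_ideal W0"
      proof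
        assume "\<sigma> i \<in> max_ideal W0"
        from valuation_max_ideal_diff[OF P0(1) this \<sigma>m[of i]] show False using P0(2) by simp
      qed
      ultimately show ?thesis using units_of_set_iff[OF P0(2)] by blast
    qed
    have \<sigma>0: "\<sigma> i \<noteq> 0" for i using \<sigma>u[of i] by (auto simp: units_of_set_def)
    \<comment> \<open>The orders at the places where some \<open>h\<close> of \<open>H\<close>
      vanishes; only there can a \<open>\<sigma> i\<close> fail to be a unit.\<close>
    define \<V> where "\<V> = (\<Union>h\<in>{h\<in>H. \<not> alg_over k h}. place_val L h ` {W. place k h W})"
    have finV: "finite \<V>" unfolding \<V>_def
    proof (intro finite_UN_I)
      fix h assume h: "h \<in> {h\<in>H. \<not> alg_over k h}"
      then show "finite (place_val L h ` {W. place k h W})"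
        using H by (intro finite_place_vals[OF k _ L] fin) auto
    qed (use H in auto)
    \<comment> \<open>One more unit than there are order functions, so that the vectors of orders
      are linearly dependent.\<close>
    define I where "I = {..card \<V>}"
    have "\<exists>c. (\<forall>i. c i \<in> (UNIV :: rat set)) \<and> (\<exists>i\<in>I. c i \<noteq> 0) \<and> (\<forall>\<nu>\<in>\<V>. (\<Sum>i\<in>I. c i * \<nu> (\<sigma> i)) = 0)"
      by (rule matrix_dependent) (auto simp: field_set_def ring_set_def finV I_def)
    then obtain c where c: "\<exists>i\<in>I. c i \<noteq> 0" "\<And>\<nu>. \<nu> \<in> \<V> \<Longrightarrow> (\<Sum>i\<in>I. c i * \<nu> (\<sigma> i)) = (0::rat)" by auto
    obtain d z where dz: "d > 0" "\<And>i. i \<in> I \<Longrightarrow> of_int d * c i = of_int (z i)"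
      using rat_common_denominator[of I c] unfolding I_def by auto
    have z0: "z i \<noteq> 0 \<longleftrightarrow> c i \<noteq> 0" if "i \<in> I" for i using dz(2)[OF that] dz(1) by auto
    have z\<nu>: "(\<Sum>i\<in>I. of_int (z i) * \<nu> (\<sigma> i)) = 0" if "\<nu> \<in> \<V>" for \<nu>
    proof -
      have "(\<Sum>i\<in>I. of_int (z i) * \<nu> (\<sigma> i)) = of_int d * (\<Sum>i\<in>I. c i * \<nu> (\<sigma> i))"
        unfolding sum_distrib_left by (intro sum.cong refl) (simp add: dz(2)[symmetric] mult.assoc)
      then show ?thesis using c(2)[OF that] by simp
    qed
    define G where "G = (\<Prod>i\<in>I. \<sigma> i powi z i)"
    have finI: "finite I" unfolding I_def by simp
    have GL: "G \<in> L" unfolding G_def using \<sigma>(2) RL field_set_inverse[OF L(1)]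
      by (intro ring_set_prod) (auto simp: power_int_def ring_set_power)
    have GW: "G \<in> W" if W: "valuation_set W" "k \<subseteq> W" for W
    proof -
      have "G \<in> units_of_set W"
      proof (cases "\<forall>h\<in>H. h \<notin> max_ideal W")
        case True
        then have "\<sigma> i \<in> units_of_set W" for i using \<sigma>(1)[of i] W unfolding Good_def by blast
        then show ?thesis unfolding G_def using valuation_setD[OF W(1)]
          by (intro units_of_set_prod units_of_set_power_int) auto
      next
        case False
        then obtain h where h: "h \<in> H" "place k h W" using W unfolding place_def by blast
        have h0: "h \<noteq> 0" using h H by auto
        note ht = trans[OF h(2) h0]
        have alg: "alg_over (ratfuns k h) f" if "f \<in> L" for f using algL[of h f] h ht that by simp
        have "place_val L h W \<in> \<V>" unfolding \<V>_def using h ht by blast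
        from z\<nu>[OF this] have "(\<Sum>i\<in>I. of_int (z i) * vord W h (\<sigma> i)) = 0"
          using \<sigma>(2) \<sigma>0 unfolding place_val_def by simp
        then have "vord W h G = 0" unfolding G_def
          using vord_prod_powi[OF k h(2) h0 L(1) alg, of I \<sigma> z] \<sigma>(2) \<sigma>0 finI by simp
        then show ?thesis using \<sigma>0 finI
          by (intro vord_eq_0[OF k h(2) h0 alg[OF GL]]) (auto simp: G_def power_int_not_zero)
      qed
      then show ?thesis by (simp add: units_of_set_def)
    qed
    \<comment> \<open>\<open>G\<close> lies in every valuation ring over \<open>k\<close>, so
      \<open>G - 1\<close> is constant. It is also in the maximal ideal of \<open>W0\<close>, where
      nonzero constants are units, hence it is 0.\<close>
    have "alg_over k (G - 1)"
      using GW by (intro alg_over_of_all_valuations[OF k]) (auto intro!: ring_set_diff valuation_setD simp: valuation_setD)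
    moreover have "G \<in> one_units W0 1" unfolding G_def
      using \<sigma>m \<sigma>u by (intro one_units_prod one_units_powi P0(1)) (auto simp: one_units_def)
    then have "G - 1 \<in> max_ideal W0" unfolding one_units_def by simp
    ultimately have G1: "G = 1"
      using alg_over_unit[OF k P0(3,1), of "G - 1"] units_of_set_iff[OF P0(2)] by auto
    \<comment> \<open>The least index with nonzero exponent, so that \<open>\<sigma> j - 1\<close>
      has the lowest order among the factors that occur.\<close>
    define j where "j = Min {i\<in>I. z i \<noteq> 0}"
    have "{i\<in>I. z i \<noteq> 0} \<noteq> {}" using c(1) z0 by blast
    then have j: "j \<in> I" "z j \<noteq> 0" and jmin: "\<And>i. i \<in> I \<Longrightarrow> z i \<noteq> 0 \<Longrightarrow> j \<le> i"
      using Min_in[of "{i\<in>I. z i \<noteq> 0}"] finI unfolding j_def by auto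
    define \<delta> where "\<delta> = \<sigma> j - 1"
    have rest: "\<sigma> i powi z i \<in> one_units W0 \<delta>" if i: "i \<in> I - {j}" for i
    proof (cases "z i = 0")
      case True
      then show ?thesis using one_units_1[OF P0(2)] by simp
    next
      case False
      then have ji: "j < i" using jmin[of i] i by auto
      have dL: "(\<sigma> i - 1) / \<delta> \<in> L" "inverse \<delta> \<in> L" "\<delta> \<in> L" "\<delta> \<noteq> 0"
        unfolding \<delta>_def using \<sigma> L(1) by (auto intro: field_set_divide field_set_inverse)
      have "vord W0 t ((\<sigma> i - 1) * inverse \<delta>) = vord W0 t (\<sigma> i - 1) + vord W0 t (inverse \<delta>)"
        using \<sigma> dL by (intro vord_mult[OF k W0(1,2)] algt) auto
      also have "vord W0 t (inverse \<delta>) = - vord W0 t \<delta>"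
        using dL by (intro vord_inverse[OF k W0(1,2)] algt)
      finally have "vord W0 t ((\<sigma> i - 1) / \<delta>) > 0"
        using mono[OF ji] unfolding q_def \<delta>_def by (simp add: divide_inverse)
      then have "(\<sigma> i - 1) / \<delta> \<in> max_ideal W0"
        using dL \<sigma> by (intro vord_pos[OF k W0(1,2)] algt) auto
      then have "\<sigma> i \<in> one_units W0 \<delta>" using \<sigma>u unfolding one_units_def by auto
      then show ?thesis by (rule one_units_powi[OF P0(1)])
    qed
    have "\<sigma> j powi z j * (\<Prod>i\<in>I - {j}. \<sigma> i powi z i) = 1"
      using G1 unfolding G_def by (subst (asm) prod.remove[OF finI j(1)])
    moreover have "(\<Prod>i\<in>I - {j}. \<sigma> i powi z i) \<in> one_units W0 \<delta>" by (intro one_units_prod P0(1) rest)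
    ultimately have jz: "\<sigma> j powi z j \<in> one_units W0 \<delta>"
      using one_units_inverse[OF P0(1)] by (metis inverse_unique mult.commute)
    define m where "m = nat \<bar>z j\<bar>"
    have m: "m > 0" unfolding m_def using j by simp
    have "\<sigma> j ^ m \<in> one_units W0 \<delta>"
    proof (cases "z j \<ge> 0")
      case True then show ?thesis using jz unfolding m_def by (simp add: power_int_def)
    next
      case False
      then have "\<sigma> j ^ m = inverse (\<sigma> j powi z j)" unfolding m_def by (simp add: power_int_def power_inverse)
      then show ?thesis using one_units_inverse[OF P0(1) jz] by simp
    qed
    then have "(\<sigma> j ^ m - 1) / \<delta> \<in> max_ideal W0" unfolding one_units_def by simp
    \<comment> \<open>This is the geometric sum
      \<open>(\<sigma> j ^ m - 1) / (\<sigma> j - 1)\<close>. Every summand is congruent to 1, so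
      the sum is congruent to \<open>m\<close>, a unit in characteristic 0.\<close>
    then have s: "(\<Sum>i<m. \<sigma> j ^ i) \<in> max_ideal W0"
      unfolding \<delta>_def power_diff_1_eq using \<sigma>(3)[of j] by simp
    have "(\<Sum>i<m. \<sigma> j ^ i - 1) \<in> max_ideal W0"
    proof (intro valuation_max_ideal_sum P0(1))
      fix i
      have "\<sigma> j \<in> one_units W0 1" using \<sigma>m \<sigma>u unfolding one_units_def by simp
      from one_units_power[OF P0(1) this] show "\<sigma> j ^ i - 1 \<in> max_ideal W0" unfolding one_units_def by simp
    qed
    from valuation_max_ideal_diff[OF P0(1) s this] have "of_nat m \<in> max_ideal W0"
      by (simp add: sum_subtractf)
    moreover have "(of_nat m :: 'a) \<in> units_of_set W0"
      using m char by (intro field_set_units[OF k P0(3)])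
        (auto simp: of_nat_eq_0_iff_char_dvd intro: ring_set_of_nat field_setD[OF k])
    ultimately show False using units_of_set_iff[OF P0(2)] by blast
  qed
  then obtain n where "\<And>f. Good f \<Longrightarrow> (f - 1) / t ^ n \<notin> W0" by blast
  then show ?thesis using that[of n] unfolding Good_def by blast
qed

section \<open>One-dimensional finitely generated domains\<close>

subsection \<open>Prime ideals and local rings\<close>

definition prime_set :: "'a::field set \<Rightarrow> 'a set \<Rightarrow> bool" where
  "prime_set A p \<longleftrightarrow> p \<subseteq> A \<and> 0 \<in> p \<and> 1 \<notin> p \<and> (\<forall>x\<in>p. \<forall>y\<in>p. x + y \<in> p) \<and>
     (\<forall>a\<in>A. \<forall>x\<in>p. a * x \<in> p) \<and> (\<forall>a\<in>A. \<forall>b\<in>A. a * b \<in> p \<longrightarrow> a \<in> p \<or> b \<in> p)"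

lemma prime_setD:
  assumes "prime_set A p"
  shows "p \<subseteq> A" "0 \<in> p" "1 \<notin> p" "\<And>x y. x \<in> p \<Longrightarrow> y \<in> p \<Longrightarrow> x + y \<in> p"
    "\<And>a x. a \<in> A \<Longrightarrow> x \<in> p \<Longrightarrow> a * x \<in> p"
    "\<And>a b. a \<in> A \<Longrightarrow> b \<in> A \<Longrightarrow> a * b \<in> p \<Longrightarrow> a \<in> p \<or> b \<in> p"
  using assms unfolding prime_set_def by blast+

lemma subring_of_simps [simp]:
  "carrier (subring_of A) = A" "x \<oplus>\<^bsub>subring_of A\<^esub> y = x + y" "x \<otimes>\<^bsub>subring_of A\<^esub> y = x * y"
  "\<one>\<^bsub>subring_of A\<^esub> = 1" "\<zero>\<^bsub>subring_of A\<^esub> = 0"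
  by (simp_all add: subring_of_def ring_of_type_algebra_def)

lemma cring_subring_of:
  assumes "1 \<in> A" "\<And>x y. x \<in> A \<Longrightarrow> y \<in> A \<Longrightarrow> x - y \<in> A" "\<And>x y. x \<in> A \<Longrightarrow> y \<in> A \<Longrightarrow> x * y \<in> A"
  shows "cring (subring_of A)"
proof -
  have z: "0 \<in> A" using assms(2)[of 1 1] assms(1) by simp
  have m: "- x \<in> A" if "x \<in> A" for x using assms(2)[OF z that] by simp
  have p: "x + y \<in> A" if "x \<in> A" "y \<in> A" for x y using assms(2)[OF that(1) m[OF that(2)]] by simp
  show ?thesis
  proof (rule cringI)
    show "abelian_group (subring_of A)"
      by (rule abelian_groupI)
        (use z p m in \<open>auto simp: algebra_simps intro: bexI[of _ "- x" for x]\<close>)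
    show "comm_monoid (subring_of A)"
      by (rule comm_monoidI) (use assms in \<open>auto simp: algebra_simps\<close>)
  qed (auto simp: algebra_simps)
qed

lemma ideal_subring_ofI:
  assumes A: "1 \<in> A" "\<And>x y. x \<in> A \<Longrightarrow> y \<in> A \<Longrightarrow> x - y \<in> A" "\<And>x y. x \<in> A \<Longrightarrow> y \<in> A \<Longrightarrow> x * y \<in> A"
    and p: "p \<subseteq> A" "0 \<in> p" "\<And>x y. x \<in> p \<Longrightarrow> y \<in> p \<Longrightarrow> x + y \<in> p" "\<And>a x. a \<in> A \<Longrightarrow> x \<in> p \<Longrightarrow> a * x \<in> p"
  shows "ideal p (subring_of A)"
proof -
  interpret R: cring "subring_of A" by (rule cring_subring_of[OF A])
  have z: "0 \<in> A" using A(2)[of 1 1] A(1) by simp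
  have m1: "- 1 \<in> A" using A(2)[OF z A(1)] by simp
  have p': "x * a \<in> p" if "a \<in> A" "x \<in> p" for a x using p(4)[OF that] by (simp add: mult.commute)
  have inv: "\<ominus>\<^bsub>subring_of A\<^esub> x = - x" if "x \<in> p" for x
  proof -
    have "- x \<in> A" using A(2)[OF z, of x] that p(1) by auto
    then show ?thesis using that p(1) by (intro R.minus_equality) auto
  qed
  show ?thesis
  proof (intro idealI R.ring_axioms)
    show "subgroup p (add_monoid (subring_of A))"
    proof (rule R.add.subgroupI)
      fix x assume x: "x \<in> p"
      then have "- 1 * x \<in> p" using p(4)[OF m1] by blast
      then show "\<ominus>\<^bsub>subring_of A\<^esub> x \<in> p" using inv[OF x] by simp
    qed (use p in auto)
  qed (use p p' in auto)
qed

lemma primeideal_subring_of_iff: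
  assumes A: "ring_set A"
  shows "primeideal p (subring_of A) \<longleftrightarrow> prime_set A p"
proof
  assume "primeideal p (subring_of A)"
  then interpret P: primeideal p "subring_of A" .
  have one: "1 \<notin> p" using P.one_imp_carrier P.I_notcarr by auto
  show "prime_set A p"
    unfolding prime_set_def
    using one P.a_subset additive_subgroup.zero_closed[OF P.is_additive_subgroup]
      additive_subgroup.a_closed[OF P.is_additive_subgroup] P.I_l_closed P.I_prime by simp
next
  assume p: "prime_set A p"
  note D = prime_setD[OF p]
  have "ideal p (subring_of A)"
    using A D by (intro ideal_subring_ofI) (auto intro: ring_set_intros)
  moreover have "cring (subring_of A)" using A by (intro cring_subring_of) (auto intro: ring_set_intros)
  moreover have "A \<noteq> p" using D(3) A by auto
  ultimately show "primeideal p (subring_of A)" using D(6) by (intro primeidealI) auto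
qed

locale local_ring_at =
  fixes A p :: "'a::field set"
  assumes A: "ring_set A" and p: "prime_set A p"
begin

lemmas pD = prime_setD[OF p]

abbreviation "P \<equiv> localize A p"

lemma pow_notin: "s \<in> A \<Longrightarrow> u \<in> A \<Longrightarrow> s \<notin> p \<Longrightarrow> u \<notin> p \<Longrightarrow> s * u \<in> A - p"
  using pD(6) A by (auto intro: ring_set_mult)

lemma nz: "s \<notin> p \<Longrightarrow> s \<noteq> 0" using pD(2) by auto

lemma localizeE:
  assumes "x \<in> P" obtains a b where "a \<in> A" "b \<in> A" "b \<notin> p" "b \<noteq> 0" "x = a / b"
  using assms nz unfolding localize_def by blast

lemma localizeI: "a \<in> A \<Longrightarrow> b \<in> A \<Longrightarrow> b \<notin> p \<Longrightarrow> a / b \<in> P"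
  unfolding localize_def by blast

lemma superset: "A \<subseteq> P"
  using localizeI[of _ 1] A pD(3) by auto

lemma ring_set_P: "ring_set P"
  unfolding ring_set_def
proof (intro conjI ballI)
  show "1 \<in> P" using superset A by auto
  fix x y assume "x \<in> P" "y \<in> P"
  then obtain a b c d where x: "a \<in> A" "b \<in> A" "b \<notin> p" "b \<noteq> 0" "x = a / b"
    and y: "c \<in> A" "d \<in> A" "d \<notin> p" "d \<noteq> 0" "y = c / d" using localizeE by metis
  have "x - y = (a * d - c * b) / (b * d)" "x * y = (a * c) / (b * d)"
    using x y by (simp_all add: diff_frac_eq)
  moreover have "b * d \<in> A - p" using pow_notin x y by blast
  moreover have "a * d - c * b \<in> A" "a * c \<in> A" using x y A by (auto intro: ring_set_intros)
  ultimately show "x - y \<in> P" "x * y \<in> P" using localizeI by auto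
qed

lemma max_ideal_iff: "x \<in> max_ideal P \<longleftrightarrow> (\<exists>a b. a \<in> p \<and> b \<in> A \<and> b \<notin> p \<and> x = a / b)"
proof
  assume x: "x \<in> max_ideal P"
  then have "x \<in> P" using max_ideal_subset by blast
  then obtain a b where ab: "a \<in> A" "b \<in> A" "b \<notin> p" "b \<noteq> 0" "x = a / b" by (rule localizeE)
  have "a \<in> p"
  proof (rule ccontr)
    assume "a \<notin> p"
    then have "b / a \<in> P" "a \<noteq> 0" using ab localizeI nz by auto
    then show False using x ab by (auto simp: max_ideal_def)
  qed
  then show "\<exists>a b. a \<in> p \<and> b \<in> A \<and> b \<notin> p \<and> x = a / b" using ab by blast
next
  assume "\<exists>a b. a \<in> p \<and> b \<in> A \<and> b \<notin> p \<and> x = a / b"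
  then obtain a b where ab: "a \<in> p" "b \<in> A" "b \<notin> p" "x = a / b" by blast
  have "x = 0 \<or> inverse x \<notin> P"
  proof (rule ccontr)
    assume "\<not> (x = 0 \<or> inverse x \<notin> P)"
    then have "x \<noteq> 0" "inverse x \<in> P" by auto
    then obtain c d where cd: "c \<in> A" "d \<in> A" "d \<notin> p" "d \<noteq> 0" "inverse x = c / d" using localizeE by metis
    have "a \<noteq> 0" using \<open>x \<noteq> 0\<close> ab by auto
    have "b / a = c / d" using cd(5) ab(4) by simp
    then have "b * d = c * a" using \<open>a \<noteq> 0\<close> cd(4) by (simp add: frac_eq_eq)
    moreover have "c * a \<in> p" using pD(5) cd ab by blast
    ultimately show False using pow_notin[of b d] ab cd by auto
  qed
  moreover have "x \<in> P" using ab pD(1) localizeI by auto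
  ultimately show "x \<in> max_ideal P" by (simp add: max_ideal_def)
qed

lemma max_ideal_Int: "max_ideal P \<inter> A = p"
proof
  show "p \<subseteq> max_ideal P \<inter> A"
  proof
    fix x assume x: "x \<in> p"
    then have "x = x / 1" "1 \<in> A" using A by auto
    then show "x \<in> max_ideal P \<inter> A" using x pD(1,3) max_ideal_iff by blast
  qed
  show "max_ideal P \<inter> A \<subseteq> p"
  proof
    fix x assume "x \<in> max_ideal P \<inter> A"
    then obtain a b where ab: "a \<in> p" "b \<in> A" "b \<notin> p" "x = a / b" and x: "x \<in> A"
      using max_ideal_iff by blast
    then have "b * x \<in> p" using nz by simp
    then show "x \<in> p" using pD(6) ab x by blast
  qed
qed

lemma max_ideal_add:
  assumes "x \<in> max_ideal P" "y \<in> max_ideal P" shows "x + y \<in> max_ideal P"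
proof -
  obtain a b c d where x: "a \<in> p" "b \<in> A" "b \<notin> p" "x = a / b"
    and y: "c \<in> p" "d \<in> A" "d \<notin> p" "y = c / d" using assms max_ideal_iff by metis
  have "x + y = (d * a + b * c) / (b * d)"
    using x y nz by (simp add: add_frac_eq mult.commute)
  moreover have "d * a + b * c \<in> p" using x y pD(4,5) by blast
  moreover have "b * d \<in> A - p" using pow_notin x y by blast
  ultimately show ?thesis using max_ideal_iff by blast
qed

lemma max_ideal_sum:
  "(\<And>i. i \<in> I \<Longrightarrow> f i \<in> max_ideal P) \<Longrightarrow> sum f I \<in> max_ideal P"
  by (induction I rule: infinite_finite_induct) (auto intro: max_ideal_add simp: ring_set_P)

lemma max_ideal_diff: "x \<in> max_ideal P \<Longrightarrow> y \<in> max_ideal P \<Longrightarrow> x - y \<in> max_ideal P"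
  using max_ideal_add[of x "- y"] valuation_max_ideal_uminus[OF ring_set_P] by simp

lemma subset_ring:
  assumes "ring_set S" "A \<subseteq> S" "\<And>b. b \<in> A \<Longrightarrow> b \<notin> p \<Longrightarrow> inverse b \<in> S"
  shows "P \<subseteq> S"
  using assms by (auto elim!: localizeE simp: divide_inverse intro!: ring_set_mult)

end

lemma prime_set_center:
  assumes A: "ring_set A" and W: "valuation_set W" "A \<subseteq> W"
  shows "prime_set A (A \<inter> max_ideal W)"
  unfolding prime_set_def
  using A W valuation_setD[OF W(1)] max_ideal_mult_iff[OF valuation_setD[OF W(1)]]
  by (auto intro: ring_set_intros valuation_max_ideal_add max_ideal_mult_left)

lemma localize_center_subset:
  assumes A: "ring_set A" and W: "valuation_set W" "A \<subseteq> W"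
  shows "localize A (A \<inter> max_ideal W) \<subseteq> W"
proof -
  interpret local_ring_at A "A \<inter> max_ideal W" using A prime_set_center[OF assms] by unfold_locales
  show ?thesis using W by (intro subset_ring valuation_setD) (auto simp: max_ideal_def)
qed

text \<open>Fields are included. That a curve has dimension exactly one enters through a generator
  transcendental over \<open>k\<close>.\<close>

definition dim_le_one :: "'a::field set \<Rightarrow> bool" where
  "dim_le_one A \<longleftrightarrow> (\<forall>p q. prime_set A p \<longrightarrow> prime_set A q \<longrightarrow> p \<subset> q \<longrightarrow> p = {0})"

lemma dim_le_one_if_no_chain:
  assumes A: "ring_set A" and nc: "\<not> has_prime_chain A 2"
  shows "dim_le_one A"
  unfolding dim_le_one_def
proof (intro allI impI, rule ccontr)
  fix p q assume pq: "prime_set A p" "prime_set A q" "p \<subset> q" "p \<noteq> {0}"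
  have z: "prime_set A {0}" unfolding prime_set_def using A by auto
  have "{0} \<subset> p" using pq(4) prime_setD(2)[OF pq(1)] by auto
  then have "has_prime_chain A 2" unfolding has_prime_chain_def
    using pq z primeideal_subring_of_iff[OF A]
    by (intro exI[of _ "\<lambda>i. if i = 0 then {0} else if i = 1 then p else q"])
      (auto simp: less_2_cases_iff)
  then show False using nc by blast
qed

subsection \<open>Transcendence degree\<close>

text \<open>Steinitz exchange. The equation for \<open>x\<close> over \<open>F[y]\<close> is a
  polynomial in two variables; sorted by powers of \<open>y\<close> it becomes an equation for
  \<open>y\<close> over \<open>F[x]\<close>, which is not identically zero because \<open>x\<close>
  is transcendental over \<open>F\<close>.\<close>

lemma alg_over_exchange:
  assumes F: "field_set F" and x: "alg_over (ratfuns F y) x" "\<not> alg_over F x"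
  shows "alg_over (ratfuns F x) y"
proof -
  note R = field_setD[OF F]
  obtain p where p: "p \<noteq> 0" "\<forall>i. coeff p i \<in> adjoin F y" "poly p x = 0"
    using alg_over_fracs[OF ring_set_adjoin[OF R] x(1)] unfolding alg_over_def by blast
  have "\<forall>i. \<exists>q. coeff p i = poly q y \<and> (\<forall>j. coeff q j \<in> F)" using p(2) unfolding adjoin_def by blast
  then obtain Q where Q: "\<And>i. coeff p i = poly (Q i) y" "\<And>i j. coeff (Q i) j \<in> F" by metis
  define N where "N = Max ((\<lambda>i. degree (Q i)) ` {..degree p})"
  have dN: "degree (Q i) \<le> N" if "i \<le> degree p" for i unfolding N_def using that by (intro Max_ge) auto
  define r where "r j = (\<Sum>i\<le>degree p. monom (coeff (Q i) j) i)" for j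
  have cr: "coeff (r j) i = (if i \<le> degree p then coeff (Q i) j else 0)" for i j
    unfolding r_def by (simp add: coeff_sum)
  have crF: "coeff (r j) i \<in> F" for i j using cr Q R by auto
  have rx: "poly (r j) x = 0 \<Longrightarrow> r j = 0" for j using x(2) crF unfolding alg_over_def by blast
  define q where "q = (\<Sum>j\<le>N. monom (poly (r j) x) j)"
  have cq: "coeff q j = (if j \<le> N then poly (r j) x else 0)" for j unfolding q_def by (simp add: coeff_sum)
  have "poly q y = (\<Sum>j\<le>N. \<Sum>i\<le>degree p. coeff (Q i) j * x ^ i * y ^ j)"
    unfolding q_def r_def by (simp add: poly_sum poly_monom sum_distrib_right)
  also have "\<dots> = (\<Sum>i\<le>degree p. \<Sum>j\<le>N. coeff (Q i) j * x ^ i * y ^ j)" by (rule sum.swap)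
  also have "\<dots> = (\<Sum>i\<le>degree p. coeff p i * x ^ i)"
  proof (intro sum.cong refl)
    fix i assume i: "i \<in> {..degree p}"
    have "poly (Q i) y = (\<Sum>j\<le>N. coeff (Q i) j * y ^ j)"
      unfolding poly_altdef using dN[of i] i by (intro sum.mono_neutral_left) (auto simp: coeff_eq_0)
    then show "(\<Sum>j\<le>N. coeff (Q i) j * x ^ i * y ^ j) = coeff p i * x ^ i"
      unfolding Q(1) by (simp only: sum_distrib_right) (intro sum.cong refl, simp add: mult_ac)
  qed
  also have "\<dots> = 0" using p(3) by (simp add: poly_altdef)
  finally have "poly q y = 0" .
  moreover have "q \<noteq> 0"
  proof
    assume "q = 0"
    then have "r j = 0" if "j \<le> N" for j using cq[of j] rx that by simp
    then have "coeff (Q (degree p)) j = 0" if "j \<le> N" for j using cr[of j "degree p"] that by simp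
    then have "Q (degree p) = 0" using dN[of "degree p"] by (metis leading_coeff_0_iff order_refl)
    then show False using Q(1)[of "degree p"] p(1) by simp
  qed
  moreover have "coeff q j \<in> ratfuns F x" for j
  proof -
    have "poly (r j) x \<in> adjoin F x" unfolding adjoin_def using crF by blast
    then show ?thesis using cq fracs_superset[OF ring_set_adjoin[OF R]] field_setD[OF field_set_ratfuns[OF F]]
      by (auto split: if_splits)
  qed
  ultimately show ?thesis unfolding alg_over_def by blast
qed

lemma poly_diff_max_ideal:
  assumes W: "valuation_set W" and p: "\<And>i. coeff p i \<in> W" and xc: "x \<in> W" "c \<in> W" "x - c \<in> max_ideal W"
  shows "poly p x - poly p c \<in> max_ideal W"
  using p
proof (induction p rule: pCons_induct)
  case 0
  then show ?case using valuation_setD[OF W] by simp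
next
  case (pCons a p)
  note R = valuation_setD[OF W]
  have p: "coeff p i \<in> W" for i using pCons.prems by (metis coeff_pCons_Suc)
  have "x * (poly p x - poly p c) + poly p c * (x - c) \<in> max_ideal W"
    using pCons.IH p xc R
    by (intro valuation_max_ideal_add[OF W] max_ideal_mult_left) (auto intro: ring_set_poly)
  then show ?case by (simp add: algebra_simps)
qed

text \<open>Natural numbers lie in every subfield, so they can serve as residues over any base
  field, and in characteristic 0 there are infinitely many of them.\<close>

lemma exists_nat_nonroot:
  assumes "CHAR('a::field) = 0" "p \<noteq> 0" shows "\<exists>n. poly p (of_nat n :: 'a) \<noteq> 0"
proof (rule ccontr)
  assume "\<not> ?thesis"
  then have "range (of_nat :: nat \<Rightarrow> 'a) \<subseteq> {x. poly p x = 0}" by auto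
  then have "finite (range (of_nat :: nat \<Rightarrow> 'a))" using poly_roots_finite[OF assms(2)] finite_subset by blast
  moreover have "inj (of_nat :: nat \<Rightarrow> 'a)"
  proof (rule linorder_injI)
    fix m n :: nat assume "m < n"
    moreover have "of_nat (n - m) \<noteq> (0 :: 'a)"
      using assms(1) \<open>m < n\<close> by (simp only: of_nat_eq_0_iff_char_dvd) simp
    ultimately show "of_nat m \<noteq> (of_nat n :: 'a)" by (metis diff_self less_imp_le of_nat_diff)
  qed
  ultimately show False by (metis finite_imageD infinite_UNIV_nat)
qed

lemma units_of_set_factor:
  assumes "ring_set W" "a \<in> W" "b \<in> W" "a * b \<in> units_of_set W" shows "a \<in> units_of_set W"
  using assms max_ideal_mult_iff[OF assms(1-3)] units_of_set_iff[OF assms(1)] by auto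

lemma valuation_add_max_unit:
  assumes W: "valuation_set W" and u: "u \<in> units_of_set W" and m: "x - u \<in> max_ideal W"
  shows "x \<in> units_of_set W"
proof -
  note R = valuation_setD[OF W]
  have "(x - u) + u \<in> W" using m u max_ideal_subset R by (intro ring_set_add) (auto simp: units_of_set_def)
  moreover have "x \<notin> max_ideal W"
    using valuation_max_ideal_diff[OF W _ m] u units_of_set_iff[OF R] by force
  ultimately show ?thesis using units_of_set_iff[OF R] by auto
qed

text \<open>The valuation ring is of rank two, composed of the places \<open>z1 = c1\<close> and \<open>z2 = c2\<close>.\<close>

lemma exists_rank_two_valuation:
  fixes F :: "'a::field set"
  assumes char: "CHAR('a) = 0" and F: "field_set F" and z1: "\<not> alg_over F z1" and z2: "\<not> alg_over (ratfuns F z1) z2"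
    and w: "w \<in> adjoin (adjoin F z1) z2" "w \<noteq> 0"
  obtains W c1 c2 where "valuation_set W" "F \<subseteq> W" "z1 - of_nat c1 \<in> max_ideal W"
    "z2 - of_nat c2 \<in> max_ideal W" "\<And>n. (z1 - of_nat c1) / (z2 - of_nat c2) ^ n \<in> W" "w \<in> units_of_set W"
proof -
  note R = field_setD[OF F]
  define E where "E = ratfuns F z2"
  have E: "field_set E" "F \<subseteq> E" "z2 \<in> E"
    unfolding E_def using field_set_ratfuns[OF F] ratfuns_superset[OF F] by auto
  note RE = field_setD[OF E(1)]
  have z2F: "\<not> alg_over F z2" using z2 alg_over_mono ratfuns_superset(1)[OF F] by blast
  have z1E: "\<not> alg_over E z1" using alg_over_exchange[OF F] z1 z2 unfolding E_def by blast
  have "adjoin (adjoin F z1) z2 \<subseteq> adjoin E z1"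
    using adjoin_superset[OF RE, of z1] adjoin_self[OF RE, of z1] E ring_set_adjoin[OF RE]
    by (intro adjoin_subset) auto
  then obtain p where p: "w = poly p z1" "\<And>i. coeff p i \<in> E" using w(1) unfolding adjoin_def by auto
  have "p \<noteq> 0" using w(2) p(1) by auto
  \<comment> \<open>\<open>w\<close> is regarded as a polynomial in \<open>z1\<close> over
    \<open>F(z2)\<close>. \<open>c1\<close> avoids its zeros, and \<open>c2\<close> below avoids
    those of numerator and denominator of the resulting element \<open>w1\<close> of
    \<open>F(z2)\<close>. This makes \<open>w\<close> a unit in the end.\<close>
  then obtain c1 where c1: "poly p (of_nat c1) \<noteq> 0" using exists_nat_nonroot[OF char] by blast
  define s1 where "s1 = z1 - of_nat c1"
  define w1 where "w1 = poly p (of_nat c1)"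
  have w1: "w1 \<in> E" "w1 \<noteq> 0" unfolding w1_def using p(2) RE c1 by (auto intro!: ring_set_intros)
  obtain a b where ab: "w1 = poly a z2 / poly b z2" "\<And>i. coeff a i \<in> F" "\<And>i. coeff b i \<in> F" "poly b z2 \<noteq> 0"
    using w1(1) unfolding E_def fracs_def adjoin_def by auto
  have "a * b \<noteq> 0" using ab w1(2) by auto
  then obtain c2 where "poly (a * b) (of_nat c2) \<noteq> 0" using exists_nat_nonroot[OF char] by blast
  then have c2: "poly a (of_nat c2) \<noteq> 0" "poly b (of_nat c2) \<noteq> 0" by auto
  define s2 where "s2 = z2 - of_nat c2"
  have nonalg: "x - of_nat c \<in> M \<Longrightarrow> x \<in> M" if "ring_set M" for x :: 'a and c M
    using ring_set_add[OF that _ ring_set_of_nat[OF that], of "x - of_nat c" c] by simp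
  have s2E: "s2 \<in> E" unfolding s2_def using E RE by (auto intro!: ring_set_intros)
  have s2nz: "poly q s2 \<noteq> 0" if "\<And>i. coeff q i \<in> F" "q \<noteq> 0" for q
  proof
    assume "poly q s2 = 0"
    then have sa: "alg_over F s2" using that unfolding alg_over_def by blast
    obtain L where L: "field_set L" "F \<subseteq> L" "s2 \<in> L" "finite_over F L"
      by (rule finite_alg_extension[OF F, of "{s2}"]) (use sa in auto)
    then have "z2 \<in> L" using nonalg[OF field_setD[OF L(1)]] unfolding s2_def by blast
    then show False using finite_over_imp_alg_over[OF F L(4) field_setD[OF L(1)]] z2F by blast
  qed
  have "1 \<notin> (\<lambda>a. s1 * a) ` adjoin E z1"
  proof
    assume "1 \<in> (\<lambda>a. s1 * a) ` adjoin E z1"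
    then obtain q where q: "1 = s1 * poly q z1" "\<And>i. coeff q i \<in> E" unfolding adjoin_def by auto
    define r where "r = [:- of_nat c1, 1:] * q - 1"
    have "poly r z1 = 0" unfolding r_def using q(1) by (simp add: s1_def algebra_simps)
    moreover have "coeff r i \<in> E" for i unfolding r_def coeff_diff using q(2) RE
      by (intro ring_set_diff ring_set_coeff_mult)
        (auto simp: coeff_pCons coeff_1 intro: ring_set_uminus ring_set_of_nat split: nat.splits)
    moreover have "poly r (of_nat c1) = - 1" unfolding r_def by simp
    then have "r \<noteq> 0" by auto
    ultimately show False using z1E unfolding alg_over_def by blast
  qed
  moreover have "s1 \<in> adjoin E z1"
    unfolding s1_def using ring_set_adjoin[OF RE] adjoin_self[OF RE] by (auto intro!: ring_set_intros)
  ultimately obtain W1 where W1: "valuation_set W1" "adjoin E z1 \<subseteq> W1" "s1 \<in> max_ideal W1"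
    using exists_valuation_set[OF ring_set_adjoin[OF RE]] by metis
  note R1 = valuation_setD[OF W1(1)]
  have EW1: "E \<subseteq> W1" "z1 \<in> W1" using W1 adjoin_superset[OF RE] adjoin_self[OF RE] by auto
  have Eu: "x \<in> units_of_set W1" if "x \<in> E" "x \<noteq> 0" for x using field_set_units[OF E(1) EW1(1) that] .
  have ww1: "w - w1 \<in> max_ideal W1"
    unfolding p(1) w1_def using p(2) EW1 W1(3) R1
    by (intro poly_diff_max_ideal[OF W1(1)]) (auto simp: s1_def intro: ring_set_of_nat)
  have s2_0: "s2 \<noteq> 0" using s2nz[of "[:0, 1:]"] R by (auto simp: coeff_pCons split: nat.splits)
  \<comment> \<open>\<open>s2\<close> is a unit of \<open>W1\<close>, so the maximal ideal of
    \<open>W1\<close> is divisible by all powers of \<open>s2\<close>. This is the source of the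
    divisibility of \<open>s1\<close> by all powers of \<open>s2\<close> in
    \<open>W\<close>.\<close>
  have divm: "x / s2 ^ n \<in> max_ideal W1" if "x \<in> max_ideal W1" for x n
  proof -
    have "inverse (s2 ^ n) \<in> W1"
      using s2E EW1 RE field_set_inverse[OF E(1)] by (auto intro: ring_set_power)
    then have "inverse (s2 ^ n) * x \<in> max_ideal W1" by (intro max_ideal_mult_left R1 that)
    then show ?thesis by (simp add: divide_inverse mult.commute)
  qed
  \<comment> \<open>The preimage of \<open>F[s2]\<close> under reduction modulo the maximal ideal of
    \<open>W1\<close>. A valuation ring above it in which \<open>s2\<close> vanishes composes the
    second place with the first.\<close>
  define R2 where "R2 = {u + m | u m. u \<in> adjoin F s2 \<and> m \<in> max_ideal W1}"
  have adjF: "ring_set (adjoin F s2)" "adjoin F s2 \<subseteq> E"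
    using ring_set_adjoin[OF R] adjoin_subset[OF RE E(2) s2E] by auto
  have R2: "ring_set R2" unfolding ring_set_def
  proof (intro conjI ballI)
    show "1 \<in> R2" unfolding R2_def using adjF R1 by (intro CollectI exI[of _ 1] exI[of _ 0]) auto
    fix x y assume "x \<in> R2" "y \<in> R2"
    then obtain u m v l where xy: "x = u + m" "y = v + l" "u \<in> adjoin F s2" "v \<in> adjoin F s2"
      "m \<in> max_ideal W1" "l \<in> max_ideal W1" unfolding R2_def by blast
    have "x - y = (u - v) + (m - l)" using xy by simp
    moreover have "u - v \<in> adjoin F s2" "m - l \<in> max_ideal W1"
      using xy adjF valuation_max_ideal_diff[OF W1(1)] by (auto intro: ring_set_diff)
    ultimately show "x - y \<in> R2" unfolding R2_def by blast
    have uv: "u \<in> W1" "v \<in> W1" "m \<in> W1" using xy adjF EW1 max_ideal_subset by auto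
    have "x * y = u * v + (u * l + (v * m + m * l))" using xy by (simp add: algebra_simps)
    moreover have "u * v \<in> adjoin F s2" using xy adjF by (auto intro: ring_set_mult)
    moreover have "u * l + (v * m + m * l) \<in> max_ideal W1"
      using xy uv by (intro valuation_max_ideal_add[OF W1(1)] max_ideal_mult_left[OF R1])
    ultimately show "x * y \<in> R2" unfolding R2_def by blast
  qed
  have s2R2: "s2 \<in> R2" "max_ideal W1 \<subseteq> R2" "F \<subseteq> R2"
  proof -
    show "s2 \<in> R2" "F \<subseteq> R2" unfolding R2_def
      using adjoin_self[OF R] adjoin_superset[OF R] R1 by (force intro: exI[of _ 0])+
    show "max_ideal W1 \<subseteq> R2" unfolding R2_def using adjF by (force intro: exI[of _ 0])
  qed
  \<comment> \<open>Otherwise the nonzero element \<open>poly r s2\<close> of \<open>E\<close> would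
    lie in the maximal ideal of \<open>W1\<close>, whereas \<open>E\<close> consists of 0 and units
    of \<open>W1\<close>.\<close>
  have "1 \<notin> (\<lambda>a. s2 * a) ` R2"
  proof
    assume "1 \<in> (\<lambda>a. s2 * a) ` R2"
    then obtain q m where q: "1 = s2 * (poly q s2 + m)" "\<And>i. coeff q i \<in> F" "m \<in> max_ideal W1"
      unfolding R2_def adjoin_def by auto
    define r where "r = 1 - pCons 0 q"
    have rF: "coeff r i \<in> F" for i unfolding r_def using q(2) R
      by (auto simp: coeff_1 coeff_pCons ring_set_uminus split: nat.splits)
    have "coeff r 0 = 1" unfolding r_def by simp
    then have "r \<noteq> 0" by auto
    then have r0: "poly r s2 \<noteq> 0" using s2nz rF by blast
    have "poly r s2 = s2 * m" unfolding r_def using q(1) by (simp add: algebra_simps)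
    also have "\<dots> \<in> max_ideal W1" using s2E EW1 q(3) by (intro max_ideal_mult_left[OF R1]) auto
    finally have "poly r s2 \<in> max_ideal W1" .
    moreover have "poly r s2 \<in> E" using rF E(2) s2E RE by (auto intro!: ring_set_poly)
    ultimately show False using Eu[OF _ r0] units_of_set_iff[OF R1] by blast
  qed
  then obtain W where W: "valuation_set W" "R2 \<subseteq> W" "s2 \<in> max_ideal W"
    using exists_valuation_set[OF R2 s2R2(1)] by metis
  note RW = valuation_setD[OF W(1)]
  have mW: "m \<in> max_ideal W" if "m \<in> max_ideal W1" for m
  proof -
    have "m / s2 ^ 1 * s2 \<in> max_ideal W"
      using divm[OF that, of 1] s2R2 W by (intro max_ideal_mult_left[OF RW]) auto
    then show ?thesis using s2_0 by simp
  qed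
  have FW: "F \<subseteq> W" using s2R2 W by blast
  have z2W: "z2 \<in> W" using nonalg[OF RW, of z2 c2] W(3) max_ideal_subset unfolding s2_def by auto
  have uz: "poly q z2 \<in> units_of_set W" if "\<And>i. coeff q i \<in> F" "poly q (of_nat c2) \<noteq> 0" for q
  proof (rule valuation_add_max_unit[OF W(1)])
    show "poly q (of_nat c2) \<in> units_of_set W"
      using that R by (intro field_set_units[OF F FW]) (auto intro!: ring_set_intros)
    show "poly q z2 - poly q (of_nat c2) \<in> max_ideal W"
      using that FW z2W W(3) RW by (intro poly_diff_max_ideal[OF W(1)]) (auto simp: s2_def intro: ring_set_of_nat)
  qed
  have "w1 \<in> units_of_set W"
    unfolding ab(1) divide_inverse using uz ab c2 by (intro units_of_set_mult[OF RW] units_of_set_inverse) auto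
  then have wu: "w \<in> units_of_set W" by (rule valuation_add_max_unit[OF W(1) _ mW[OF ww1]])
  have "s1 / s2 ^ n \<in> W" for n using divm[OF W1(3)] s2R2 W by blast
  then show ?thesis using that[of W c1 c2] W FW mW[OF W1(3)] wu unfolding s1_def s2_def by blast
qed

text \<open>Given two generators \<open>z1\<close>, \<open>z2\<close> independent over a suitable
  field \<open>F\<close>, a rank two valuation ring containing \<open>A\<close> cuts out two nonzero
  primes on \<open>A\<close>, one strictly inside the other: the elements divisible by all powers of
  \<open>s2\<close>, and those in the maximal ideal. This takes the place of Noether
  normalization.\<close>

lemma finitely_generated_dim_one_transcendence:
  fixes A :: "'a::field set"
  assumes char: "CHAR('a) = 0" and k: "field_set k" and A: "ring_set A" "k \<subseteq> A" and Y: "finite Y" "Y \<subseteq> A"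
    and gen: "\<And>S. ring_set S \<Longrightarrow> k \<subseteq> S \<Longrightarrow> Y \<subseteq> S \<Longrightarrow> A \<subseteq> S" and dim: "dim_le_one A"
    and z: "z \<in> Y" "\<not> alg_over k z" and y: "y \<in> Y"
  shows "alg_over (ratfuns k z) y"
proof (rule ccontr)
  assume ny: "\<not> alg_over (ratfuns k z) y"
  \<comment> \<open>\<open>Z\<close> is to be a largest set of generators that can be moved into the
    base field while two generators stay independent over it. Maximality then makes all generators
    algebraic over \<open>F(z1, z2)\<close>.\<close>
  define Q where "Q Z \<longleftrightarrow> Z \<subseteq> Y \<and> (\<exists>F z1 z2. field_set F \<and> k \<subseteq> F \<and> Z \<subseteq> F \<and> z1 \<in> Y \<and> z2 \<in> Y \<and>
    \<not> alg_over F z1 \<and> \<not> alg_over (ratfuns F z1) z2)" for Z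
  have "Q {}" unfolding Q_def using k z y ny by blast
  moreover have "card Z < Suc (card Y)" if "Q Z" for Z
    using that Y(1) by (auto simp: Q_def less_Suc_eq_le intro: card_mono)
  ultimately obtain Z where Z: "Q Z" "\<And>Z'. Q Z' \<Longrightarrow> card Z' \<le> card Z"
    using ex_has_greatest_nat[of Q "{}" card "Suc (card Y)"] by blast
  then obtain F z1 z2 where F: "field_set F" "k \<subseteq> F" "Z \<subseteq> F" "z1 \<in> Y" "z2 \<in> Y" "\<not> alg_over F z1"
    "\<not> alg_over (ratfuns F z1) z2" and ZY: "Z \<subseteq> Y" unfolding Q_def by blast
  note F1 = field_set_ratfuns[OF F(1), of z1]
  have algE: "alg_over (ratfuns (ratfuns F z1) z2) x" if x: "x \<in> Y" for x
  proof (rule ccontr)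
    assume nx: "\<not> alg_over (ratfuns (ratfuns F z1) z2) x"
    have FE: "F \<subseteq> ratfuns F z1" "ratfuns F z1 \<subseteq> ratfuns (ratfuns F z1) z2"
      using ratfuns_superset(1) F(1) F1 by blast+
    have "x \<notin> Z" using nx F(3) FE alg_over_self[OF field_setD[OF field_set_ratfuns[OF F1]]] by blast
    have 1: "\<not> alg_over (ratfuns F x) z1"
      using alg_over_exchange[OF F(1) _ F(6)] nx FE(2) alg_over_mono by blast
    have sub: "ratfuns (ratfuns F x) z1 \<subseteq> ratfuns (ratfuns F z1) x"
    proof (intro ratfuns_subset field_set_ratfuns F1 F(1))
      show "F \<subseteq> ratfuns (ratfuns F z1) x" "x \<in> ratfuns (ratfuns F z1) x" "z1 \<in> ratfuns (ratfuns F z1) x"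
        using ratfuns_superset[OF F1, of x] ratfuns_superset[OF F(1), of z1] by auto
    qed
    have 2: "\<not> alg_over (ratfuns (ratfuns F x) z1) z2"
      using alg_over_exchange[OF F1 _ F(7)] nx sub alg_over_mono by blast
    have "Q (insert x Z)" unfolding Q_def
      using 1 2 F ZY x field_set_ratfuns[OF F(1)] ratfuns_superset[OF F(1), of x]
      by (intro conjI exI[of _ "ratfuns F x"] exI[of _ z1] exI[of _ z2]) auto
    then have "card (insert x Z) \<le> card Z" by (rule Z(2))
    then show False using \<open>x \<notin> Z\<close> finite_subset[OF ZY Y(1)] by simp
  qed
  define B where "B = adjoin (adjoin F z1) z2"
  note R = field_setD[OF F(1)]
  have B: "ring_set B" unfolding B_def by (intro ring_set_adjoin R)
  have "adjoin F z1 \<subseteq> B" "z2 \<in> B"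
    unfolding B_def using adjoin_superset adjoin_self ring_set_adjoin R by blast+
  then have BB: "F \<subseteq> B" "z1 \<in> B" "z2 \<in> B" using adjoin_superset[OF R] adjoin_self[OF R] by blast+
  have "ratfuns (ratfuns F z1) z2 \<subseteq> fracs B"
    using BB fracs_superset[OF B] by (intro ratfuns_subset field_set_fracs B) auto
  then have "\<forall>x\<in>Y. alg_over B x" using algE alg_over_fracs[OF B] alg_over_mono by blast
  then have "\<forall>x\<in>Y. \<exists>p. p \<noteq> 0 \<and> (\<forall>i. coeff p i \<in> B) \<and> poly p x = 0" unfolding alg_over_def .
  then obtain p where p: "\<And>x. x \<in> Y \<Longrightarrow> p x \<noteq> 0" "\<And>x i. x \<in> Y \<Longrightarrow> coeff (p x) i \<in> B"
    "\<And>x. x \<in> Y \<Longrightarrow> poly (p x) x = 0" by metis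
  \<comment> \<open>If the leading coefficients are units of \<open>W\<close>, all of
    \<open>Y\<close> lies in \<open>W\<close>. The freedom to prescribe a unit in the rank two
    construction serves this purpose.\<close>
  define w where "w = (\<Prod>x\<in>Y. lead_coeff (p x))"
  have w: "w \<in> B" "w \<noteq> 0" unfolding w_def using p Y(1) B by (auto intro: ring_set_prod)
  obtain W c1 c2 where W: "valuation_set W" "F \<subseteq> W" "z1 - of_nat c1 \<in> max_ideal W"
    "z2 - of_nat c2 \<in> max_ideal W" "\<And>n. (z1 - of_nat c1) / (z2 - of_nat c2) ^ n \<in> W" "w \<in> units_of_set W"
    using exists_rank_two_valuation[OF char F(1,6,7) w(1)[unfolded B_def] w(2)] by blast
  note RW = valuation_setD[OF W(1)]
  define s1 s2 where "s1 = z1 - of_nat c1" and "s2 = z2 - of_nat c2"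
  have shift: "x \<in> W" if "x - of_nat c \<in> max_ideal W" for x c
    using ring_set_add[OF RW subsetD[OF max_ideal_subset that] ring_set_of_nat[OF RW, of c]] by simp
  have "B \<subseteq> W" unfolding B_def using W(2) shift[OF W(3)] shift[OF W(4)] RW by (intro adjoin_subset)
  have "x \<in> W" if x: "x \<in> Y" for x
  proof (rule root_in_valuation_set[OF W(1) _ _ p(3)[OF x]])
    show "coeff (p x) i \<in> W" for i using p(2)[OF x] \<open>B \<subseteq> W\<close> by blast
    have "w = lead_coeff (p x) * (\<Prod>x\<in>Y - {x}. lead_coeff (p x))"
      unfolding w_def using x Y(1) by (subst prod.remove[of _ x]) auto
    then have "lead_coeff (p x) * (\<Prod>x\<in>Y - {x}. lead_coeff (p x)) \<in> units_of_set W" using W(6) by metis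
    moreover have "(\<Prod>x\<in>Y - {x}. lead_coeff (p x)) \<in> W"
      using p(2) \<open>B \<subseteq> W\<close> by (intro ring_set_prod[OF RW]) auto
    moreover have "lead_coeff (p x) \<in> W" using p(2)[OF x] \<open>B \<subseteq> W\<close> by blast
    ultimately show "lead_coeff (p x) \<in> units_of_set W" by (metis units_of_set_factor[OF RW])
  qed
  then have AW: "A \<subseteq> W" using F(2) W(2) by (intro gen RW) auto
  have s: "s1 \<in> A" "s2 \<in> A" "s1 \<noteq> 0" "s2 \<noteq> 0"
  proof -
    show "s1 \<in> A" "s2 \<in> A" unfolding s1_def s2_def using F(4,5) Y A by (auto intro!: ring_set_intros)
    have "z1 \<noteq> of_nat c1" using F(6) alg_over_self[OF R ring_set_of_nat[OF R]] by metis
    then show "s1 \<noteq> 0" unfolding s1_def by simp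
    have "z2 \<noteq> of_nat c2" using F(7) alg_over_self[OF field_setD[OF F1] ring_set_of_nat[OF field_setD[OF F1]]] by metis
    then show "s2 \<noteq> 0" unfolding s2_def by simp
  qed
  have s2i: "inverse s2 \<notin> W" using W(4) s(4) unfolding s2_def[symmetric] max_ideal_def by simp
  \<comment> \<open>The centre on \<open>A\<close> of the coarser ring obtained from
    \<open>W\<close> by inverting \<open>s2\<close>. It contains \<open>s1\<close> and not
    \<open>s2\<close>, so it is nonzero and strictly smaller than the centre of
    \<open>W\<close>.\<close>
  define q where "q = {a \<in> A. \<forall>n. a / s2 ^ n \<in> W}"
  have q: "prime_set A q" unfolding prime_set_def
  proof (intro conjI ballI impI)
    show "1 \<notin> q" unfolding q_def using s2i by (auto simp: inverse_eq_divide intro!: exI[of _ 1])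
    fix a b assume a: "a \<in> A" and b: "b \<in> A" and ab: "a * b \<in> q"
    show "a \<in> q \<or> b \<in> q"
    proof (rule ccontr)
      assume "\<not> (a \<in> q \<or> b \<in> q)"
      then obtain n m where nm: "a / s2 ^ n \<notin> W" "b / s2 ^ m \<notin> W" using a b unfolding q_def by blast
      then have "s2 ^ n / a \<in> W" "s2 ^ m / b \<in> W" using valuation_set_inverse[OF W(1)] by fastforce+
      moreover have "a * b / s2 ^ (n + m + 1) \<in> W" using ab unfolding q_def by blast
      ultimately have "(s2 ^ n / a) * (s2 ^ m / b) * (a * b / s2 ^ (n + m + 1)) \<in> W"
        using RW by (intro ring_set_mult)
      moreover have "a \<noteq> 0" "b \<noteq> 0" using nm RW by auto
      ultimately show False using s2i s(4) by (simp add: power_add field_simps inverse_eq_divide)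
    qed
  qed (use A AW RW in \<open>auto simp: q_def add_divide_distrib intro: ring_set_intros\<close>,
      use RW AW in \<open>metis ring_set_mult subsetD times_divide_eq_right\<close>)
  note c = prime_set_center[OF A(1) W(1) AW]
  have "q \<subseteq> A \<inter> max_ideal W"
  proof
    fix a assume a: "a \<in> q"
    then have "a / s2 ^ 1 \<in> W" "a \<in> A" unfolding q_def by blast+
    moreover have "a / s2 ^ 1 * s2 \<in> max_ideal W"
      using \<open>a / s2 ^ 1 \<in> W\<close> W(4) by (intro max_ideal_mult_left[OF RW]) (simp_all add: s2_def)
    ultimately show "a \<in> A \<inter> max_ideal W" using s(4) by simp
  qed
  moreover have "s2 \<in> A \<inter> max_ideal W" using s(2) W(4) unfolding s2_def by blast
  moreover have "s2 \<notin> q"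
  proof
    assume "s2 \<in> q"
    then have "s2 / s2 ^ 2 \<in> W" unfolding q_def by blast
    then show False using s2i s(4) by (simp add: power2_eq_square inverse_eq_divide)
  qed
  ultimately have "q \<subset> A \<inter> max_ideal W" by blast
  moreover have "s1 \<in> q" unfolding q_def using s(1) W(5) unfolding s1_def s2_def by blast
  ultimately show False using dim q c s(3) unfolding dim_le_one_def by blast
qed

subsection \<open>Finiteness over rational function fields\<close>

lemma finite_over_mono: "finite_over F L \<Longrightarrow> M \<subseteq> L \<Longrightarrow> finite_over F M"
  unfolding finite_over_def by blast

text \<open>By exchange \<open>z\<close> is algebraic over \<open>k(g)\<close>, so \<open>z\<close>
  and then \<open>Y\<close> can be adjoined in finite steps. The hypothesis on \<open>L\<close> says
  that it lies in the field generated by \<open>k\<close>, \<open>z\<close> and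
  \<open>Y\<close>.\<close>

lemma finite_over_ratfuns_change:
  assumes k: "field_set k" and Y: "finite Y" "\<And>x. x \<in> Y \<Longrightarrow> alg_over (ratfuns k z) x"
    and g: "\<not> alg_over k g" "alg_over (ratfuns k z) g"
    and L: "\<And>S. field_set S \<Longrightarrow> k \<subseteq> S \<Longrightarrow> z \<in> S \<Longrightarrow> Y \<subseteq> S \<Longrightarrow> L \<subseteq> S"
  shows "finite_over (ratfuns k g) L"
proof -
  note Fg = field_set_ratfuns[OF k, of g]
  have zg: "alg_over (ratfuns k g) z" by (rule alg_over_exchange[OF k g(2,1)])
  obtain L1 where L1: "field_set L1" "ratfuns k g \<subseteq> L1" "z \<in> L1" "finite_over (ratfuns k g) L1"
    by (rule finite_alg_extension[OF Fg, of "{z}"]) (use zg in auto)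
  have k1: "k \<subseteq> L1" using L1 ratfuns_superset[OF k] by blast
  have "ratfuns k z \<subseteq> L1" by (intro ratfuns_subset L1 k1)
  then have Y1: "alg_over L1 x" if "x \<in> Y" for x using Y(2)[OF that] alg_over_mono by blast
  obtain L2 where L2: "field_set L2" "L1 \<subseteq> L2" "Y \<subseteq> L2" "finite_over L1 L2"
    by (rule finite_alg_extension[OF L1(1) Y(1) Y1]) auto
  have "finite_over (ratfuns k g) L2"
    by (rule finite_over_trans[OF field_setD[OF Fg] L1(4) L2(4)])
  moreover have "L \<subseteq> L2" using L2 k1 L1(3) by (intro L) auto
  ultimately show ?thesis by (rule finite_over_mono)
qed

text \<open>The derivative of an equation of least degree has smaller degree and is nonzero in
  characteristic 0, so it cannot vanish at \<open>y\<close>.\<close>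

lemma alg_over_separable:
  fixes y :: "'a::field"
  assumes char: "CHAR('a) = 0" and R: "ring_set R" and y: "alg_over R y"
  obtains F where "\<And>i. coeff F i \<in> R" "poly F y = 0" "poly (pderiv F) y \<noteq> 0"
proof -
  define Q where "Q F \<longleftrightarrow> F \<noteq> 0 \<and> (\<forall>i. coeff F i \<in> R) \<and> poly F y = 0" for F
  obtain F0 where "Q F0" using y unfolding alg_over_def Q_def by blast
  then obtain F where F: "Q F" "\<And>F'. Q F' \<Longrightarrow> degree F \<le> degree F'"
    using ex_has_least_nat[of Q F0 degree] by blast
  have "poly (pderiv F) y \<noteq> 0"
  proof
    assume 0: "poly (pderiv F) y = 0"
    have d: "degree F > 0"
    proof (rule ccontr)
      assume "\<not> degree F > 0"
      then obtain c where "F = [:c:]" using degree_eq_zeroE by blast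
      then show False using F(1) unfolding Q_def by auto
    qed
    have less: "degree (pderiv F) < degree F"
    proof -
      have "degree (pderiv F) \<le> degree F - 1" by (rule degree_le) (auto simp: coeff_pderiv coeff_eq_0)
      then show ?thesis using d by simp
    qed
    have "of_nat (degree F) * lead_coeff F \<noteq> 0"
      using d char by (auto simp: of_nat_eq_0_iff_char_dvd)
    then have "coeff (pderiv F) (degree F - 1) \<noteq> 0" using d by (simp add: coeff_pderiv)
    then have "pderiv F \<noteq> 0" by auto
    moreover have "\<forall>i. coeff (pderiv F) i \<in> R"
    proof
      fix i
      have "of_nat (Suc i) * coeff F (Suc i) \<in> R"
        using F(1) R unfolding Q_def by (intro ring_set_mult ring_set_of_nat) auto
      then show "coeff (pderiv F) i \<in> R" by (simp add: coeff_pderiv)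
    qed
    ultimately have "Q (pderiv F)" using 0 unfolding Q_def by blast
    then show False using F(2)[of "pderiv F"] less by simp
  qed
  then show ?thesis using that[of F] F(1) unfolding Q_def by blast
qed

text \<open>Long division only inverts the leading coefficient of the divisor. The coefficient ring
  is recorded because the division is also carried out over subrings of a local ring that need not
  be fields.\<close>

lemma poly_division_coeffs:
  fixes h c :: "'a::field poly"
  assumes R: "ring_set R" and h: "h \<noteq> 0" "\<And>i. coeff h i \<in> R" "inverse (lead_coeff h) \<in> R"
    and c: "\<And>i. coeff c i \<in> R"
  shows "\<exists>q r. (\<forall>i. coeff q i \<in> R) \<and> (\<forall>i. coeff r i \<in> R) \<and> c = h * q + r \<and> (r = 0 \<or> degree r < degree h)"
  using c
proof (induction "degree c" arbitrary: c rule: less_induct)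
  case less
  show ?case
  proof (cases "c = 0 \<or> degree c < degree h")
    case True
    then show ?thesis using less.prems R by (intro exI[of _ 0] exI[of _ c]) auto
  next
    case False
    define m where "m = monom (lead_coeff c * inverse (lead_coeff h)) (degree c - degree h)"
    define c' where "c' = c - h * m"
    have mR: "coeff m i \<in> R" for i unfolding m_def using less.prems R h(3) by (auto intro: ring_set_mult)
    have c'R: "coeff c' i \<in> R" for i
      unfolding c'_def coeff_diff using less.prems mR h(2) by (intro ring_set_diff[OF R] ring_set_coeff_mult[OF R])
    have dc: "coeff c' i = 0" if "i \<ge> degree c" for i
    proof (cases "i = degree c")
      case True
      have "coeff (h * m) (degree c) = lead_coeff c"
        unfolding m_def using False h(1) by (simp add: coeff_monom_mult mult.commute[of h])
      then show ?thesis unfolding c'_def True by simp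
    next
      case f: False
      have "degree (h * m) \<le> degree h + (degree c - degree h)"
        unfolding m_def by (intro order_trans[OF degree_mult_le] add_mono degree_monom_le order_refl)
      then have "coeff (h * m) i = 0" using that f False by (intro coeff_eq_0) auto
      moreover have "coeff c i = 0" using that f by (intro coeff_eq_0) auto
      ultimately show ?thesis unfolding c'_def by simp
    qed
    show ?thesis
    proof (cases "c' = 0")
      case True
      then have "c = h * m + 0" unfolding c'_def by simp
      then show ?thesis using mR R by (intro exI[of _ m] exI[of _ "0::'a poly"]) auto
    next
      case c'0: False
      have "degree c' < degree c" using dc c'0 by (metis leading_coeff_0_iff not_le_imp_less)
      from less.hyps[OF this c'R] obtain q r where qr: "\<forall>i. coeff q i \<in> R" "\<forall>i. coeff r i \<in> R"
        "c' = h * q + r" "r = 0 \<or> degree r < degree h" by blast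
      have "c = h * (q + m) + r" using qr(3) unfolding c'_def by (simp add: algebra_simps)
      moreover have "\<forall>i. coeff (q + m) i \<in> R" using qr(1) mR R by (auto intro: ring_set_add)
      ultimately show ?thesis using qr by blast
    qed
  qed
qed

lemma alg_over_nonzero_const:
  fixes y :: "'a::field"
  assumes y: "alg_over F y" "y \<noteq> 0"
  obtains q where "coeff q 0 \<noteq> 0" "\<And>i. coeff q i \<in> F" "poly q y = 0"
proof -
  obtain p where "p \<noteq> 0" "\<forall>i. coeff p i \<in> F" "poly p y = 0" using y unfolding alg_over_def by blast
  then have "\<exists>q. coeff q 0 \<noteq> 0 \<and> (\<forall>i. coeff q i \<in> F) \<and> poly q y = 0"
  proof (induction p rule: pCons_induct)
    case (pCons a p)
    show ?case
    proof (cases "a = 0")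
      case True
      then have "p \<noteq> 0" "poly p y = 0" using pCons.prems y(2) by auto
      moreover have "\<forall>i. coeff p i \<in> F" using pCons.prems(2) by (metis coeff_pCons_Suc)
      ultimately show ?thesis using pCons.IH by blast
    next
      case False
      then show ?thesis using pCons.prems by (intro exI[of _ "pCons a p"]) auto
    qed
  qed simp
  then show ?thesis using that by blast
qed

subsection \<open>Regular points\<close>

text \<open>\<open>R\<close> modulo \<open>\<pi> P\<close> is a subfield of \<open>P / \<pi> P\<close>.\<close>

definition field_modulo :: "'a::field set \<Rightarrow> 'a \<Rightarrow> 'a set \<Rightarrow> bool" where
  "field_modulo P \<pi> R \<longleftrightarrow> ring_set R \<and> R \<subseteq> P \<and> (\<forall>x\<in>R. x \<in> max_ideal P \<longrightarrow> x \<in> (\<lambda>a. \<pi> * a) ` P) \<and>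
     (\<forall>x\<in>R. x \<notin> max_ideal P \<longrightarrow> inverse x \<in> R)"

context local_ring_at
begin

lemma units_P_inverse: "x \<in> P \<Longrightarrow> x \<notin> max_ideal P \<Longrightarrow> inverse x \<in> P"
  by (auto simp: max_ideal_def)

lemma principal_add: "x \<in> (\<lambda>a. \<pi> * a) ` P \<Longrightarrow> y \<in> (\<lambda>a. \<pi> * a) ` P \<Longrightarrow> x + y \<in> (\<lambda>a. \<pi> * a) ` P"
  using ring_set_P by (force simp: image_iff distrib_left[symmetric] intro: ring_set_add)

lemma principal_mult: "x \<in> (\<lambda>a. \<pi> * a) ` P \<Longrightarrow> y \<in> P \<Longrightarrow> y * x \<in> (\<lambda>a. \<pi> * a) ` P"
  using ring_set_P by (force simp: image_iff mult.left_commute intro: ring_set_mult)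

lemma principal_sum: "(\<And>i. i \<in> I \<Longrightarrow> f i \<in> (\<lambda>a. \<pi> * a) ` P) \<Longrightarrow> sum f I \<in> (\<lambda>a. \<pi> * a) ` P"
proof (induction I rule: infinite_finite_induct)
  case (insert x F)
  then show ?case using principal_add by auto
qed (use ring_set_P in \<open>auto simp: image_iff intro!: bexI[of _ 0]\<close>)

lemma principal_poly:
  assumes "\<And>i. coeff r i \<in> (\<lambda>a. \<pi> * a) ` P" "y \<in> P" shows "poly r y \<in> (\<lambda>a. \<pi> * a) ` P"
  unfolding poly_altdef
proof (intro principal_sum)
  fix i
  have "y ^ i * coeff r i \<in> (\<lambda>a. \<pi> * a) ` P"
    by (rule principal_mult[OF assms(1)]) (use assms(2) ring_set_P in \<open>auto intro: ring_set_power\<close>)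
  then show "coeff r i * y ^ i \<in> (\<lambda>a. \<pi> * a) ` P" by (simp add: mult.commute)
qed

lemma max_ideal_poly:
  assumes "\<And>i. coeff r i \<in> max_ideal P" "y \<in> P" shows "poly r y \<in> max_ideal P"
  unfolding poly_altdef
proof (intro max_ideal_sum)
  fix i
  have "y ^ i * coeff r i \<in> max_ideal P"
    using assms ring_set_P by (intro max_ideal_mult_left) (auto intro: ring_set_power)
  then show "coeff r i * y ^ i \<in> max_ideal P" by (simp add: mult.commute)
qed

text \<open>The inverses of those elements of \<open>R\<close> that are units of \<open>P\<close>
  are added. The condition on non-units is inherited, since such denominators can be cleared without
  changing membership in \<open>\<pi> P\<close>.\<close>

lemma field_modulo_localize:
  assumes R: "ring_set R" "R \<subseteq> P" "\<And>x. x \<in> R \<Longrightarrow> x \<in> max_ideal P \<Longrightarrow> x \<in> (\<lambda>a. \<pi> * a) ` P"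
  shows "\<exists>S. field_modulo P \<pi> S \<and> R \<subseteq> S"
proof -
  define S where "S = {a / b | a b. a \<in> R \<and> b \<in> R \<and> b \<notin> max_ideal P}"
  have nz0: "b \<noteq> 0" if "b \<notin> max_ideal P" for b using that ring_set_P by auto
  have RS: "R \<subseteq> S" unfolding S_def using R(1) ring_set_P by (force intro: exI[of _ 1])
  have SP: "S \<subseteq> P" unfolding S_def using R(2) ring_set_P by (auto intro: ring_set_divide_unit)
  have "ring_set S" unfolding ring_set_def
  proof (intro conjI ballI)
    show "1 \<in> S" using RS R(1) by auto
    fix x y assume "x \<in> S" "y \<in> S"
    then obtain a b c d where x: "a \<in> R" "b \<in> R" "b \<notin> max_ideal P" "x = a / b"
      and y: "c \<in> R" "d \<in> R" "d \<notin> max_ideal P" "y = c / d" unfolding S_def by blast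
    have "x - y = (a * d - c * b) / (b * d)" "x * y = (a * c) / (b * d)"
      using x y nz0 by (simp_all add: diff_frac_eq)
    moreover have "b * d \<notin> max_ideal P" using x y R(2) max_ideal_mult_iff[OF ring_set_P] by blast
    moreover have "a * d - c * b \<in> R" "a * c \<in> R" "b * d \<in> R" using x y R(1) by (auto intro: ring_set_intros)
    ultimately show "x - y \<in> S" "x * y \<in> S" unfolding S_def by blast+
  qed
  moreover have "x \<in> (\<lambda>a. \<pi> * a) ` P" if x: "x \<in> S" "x \<in> max_ideal P" for x
  proof -
    obtain a b where ab: "a \<in> R" "b \<in> R" "b \<notin> max_ideal P" "x = a / b" using x(1) unfolding S_def by blast
    have "b * x \<in> max_ideal P" using ab R(2) x(2) by (intro max_ideal_mult_left ring_set_P) auto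
    then have "a \<in> (\<lambda>a. \<pi> * a) ` P" using ab nz0 R(3) by simp
    then have "inverse b * a \<in> (\<lambda>a. \<pi> * a) ` P" using ab R(2) units_P_inverse by (intro principal_mult) auto
    then show ?thesis using ab(4) by (simp add: divide_inverse mult.commute)
  qed
  moreover have "inverse x \<in> S" if x: "x \<in> S" "x \<notin> max_ideal P" for x
  proof -
    obtain a b where ab: "a \<in> R" "b \<in> R" "b \<notin> max_ideal P" "x = a / b" using x(1) unfolding S_def by blast
    have "a \<notin> max_ideal P"
    proof
      assume "a \<in> max_ideal P"
      then have "inverse b * a \<in> max_ideal P"
        using ab R(2) units_P_inverse by (intro max_ideal_mult_left ring_set_P) auto
      then show False using ab x by (simp add: divide_inverse mult.commute)
    qed
    then show ?thesis unfolding S_def using ab by auto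
  qed
  ultimately show ?thesis using RS SP unfolding field_modulo_def by blast
qed

text \<open>A root of \<open>F\<close> that stays simple modulo the maximal ideal generates an
  unramified extension. Let \<open>\<mu>\<close> lift the minimal polynomial of the residue of
  \<open>y\<close>. Division gives \<open>F = \<mu> * \<nu> + \<rho>\<close>, where
  \<open>\<rho>\<close> reduces to 0 and \<open>poly \<nu> y\<close> is a unit because the root is
  simple. So \<open>poly \<mu> y\<close> lies in \<open>\<pi> P\<close>, and the non-units of
  \<open>R[y]\<close> lie in \<open>\<pi> P\<close> too.\<close>

lemma field_modulo_adjoin:
  assumes R: "field_modulo P \<pi> R" and y: "y \<in> P"
    and F: "\<And>i. coeff F i \<in> R" "poly F y = 0" "poly (pderiv F) y \<notin> max_ideal P" and \<pi>: "\<pi> \<in> max_ideal P"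
  shows "\<exists>S. field_modulo P \<pi> S \<and> R \<subseteq> S \<and> y \<in> S"
proof -
  have R1: "ring_set R" "R \<subseteq> P" and R2: "\<And>x. x \<in> R \<Longrightarrow> x \<in> max_ideal P \<Longrightarrow> x \<in> (\<lambda>a. \<pi> * a) ` P"
    and R3: "\<And>x. x \<in> R \<Longrightarrow> x \<notin> max_ideal P \<Longrightarrow> inverse x \<in> R" using R unfolding field_modulo_def by blast+
  \<comment> \<open>Polynomials over \<open>R\<close> with nonzero reduction that vanishes at the
    residue of \<open>y\<close>; one of least degree lifts the minimal polynomial.\<close>
  define Q where "Q \<mu> \<longleftrightarrow> (\<forall>i. coeff \<mu> i \<in> R) \<and> (\<exists>i. coeff \<mu> i \<notin> max_ideal P) \<and> poly \<mu> y \<in> max_ideal P" for \<mu>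
  have pd: "coeff (pderiv r) i \<in> M" if "\<And>i. coeff r i \<in> M" "\<And>n x. x \<in> M \<Longrightarrow> of_nat n * x \<in> M" for r i M
    using that(2)[OF that(1)[of "Suc i"], of "Suc i"] by (simp add: coeff_pderiv)
  have natm: "of_nat n * x \<in> max_ideal P" if "x \<in> max_ideal P" for n x
    using that ring_set_P by (intro max_ideal_mult_left ring_set_of_nat)
  have "Q F"
  proof -
    have "\<exists>i. coeff F i \<notin> max_ideal P"
      using F(3) max_ideal_poly[OF pd[of F "max_ideal P"] y] natm by blast
    then show ?thesis unfolding Q_def using F ring_set_P by simp
  qed
  then obtain \<mu> where \<mu>: "Q \<mu>" "\<And>\<nu>. Q \<nu> \<Longrightarrow> degree \<mu> \<le> degree \<nu>"
    using ex_has_least_nat[of Q F degree] by blast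
  have \<mu>R: "coeff \<mu> i \<in> R" for i using \<mu>(1) unfolding Q_def by blast
  \<comment> \<open>By minimality of \<open>\<mu>\<close> a remainder vanishing at the residue of
    \<open>y\<close> has zero reduction. Its coefficients are non-units in \<open>R\<close>, hence
    in \<open>\<pi> P\<close>.\<close>
  have small: "poly r y \<in> (\<lambda>a. \<pi> * a) ` P \<and> (\<forall>i. coeff r i \<in> max_ideal P)"
    if r: "\<And>i. coeff r i \<in> R" "r = 0 \<or> degree r < degree \<mu>" "poly r y \<in> max_ideal P" for r
  proof -
    have "\<forall>i. coeff r i \<in> max_ideal P"
    proof (cases "r = 0")
      case True
      then show ?thesis using ring_set_P by simp
    next
      case False
      then show ?thesis using \<mu>(2)[of r] r unfolding Q_def by auto
    qed
    then show ?thesis using r(1) R2 by (auto intro!: principal_poly y)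
  qed
  have lc: "lead_coeff \<mu> \<notin> max_ideal P"
  proof
    assume l: "lead_coeff \<mu> \<in> max_ideal P"
    \<comment> \<open>If the leading coefficient were a non-unit, dropping its term would give a
      competitor of smaller degree.\<close>
    define r where "r = \<mu> - monom (lead_coeff \<mu>) (degree \<mu>)"
    have cr: "coeff r i = (if i = degree \<mu> then 0 else coeff \<mu> i)" for i unfolding r_def by simp
    obtain i where i: "coeff \<mu> i \<notin> max_ideal P" using \<mu>(1) unfolding Q_def by blast
    then have ci: "coeff r i \<notin> max_ideal P" using l cr by auto
    then have r0: "r \<noteq> 0" using ring_set_P by auto
    have "coeff r j = 0" if "j \<ge> degree \<mu>" for j using that cr by (auto simp: coeff_eq_0)
    then have "degree r < degree \<mu>" using r0 by (metis leading_coeff_0_iff not_le_imp_less)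
    moreover have "poly r y \<in> max_ideal P"
    proof -
      have "y ^ degree \<mu> * lead_coeff \<mu> \<in> max_ideal P"
        using y ring_set_P by (intro max_ideal_mult_left l) (auto intro: ring_set_power)
      then show ?thesis unfolding r_def using \<mu>(1) max_ideal_diff
        by (simp add: Q_def poly_monom mult.commute)
    qed
    moreover have "\<forall>j. coeff r j \<in> R" using cr \<mu>R R1 by auto
    ultimately have "Q r" unfolding Q_def using ci by blast
    then show False using \<mu>(2)[of r] \<open>degree r < degree \<mu>\<close> by simp
  qed
  then have \<mu>0: "\<mu> \<noteq> 0" using ring_set_P by auto
  note div = poly_division_coeffs[OF R1(1) \<mu>0 \<mu>R R3[OF \<mu>R lc]]
  have RyP: "poly q y \<in> P" if "\<And>i. coeff q i \<in> R" for q using that R1 y ring_set_P by (intro ring_set_poly) auto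
  have \<mu>m: "poly \<mu> y \<in> max_ideal P" using \<mu>(1) unfolding Q_def by blast
  have \<mu>\<pi>: "poly \<mu> y \<in> (\<lambda>a. \<pi> * a) ` P"
  proof -
    obtain \<nu> \<rho> where d: "\<And>i. coeff \<nu> i \<in> R" "\<And>i. coeff \<rho> i \<in> R" "F = \<mu> * \<nu> + \<rho>" "\<rho> = 0 \<or> degree \<rho> < degree \<mu>"
      using div[OF F(1)] by blast
    have 0: "poly \<rho> y = - (poly \<nu> y * poly \<mu> y)" using F(2) unfolding d(3) by (simp add: eq_neg_iff_add_eq_0 algebra_simps)
    have "poly \<rho> y \<in> max_ideal P" unfolding 0 using \<mu>m RyP[OF d(1)] ring_set_P
      by (intro valuation_max_ideal_uminus max_ideal_mult_left)
    from small[OF d(2,4) this] have \<rho>: "poly \<rho> y \<in> (\<lambda>a. \<pi> * a) ` P" "\<And>i. coeff \<rho> i \<in> max_ideal P" by blast+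
    have "poly \<nu> y \<notin> max_ideal P"
    proof
      assume n: "poly \<nu> y \<in> max_ideal P"
      have "coeff (pderiv \<mu>) i \<in> R" "coeff (pderiv \<nu>) i \<in> R" for i
        using pd[of \<mu> R i] pd[of \<nu> R i] \<mu>R d(1) R1(1) by (auto intro: ring_set_mult ring_set_of_nat)
      then have P': "poly (pderiv \<mu>) y \<in> P" "poly (pderiv \<nu>) y \<in> P" using RyP by blast+
      \<comment> \<open>If \<open>poly \<nu> y\<close> were a non-unit, so would be all three terms
        of the derivative, against the simplicity of the root.\<close>
      have "poly (pderiv F) y = poly (pderiv \<nu>) y * poly \<mu> y + poly (pderiv \<mu>) y * poly \<nu> y + poly (pderiv \<rho>) y"
        unfolding d(3) by (simp add: pderiv_add pderiv_mult algebra_simps)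
      also have "\<dots> \<in> max_ideal P"
        by (intro max_ideal_add max_ideal_mult_left[OF ring_set_P] P' n \<mu>m max_ideal_poly[OF pd[OF \<rho>(2) natm] y])
      finally show False using F(3) by blast
    qed
    then have inv: "inverse (poly \<nu> y) \<in> P" "poly \<nu> y \<noteq> 0" using RyP[OF d(1)] units_P_inverse ring_set_P by auto
    have "- inverse (poly \<nu> y) * poly \<rho> y \<in> (\<lambda>a. \<pi> * a) ` P"
      using \<rho>(1) inv ring_set_P by (intro principal_mult ring_set_uminus)
    also have "- inverse (poly \<nu> y) * poly \<rho> y = poly \<mu> y" unfolding 0 using inv(2) by simp
    finally show ?thesis .
  qed
  have "x \<in> (\<lambda>a. \<pi> * a) ` P" if x: "x \<in> adjoin R y" "x \<in> max_ideal P" for x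
  proof -
    obtain g where g: "x = poly g y" "\<And>i. coeff g i \<in> R" using x(1) unfolding adjoin_def by blast
    obtain q r where d: "\<And>i. coeff q i \<in> R" "\<And>i. coeff r i \<in> R" "g = \<mu> * q + r" "r = 0 \<or> degree r < degree \<mu>"
      using div[OF g(2)] by blast
    have "poly r y = x - poly q y * poly \<mu> y" unfolding g(1) d(3) by (simp add: mult.commute)
    also have "\<dots> \<in> max_ideal P"
      using x(2) \<mu>m RyP[OF d(1)] by (intro max_ideal_diff max_ideal_mult_left ring_set_P)
    finally have "poly r y \<in> (\<lambda>a. \<pi> * a) ` P" using small[OF d(2,4)] by blast
    moreover have "poly q y * poly \<mu> y \<in> (\<lambda>a. \<pi> * a) ` P" by (rule principal_mult[OF \<mu>\<pi> RyP[OF d(1)]])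
    ultimately have "poly q y * poly \<mu> y + poly r y \<in> (\<lambda>a. \<pi> * a) ` P" by (intro principal_add)
    then show ?thesis unfolding g(1) d(3) by (simp add: mult.commute)
  qed
  moreover have "adjoin R y \<subseteq> P" using R1 y ring_set_P by (intro adjoin_subset)
  ultimately obtain S where "field_modulo P \<pi> S" "adjoin R y \<subseteq> S"
    using field_modulo_localize[OF ring_set_adjoin[OF R1(1)]] by metis
  then show ?thesis using adjoin_superset[OF R1(1)] adjoin_self[OF R1(1)] by blast
qed

end

section \<open>Charts of a curve: function field and uniformizers\<close>

locale curve_chart =
  fixes k A Y :: "'a::field set" and z :: 'a
  assumes char: "CHAR('a) = 0" and k: "field_set k" and A: "ring_set A" "k \<subseteq> A" and Y: "finite Y" "Y \<subseteq> A"
    and gen: "\<And>S. ring_set S \<Longrightarrow> k \<subseteq> S \<Longrightarrow> Y \<subseteq> S \<Longrightarrow> A \<subseteq> S"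
    and dim: "dim_le_one A" and frac: "\<And>x. \<exists>a\<in>A. \<exists>b\<in>A. b \<noteq> 0 \<and> x = a / b"
    and z: "z \<in> Y" "\<not> alg_over k z"
begin

lemma algY: "y \<in> Y \<Longrightarrow> alg_over (ratfuns k z) y"
  by (rule finitely_generated_dim_one_transcendence[OF char k A Y gen dim z])

lemma field_superset_UNIV:
  assumes "field_set S" "k \<subseteq> S" "Y \<subseteq> S" shows "UNIV \<subseteq> S"
proof
  fix x
  obtain a b where "a \<in> A" "b \<in> A" "x = a / b" using frac by blast
  moreover have "A \<subseteq> S" using assms by (intro gen field_setD)
  ultimately show "x \<in> S" using field_set_divide[OF assms(1)] by blast
qed

lemma alg_over_z: "alg_over (ratfuns k z) x"
proof -
  obtain L where L: "field_set L" "ratfuns k z \<subseteq> L" "Y \<subseteq> L" "finite_over (ratfuns k z) L"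
    by (rule finite_alg_extension[OF field_set_ratfuns[OF k] Y(1) algY]) auto
  then have "UNIV \<subseteq> L" using ratfuns_superset(1)[OF k] by (intro field_superset_UNIV) blast+
  then show ?thesis
    using finite_over_imp_alg_over[OF field_set_ratfuns[OF k] L(4) field_setD[OF L(1)]] by blast
qed

lemma finite_over_UNIV: "\<not> alg_over k g \<Longrightarrow> finite_over (ratfuns k g) UNIV"
  by (rule finite_over_ratfuns_change[OF k Y(1) algY _ alg_over_z field_superset_UNIV])

text \<open>\<open>A\<close> is generated over \<open>k[z]\<close> by elements \<open>y\<close> with
  separable equations \<open>F y\<close>. Away from the zeros of \<open>b\<close>, the product of
  the values of the derivatives, it is unramified over \<open>k[z]\<close>, so a generator of the
  prime ideal that \<open>p\<close> cuts out on \<open>k[z]\<close> remains a uniformizer.\<close>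

lemma exists_uniformizer:
  obtains b where "b \<in> A" "b \<noteq> 0"
    "\<And>p. prime_set A p \<Longrightarrow> p \<noteq> {0} \<Longrightarrow> b \<notin> p \<Longrightarrow> \<exists>t. uniformizer (localize A p) t"
proof -
  note Rk = field_setD[OF k]
  have adjA: "adjoin k z \<subseteq> A" using A Y z by (intro adjoin_subset) auto
  have "\<forall>y\<in>Y. \<exists>F. (\<forall>i. coeff F i \<in> adjoin k z) \<and> poly F y = 0 \<and> poly (pderiv F) y \<noteq> 0"
    using alg_over_separable[OF char ring_set_adjoin[OF Rk] alg_over_fracs[OF ring_set_adjoin[OF Rk] algY]] by metis
  then obtain F where F: "\<And>y i. y \<in> Y \<Longrightarrow> coeff (F y) i \<in> adjoin k z" "\<And>y. y \<in> Y \<Longrightarrow> poly (F y) y = 0"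
    "\<And>y. y \<in> Y \<Longrightarrow> poly (pderiv (F y)) y \<noteq> 0" by metis
  define b where "b = (\<Prod>y\<in>Y. poly (pderiv (F y)) y)"
  have FA: "poly (pderiv (F y)) y \<in> A" if y: "y \<in> Y" for y
  proof (rule ring_set_poly[OF A(1)])
    show "coeff (pderiv (F y)) i \<in> A" for i
      using F(1)[OF y, of "Suc i"] adjA ring_set_mult[OF A(1) ring_set_of_nat[OF A(1), of "Suc i"]]
      by (auto simp: coeff_pderiv)
  qed (use y Y in auto)
  have b: "b \<in> A" "b \<noteq> 0" unfolding b_def using FA F(3) Y(1) A(1) by (auto intro: ring_set_prod)
  moreover have "\<exists>t. uniformizer (localize A p) t" if pr: "prime_set A p" "p \<noteq> {0}" "b \<notin> p" for p
  proof -
    interpret local_ring_at A p using A pr by unfold_locales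
    \<comment> \<open>A polynomial of least degree with value in \<open>p\<close> generates the
      prime ideal that \<open>p\<close> cuts out on \<open>k[z]\<close>.\<close>
    define Q where "Q h \<longleftrightarrow> h \<noteq> 0 \<and> (\<forall>i. coeff h i \<in> k) \<and> poly h z \<in> p" for h
    have "\<exists>h. Q h"
    proof -
      \<comment> \<open>This prime ideal is nonzero: an equation over \<open>k[z]\<close> for a
        nonzero \<open>a\<close> in \<open>p\<close> can be given a nonzero constant term, and that
        term is a multiple of \<open>a\<close> in \<open>A\<close>.\<close>
      obtain a where a: "a \<in> p" "a \<noteq> 0" using pr(2) pD(2) by blast
      have "alg_over (adjoin k z) a" by (rule alg_over_fracs[OF ring_set_adjoin[OF Rk] alg_over_z])
      then obtain q where q: "coeff q 0 \<noteq> 0" "\<And>i. coeff q i \<in> adjoin k z" "poly q a = 0"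
        using alg_over_nonzero_const a(2) by metis
      obtain h where h: "coeff q 0 = poly h z" "\<forall>i. coeff h i \<in> k" using q(2)[of 0] unfolding adjoin_def by blast
      obtain c r where cr: "q = pCons c r" by (cases q)
      have "poly r a \<in> A" using q(2) adjA a pD(1) cr A(1)
        by (intro ring_set_poly) (auto, metis coeff_pCons_Suc subsetD)
      then have "- poly r a * a \<in> p" using A(1) a by (intro pD(5)) (auto intro: ring_set_uminus)
      moreover have "coeff q 0 = - poly r a * a" using q(3) cr by (simp add: eq_neg_iff_add_eq_0 mult.commute)
      ultimately have "poly h z \<in> p" using h(1) by simp
      moreover have "h \<noteq> 0" using h(1) q(1) by auto
      ultimately show ?thesis unfolding Q_def using h(2) by blast
    qed
    then obtain h0 where "Q h0" by blast
    then obtain h where h: "Q h" "\<And>h'. Q h' \<Longrightarrow> degree h \<le> degree h'"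
      using ex_has_least_nat[of Q h0 degree] by blast
    have hk: "\<And>i. coeff h i \<in> k" "h \<noteq> 0" "poly h z \<in> p" using h(1) unfolding Q_def by auto
    define \<pi> where "\<pi> = poly h z"
    have \<pi>: "\<pi> \<in> max_ideal P" "\<pi> \<noteq> 0"
    proof -
      show "\<pi> \<in> max_ideal P" unfolding \<pi>_def using hk max_ideal_Int by blast
      show "\<pi> \<noteq> 0" unfolding \<pi>_def using z(2) hk unfolding alg_over_def by blast
    qed
    have zP: "adjoin k z \<subseteq> P" using adjA superset by blast
    have "x \<in> (\<lambda>a. \<pi> * a) ` P" if x: "x \<in> adjoin k z" "x \<in> max_ideal P" for x
    proof -
      obtain c where c: "x = poly c z" "\<And>i. coeff c i \<in> k" using x(1) unfolding adjoin_def by blast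
      obtain q r where d: "\<And>i. coeff q i \<in> k" "\<And>i. coeff r i \<in> k" "c = h * q + r" "r = 0 \<or> degree r < degree h"
        using poly_division_coeffs[OF Rk hk(2,1) field_set_inverse[OF k hk(1)] c(2)] by blast
      have qz: "poly q z \<in> adjoin k z" "poly r z \<in> adjoin k z" using d unfolding adjoin_def by blast+
      have "poly r z = x - poly q z * \<pi>" unfolding c(1) d(3) \<pi>_def by simp
      also have "\<dots> \<in> max_ideal P"
        using x(2) qz zP by (intro max_ideal_diff max_ideal_mult_left ring_set_P \<pi>) auto
      finally have "poly r z \<in> p" using qz adjA max_ideal_Int by blast
      then have "Q r" if "r \<noteq> 0" using that d(2) unfolding Q_def by blast
      then have "r = 0" using h(2)[of r] d(4) by force
      then show ?thesis unfolding c(1) d(3) \<pi>_def using qz zP by auto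
    qed
    then obtain S0 where S0: "field_modulo P \<pi> S0" "adjoin k z \<subseteq> S0"
      using field_modulo_localize[OF ring_set_adjoin[OF Rk] zP] by metis
    have unit: "poly (pderiv (F y)) y \<notin> max_ideal P" if y: "y \<in> Y" for y
    proof
      assume "poly (pderiv (F y)) y \<in> max_ideal P"
      then have "poly (pderiv (F y)) y \<in> p" using FA[OF y] max_ideal_Int by blast
      then have "(\<Prod>y\<in>Y - {y}. poly (pderiv (F y)) y) * poly (pderiv (F y)) y \<in> p"
        using FA A(1) by (intro pD(5)) (auto intro: ring_set_prod)
      also have "(\<Prod>y\<in>Y - {y}. poly (pderiv (F y)) y) * poly (pderiv (F y)) y = b"
        unfolding b_def using y Y(1) by (subst (2) prod.remove[of _ y]) (auto simp: mult.commute)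
      finally show False using pr(3) by blast
    qed
    \<comment> \<open>The generators are adjoined one at a time, starting from the localization of
      \<open>k[z]\<close>. Each step is unramified because \<open>F y\<close> keeps a simple root
      modulo the maximal ideal.\<close>
    have "\<exists>S. field_modulo P \<pi> S \<and> adjoin k z \<subseteq> S \<and> Z \<subseteq> S" if "finite Z" "Z \<subseteq> Y" for Z
      using that
    proof (induction Z rule: finite_induct)
      case empty
      then show ?case using S0 by blast
    next
      case (insert y Z)
      then obtain S where S: "field_modulo P \<pi> S" "adjoin k z \<subseteq> S" "Z \<subseteq> S" by auto
      have "\<exists>S'. field_modulo P \<pi> S' \<and> S \<subseteq> S' \<and> y \<in> S'"
        using insert.prems Y superset F S unit \<pi> by (intro field_modulo_adjoin[of \<pi> S y "F y"]) auto
      then show ?case using S by blast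
    qed
    then obtain S where S: "field_modulo P \<pi> S" "adjoin k z \<subseteq> S" "Y \<subseteq> S" using Y(1) by blast
    have Sr: "ring_set S" "S \<subseteq> P" using S(1) unfolding field_modulo_def by blast+
    \<comment> \<open>With \<open>A\<close> and the inverses of the elements outside
      \<open>p\<close>, the ring \<open>S\<close> is all of \<open>P\<close>, and its defining
      property then reads: non-units of \<open>P\<close> lie in \<open>\<pi> P\<close>.\<close>
    have "A \<subseteq> S" using S adjoin_superset[OF Rk] Sr by (intro gen) auto
    then have "P \<subseteq> S" using S(1) max_ideal_Int Sr unfolding field_modulo_def by (intro subset_ring) blast+
    then have "max_ideal P \<subseteq> (\<lambda>a. \<pi> * a) ` P"
      using S(1) max_ideal_subset unfolding field_modulo_def by blast
    moreover have "(\<lambda>a. \<pi> * a) ` P \<subseteq> max_ideal P"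
      using max_ideal_mult_left[OF ring_set_P _ \<pi>(1)] by (auto simp: mult.commute)
    ultimately show ?thesis unfolding uniformizer_def using \<pi>(2) by blast
  qed
  ultimately show ?thesis using that by blast
qed

end

section \<open>Evaluation of polynomials\<close>

locale comm_ring_hom =
  fixes h :: "'a::comm_ring_1 \<Rightarrow> 'b::comm_ring_1"
  assumes h_add: "h (x + y) = h x + h y" and h_mult: "h (x * y) = h x * h y" and h_1: "h 1 = 1"
begin

lemma h_0: "h 0 = 0" using h_add[of 0 0] by simp
lemma h_sum: "h (sum f I) = (\<Sum>i\<in>I. h (f i))"
  by (induction I rule: infinite_finite_induct) (auto simp: h_0 h_add)
lemma h_power: "h (x ^ n) = h x ^ n" by (induction n) (auto simp: h_1 h_mult)
lemma h_prod: "h (prod f I) = (\<Prod>i\<in>I. h (f i))"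
  by (induction I rule: infinite_finite_induct) (auto simp: h_1 h_mult)

end

lemma comm_ring_hom_id: "comm_ring_hom id" by unfold_locales auto
lemma comm_ring_hom_to_ac: "comm_ring_hom to_ac" by unfold_locales auto

definition monom_eval :: "(nat \<Rightarrow> 'b::comm_ring_1) \<Rightarrow> (nat \<Rightarrow>\<^sub>0 nat) \<Rightarrow> 'b" where
  "monom_eval x m = (\<Prod>i\<in>Poly_Mapping.keys m. x i ^ Poly_Mapping.lookup m i)"

lemma monom_eval_superset:
  "finite S \<Longrightarrow> Poly_Mapping.keys m \<subseteq> S \<Longrightarrow> monom_eval x m = (\<Prod>i\<in>S. x i ^ Poly_Mapping.lookup m i)"
  unfolding monom_eval_def by (intro prod.mono_neutral_left) (auto simp: in_keys_iff)

lemma monom_eval_0 [simp]: "monom_eval x 0 = 1" by (simp add: monom_eval_def)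

lemma monom_eval_single: "monom_eval x (Poly_Mapping.single i n) = x i ^ n"
  by (simp add: monom_eval_superset[of "{i}"])

lemma monom_eval_add: "monom_eval x (m + n) = monom_eval x m * monom_eval x n"
proof -
  let ?S = "Poly_Mapping.keys m \<union> Poly_Mapping.keys n"
  have "Poly_Mapping.keys (m + n) \<subseteq> ?S" by (rule keys_add)
  then show ?thesis
    using monom_eval_superset[of ?S "m + n" x] monom_eval_superset[of ?S m x] monom_eval_superset[of ?S n x]
    by (simp add: lookup_add power_add prod.distrib)
qed

lemma mev_alt: "mev h p x = (\<Sum>m\<in>Poly_Mapping.keys p. h (Poly_Mapping.lookup p m) * monom_eval x m)"
  unfolding mev_def monom_eval_def ..

lemma mpoly_sum_singles: "p = (\<Sum>m\<in>Poly_Mapping.keys p. Poly_Mapping.single m (Poly_Mapping.lookup p m))"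
  by (rule poly_mapping_eqI)
    (auto simp: lookup_sum lookup_single in_keys_iff when_def cong: if_cong intro!: sum.neutral)

context comm_ring_hom
begin

lemma mev_superset:
  "finite S \<Longrightarrow> Poly_Mapping.keys p \<subseteq> S \<Longrightarrow> mev h p x = (\<Sum>m\<in>S. h (Poly_Mapping.lookup p m) * monom_eval x m)"
  unfolding mev_alt by (intro sum.mono_neutral_left) (auto simp: in_keys_iff h_0)

lemma mev_0 [simp]: "mev h 0 x = 0" by (simp add: mev_alt)

lemma mev_add: "mev h (p + q) x = mev h p x + mev h q x"
proof -
  let ?S = "Poly_Mapping.keys p \<union> Poly_Mapping.keys q"
  have "Poly_Mapping.keys (p + q) \<subseteq> ?S" by (rule keys_add)
  then show ?thesis
    using mev_superset[of ?S "p + q" x] mev_superset[of ?S p x] mev_superset[of ?S q x]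
    by (simp add: lookup_add h_add distrib_right sum.distrib)
qed

lemma mev_single: "mev h (Poly_Mapping.single m c) x = h c * monom_eval x m"
  by (subst mev_superset[of "{m}"]) auto

lemma mev_sum: "mev h (sum f I) x = (\<Sum>i\<in>I. mev h (f i) x)"
  by (induction I rule: infinite_finite_induct) (auto simp: mev_add)

lemma mev_mult: "mev h (p * q) x = mev h p x * mev h q x"
proof -
  let ?P = "Poly_Mapping.keys p" and ?Q = "Poly_Mapping.keys q"
  let ?p = "Poly_Mapping.lookup p" and ?q = "Poly_Mapping.lookup q"
  have "p * q = (\<Sum>m\<in>?P. Poly_Mapping.single m (?p m)) * (\<Sum>n\<in>?Q. Poly_Mapping.single n (?q n))"
    using mpoly_sum_singles[of p] mpoly_sum_singles[of q] by simp
  also have "\<dots> = (\<Sum>m\<in>?P. \<Sum>n\<in>?Q. Poly_Mapping.single (m + n) (?p m * ?q n))"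
    by (simp add: sum_product mult_single)
  finally have "mev h (p * q) x = (\<Sum>m\<in>?P. \<Sum>n\<in>?Q. h (?p m * ?q n) * monom_eval x (m + n))"
    by (simp only: mev_sum mev_single)
  also have "\<dots> = (\<Sum>m\<in>?P. \<Sum>n\<in>?Q. (h (?p m) * monom_eval x m) * (h (?q n) * monom_eval x n))"
    by (simp add: h_mult monom_eval_add mult_ac)
  also have "\<dots> = mev h p x * mev h q x" unfolding mev_alt sum_product ..
  finally show ?thesis .
qed

lemma mev_mconst: "mev h (mconst c) x = h c" unfolding mconst_def by (simp add: mev_single)

lemma mev_1 [simp]: "mev h 1 x = 1"
  using mev_mconst[of 1 x] by (simp add: mconst_def h_1)

lemma mev_mvar: "mev h (mvar i) x = x i"
  unfolding mvar_def by (simp add: mev_single monom_eval_single h_1)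

lemma mev_uminus: "mev h (- p) x = - mev h p x"
  using mev_add[of p "- p" x] by (simp add: eq_neg_iff_add_eq_0 add.commute)

lemma mev_diff: "mev h (p - q) x = mev h p x - mev h q x"
  using mev_add[of p "- q" x] by (simp add: mev_uminus)

lemma mev_power: "mev h (p ^ n) x = mev h p x ^ n" by (induction n) (auto simp: mev_mult)

lemma mev_prod: "mev h (prod f I) x = (\<Prod>i\<in>I. mev h (f i) x)"
  by (induction I rule: infinite_finite_induct) (auto simp: mev_mult)

lemma mev_msubst: "mev h (msubst p g) x = mev h p (\<lambda>i. mev h (g i) x)"
  unfolding msubst_def mev_def[of mconst] mev_def[of h p] mev_sum mev_mult mev_mconst mev_prod mev_power ..

lemma mev_hom_comp: "mev h p (\<lambda>i. h (x i)) = h (mev id p x)"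
  unfolding mev_def by (simp add: h_sum h_mult h_prod h_power)

text \<open>\<open>h\<close> may kill coefficients, so the support can shrink; the sum is taken over
  the original support.\<close>

lemma mev_map: "mev id (Poly_Mapping.map h p) x = mev h p x"
proof -
  interpret i: comm_ring_hom "id :: 'b \<Rightarrow> 'b" by (rule comm_ring_hom_id)
  have l: "Poly_Mapping.lookup (Poly_Mapping.map h p) m = h (Poly_Mapping.lookup p m)" for m
    by (simp add: Poly_Mapping.map.rep_eq h_0 when_def)
  have sub: "Poly_Mapping.keys (Poly_Mapping.map h p) \<subseteq> Poly_Mapping.keys p"
    by (auto simp: in_keys_iff l h_0)
  show ?thesis unfolding i.mev_superset[OF finite_keys sub] by (simp only: l mev_alt id_apply)
qed

end

lemma mev_cong:
  assumes "p \<in> mpolys n R" "\<And>i. i < n \<Longrightarrow> x i = y i" shows "mev h p x = mev h p y"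
  unfolding mev_def
proof (intro sum.cong refl arg_cong2[where f = "(*)"] prod.cong)
  fix m i assume "m \<in> Poly_Mapping.keys p" "i \<in> Poly_Mapping.keys m"
  then show "x i ^ Poly_Mapping.lookup m i = y i ^ Poly_Mapping.lookup m i"
    using assms by (force simp: mpolys_def)
qed

lemma mpolys_mono: "R \<subseteq> S \<Longrightarrow> mpolys n R \<subseteq> mpolys n S" unfolding mpolys_def by blast

lemma mpolys_closed:
  "1 \<in> mpolys n UNIV" "p \<in> mpolys n UNIV \<Longrightarrow> q \<in> mpolys n UNIV \<Longrightarrow> p - q \<in> mpolys n UNIV"
  "p \<in> mpolys n UNIV \<Longrightarrow> q \<in> mpolys n UNIV \<Longrightarrow> p * q \<in> mpolys n UNIV"
proof -
  show "1 \<in> mpolys n UNIV" by (auto simp: mpolys_def)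
  show "p - q \<in> mpolys n UNIV" if "p \<in> mpolys n UNIV" "q \<in> mpolys n UNIV"
  proof -
    have "Poly_Mapping.keys (p - q) \<subseteq> Poly_Mapping.keys p \<union> Poly_Mapping.keys q"
      by (auto simp: in_keys_iff lookup_minus)
    then show ?thesis using that unfolding mpolys_def by blast
  qed
  show "p * q \<in> mpolys n UNIV" if pq: "p \<in> mpolys n UNIV" "q \<in> mpolys n UNIV"
  proof -
    have "Poly_Mapping.keys m \<subseteq> {..<n}" if m: "m \<in> Poly_Mapping.keys (p * q)" for m
    proof -
      obtain a b where "m = a + b" "a \<in> Poly_Mapping.keys p" "b \<in> Poly_Mapping.keys q"
        using keys_mult[of p q] m by blast
      then show ?thesis using pq keys_add[of a b] unfolding mpolys_def by blast
    qed
    then show ?thesis by (auto simp: mpolys_def)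
  qed
qed

lemma mvar_mpolys: "i < n \<Longrightarrow> mvar i \<in> mpolys n UNIV"
  unfolding mpolys_def mvar_def by (auto split: if_splits)

lemma mconst_mpolys: "mconst c \<in> mpolys n UNIV"
  unfolding mpolys_def mconst_def by (auto split: if_splits)

text \<open>The polynomials with property \<open>Q\<close> form an ideal containing
  \<open>F\<close>. Coefficients range over the whole ring, which is the case of generic
  fibres.\<close>

lemma mideal_induct:
  assumes p: "p \<in> mideal n UNIV F" and F: "F \<subseteq> mpolys n UNIV"
    and Q: "Q 0" "\<And>x y. Q x \<Longrightarrow> Q y \<Longrightarrow> Q (x + y)" "\<And>a x. a \<in> mpolys n UNIV \<Longrightarrow> Q x \<Longrightarrow> Q (a * x)"
      "\<And>f. f \<in> F \<Longrightarrow> Q f"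
  shows "Q p"
proof -
  let ?M = "mpolys n UNIV"
  have "0 \<in> ?M" using mpolys_closed(2)[OF mpolys_closed(1) mpolys_closed(1)] by simp
  moreover have "x + y \<in> ?M" if "x \<in> ?M" "y \<in> ?M" for x y
    using mpolys_closed(2)[OF that(1) mpolys_closed(2)[OF \<open>0 \<in> ?M\<close> that(2)]] by simp
  ultimately have "ideal {p \<in> ?M. Q p} (subring_of ?M)"
    using Q mpolys_closed by (intro ideal_subring_ofI) auto
  then have "mideal n UNIV F \<subseteq> {p \<in> ?M. Q p}"
    unfolding mideal_def genideal_def using F Q(4) by (intro Inter_lower) auto
  then show ?thesis using p by blast
qed

section \<open>Curves\<close>

subsection \<open>Charts\<close>

definition const_field :: "('k::field, 'a::field) pscheme \<Rightarrow> 'a set" where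
  "const_field \<X> = range (base_emb \<X>)"

definition chart_gens :: "('k::field, 'a::field) pscheme \<Rightarrow> nat \<Rightarrow> 'a set" where
  "chart_gens \<X> i = acoord \<X> i ` {..proj_dim \<X>}"

lemma base_emb_hom:
  assumes "integral_projective \<X>" shows "comm_ring_hom (base_emb \<X>)"
proof -
  have "base_emb \<X> \<in> ring_hom ring_of_type_algebra ring_of_type_algebra"
    using assms unfolding integral_projective_def by blast
  then show ?thesis by unfold_locales (auto simp: ring_hom_def ring_of_type_algebra_def)
qed

lemma CHAR_function_field:
  fixes \<X> :: "('k::field_char_0, 'a::field) pscheme"
  assumes "integral_projective \<X>" shows "CHAR('a) = 0"
  unfolding CHAR_eq0_iff
proof (intro allI impI notI)
  interpret comm_ring_hom "base_emb \<X>" by (rule base_emb_hom[OF assms])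
  have e: "base_emb \<X> (of_nat n) = of_nat n" for n by (induction n) (simp_all add: h_0 h_1 h_add)
  fix n :: nat assume n: "n > 0" "of_nat n = (0 :: 'a)"
  have "base_emb \<X> (of_nat n) * base_emb \<X> (inverse (of_nat n)) = base_emb \<X> 1"
    using n(1) by (simp flip: h_mult)
  then show False unfolding e n(2) by (simp add: h_1)
qed

lemma field_set_const_field:
  assumes "integral_projective \<X>" shows "field_set (const_field \<X>)"
proof -
  interpret comm_ring_hom "base_emb \<X>" by (rule base_emb_hom[OF assms])
  have diff: "base_emb \<X> x - base_emb \<X> y = base_emb \<X> (x - y)" for x y
    using h_add[of "x - y" y] by (simp add: algebra_simps)
  have inv: "inverse (base_emb \<X> x) = base_emb \<X> (inverse x)" for x
  proof (cases "x = 0")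
    case False
    then have "base_emb \<X> x * base_emb \<X> (inverse x) = 1" by (simp add: h_1 flip: h_mult)
    then show ?thesis by (rule inverse_unique)
  qed (simp add: h_0)
  show ?thesis unfolding field_set_def ring_set_def
  proof (intro conjI ballI)
    show "1 \<in> const_field \<X>" unfolding const_field_def using h_1 by (metis rangeI)
    fix x assume "x \<in> const_field \<X>"
    then obtain a where x: "x = base_emb \<X> a" unfolding const_field_def by blast
    then show "inverse x \<in> const_field \<X>" using inv unfolding const_field_def by blast
    fix y assume "y \<in> const_field \<X>"
    then obtain b where "y = base_emb \<X> b" unfolding const_field_def by blast
    then show "x - y \<in> const_field \<X>" "x * y \<in> const_field \<X>"
      unfolding x const_field_def by (simp_all add: diff flip: h_mult)
  qed
qed

lemma chart_props:
  assumes \<X>: "integral_projective \<X>"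
  shows "ring_set (chart \<X> i)" "const_field \<X> \<subseteq> chart \<X> i" "chart_gens \<X> i \<subseteq> chart \<X> i"
    "ring_set S \<Longrightarrow> const_field \<X> \<subseteq> S \<Longrightarrow> chart_gens \<X> i \<subseteq> S \<Longrightarrow> chart \<X> i \<subseteq> S"
proof -
  interpret comm_ring_hom "base_emb \<X>" by (rule base_emb_hom[OF \<X>])
  let ?M = "mpolys (Suc (proj_dim \<X>)) UNIV" and ?e = "\<lambda>f. mev (base_emb \<X>) f (acoord \<X> i)"
  have ch: "chart \<X> i = ?e ` ?M" unfolding chart_def by blast
  show "ring_set (chart \<X> i)" unfolding ring_set_def ch
  proof (intro conjI ballI)
    show "1 \<in> ?e ` ?M" by (rule image_eqI[of _ _ 1]) (auto simp: mpolys_closed)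
    fix x y assume "x \<in> ?e ` ?M" "y \<in> ?e ` ?M"
    then obtain p q where "x = ?e p" "y = ?e q" "p \<in> ?M" "q \<in> ?M" by blast
    then show "x - y \<in> ?e ` ?M" "x * y \<in> ?e ` ?M"
      by (auto simp: mpolys_closed simp flip: mev_diff mev_mult)
  qed
  show "const_field \<X> \<subseteq> chart \<X> i"
  proof
    fix x assume "x \<in> const_field \<X>"
    then obtain c where "x = base_emb \<X> c" unfolding const_field_def by blast
    then have "x = ?e (mconst c)" by (simp add: mev_mconst)
    then show "x \<in> chart \<X> i" unfolding ch using mconst_mpolys by blast
  qed
  show "chart_gens \<X> i \<subseteq> chart \<X> i" unfolding ch chart_gens_def
    by (auto intro!: image_eqI[OF _ mvar_mpolys] simp: mev_mvar)
  show "chart \<X> i \<subseteq> S" if "ring_set S" "const_field \<X> \<subseteq> S" "chart_gens \<X> i \<subseteq> S"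
  proof
    fix x assume "x \<in> chart \<X> i"
    then obtain f where f: "f \<in> ?M" "x = ?e f" unfolding ch by blast
    show "x \<in> S" unfolding f(2) mev_def
    proof (intro ring_set_sum[OF that(1)] ring_set_mult[OF that(1)] ring_set_prod[OF that(1)] ring_set_power[OF that(1)])
      fix m j assume "m \<in> Poly_Mapping.keys f" "j \<in> Poly_Mapping.keys m"
      then have "j \<le> proj_dim \<X>" using f(1) by (force simp: mpolys_def)
      then show "acoord \<X> i j \<in> S" using that(3) unfolding chart_gens_def by blast
    qed (use that in \<open>auto simp: const_field_def\<close>)
  qed
qed

text \<open>If all coordinates were algebraic over \<open>k\<close>, so would be the function field,
  and every subring of it containing \<open>k\<close> would be a field; but some chart has a nonzero
  prime ideal. That chart \<open>j\<close> may differ from \<open>i\<close>, hence the detour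
  through the whole function field.\<close>

lemma smooth_projective_curve_charts:
  fixes \<X> :: "('k::field_char_0, 'a::field) pscheme"
  assumes \<X>: "smooth_projective_curve \<X>" and i: "i \<in> chart_index \<X>"
  obtains z where "curve_chart (const_field \<X>) (chart \<X> i) (chart_gens \<X> i) z"
proof -
  have ip: "integral_projective \<X>" and hd: "has_dimension \<X> 1" using \<X> unfolding smooth_projective_curve_def by auto
  note k = field_set_const_field[OF ip] and ch = chart_props[OF ip]
  have frac: "\<exists>a\<in>chart \<X> j. \<exists>b\<in>chart \<X> j. b \<noteq> 0 \<and> x = a / b" if "j \<in> chart_index \<X>" for x j
    using ip that unfolding integral_projective_def by blast
  have dim: "dim_le_one (chart \<X> i)"
    using hd i unfolding has_dimension_def by (intro dim_le_one_if_no_chain ch) (auto simp: numeral_2_eq_2)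
  obtain j where j: "j \<in> chart_index \<X>" "has_prime_chain (chart \<X> j) 1" using hd unfolding has_dimension_def by auto
  have fin: "finite (chart_gens \<X> j)" for j unfolding chart_gens_def by simp
  have "\<exists>z\<in>chart_gens \<X> i. \<not> alg_over (const_field \<X>) z"
  proof (rule ccontr)
    assume "\<not> ?thesis"
    then have a: "\<And>z. z \<in> chart_gens \<X> i \<Longrightarrow> alg_over (const_field \<X>) z" by blast
    obtain L where L: "field_set L" "const_field \<X> \<subseteq> L" "chart_gens \<X> i \<subseteq> L" "finite_over (const_field \<X>) L"
      by (rule finite_alg_extension[OF k fin a]) auto
    have "chart \<X> i \<subseteq> L" using L by (intro ch field_setD) auto
    then have "x \<in> L" for x using frac[OF i, of x] field_set_divide[OF L(1)] by blast
    then have alg: "alg_over (const_field \<X>) x" for x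
      using finite_over_imp_alg_over[OF k L(4) field_setD[OF L(1)]] by blast
    obtain p where p': "\<forall>i\<le>1. primeideal (p i) (subring_of (chart \<X> j))" "\<forall>i<1. p i \<subset> p (Suc i)"
      using j(2) unfolding has_prime_chain_def by blast
    have p: "primeideal (p 0) (subring_of (chart \<X> j))" "primeideal (p 1) (subring_of (chart \<X> j))" "p 0 \<subset> p 1"
      using p'(1)[rule_format, of 0] p'(1)[rule_format, of 1] p'(2)[rule_format, of 0] by simp_all
    then have pp: "prime_set (chart \<X> j) (p 0)" "prime_set (chart \<X> j) (p 1)"
      using primeideal_subring_of_iff[OF ch(1)] by auto
    then obtain x where x: "x \<in> p 1" "x \<noteq> 0" using p(3) prime_setD(2)[OF pp(1)] by blast
    have "inverse x \<in> chart \<X> j"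
      using x(1) prime_setD(1)[OF pp(2)] ch by (intro alg_inverse_mem[OF k _ _ _ alg]) auto
    then have "inverse x * x \<in> p 1" using prime_setD(5)[OF pp(2)] x by blast
    then show False using x(2) prime_setD(3)[OF pp(2)] by simp
  qed
  then obtain z where "z \<in> chart_gens \<X> i" "\<not> alg_over (const_field \<X>) z" by blast
  then have "curve_chart (const_field \<X>) (chart \<X> i) (chart_gens \<X> i) z"
    using CHAR_function_field[OF ip] k ch fin dim frac[OF i] by unfold_locales auto
  then show ?thesis using that by blast
qed

subsection \<open>Discrete valuations\<close>

text \<open>The third clause is stronger than having a uniformizer, which alone would allow nonzero
  elements divisible by all powers of \<open>t\<close>.\<close>

definition dvr :: "'a::field set \<Rightarrow> 'a \<Rightarrow> bool" where
  "dvr P t \<longleftrightarrow> ring_set P \<and> uniformizer P t \<and> (\<forall>x. x \<noteq> 0 \<longrightarrow> (\<exists>n. \<exists>u\<in>units_of_set P. x = u * t powi n))"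

text \<open>The elements of \<open>A\<close> divisible in \<open>P\<close> by all powers of
  \<open>t\<close> form a prime ideal strictly inside \<open>p\<close>, which is 0 in dimension one.
  This stands in for Krull's intersection theorem.\<close>

lemma (in local_ring_at) dvr_if_uniformizer:
  assumes dim: "dim_le_one A" and frac: "\<And>x. \<exists>a\<in>A. \<exists>b\<in>A. b \<noteq> 0 \<and> x = a / b" and t: "uniformizer P t"
  shows "dvr P t"
proof -
  note R = ring_set_P
  have t0: "t \<noteq> 0" and m: "max_ideal P = (\<lambda>a. t * a) ` P" using t unfolding uniformizer_def by auto
  have tm: "t \<in> max_ideal P" unfolding m using R by (auto intro: image_eqI[of _ _ 1])
  have it: "inverse t \<notin> P" using tm t0 unfolding max_ideal_def by auto
  have tP: "t \<in> P" using tm max_ideal_subset by blast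
  \<comment> \<open>Powers of \<open>t\<close> are split off as long as a non-unit is left;
    \<open>N\<close> bounds the number of divisions.\<close>
  have decomp: "\<exists>n u. u \<in> units_of_set P \<and> a = u * t ^ n" if a: "a \<in> P" "a / t ^ N \<notin> P" for a N
    using a
  proof (induction N arbitrary: a)
    case (Suc N)
    show ?case
    proof (cases "a \<in> max_ideal P")
      case True
      then obtain b where b: "b \<in> P" "a = t * b" unfolding m by blast
      then have "b / t ^ N \<notin> P" using Suc.prems(2) t0 by auto
      then obtain n u where "u \<in> units_of_set P" "b = u * t ^ n" using Suc.IH b(1) by blast
      then show ?thesis using b(2) by (intro exI[of _ "Suc n"] exI[of _ u]) auto
    next
      case False
      then have "a \<in> units_of_set P" "a = a * t ^ 0" using Suc.prems(1) units_of_set_iff[OF R] by auto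
      then show ?thesis by blast
    qed
  qed simp
  define q where "q = {a \<in> A. \<forall>n. a / t ^ n \<in> P}"
  have q: "prime_set A q" unfolding prime_set_def
  proof (intro conjI ballI impI)
    show "1 \<notin> q" unfolding q_def using it by (auto simp: inverse_eq_divide intro!: exI[of _ 1])
    show "a * x \<in> q" if "a \<in> A" "x \<in> q" for a x
    proof -
      have "a * (x / t ^ n) \<in> P" for n using that superset R unfolding q_def by (intro ring_set_mult) auto
      then show ?thesis using that A unfolding q_def by (auto intro: ring_set_mult)
    qed
    fix a b assume a: "a \<in> A" and b: "b \<in> A" and ab: "a * b \<in> q"
    show "a \<in> q \<or> b \<in> q"
    proof (rule ccontr)
      assume "\<not> (a \<in> q \<or> b \<in> q)"
      then obtain N M where NM: "a / t ^ N \<notin> P" "b / t ^ M \<notin> P" using a b unfolding q_def by blast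
      have aP: "a \<in> P" "b \<in> P" using a b superset by auto
      obtain n u where u: "u \<in> units_of_set P" "a = u * t ^ n" using decomp[OF aP(1) NM(1)] by blast
      obtain l v where v: "v \<in> units_of_set P" "b = v * t ^ l" using decomp[OF aP(2) NM(2)] by blast
      have "a * b / t ^ (n + l + 1) \<in> P" using ab unfolding q_def by blast
      also have "a * b / t ^ (n + l + 1) = (u * v) / t" using u v t0 by (simp add: power_add field_simps)
      finally have "inverse (u * v) * (u * v / t) \<in> P"
        using units_of_set_mult[OF R u(1) v(1)] R by (intro ring_set_mult) (auto simp: units_of_set_def)
      moreover have "u \<noteq> 0" "v \<noteq> 0" using u v by (auto simp: units_of_set_def)
      ultimately show False using it by (simp add: field_simps)
    qed
  qed (use A superset R in \<open>auto simp: q_def add_divide_distrib intro: ring_set_intros\<close>)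
  have "q \<subseteq> p"
  proof
    fix a assume a: "a \<in> q"
    then have "a / t ^ 1 \<in> P" "a \<in> A" unfolding q_def by blast+
    then have "t * (a / t ^ 1) \<in> max_ideal P" unfolding m by blast
    then show "a \<in> p" using t0 \<open>a \<in> A\<close> max_ideal_Int by auto
  qed
  \<comment> \<open>\<open>t\<close> is a fraction with numerator in \<open>p\<close>, and it is not
    divisible by \<open>t ^ 2\<close>.\<close>
  moreover have "q \<noteq> p"
  proof
    assume qp: "q = p"
    obtain a b where ab: "a \<in> p" "b \<in> A" "b \<notin> p" "t = a / b" using tm max_ideal_iff by blast
    have "a / t ^ 2 \<in> P" using ab(1) qp unfolding q_def by blast
    then have "inverse b * (a / t ^ 2) \<in> P"
      using ab localizeI[of 1 b] A R by (intro ring_set_mult) (auto simp: divide_inverse)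
    moreover have "inverse b * (a / t ^ 2) = (a / b) / t ^ 2" by (simp add: divide_inverse mult_ac)
    moreover have "(a / b) / t ^ 2 = inverse t"
      unfolding ab(4)[symmetric] using t0 by (simp add: power2_eq_square inverse_eq_divide)
    ultimately show False using it by simp
  qed
  ultimately have q0: "q = {0}" using dim q p unfolding dim_le_one_def by blast
  have "\<exists>n. \<exists>u\<in>units_of_set P. x = u * t powi n" if x: "x \<noteq> 0" for x
  proof -
    obtain a b where ab: "a \<in> A" "b \<in> A" "b \<noteq> 0" "x = a / b" using frac by blast
    have ex: "\<exists>n u. u \<in> units_of_set P \<and> c = u * t ^ n" if "c \<in> A" "c \<noteq> 0" for c
    proof -
      have "c \<notin> q" using q0 that by blast
      then show ?thesis using that superset decomp unfolding q_def by blast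
    qed
    have "a \<noteq> 0" using x ab by auto
    obtain n u where u: "u \<in> units_of_set P" "a = u * t ^ n" using ex ab \<open>a \<noteq> 0\<close> by blast
    obtain l v where v: "v \<in> units_of_set P" "b = v * t ^ l" using ex ab by blast
    have "x = (u * inverse v) * t powi (int n - int l)"
      unfolding ab(4) u(2) v(2) using t0 by (simp add: power_int_diff field_simps)
    moreover have "u * inverse v \<in> units_of_set P" using u v R by (intro units_of_set_mult units_of_set_inverse)
    ultimately show ?thesis by blast
  qed
  then show ?thesis unfolding dvr_def using R t by blast
qed

lemma dvrD:
  assumes "dvr P t"
  shows "ring_set P" "uniformizer P t" "t \<noteq> 0" "t \<in> max_ideal P" "t \<in> P"
proof -
  show 1: "ring_set P" "uniformizer P t" using assms unfolding dvr_def by auto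
  show "t \<noteq> 0" using 1 unfolding uniformizer_def by auto
  have "t * 1 \<in> (\<lambda>a. t * a) ` P" by (rule imageI) (rule ring_set_1[OF 1(1)])
  then show "t \<in> max_ideal P" using 1(2) unfolding uniformizer_def by simp
  then show "t \<in> P" using max_ideal_subset by blast
qed

lemma dvr_powi_in_iff:
  assumes P: "dvr P t" and u: "u \<in> units_of_set P"
  shows "u * t powi n \<in> P \<longleftrightarrow> n \<ge> 0"
proof
  note D = dvrD[OF P]
  assume n: "u * t powi n \<in> P"
  show "n \<ge> 0"
  proof (rule ccontr)
    assume "\<not> n \<ge> 0"
    have "inverse u * (u * t powi n) \<in> P"
      using u by (intro ring_set_mult[OF D(1) _ n]) (auto simp: units_of_set_def)
    also have "inverse u * (u * t powi n) = t powi n" using u by (simp add: units_of_set_def)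
    also have "t powi n = inverse (t ^ nat (- n))"
      using \<open>\<not> n \<ge> 0\<close> by (simp add: power_int_def power_inverse)
    finally have "inverse (t ^ nat (- n)) \<in> P" .
    moreover have "t ^ nat (- n) \<in> max_ideal P" using \<open>\<not> n \<ge> 0\<close> by (intro max_ideal_power D) auto
    ultimately show False using D(3) by (auto simp: max_ideal_def)
  qed
next
  note D = dvrD[OF P]
  assume "n \<ge> 0"
  then show "u * t powi n \<in> P" using u D by (auto simp: units_of_set_def power_int_def intro!: ring_set_mult ring_set_power)
qed

text \<open>Two uniformizers differ by a unit, so the exponent in the description does not depend on
  which one is chosen.\<close>

lemma dvr_ord_at:
  assumes P: "dvr P t" and u: "u \<in> units_of_set P"
  shows "ord_at P (u * t powi n) = n"
  unfolding ord_at_def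
proof (rule the_equality)
  note D = dvrD[OF P]
  show "\<exists>t' u'. uniformizer P t' \<and> u' \<in> P - max_ideal P \<and> u * t powi n = u' * t' powi n"
    using D u units_of_set_iff[OF D(1)] by blast
  fix m assume "\<exists>t' u'. uniformizer P t' \<and> u' \<in> P - max_ideal P \<and> u * t powi n = u' * t' powi m"
  then obtain t' u' where t': "uniformizer P t'" and u': "u' \<in> units_of_set P" and eq: "u * t powi n = u' * t' powi m"
    using units_of_set_iff[OF D(1)] by blast
  have "t' * 1 \<in> (\<lambda>a. t' * a) ` P" by (rule imageI) (rule ring_set_1[OF D(1)])
  then have "t' \<in> (\<lambda>a. t * a) ` P" using t' D(2) unfolding uniformizer_def by simp
  then obtain v where v: "v \<in> P" "t' = t * v" by blast
  have "t \<in> (\<lambda>a. t' * a) ` P" using D(4) t' unfolding uniformizer_def by simp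
  then obtain w where w: "w \<in> P" "t = t' * w" by blast
  have "t * (v * w) = t * 1" using v(2) w(2) by (metis mult.assoc mult_1_right)
  then have "v * w = 1" using D(3) by (metis mult_left_cancel)
  then have vu: "v \<in> units_of_set P" using v w by (auto simp: units_of_set_def dest: inverse_unique)
  have uv: "inverse u * (u' * v powi m) \<in> units_of_set P"
    using u u' vu D(1) by (intro units_of_set_mult units_of_set_inverse units_of_set_power_int)
  have u0: "u \<noteq> 0" using u by (auto simp: units_of_set_def)
  have "t powi n = inverse u * (u * t powi n)" using u0 by simp
  also have "\<dots> = inverse u * (u' * v powi m) * t powi m"
    unfolding eq v(2) by (simp add: power_int_mult_distrib mult_ac)
  finally have tn: "t powi n = inverse u * (u' * v powi m) * t powi m" .
  have a: "inverse u * (u' * v powi m) * t powi (m - n) = 1"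
  proof -
    have "inverse u * (u' * v powi m) * t powi (m - n) = inverse u * (u' * v powi m) * t powi m / t powi n"
      using D(3) by (simp add: power_int_diff)
    also have "\<dots> = t powi n / t powi n" by (simp only: tn[symmetric])
    finally show ?thesis using D(3) by (simp add: power_int_not_zero)
  qed
  then have "inverse u * (u' * v powi m) * t powi (m - n) \<in> P" using D(1) by simp
  then have "m \<ge> n" using dvr_powi_in_iff[OF P uv] by simp
  moreover have "inverse (inverse u * (u' * v powi m)) * t powi (n - m) = inverse (inverse u * (u' * v powi m) * t powi (m - n))"
    using power_int_minus[of t "m - n"] by simp
  then have "inverse (inverse u * (u' * v powi m)) * t powi (n - m) \<in> P" using a D(1) by simp
  then have "n \<ge> m" using dvr_powi_in_iff[OF P units_of_set_inverse[OF uv]] by simp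
  ultimately show "m = n" by simp
qed

lemma dvr_val_ge_iff:
  assumes P: "dvr P t" shows "val_ge P n x \<longleftrightarrow> x * t powi (- n) \<in> P"
proof (cases "x = 0")
  case True
  then show ?thesis using dvrD(1)[OF P] by (simp add: val_ge_def)
next
  case False
  then obtain m u where u: "u \<in> units_of_set P" "x = u * t powi m" using P unfolding dvr_def by blast
  have "x * t powi (- n) = u * t powi (m - n)"
    unfolding u(2) using dvrD(3)[OF P] by (simp add: power_int_diff power_int_minus divide_inverse)
  then have "x * t powi (- n) \<in> P \<longleftrightarrow> n \<le> m" using dvr_powi_in_iff[OF P u(1), of "m - n"] by simp
  moreover have "ord_at P x = m" unfolding u(2) by (rule dvr_ord_at[OF P u(1)])
  ultimately show ?thesis using False unfolding val_ge_def by simp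
qed

text \<open>Without uniformizer the description in \<open>ord_at\<close> is one and the same
  unspecified integer \<open>c\<close> for every \<open>x\<close>. So \<open>val_ge P n\<close>
  holds everywhere for \<open>n \<le> c\<close> and only at 0 for larger \<open>n\<close>.\<close>

lemma val_ge_junk:
  assumes "\<nexists>t. uniformizer P t" obtains c where "\<And>n x. val_ge P n x \<longleftrightarrow> x = 0 \<or> n \<le> c"
proof -
  have "ord_at P x = (THE n. False)" for x unfolding ord_at_def using assms by simp
  then show ?thesis using that[of "THE n. False"] unfolding val_ge_def by simp
qed

subsection \<open>Points and valuations\<close>

text \<open>For a point \<open>P\<close> of the curve this says that \<open>P\<close> is the local
  ring at the centre of \<open>V\<close>.\<close>

definition dominated :: "'a::field set \<Rightarrow> 'a set \<Rightarrow> bool" where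
  "dominated V P \<longleftrightarrow> P \<subseteq> V \<and> max_ideal P \<subseteq> max_ideal V"

lemma (in local_ring_at) dominatedD:
  assumes "valuation_set V" "dominated V P" shows "A \<subseteq> V" "p = A \<inter> max_ideal V"
proof -
  show "A \<subseteq> V" using assms superset unfolding dominated_def by blast
  have "a \<in> p" if a: "a \<in> A" "a \<in> max_ideal V" for a
  proof (rule ccontr)
    assume "a \<notin> p"
    then have "inverse a \<in> V" "a \<noteq> 0"
      using localizeI[of 1 a] a(1) A nz assms(2) by (auto simp: divide_inverse dominated_def)
    then show False using a by (simp add: max_ideal_def)
  qed
  then show "p = A \<inter> max_ideal V" using assms pD(1) max_ideal_Int unfolding dominated_def by blast
qed

locale curve =
  fixes \<X> :: "('k::field_char_0, 'a::field) pscheme"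
  assumes \<X>: "smooth_projective_curve \<X>"
begin

lemma ip: "integral_projective \<X>" using \<X> unfolding smooth_projective_curve_def by blast

abbreviation "k \<equiv> const_field \<X>"

lemmas k = field_set_const_field[OF ip]
lemmas ch = chart_props[OF ip]

lemma chart_curve: assumes "i \<in> chart_index \<X>"
  shows "\<exists>z. curve_chart k (chart \<X> i) (chart_gens \<X> i) z"
  using smooth_projective_curve_charts[OF \<X> assms] by blast

lemma chart_dim: "i \<in> chart_index \<X> \<Longrightarrow> dim_le_one (chart \<X> i)"
  using chart_curve curve_chart.dim by blast

lemma chart_frac: "i \<in> chart_index \<X> \<Longrightarrow> \<exists>a\<in>chart \<X> i. \<exists>b\<in>chart \<X> i. b \<noteq> 0 \<and> x = a / b"
  using chart_curve curve_chart.frac by blast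

lemma chart_index_ex: obtains i where "i \<in> chart_index \<X>"
  using ip unfolding integral_projective_def by blast

section \<open>Points of the curve and the Zariski topology\<close>

definition is_point :: "nat \<Rightarrow> 'a set \<Rightarrow> 'a set \<Rightarrow> bool" where
  "is_point i p P \<longleftrightarrow> i \<in> chart_index \<X> \<and> prime_set (chart \<X> i) p \<and> P = localize (chart \<X> i) p"

lemma is_point_local: "is_point i p P \<Longrightarrow> local_ring_at (chart \<X> i) p"
  unfolding is_point_def using ch by unfold_locales auto

lemma basic_open_iff:
  assumes "i \<in> chart_index \<X>"
  shows "P \<in> basic_open (chart \<X> i) f \<longleftrightarrow> (\<exists>p. is_point i p P \<and> f \<notin> p)"
  unfolding basic_open_def is_point_def using assms primeideal_subring_of_iff[OF ch(1)] by blast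

lemma open_point:
  assumes "openin (zariski \<X>) U" "P \<in> U" obtains i p where "is_point i p P"
proof -
  have "P \<in> topspace (zariski \<X>)" using assms openin_subset by blast
  then obtain i f where "i \<in> chart_index \<X>" "P \<in> basic_open (chart \<X> i) f"
    unfolding zariski_def topology_generated_by_topspace by blast
  then show ?thesis using that basic_open_iff by blast
qed

lemma basic_open_open: "i \<in> chart_index \<X> \<Longrightarrow> f \<in> chart \<X> i \<Longrightarrow> openin (zariski \<X>) (basic_open (chart \<X> i) f)"
  unfolding zariski_def by (intro topology_generated_by_Basis) blast

lemma generic_point:
  assumes "i \<in> chart_index \<X>" shows "is_point i {0} UNIV"
proof -
  have "localize (chart \<X> i) {0} = UNIV" unfolding localize_def using chart_frac[OF assms] by blast
  then show ?thesis unfolding is_point_def using assms ch by (auto simp: prime_set_def)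
qed

lemma point_eq_UNIV_iff: assumes "is_point i p P" shows "P = UNIV \<longleftrightarrow> p = {0}"
proof
  interpret local_ring_at "chart \<X> i" p by (rule is_point_local[OF assms])
  have P: "P = localize (chart \<X> i) p" using assms unfolding is_point_def by blast
  assume "P = UNIV"
  then have "max_ideal (localize (chart \<X> i) p) = {0}" unfolding P max_ideal_def by auto
  then show "p = {0}" using max_ideal_Int pD(2) by auto
next
  assume "p = {0}"
  then show "P = UNIV" using assms generic_point unfolding is_point_def by blast
qed

lemma point_const_subset: assumes "is_point i p P" shows "ring_set P" "chart \<X> i \<subseteq> P" "k \<subseteq> P"
proof -
  interpret local_ring_at "chart \<X> i" p by (rule is_point_local[OF assms])
  show "ring_set P" "chart \<X> i \<subseteq> P" using assms ring_set_P superset unfolding is_point_def by auto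
  then show "k \<subseteq> P" using ch(2) by blast
qed

lemma point_prime_eq: "is_point i p P \<Longrightarrow> p = max_ideal P \<inter> chart \<X> i"
  using local_ring_at.max_ideal_Int[OF is_point_local] unfolding is_point_def by blast

text \<open>In dimension one a nonzero prime \<open>p'\<close> is not contained in any other prime
  \<open>q\<close>. So some \<open>f\<close> vanishes at \<open>P\<close> and not at
  \<open>Q\<close>, and the basic open set of \<open>f\<close> separates \<open>Q\<close> from
  \<open>P\<close>.\<close>

lemma point_closed:
  assumes U: "openin (zariski \<X>) U" "P \<in> U" and P: "P \<noteq> UNIV"
  shows "P \<in> closed_points \<X> U"
proof -
  have "openin (zariski \<X>) (U - {P})"
  proof (subst openin_subopen, intro ballI)
    fix Q assume Q: "Q \<in> U - {P}"
    then obtain j q where q: "is_point j q Q" using open_point[OF U(1)] by blast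
    then have j: "j \<in> chart_index \<X>" and qp: "prime_set (chart \<X> j) q" unfolding is_point_def by auto
    have "\<exists>f\<in>chart \<X> j. f \<notin> q \<and> P \<notin> basic_open (chart \<X> j) f"
    proof (cases "\<exists>p'. is_point j p' P")
      case False
      then show ?thesis using ch(1) prime_setD(3)[OF qp] basic_open_iff[OF j] by (intro bexI[of _ 1]) auto
    next
      case True
      then obtain p' where p': "is_point j p' P" by blast
      have "p' \<noteq> {0}" using p' P point_eq_UNIV_iff by blast
      moreover have "p' \<noteq> q" using p' q Q unfolding is_point_def by blast
      ultimately have "\<not> p' \<subseteq> q"
        using chart_dim[OF j] p' qp unfolding dim_le_one_def is_point_def by blast
      then obtain f where f: "f \<in> p'" "f \<notin> q" by blast
      moreover have "f \<in> chart \<X> j" using f p' prime_setD(1) unfolding is_point_def by blast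
      moreover have "P \<notin> basic_open (chart \<X> j) f"
        using f(1) point_prime_eq[OF p'] point_prime_eq basic_open_iff[OF j] by blast
      ultimately show ?thesis by blast
    qed
    then obtain f where f: "f \<in> chart \<X> j" "f \<notin> q" "P \<notin> basic_open (chart \<X> j) f" by blast
    show "\<exists>T. openin (zariski \<X>) T \<and> Q \<in> T \<and> T \<subseteq> U - {P}"
      using basic_open_open[OF j f(1)] U(1) f q Q basic_open_iff[OF j]
      by (intro exI[of _ "basic_open (chart \<X> j) f \<inter> U"]) auto
  qed
  then have "openin (subtopology (zariski \<X>) U) (U - {P})"
    using U(1) by (subst openin_open_subtopology) auto
  moreover have "topspace (subtopology (zariski \<X>) U) = U"
    using openin_subset[OF U(1)] by auto
  ultimately have "closedin (subtopology (zariski \<X>) U) {P}" using U(2) unfolding closedin_def by auto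
  then show ?thesis unfolding closed_points_def using U by blast
qed

lemma acoord_mult: "j \<in> chart_index \<X> \<Longrightarrow> acoord \<X> i j * acoord \<X> j l = acoord \<X> i l"
  unfolding acoord_def chart_index_def by simp

lemma acoord_in_chart: "l \<le> proj_dim \<X> \<Longrightarrow> acoord \<X> i l \<in> chart \<X> i"
  using ch(3) unfolding chart_gens_def by blast

text \<open>Separatedness, in the form of the valuative criterion.\<close>

lemma dominated_subset:
  assumes V: "valuation_set V" and P: "is_point i p P" "dominated V P" and Q: "is_point j q Q" "dominated V Q"
  shows "Q \<subseteq> P"
proof -
  interpret p: local_ring_at "chart \<X> i" p by (rule is_point_local[OF P(1)])
  interpret q: local_ring_at "chart \<X> j" q by (rule is_point_local[OF Q(1)])
  have Peq: "P = localize (chart \<X> i) p" and Qeq: "Q = localize (chart \<X> j) q"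
    using P(1) Q(1) unfolding is_point_def by auto
  note PD = p.dominatedD[OF V P(2)[unfolded Peq]] and QD = q.dominatedD[OF V Q(2)[unfolded Qeq]]
  note R = p.ring_set_P[folded Peq]
  have ij: "i \<in> chart_index \<X>" "j \<in> chart_index \<X>" using P(1) Q(1) unfolding is_point_def by auto
  then have le: "i \<le> proj_dim \<X>" "j \<le> proj_dim \<X>" unfolding chart_index_def by auto
  define c where "c = acoord \<X> i j"
  have c: "c \<in> chart \<X> i" "c \<noteq> 0" "inverse c = acoord \<X> j i"
    unfolding c_def using acoord_in_chart le ij by (auto simp: acoord_def chart_index_def)
  \<comment> \<open>\<open>c\<close> is a coordinate of chart \<open>i\<close> and its inverse one
    of chart \<open>j\<close>, so both lie in \<open>V\<close>. The centre is therefore in the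
    overlap, where the coordinates of chart \<open>j\<close> are fractions over chart
    \<open>i\<close> with denominator \<open>c\<close>.\<close>
  have "inverse c \<in> V" using c(3) acoord_in_chart[OF le(1), of j] QD(1) by auto
  then have "c \<notin> p" unfolding PD(2) using c(2) by (auto simp: max_ideal_def)
  have sub: "chart \<X> j \<subseteq> P"
  proof (rule ch(4)[OF R])
    show "k \<subseteq> P" using point_const_subset P(1) by blast
    show "chart_gens \<X> j \<subseteq> P"
    proof
      fix x assume "x \<in> chart_gens \<X> j"
      then obtain l where l: "l \<le> proj_dim \<X>" "x = acoord \<X> j l" unfolding chart_gens_def by blast
      have "c * x = acoord \<X> i l" unfolding c_def l(2) by (rule acoord_mult[OF ij(2)])
      then have "x = acoord \<X> i l / c" using c(2) by (simp add: field_simps)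
      then show "x \<in> P" unfolding Peq using p.localizeI acoord_in_chart[OF l(1)] c(1) \<open>c \<notin> p\<close> by simp
    qed
  qed
  show ?thesis unfolding Qeq
  proof (rule q.subset_ring[OF R sub])
    fix b assume b: "b \<in> chart \<X> j" "b \<notin> q"
    then have "b \<notin> max_ideal V" using QD(2) by blast
    then have "b \<notin> max_ideal P" using P(2) unfolding dominated_def by blast
    then show "inverse b \<in> P" using b sub by (auto simp: max_ideal_def)
  qed
qed

lemma dominated_unique:
  assumes "valuation_set V" "is_point i p P" "dominated V P" "is_point j q Q" "dominated V Q"
  shows "P = Q"
  using dominated_subset assms by (metis subset_antisym)

section \<open>Centres of valuation rings and finiteness of places\<close>

lemma center_point:
  assumes V: "valuation_set V" "chart \<X> i \<subseteq> V" and i: "i \<in> chart_index \<X>"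
  defines "P \<equiv> localize (chart \<X> i) (chart \<X> i \<inter> max_ideal V)"
  shows "is_point i (chart \<X> i \<inter> max_ideal V) P" "dominated V P"
proof -
  show pt: "is_point i (chart \<X> i \<inter> max_ideal V) P"
    unfolding is_point_def P_def using i prime_set_center[OF ch(1) V] by blast
  interpret local_ring_at "chart \<X> i" "chart \<X> i \<inter> max_ideal V" by (rule is_point_local[OF pt])
  have "localize (chart \<X> i) (chart \<X> i \<inter> max_ideal V) \<subseteq> V" by (rule localize_center_subset[OF ch(1) V])
  moreover have "max_ideal (localize (chart \<X> i) (chart \<X> i \<inter> max_ideal V)) \<subseteq> max_ideal V"
  proof
    fix x assume "x \<in> max_ideal (localize (chart \<X> i) (chart \<X> i \<inter> max_ideal V))"
    then obtain a b where ab: "a \<in> chart \<X> i \<inter> max_ideal V" "b \<in> chart \<X> i" "b \<notin> chart \<X> i \<inter> max_ideal V" "x = a / b"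
      using max_ideal_iff by blast
    have "b \<in> V" "b \<notin> max_ideal V" using ab V by auto
    then have "inverse b \<in> V" by (auto simp: max_ideal_def)
    then have "inverse b * a \<in> max_ideal V" using ab by (intro max_ideal_mult_left valuation_setD V) auto
    then show "x \<in> max_ideal V" using ab(4) by (simp add: divide_inverse mult.commute)
  qed
  ultimately show "dominated V P" unfolding dominated_def P_def by blast
qed

text \<open>Properness of projective space: division by a homogeneous coordinate of dominant value
  brings all affine coordinates of that chart into \<open>V\<close>.\<close>

lemma exists_center:
  assumes V: "valuation_set V" "k \<subseteq> V"
  obtains i p P where "is_point i p P" "dominated V P"
proof -
  have ne: "chart_index \<X> \<noteq> {}" using chart_index_ex by blast
  have "\<exists>i\<in>chart_index \<X>. \<forall>j\<in>chart_index \<X>. hcoord \<X> j / hcoord \<X> i \<in> V"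
    by (rule valuation_dominant[OF V(1) _ ne, of "hcoord \<X>"]) (auto simp: chart_index_def)
  then obtain i where i: "i \<in> chart_index \<X>" "\<forall>j\<in>chart_index \<X>. hcoord \<X> j / hcoord \<X> i \<in> V" by blast
  have "acoord \<X> i j \<in> V" if "j \<le> proj_dim \<X>" for j
    using i(2) that valuation_setD[OF V(1)] by (cases "hcoord \<X> j = 0") (auto simp: acoord_def chart_index_def)
  then have "chart \<X> i \<subseteq> V" using V by (intro ch(4) valuation_setD) (auto simp: chart_gens_def)
  then show ?thesis using that center_point[OF V(1) _ i(1)] by blast
qed

text \<open>For a basic open set, the generators of its chart and \<open>inverse f\<close> do: a
  ring \<open>V\<close> containing them contains the chart and has \<open>f\<close> as a unit. An
  intersection needs both sets, a union only that of one nonempty member. Read contrapositively, a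
  centre outside \<open>U\<close> keeps some \<open>h\<close> of \<open>H\<close> out of
  \<open>V\<close> and makes \<open>V\<close> a place of \<open>inverse h\<close>.\<close>

lemma open_contains_centers:
  assumes U: "openin (zariski \<X>) U" "U \<noteq> {}"
  obtains H where "finite H" "0 \<notin> H"
    "\<And>V i p P. valuation_set V \<Longrightarrow> k \<subseteq> V \<Longrightarrow> H \<subseteq> V \<Longrightarrow> is_point i p P \<Longrightarrow> dominated V P \<Longrightarrow> P \<in> U"
proof -
  define good where "good s H \<longleftrightarrow> finite H \<and> 0 \<notin> H \<and> (\<forall>V i p P. valuation_set V \<longrightarrow> k \<subseteq> V \<longrightarrow>
    H \<subseteq> V \<longrightarrow> is_point i p P \<longrightarrow> dominated V P \<longrightarrow> P \<in> s)" for s H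
  have "generate_topology_on {basic_open (chart \<X> i) f | i f. i \<in> chart_index \<X> \<and> f \<in> chart \<X> i} U"
    using U(1) unfolding zariski_def by (simp add: openin_topology_generated_by_iff)
  then have "U \<noteq> {} \<longrightarrow> (\<exists>H. good U H)"
  proof (induction rule: generate_topology_on.induct)
    case Empty
    then show ?case by simp
  next
    case (Int a b)
    show ?case
    proof
      assume "a \<inter> b \<noteq> {}"
      then obtain H1 H2 where "good a H1" "good b H2" using Int.IH by auto
      then have "good (a \<inter> b) (H1 \<union> H2)" unfolding good_def by simp
      then show "\<exists>H. good (a \<inter> b) H" by blast
    qed
  next
    case (UN K)
    show ?case
    proof
      assume "\<Union>K \<noteq> {}"
      then obtain a where a: "a \<in> K" "a \<noteq> {}" by auto
      then obtain H1 where "good a H1" using UN.IH[OF a(1)] by auto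
      then have "good (\<Union>K) H1" using a(1) unfolding good_def by (meson UnionI)
      then show "\<exists>H. good (\<Union>K) H" by blast
    qed
  next
    case (Basis s)
    then obtain i f where s: "s = basic_open (chart \<X> i) f" "i \<in> chart_index \<X>" "f \<in> chart \<X> i" by blast
    show ?case
    proof
      assume "s \<noteq> {}"
      then obtain p where "prime_set (chart \<X> i) p" "f \<notin> p" using s basic_open_iff unfolding is_point_def by blast
      then have f0: "f \<noteq> 0" using prime_setD(2) by blast
      \<comment> \<open>0 is removed so that the inverses of the members are nonzero; it lies in
        \<open>V\<close> in any case.\<close>
      let ?H = "insert (inverse f) (chart_gens \<X> i) - {0}"
      have "P \<in> s" if V: "valuation_set V" "k \<subseteq> V" "?H \<subseteq> V" and P: "is_point j q P" "dominated V P" for V j q P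
      proof -
        note R = valuation_setD[OF V(1)]
        have "chart_gens \<X> i \<subseteq> V" "inverse f \<in> V" using V(3) f0 R by auto
        then have "chart \<X> i \<subseteq> V" using V R by (intro ch(4))
        note c = center_point[OF V(1) this s(2)]
        have "P = localize (chart \<X> i) (chart \<X> i \<inter> max_ideal V)" by (rule dominated_unique[OF V(1) P c])
        moreover have "f \<notin> max_ideal V" using \<open>inverse f \<in> V\<close> f0 by (simp add: max_ideal_def)
        ultimately show ?thesis using s c(1) basic_open_iff by blast
      qed
      moreover have "finite ?H" unfolding chart_gens_def by simp
      ultimately have "good s ?H" unfolding good_def by blast
      then show "\<exists>H. good s H" by blast
    qed
  qed
  then show ?thesis using that U(2) unfolding good_def by blast
qed

text \<open>On the whole function field the order function determines its valuation ring, as the set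
  of elements of order at least 0, so the finiteness of order functions carries over. A
  \<open>g\<close> algebraic over \<open>k\<close> has no places at all.\<close>

lemma finite_places_UNIV: "finite {V. place k g V}" if g: "g \<noteq> 0"
proof (cases "alg_over k g")
  case True
  have "\<not> place k g V" for V
  proof
    assume V: "place k g V"
    have "g \<in> units_of_set V" by (rule alg_over_unit[OF k placeD(3,1)[OF V] True g])
    then show False using placeD(4)[OF V] units_of_set_iff[OF placeD(2)[OF V]] by blast
  qed
  then show ?thesis by simp
next
  case False
  obtain i where "i \<in> chart_index \<X>" using chart_index_ex .
  then obtain z where z: "curve_chart k (chart \<X> i) (chart_gens \<X> i) z" using chart_curve by blast
  note fin = curve_chart.finite_over_UNIV[OF z False]
  have "finite (place_val UNIV g ` {V. place k g V})"
    by (rule finite_place_vals[OF k g]) (auto simp: field_set_def ring_set_def fin)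
  moreover have "inj_on (place_val UNIV g) {V. place k g V}"
  proof (rule inj_onI)
    have alg: "alg_over (ratfuns k g) x" for x
      using finite_over_imp_alg_over[OF field_set_ratfuns[OF k] fin] by (simp add: ring_set_def)
    have mem: "x \<in> V \<longleftrightarrow> place_val UNIV g V x \<ge> 0" if V: "place k g V" for V x
    proof (cases "x = 0")
      case True
      then show ?thesis using placeD(2)[OF V] by (simp add: place_val_def)
    next
      case x: False
      have "x \<in> V" if "vord V g x \<ge> 0"
      proof (rule ccontr)
        assume "x \<notin> V"
        then have n: "inverse x \<in> max_ideal V" by (rule valuation_inverse_max_ideal[OF placeD(1)[OF V]])
        then have "vord V g (inverse x) \<ge> 0" using x max_ideal_subset by (intro vord_nonneg[OF k V g alg]) auto
        then have "vord V g (inverse x) = 0" using vord_inverse[OF k V g alg x] that by simp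
        then have "inverse x \<in> units_of_set V" using x by (intro vord_eq_0[OF k V g alg]) auto
        then show False using n units_of_set_iff[OF placeD(2)[OF V]] by blast
      qed
      then show ?thesis using vord_nonneg[OF k V g alg x] x by (auto simp: place_val_def)
    qed
    fix V W assume "V \<in> {V. place k g V}" "W \<in> {V. place k g V}" "place_val UNIV g V = place_val UNIV g W"
    then show "V = W" using mem by auto
  qed
  ultimately show ?thesis by (rule finite_imageD)
qed

text \<open>A nonzero \<open>s\<close> in \<open>p\<close> is put into the maximal ideal of a
  valuation ring above \<open>P\<close>. The centre of that ring on the chart is nonzero and
  contained in \<open>p\<close>, hence equal to \<open>p\<close> in dimension one.\<close>

lemma exists_dominating:
  assumes P: "is_point i p P" "P \<noteq> UNIV"
  obtains V where "valuation_set V" "k \<subseteq> V" "dominated V P"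
proof -
  interpret local_ring_at "chart \<X> i" p by (rule is_point_local[OF P(1)])
  have Peq: "P = localize (chart \<X> i) p" and i: "i \<in> chart_index \<X>" using P(1) unfolding is_point_def by auto
  obtain s where s: "s \<in> p" "s \<noteq> 0" using P point_eq_UNIV_iff pD(2) by blast
  have sm: "s \<in> max_ideal P" unfolding Peq using max_ideal_Int s by blast
  have R: "ring_set P" unfolding Peq by (rule ring_set_P)
  have "1 \<notin> (\<lambda>a. s * a) ` P"
  proof
    assume "1 \<in> (\<lambda>a. s * a) ` P"
    then obtain a where "a \<in> P" "1 = s * a" by blast
    then show False using max_ideal_mult_left[OF R, of a s] sm R by (simp add: mult.commute)
  qed
  then obtain V where V: "valuation_set V" "P \<subseteq> V" "s \<in> max_ideal V"
    using exists_valuation_set[OF R, of s] sm max_ideal_subset by blast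
  have AV: "chart \<X> i \<subseteq> V" using V superset Peq by blast
  have "chart \<X> i \<inter> max_ideal V \<subseteq> p"
  proof
    fix a assume a: "a \<in> chart \<X> i \<inter> max_ideal V"
    show "a \<in> p"
    proof (rule ccontr)
      assume "a \<notin> p"
      then have "inverse a \<in> V" "a \<noteq> 0" using localizeI[of 1 a] a A nz V Peq by (auto simp: divide_inverse)
      then show False using a by (simp add: max_ideal_def)
    qed
  qed
  moreover have "prime_set (chart \<X> i) (chart \<X> i \<inter> max_ideal V)" by (rule prime_set_center[OF A V(1) AV])
  moreover have "chart \<X> i \<inter> max_ideal V \<noteq> {0}" using s V pD(1) by blast
  ultimately have "p = chart \<X> i \<inter> max_ideal V" using chart_dim[OF i] p unfolding dim_le_one_def by blast
  then have "dominated V P" using center_point(2)[OF V(1) AV i] Peq by simp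
  moreover have "k \<subseteq> V" using AV ch(2) by blast
  ultimately show ?thesis using that V(1) by blast
qed

text \<open>Every such point is the centre of a place of one of finitely many functions
  \<open>inverse h\<close>. Each of these has finitely many places, and a valuation ring has only
  one centre.\<close>

lemma finite_points_outside:
  assumes U: "openin (zariski \<X>) U" "U \<noteq> {}"
  shows "finite {P. (\<exists>i p. is_point i p P) \<and> P \<noteq> UNIV \<and> P \<notin> U}"
proof -
  obtain H where H: "finite H" "0 \<notin> H"
    "\<And>V i p P. valuation_set V \<Longrightarrow> k \<subseteq> V \<Longrightarrow> H \<subseteq> V \<Longrightarrow> is_point i p P \<Longrightarrow> dominated V P \<Longrightarrow> P \<in> U"
    by (rule open_contains_centers[OF U]) blast
  let ?\<V> = "\<Union>h\<in>H. {V. place k (inverse h) V}"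
  have fin: "finite ?\<V>"
  proof (rule finite_UN_I[OF H(1)])
    fix h assume "h \<in> H"
    then have "inverse h \<noteq> 0" using H(2) by auto
    then show "finite {V. place k (inverse h) V}" by (rule finite_places_UNIV)
  qed
  let ?c = "\<lambda>V. SOME P. (\<exists>i p. is_point i p P) \<and> dominated V P"
  have "P \<in> ?c ` ?\<V>" if P: "is_point i p P" "P \<noteq> UNIV" "P \<notin> U" for i p P
  proof -
    obtain V where V: "valuation_set V" "k \<subseteq> V" "dominated V P" using exists_dominating[OF P(1,2)] .
    obtain h where h: "h \<in> H" "h \<notin> V" using H(3)[OF V(1,2) _ P(1) V(3)] P(3) by blast
    have "place k (inverse h) V" unfolding place_def using V valuation_inverse_max_ideal[OF V(1) h(2)] by blast
    moreover have "?c V = P"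
    proof -
      have "(\<exists>i p. is_point i p (?c V)) \<and> dominated V (?c V)" by (rule someI[of _ P]) (use P V in blast)
      then show ?thesis using dominated_unique[OF V(1) _ _ P(1) V(3)] by blast
    qed
    ultimately show ?thesis using h(1) by force
  qed
  then have "{P. (\<exists>i p. is_point i p P) \<and> P \<noteq> UNIV \<and> P \<notin> U} \<subseteq> ?c ` ?\<V>" by blast
  then show ?thesis using finite_subset[OF _ finite_imageI[OF fin]] by blast
qed

text \<open>Away from the zeros of \<open>b0\<close> uniformizers exist, and away from the zeros of
  the \<open>d x\<close> the elements of \<open>Z\<close> are regular. What remains, including the
  points outside the chosen chart, is the complement of a nonempty open set.\<close>

lemma finite_bad_points:
  assumes Z: "finite Z"
  shows "finite {P. (\<exists>i p. is_point i p P) \<and> P \<noteq> UNIV \<and> \<not> (Z \<subseteq> P \<and> (\<exists>t. uniformizer P t))}"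
proof -
  obtain i where i: "i \<in> chart_index \<X>" using chart_index_ex .
  then obtain z where z: "curve_chart k (chart \<X> i) (chart_gens \<X> i) z" using chart_curve by blast
  obtain b0 where b0: "b0 \<in> chart \<X> i" "b0 \<noteq> 0"
    "\<And>p. prime_set (chart \<X> i) p \<Longrightarrow> p \<noteq> {0} \<Longrightarrow> b0 \<notin> p \<Longrightarrow> \<exists>t. uniformizer (localize (chart \<X> i) p) t"
    by (rule curve_chart.exists_uniformizer[OF z]) blast
  have "\<forall>x. \<exists>b. b \<in> chart \<X> i \<and> b \<noteq> 0 \<and> b * x \<in> chart \<X> i"
  proof
    fix x
    obtain a b where "a \<in> chart \<X> i" "b \<in> chart \<X> i" "b \<noteq> 0" "x = a / b" using chart_frac[OF i] by blast
    then show "\<exists>b. b \<in> chart \<X> i \<and> b \<noteq> 0 \<and> b * x \<in> chart \<X> i" by (intro exI[of _ b]) auto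
  qed
  then obtain d where d: "\<And>x. d x \<in> chart \<X> i" "\<And>x. d x \<noteq> 0" "\<And>x. d x * x \<in> chart \<X> i" by metis
  define b where "b = b0 * (\<Prod>x\<in>Z. d x)"
  have b: "b \<in> chart \<X> i" "b \<noteq> 0" unfolding b_def using b0 d Z ch(1) by (auto intro!: ring_set_mult ring_set_prod)
  have ne: "basic_open (chart \<X> i) b \<noteq> {}" using generic_point[OF i] basic_open_iff[OF i] b(2) by blast
  have "Z \<subseteq> P \<and> (\<exists>t. uniformizer P t)" if P: "P \<noteq> UNIV" "P \<in> basic_open (chart \<X> i) b" for P
  proof -
    obtain p where pt: "is_point i p P" "b \<notin> p" using P basic_open_iff[OF i] by blast
    interpret local_ring_at "chart \<X> i" p by (rule is_point_local[OF pt(1)])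
    have Peq: "P = localize (chart \<X> i) p" using pt(1) unfolding is_point_def by blast
    have "b0 \<notin> p"
    proof
      assume "b0 \<in> p"
      then have "(\<Prod>x\<in>Z. d x) * b0 \<in> p" using d(1) A by (intro pD(5)) (auto intro: ring_set_prod)
      then show False using pt(2) unfolding b_def by (simp add: mult.commute)
    qed
    then have "\<exists>t. uniformizer P t" unfolding Peq using b0(3) p pt P point_eq_UNIV_iff by blast
    moreover have "x \<in> P" if x: "x \<in> Z" for x
    proof -
      have "d x \<notin> p"
      proof
        assume "d x \<in> p"
        then have "(b0 * (\<Prod>x\<in>Z - {x}. d x)) * d x \<in> p"
          using d(1) b0 A by (intro pD(5)) (auto intro!: ring_set_mult ring_set_prod)
        also have "(b0 * (\<Prod>x\<in>Z - {x}. d x)) * d x = b"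
          unfolding b_def using x Z by (subst (2) prod.remove[of _ x]) (auto simp: mult_ac)
        finally show False using pt(2) by blast
      qed
      then have "(d x * x) / d x \<in> P" unfolding Peq using d by (intro localizeI)
      then show ?thesis using d(2) by simp
    qed
    ultimately show ?thesis by blast
  qed
  then have "{P. (\<exists>i p. is_point i p P) \<and> P \<noteq> UNIV \<and> \<not> (Z \<subseteq> P \<and> (\<exists>t. uniformizer P t))}
    \<subseteq> {P. (\<exists>i p. is_point i p P) \<and> P \<noteq> UNIV \<and> P \<notin> basic_open (chart \<X> i) b}" by blast
  then show ?thesis using finite_points_outside[OF basic_open_open[OF i b(1)] ne] finite_subset by blast
qed

lemma point_dvr:
  assumes P: "is_point i p P" and t: "uniformizer P t" shows "dvr P t"
proof -
  interpret local_ring_at "chart \<X> i" p by (rule is_point_local[OF P])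
  have Peq: "P = localize (chart \<X> i) p" and i: "i \<in> chart_index \<X>" using P unfolding is_point_def by auto
  show ?thesis using dvr_if_uniformizer[OF chart_dim[OF i] chart_frac[OF i]] t unfolding Peq by blast
qed

end

section \<open>Completions and local points\<close>

text \<open>Isolated so as to cover the local rings without uniformizer as well, at which \<open>val_ge\<close>
  defines the discrete topology.\<close>

locale valued =
  fixes P :: "'a::field set"
  assumes vg_0: "val_ge P n 0"
    and vg_diff: "val_ge P n x \<Longrightarrow> val_ge P n y \<Longrightarrow> val_ge P n (x - y)"
    and vg_mult: "\<exists>m. \<forall>x y. val_ge P m x \<longrightarrow> val_ge P m y \<longrightarrow> val_ge P n (x * y)"
    and vg_scale: "\<exists>m. \<forall>x. val_ge P m x \<longrightarrow> val_ge P n (c * x)"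
    and vg_mono: "n \<le> m \<Longrightarrow> val_ge P m x \<Longrightarrow> val_ge P n x"
    and vg_sep: "(\<And>n. val_ge P n x) \<Longrightarrow> x = 0"

text \<open>Level \<open>c + 1\<close> contains only 0, which settles products, scaling and
  separation at once.\<close>

lemma valued_junk:
  assumes "\<nexists>t. uniformizer P t" shows "valued P"
proof -
  obtain c where c: "\<And>n x. val_ge P n x \<longleftrightarrow> x = 0 \<or> n \<le> c" using val_ge_junk[OF assms] by blast
  show ?thesis
  proof
    show "\<exists>m. \<forall>x y. val_ge P m x \<longrightarrow> val_ge P m y \<longrightarrow> val_ge P n (x * y)" for n
      using c by (intro exI[of _ "c + 1"]) auto
    show "\<exists>m. \<forall>x. val_ge P m x \<longrightarrow> val_ge P n (d * x)" for n d
      using c by (intro exI[of _ "c + 1"]) auto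
    show "(\<And>n. val_ge P n x) \<Longrightarrow> x = 0" for x using c[of "c + 1" x] by auto
  qed (use c in auto)
qed

lemma valued_dvr:
  assumes P: "dvr P t" shows "valued P"
proof
  note D = dvrD[OF P] and v = dvr_val_ge_iff[OF P]
  have tp: "t powi n \<in> P" if "n \<ge> 0" for n using dvr_powi_in_iff[OF P, of 1 n] that D(1) by simp
  have mono: "val_ge P n x" if "n \<le> m" "val_ge P m x" for n m x
  proof -
    have "(x * t powi (- m)) * t powi (m - n) \<in> P"
      by (rule ring_set_mult[OF D(1)]) (use that v tp in auto)
    also have "(x * t powi (- m)) * t powi (m - n) = x * t powi (- n)"
      using D(3) by (simp add: mult.assoc flip: power_int_add)
    finally show ?thesis by (simp add: v)
  qed
  then show "\<And>n m x. n \<le> m \<Longrightarrow> val_ge P m x \<Longrightarrow> val_ge P n x" .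
  show "val_ge P n 0" for n by (simp add: val_ge_def)
  show "val_ge P n x \<Longrightarrow> val_ge P n y \<Longrightarrow> val_ge P n (x - y)" for n x y
    unfolding v using ring_set_diff[OF D(1)] by (simp add: left_diff_distrib)
  \<comment> \<open>The maximum with 0 is there because a factor of negative level could lower the
    level of the other one.\<close>
  show "\<exists>m. \<forall>x y. val_ge P m x \<longrightarrow> val_ge P m y \<longrightarrow> val_ge P n (x * y)" for n
  proof (intro exI[of _ "max n 0"] allI impI)
    fix x y assume xy: "val_ge P (max n 0) x" "val_ge P (max n 0) y"
    have "val_ge P 0 y" using mono[OF _ xy(2)] by simp
    then have "(x * t powi (- (max n 0))) * y \<in> P"
      using xy(1) by (intro ring_set_mult[OF D(1), of "x * t powi (- (max n 0))" y]) (simp_all add: v)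
    then have "val_ge P (max n 0) (x * y)" unfolding v by (simp add: mult_ac)
    then show "val_ge P n (x * y)" by (rule mono[of n "max n 0", rotated]) simp
  qed
  show "\<exists>m. \<forall>x. val_ge P m x \<longrightarrow> val_ge P n (c * x)" for n c
  proof (cases "c = 0")
    case True
    then show ?thesis by (simp add: val_ge_def)
  next
    case False
    then obtain l u where u: "u \<in> units_of_set P" "c = u * t powi l" using P unfolding dvr_def by blast
    show ?thesis
    proof (intro exI[of _ "n - l"] allI impI)
      fix x assume "val_ge P (n - l) x"
      then have "u * (x * t powi (- (n - l))) \<in> P"
        unfolding v using u(1) by (intro ring_set_mult[OF D(1), of u]) (auto simp: units_of_set_def)
      also have "t powi (- (n - l)) = t powi l * t powi (- n)" using D(3) by (simp flip: power_int_add)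
      finally show "val_ge P n (c * x)" unfolding v u(2) by (simp add: mult_ac)
    qed
  qed
  show "x = 0" if "\<And>n. val_ge P n x" for x
  proof (rule ccontr)
    assume "x \<noteq> 0"
    then obtain l u where u: "u \<in> units_of_set P" "x = u * t powi l" using P unfolding dvr_def by blast
    have "val_ge P (l + 1) x" by (rule that)
    then have "l + 1 \<le> l" using dvr_ord_at[OF P u(1), of l] u(2) \<open>x \<noteq> 0\<close> unfolding val_ge_def by simp
    then show False by simp
  qed
qed

lemma (in curve) point_valued: assumes "is_point i p P" shows "valued P"
  using valued_junk valued_dvr point_dvr[OF assms] by blast

context valued
begin

section \<open>The completion as Cauchy sequences modulo null sequences\<close>

lemma vg_uminus: "val_ge P n x \<Longrightarrow> val_ge P n (- x)" using vg_diff[OF vg_0, of n x] by simp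
lemma vg_add: "val_ge P n x \<Longrightarrow> val_ge P n y \<Longrightarrow> val_ge P n (x + y)"
  using vg_diff[of n x "- y"] vg_uminus[of n y] by simp

abbreviation "R \<equiv> cauchy_seqs P"
abbreviation "N \<equiv> null_seqs P"
abbreviation "K \<equiv> completion P"
abbreviation "cl s \<equiv> N +>\<^bsub>R\<^esub> s"

lemma R_simps [simp]:
  "s \<otimes>\<^bsub>R\<^esub> t = (\<lambda>i. s i * t i)" "s \<oplus>\<^bsub>R\<^esub> t = (\<lambda>i. s i + t i)" "\<one>\<^bsub>R\<^esub> = (\<lambda>_. 1)" "\<zero>\<^bsub>R\<^esub> = (\<lambda>_. 0)"
  unfolding cauchy_seqs_def by simp_all

lemma R_iff: "s \<in> carrier R \<longleftrightarrow> (\<forall>n. \<exists>M. \<forall>i\<ge>M. \<forall>j\<ge>M. val_ge P n (s i - s j))"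
  unfolding cauchy_seqs_def by simp

lemma R_const: "(\<lambda>_. c) \<in> carrier R" by (simp add: R_iff vg_0)

lemma R_diff: assumes "s \<in> carrier R" "t \<in> carrier R" shows "(\<lambda>i. s i - t i) \<in> carrier R"
  unfolding R_iff
proof
  fix n
  obtain M1 M2 where M: "\<forall>i\<ge>M1. \<forall>j\<ge>M1. val_ge P n (s i - s j)" "\<forall>i\<ge>M2. \<forall>j\<ge>M2. val_ge P n (t i - t j)"
    using assms unfolding R_iff by meson
  show "\<exists>M. \<forall>i\<ge>M. \<forall>j\<ge>M. val_ge P n (s i - t i - (s j - t j))"
  proof (intro exI[of _ "max M1 M2"] allI impI)
    fix i j assume "max M1 M2 \<le> i" "max M1 M2 \<le> j"
    then have "val_ge P n ((s i - s j) - (t i - t j))" using M by (intro vg_diff[of n "s i - s j"]) auto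
    then show "val_ge P n (s i - t i - (s j - t j))" by (simp add: algebra_simps)
  qed
qed

text \<open>The axioms provide no bound for a Cauchy sequence, so both factors are compared with
  their values at one fixed index \<open>M1\<close>: products of differences are controlled by
  \<open>vg_mult\<close>, those with a fixed value by \<open>vg_scale\<close>.\<close>

lemma R_mult: assumes "s \<in> carrier R" "t \<in> carrier R" shows "(\<lambda>i. s i * t i) \<in> carrier R"
  unfolding R_iff
proof
  fix n
  obtain m where m: "\<And>x y. val_ge P m x \<Longrightarrow> val_ge P m y \<Longrightarrow> val_ge P n (x * y)" using vg_mult by meson
  obtain A where A1: "\<forall>i\<ge>A. \<forall>j\<ge>A. val_ge P m (s i - s j)" using assms(1) unfolding R_iff by meson
  obtain B where B1: "\<forall>i\<ge>B. \<forall>j\<ge>B. val_ge P m (t i - t j)" using assms(2) unfolding R_iff by meson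
  define M1 where "M1 = max A B"
  have M1: "\<And>i j. i \<ge> M1 \<Longrightarrow> j \<ge> M1 \<Longrightarrow> val_ge P m (s i - s j) \<and> val_ge P m (t i - t j)"
    unfolding M1_def using A1 B1 by simp
  obtain m1 where m1: "\<And>x. val_ge P m1 x \<Longrightarrow> val_ge P n (s M1 * x)" using vg_scale by meson
  obtain m2 where m2: "\<And>x. val_ge P m2 x \<Longrightarrow> val_ge P n (t M1 * x)" using vg_scale by meson
  obtain C where C: "\<forall>i\<ge>C. \<forall>j\<ge>C. val_ge P m1 (t i - t j)" using assms(2) unfolding R_iff by meson
  obtain D where D: "\<forall>i\<ge>D. \<forall>j\<ge>D. val_ge P m2 (s i - s j)" using assms(1) unfolding R_iff by meson
  show "\<exists>M. \<forall>i\<ge>M. \<forall>j\<ge>M. val_ge P n (s i * t i - s j * t j)"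
  proof (intro exI[of _ "max M1 (max C D)"] allI impI)
    fix i j assume "max M1 (max C D) \<le> i" "max M1 (max C D) \<le> j"
    then have ij: "i \<ge> M1" "j \<ge> M1" "i \<ge> C" "j \<ge> C" "i \<ge> D" "j \<ge> D" by auto
    have "val_ge P n ((s i - s M1) * (t i - t j))" "val_ge P n ((s i - s j) * (t j - t M1))"
      using M1 ij by (auto intro!: m)
    moreover have "val_ge P n (s M1 * (t i - t j))" "val_ge P n (t M1 * (s i - s j))"
      using C D ij by (auto intro!: m1 m2)
    ultimately have "val_ge P n ((s i - s M1) * (t i - t j) + s M1 * (t i - t j) +
      ((s i - s j) * (t j - t M1) + t M1 * (s i - s j)))" by (intro vg_add)
    also have "(s i - s M1) * (t i - t j) + s M1 * (t i - t j) +
      ((s i - s j) * (t j - t M1) + t M1 * (s i - s j)) = s i * t i - s j * t j"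
      by (simp add: algebra_simps)
    finally show "val_ge P n (s i * t i - s j * t j)" .
  qed
qed

lemma R_uminus: "s \<in> carrier R \<Longrightarrow> (\<lambda>i. - s i) \<in> carrier R" using R_diff[OF R_const[of 0]] by simp
lemma R_add: "s \<in> carrier R \<Longrightarrow> t \<in> carrier R \<Longrightarrow> (\<lambda>i. s i + t i) \<in> carrier R"
  using R_diff[of s "\<lambda>i. - t i"] R_uminus by simp

lemma cring_R: "cring R"
proof (rule cringI)
  show "abelian_group R"
  proof (rule abelian_groupI)
    show "\<exists>t\<in>carrier R. t \<oplus>\<^bsub>R\<^esub> s = \<zero>\<^bsub>R\<^esub>" if "s \<in> carrier R" for s
      using R_uminus[OF that] by (intro bexI[of _ "\<lambda>i. - s i"]) auto
  qed (use R_const R_add in \<open>auto simp: algebra_simps\<close>)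
  show "comm_monoid R"
    by (rule comm_monoidI) (use R_const R_mult in \<open>auto simp: algebra_simps\<close>)
qed (auto simp: algebra_simps)

lemma N_iff: "s \<in> N \<longleftrightarrow> (\<forall>n. \<exists>M. \<forall>i\<ge>M. val_ge P n (s i))"
  unfolding null_seqs_def eventually_sequentially by simp

lemma N_add: assumes "s \<in> N" "t \<in> N" shows "(\<lambda>i. s i + t i) \<in> N"
  unfolding null_seqs_def
proof (intro CollectI allI)
  fix n
  have "\<forall>\<^sub>F i in sequentially. val_ge P n (s i)" "\<forall>\<^sub>F i in sequentially. val_ge P n (t i)"
    using assms unfolding null_seqs_def by blast+
  then show "\<forall>\<^sub>F i in sequentially. val_ge P n (s i + t i)" by eventually_elim (rule vg_add)
qed

lemma N_subset: "N \<subseteq> carrier R"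
proof
  fix s assume "s \<in> N"
  then show "s \<in> carrier R" unfolding N_iff R_iff using vg_diff by meson
qed

lemma N_mult: assumes s: "s \<in> N" and t: "t \<in> carrier R" shows "(\<lambda>i. t i * s i) \<in> N"
  unfolding N_iff
proof
  fix n
  obtain m where m: "\<And>x y. val_ge P m x \<Longrightarrow> val_ge P m y \<Longrightarrow> val_ge P n (x * y)" using vg_mult by meson
  obtain A where A: "\<forall>i\<ge>A. \<forall>j\<ge>A. val_ge P m (t i - t j)" using t unfolding R_iff by meson
  obtain m1 where m1: "\<And>x. val_ge P m1 x \<Longrightarrow> val_ge P n (t A * x)" using vg_scale by meson
  obtain B where B: "\<forall>i\<ge>B. val_ge P m (s i)" using s unfolding N_iff by meson
  obtain C where C: "\<forall>i\<ge>C. val_ge P m1 (s i)" using s unfolding N_iff by meson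
  show "\<exists>M. \<forall>i\<ge>M. val_ge P n (t i * s i)"
  proof (intro exI[of _ "max A (max B C)"] allI impI)
    fix i assume "max A (max B C) \<le> i"
    then have "val_ge P n ((t i - t A) * s i + t A * s i)" using A B C by (intro vg_add m m1) auto
    then show "val_ge P n (t i * s i)" by (simp add: algebra_simps)
  qed
qed

lemma N_0: "(\<lambda>_. 0) \<in> N" by (simp add: N_iff vg_0)
lemma N_uminus: "s \<in> N \<Longrightarrow> (\<lambda>i. - s i) \<in> N" using N_mult[OF _ R_const[of "- 1"]] by simp
lemma N_diff: "s \<in> N \<Longrightarrow> t \<in> N \<Longrightarrow> (\<lambda>i. s i - t i) \<in> N"
  using N_add[of s "\<lambda>i. - t i"] N_uminus[of t] by simp

lemma R_minus: assumes "s \<in> carrier R" shows "\<ominus>\<^bsub>R\<^esub> s = (\<lambda>i. - s i)"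
proof -
  interpret cring R by (rule cring_R)
  show ?thesis using assms R_uminus by (intro minus_equality) auto
qed

lemma ideal_N: "ideal N R"
proof -
  interpret cring R by (rule cring_R)
  show ?thesis
  proof (intro idealI ring_axioms)
    show "subgroup N (add_monoid R)"
    proof (rule add.subgroupI)
      show "N \<subseteq> carrier R" by (rule N_subset)
      show "N \<noteq> {}" using N_0 by blast
      show "\<ominus>\<^bsub>R\<^esub> s \<in> N" if "s \<in> N" for s using that N_subset N_uminus R_minus by auto
      show "s \<oplus>\<^bsub>R\<^esub> t \<in> N" if "s \<in> N" "t \<in> N" for s t using N_add[OF that] by simp
    qed
    show "t \<otimes>\<^bsub>R\<^esub> s \<in> N" "s \<otimes>\<^bsub>R\<^esub> t \<in> N" if "s \<in> N" "t \<in> carrier R" for s t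
      using N_mult[OF that] by (simp_all add: mult.commute)
  qed
qed

lemma cl_hom: "ring_hom_cring R K (\<lambda>s. cl s)"
proof -
  interpret N: ideal N R by (rule ideal_N)
  have "cring K" unfolding completion_def by (rule N.quotient_is_cring[OF cring_R])
  moreover have "(\<lambda>s. cl s) \<in> ring_hom R K" unfolding completion_def using N.rcos_ring_hom .
  ultimately show ?thesis
    using cring_R by (intro ring_hom_cring.intro ring_hom_cring_axioms.intro)
qed

lemma cl_mem_iff: assumes "s \<in> carrier R" shows "s' \<in> cl s \<longleftrightarrow> (\<lambda>i. s' i - s i) \<in> N"
proof
  assume "s' \<in> cl s"
  then obtain h where "h \<in> N" "s' = (\<lambda>i. h i + s i)" unfolding a_r_coset_def' by auto
  then show "(\<lambda>i. s' i - s i) \<in> N" by simp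
next
  assume "(\<lambda>i. s' i - s i) \<in> N"
  then show "s' \<in> cl s" unfolding a_r_coset_def' by (force intro: bexI[of _ "\<lambda>i. s' i - s i"])
qed

lemma cl_eq_iff:
  assumes "s \<in> carrier R" "s' \<in> carrier R" shows "cl s = cl s' \<longleftrightarrow> (\<lambda>i. s i - s' i) \<in> N"
proof
  assume "cl s = cl s'"
  moreover have "s \<in> cl s" using cl_mem_iff[OF assms(1)] N_0 by simp
  ultimately show "(\<lambda>i. s i - s' i) \<in> N" using cl_mem_iff[OF assms(2)] by blast
next
  assume d: "(\<lambda>i. s i - s' i) \<in> N"
  have "(\<lambda>i. t i - s i) \<in> N \<longleftrightarrow> (\<lambda>i. t i - s' i) \<in> N" for t
    using N_add[OF _ d, of "\<lambda>i. t i - s i"] N_diff[OF _ d, of "\<lambda>i. t i - s' i"] by auto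
  then show "cl s = cl s'" using cl_mem_iff assms by blast
qed

lemma K_carrier: "x \<in> carrier K \<longleftrightarrow> (\<exists>s\<in>carrier R. x = cl s)"
  unfolding completion_def FactRing_def A_RCOSETS_def' by auto

lemma cl_in: "s \<in> carrier R \<Longrightarrow> cl s \<in> carrier K" using K_carrier by blast

lemma to_completion_eq: "to_completion P c = cl (\<lambda>_. c)" unfolding to_completion_def ..

lemma cl_minus:
  assumes "s \<in> carrier R" "t \<in> carrier R" shows "cl s \<ominus>\<^bsub>K\<^esub> cl t = cl (\<lambda>i. s i - t i)"
proof -
  interpret h: ring_hom_cring R K "\<lambda>s. cl s" by (rule cl_hom)
  have "cl (s \<ominus>\<^bsub>R\<^esub> t) = cl s \<ominus>\<^bsub>K\<^esub> cl t"
    unfolding a_minus_def using assms by (simp del: R_simps)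
  moreover have "s \<ominus>\<^bsub>R\<^esub> t = (\<lambda>i. s i - t i)" using assms R_minus by (simp add: a_minus_def)
  ultimately show ?thesis by simp
qed

text \<open>A null sequence eventually reaches every level, so the choice of the representative is
  immaterial.\<close>

lemma cval_ge_cl:
  assumes s: "s \<in> carrier R" shows "cval_ge P n (cl s) \<longleftrightarrow> (\<forall>\<^sub>F i in sequentially. val_ge P n (s i))"
proof
  assume "cval_ge P n (cl s)"
  then obtain s' where s': "s' \<in> cl s" "\<forall>\<^sub>F i in sequentially. val_ge P n (s' i)" unfolding cval_ge_def by blast
  have "\<forall>\<^sub>F i in sequentially. val_ge P n (s' i - s i)"
    using s'(1) cl_mem_iff[OF s] unfolding null_seqs_def by blast
  with s'(2) show "\<forall>\<^sub>F i in sequentially. val_ge P n (s i)"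
    by eventually_elim (metis vg_diff diff_diff_eq2 add_diff_cancel_left')
next
  assume "\<forall>\<^sub>F i in sequentially. val_ge P n (s i)"
  moreover have "s \<in> cl s" using cl_mem_iff[OF s] N_0 by simp
  ultimately show "cval_ge P n (cl s)" unfolding cval_ge_def by blast
qed

lemma cval_ge_to_completion: "cval_ge P n (to_completion P c) \<longleftrightarrow> val_ge P n c"
  unfolding to_completion_eq cval_ge_cl[OF R_const] by simp

lemma to_completion_inj: "to_completion P c = to_completion P d \<Longrightarrow> c = d"
proof -
  assume "to_completion P c = to_completion P d"
  then have "(\<lambda>_::nat. c - d) \<in> N" unfolding to_completion_eq using cl_eq_iff[OF R_const R_const] by simp
  then have "val_ge P n (c - d)" for n unfolding N_iff by blast
  then show "c = d" using vg_sep[of "c - d"] by simp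
qed

section \<open>Polynomials on the completion\<close>

definition seq_eval :: "(nat \<Rightarrow> nat \<Rightarrow> 'a) \<Rightarrow> 'a mpoly \<Rightarrow> nat \<Rightarrow> 'a" where
  "seq_eval s q = (\<lambda>l. mev id q (\<lambda>i. s i l))"

lemma finsum_R:
  "finite I \<Longrightarrow> (\<And>i. i \<in> I \<Longrightarrow> f i \<in> carrier R) \<Longrightarrow> finsum R f I = (\<lambda>l. \<Sum>i\<in>I. f i l)"
proof (induction I rule: finite_induct)
  case empty
  interpret cring R by (rule cring_R)
  show ?case by simp
next
  case (insert i I)
  interpret cring R by (rule cring_R)
  show ?case using insert by (subst finsum_insert) auto
qed

lemma finprod_R:
  "finite I \<Longrightarrow> (\<And>i. i \<in> I \<Longrightarrow> f i \<in> carrier R) \<Longrightarrow> finprod R f I = (\<lambda>l. \<Prod>i\<in>I. f i l)"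
proof (induction I rule: finite_induct)
  case empty
  interpret cring R by (rule cring_R)
  show ?case by simp
next
  case (insert i I)
  interpret cring R by (rule cring_R)
  show ?case using insert by (subst finprod_insert) auto
qed

lemma pow_R: "s \<in> carrier R \<Longrightarrow> s [^]\<^bsub>R\<^esub> (n::nat) = (\<lambda>l. s l ^ n)"
proof (induction n)
  case 0
  interpret cring R by (rule cring_R)
  show ?case by simp
next
  case (Suc n)
  interpret cring R by (rule cring_R)
  show ?case using Suc by (simp add: nat_pow_Suc mult.commute)
qed

lemma R_power: "s \<in> carrier R \<Longrightarrow> (\<lambda>l. s l ^ n) \<in> carrier R"
  by (induction n) (auto intro: R_const R_mult)
lemma R_prod: "(\<And>i. i \<in> I \<Longrightarrow> f i \<in> carrier R) \<Longrightarrow> (\<lambda>l. \<Prod>i\<in>I. f i l) \<in> carrier R"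
  by (induction I rule: infinite_finite_induct) (auto intro: R_const R_mult)
lemma R_sum: "(\<And>i. i \<in> I \<Longrightarrow> f i \<in> carrier R) \<Longrightarrow> (\<lambda>l. \<Sum>i\<in>I. f i l) \<in> carrier R"
  by (induction I rule: infinite_finite_induct) (auto intro: R_const R_add)

text \<open>\<open>cl\<close> is a ring homomorphism, so evaluation in the completion can be carried
  out termwise on representatives. Identities in \<open>completion P\<close> become identities over
  the field up to null sequences.\<close>

lemma mev_ring_cl:
  assumes q: "q \<in> mpolys n UNIV" and s: "\<And>i. s i \<in> carrier R" and y: "\<And>i. i < n \<Longrightarrow> y i = cl (s i)"
  shows "mev_ring K (to_completion P) q y = cl (seq_eval s q)" "seq_eval s q \<in> carrier R"
proof -
  interpret h: ring_hom_cring R K "\<lambda>s. cl s" by (rule cl_hom)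
  let ?l = "Poly_Mapping.lookup"
  define pr where "pr m = (\<lambda>l. \<Prod>i\<in>Poly_Mapping.keys m. s i l ^ ?l m i)" for m
  have prR: "pr m \<in> carrier R" for m unfolding pr_def by (intro R_prod R_power s)
  define tm where "tm m = (\<lambda>l. ?l q m * pr m l)" for m
  have tmR: "tm m \<in> carrier R" for m unfolding tm_def by (intro R_mult R_const prR)
  have ev: "seq_eval s q = (\<lambda>l. \<Sum>m\<in>Poly_Mapping.keys q. tm m l)"
    unfolding seq_eval_def mev_def tm_def pr_def by simp
  show "seq_eval s q \<in> carrier R" unfolding ev by (intro R_sum tmR)
  have fp: "finprod K (\<lambda>i. y i [^]\<^bsub>K\<^esub> ?l m i) (Poly_Mapping.keys m) = cl (pr m)"
    if m: "m \<in> Poly_Mapping.keys q" for m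
  proof -
    have in_n: "i < n" if "i \<in> Poly_Mapping.keys m" for i using q m that unfolding mpolys_def by blast
    have "cl (pr m) = cl (finprod R (\<lambda>i. s i [^]\<^bsub>R\<^esub> ?l m i) (Poly_Mapping.keys m))"
      by (subst finprod_R) (auto simp: pow_R[OF s] pr_def intro: R_power s)
    also have "\<dots> = finprod K ((\<lambda>s. cl s) \<circ> (\<lambda>i. s i [^]\<^bsub>R\<^esub> ?l m i)) (Poly_Mapping.keys m)"
      using s by (intro h.hom_finprod) auto
    also have "\<dots> = finprod K (\<lambda>i. y i [^]\<^bsub>K\<^esub> ?l m i) (Poly_Mapping.keys m)"
      using s y in_n cl_in by (intro h.S.finprod_cong') auto
    finally show ?thesis by simp
  qed
  have "cl (seq_eval s q) = cl (finsum R tm (Poly_Mapping.keys q))"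
    unfolding ev by (subst finsum_R) (auto intro: tmR)
  also have "\<dots> = finsum K ((\<lambda>s. cl s) \<circ> tm) (Poly_Mapping.keys q)"
    using tmR by (intro h.hom_finsum) auto
  also have "\<dots> = mev_ring K (to_completion P) q y"
    unfolding mev_ring_def
  proof (rule h.S.finsum_cong'[OF refl])
    have eq: "to_completion P (?l q m) \<otimes>\<^bsub>K\<^esub> cl (pr m) = cl (tm m)" for m
    proof -
      have "cl (tm m) = cl ((\<lambda>_. ?l q m) \<otimes>\<^bsub>R\<^esub> pr m)" unfolding tm_def by simp
      also have "\<dots> = cl (\<lambda>_. ?l q m) \<otimes>\<^bsub>K\<^esub> cl (pr m)" using h.hom_mult[OF R_const prR] by simp
      finally show ?thesis unfolding to_completion_eq by simp
    qed
    show "((\<lambda>s. cl s) \<circ> tm) m = to_completion P (?l q m) \<otimes>\<^bsub>K\<^esub>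
        finprod K (\<lambda>i. y i [^]\<^bsub>K\<^esub> ?l m i) (Poly_Mapping.keys m)" if "m \<in> Poly_Mapping.keys q" for m
      unfolding fp[OF that] eq by simp
    show "(\<lambda>m. to_completion P (?l q m) \<otimes>\<^bsub>K\<^esub> finprod K (\<lambda>i. y i [^]\<^bsub>K\<^esub> ?l m i) (Poly_Mapping.keys m))
        \<in> Poly_Mapping.keys q \<rightarrow> carrier K"
      using fp eq tmR cl_in by auto
  qed
  finally show "mev_ring K (to_completion P) q y = cl (seq_eval s q)" by simp
qed

lemma mev_ring_to_completion:
  assumes q: "q \<in> mpolys n UNIV" and y: "\<And>i. i < n \<Longrightarrow> y i = to_completion P (a i)"
  shows "mev_ring K (to_completion P) q y = to_completion P (mev id q a)"
  using mev_ring_cl(1)[OF q, of "\<lambda>i _. a i" y] R_const y unfolding to_completion_eq seq_eval_def by simp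

lemma K_zero: "\<zero>\<^bsub>K\<^esub> = cl (\<lambda>_. 0)"
proof -
  interpret h: ring_hom_cring R K "\<lambda>s. cl s" by (rule cl_hom)
  show ?thesis using h.hom_zero by simp
qed

lemma cl_eq_zero_iff: "s \<in> carrier R \<Longrightarrow> cl s = \<zero>\<^bsub>K\<^esub> \<longleftrightarrow> s \<in> N"
  unfolding K_zero using cl_eq_iff[OF _ R_const, of s 0] by simp

lemma seq_reps:
  assumes "\<And>i. i < n \<Longrightarrow> y i \<in> carrier K"
  obtains s where "\<And>i. s i \<in> carrier R" "\<And>i. i < n \<Longrightarrow> y i = cl (s i)"
proof -
  have "\<forall>i. \<exists>s. s \<in> carrier R \<and> (i < n \<longrightarrow> y i = cl s)" using assms K_carrier R_const by metis
  then show ?thesis using that by metis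
qed

lemma gpoints_iff:
  assumes T: "geqs T \<subseteq> mpolys (gdim T) UNIV" and s: "\<And>i. s i \<in> carrier R" "\<And>i. i < gdim T \<Longrightarrow> y i = cl (s i)"
    and D: "D \<subseteq> carrier K"
  shows "y \<in> gpoints K (to_completion P) D T \<longleftrightarrow> y \<in> {..<gdim T} \<rightarrow>\<^sub>E D \<and> (\<forall>q\<in>geqs T. seq_eval s q \<in> N)"
proof -
  have "mev_ring K (to_completion P) q y = \<zero>\<^bsub>K\<^esub> \<longleftrightarrow> seq_eval s q \<in> N" if "q \<in> geqs T" for q
  proof -
    have q: "q \<in> mpolys (gdim T) UNIV" using T that by blast
    show ?thesis using mev_ring_cl[OF q s] cl_eq_zero_iff by simp
  qed
  then show ?thesis unfolding gpoints_def by auto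
qed

lemma rational_local_point:
  assumes T: "geqs T \<subseteq> mpolys (gdim T) UNIV" and a: "a \<in> rational_points T"
  shows "(\<lambda>i\<in>{..<gdim T}. to_completion P (a i)) \<in> local_points T P"
proof -
  let ?y = "\<lambda>i\<in>{..<gdim T}. to_completion P (a i)"
  have "seq_eval (\<lambda>i _. a i) q \<in> N" if "q \<in> geqs T" for q
    using a that N_0 unfolding rational_points_def seq_eval_def by simp
  moreover have "?y \<in> {..<gdim T} \<rightarrow>\<^sub>E carrier K" using cl_in[OF R_const] by (auto simp: to_completion_eq)
  ultimately show ?thesis unfolding local_points_def
    by (subst gpoints_iff[OF T, of "\<lambda>i _. a i"]) (auto simp: R_const to_completion_eq)
qed

section \<open>Balls in the completion and in the local points\<close>

lemma adic_ball_open: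
  "z \<in> carrier K \<Longrightarrow> openin (adic_topology P) {y \<in> carrier K. cval_ge P n (y \<ominus>\<^bsub>K\<^esub> z)}"
  unfolding adic_topology_def by (intro topology_generated_by_Basis) blast

lemma ball_center: "z \<in> carrier K \<Longrightarrow> cval_ge P n (z \<ominus>\<^bsub>K\<^esub> z)"
proof -
  assume "z \<in> carrier K"
  then obtain s where "s \<in> carrier R" "z = cl s" using K_carrier by blast
  then show ?thesis using cl_minus cval_ge_cl[OF R_const[of 0]] vg_0 by simp
qed

lemma topspace_adic: "topspace (adic_topology P) = carrier K"
  unfolding adic_topology_def topology_generated_by_topspace using ball_center by blast

definition local_ball :: "'a gscheme \<Rightarrow> int \<Rightarrow> (nat \<Rightarrow> (nat \<Rightarrow> 'a) set) \<Rightarrow> (nat \<Rightarrow> (nat \<Rightarrow> 'a) set) set" where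
  "local_ball T n x = {y \<in> local_points T P. \<forall>j<gdim T. cval_ge P n (y j \<ominus>\<^bsub>K\<^esub> x j)}"

lemma local_pointsD:
  "x \<in> local_points T P \<Longrightarrow> x \<in> {..<gdim T} \<rightarrow>\<^sub>E carrier K"
  unfolding local_points_def gpoints_def by blast

lemma topspace_local: "topspace (local_topology T P) = local_points T P"
  unfolding local_topology_def using local_pointsD by (auto simp: topspace_adic topspace_product_topology)

lemma local_ball_open:
  assumes x: "x \<in> local_points T P"
  shows "openin (local_topology T P) (local_ball T n x)" "x \<in> local_ball T n x"
proof -
  have xK: "x j \<in> carrier K" if "j < gdim T" for j using local_pointsD[OF x] that by auto
  let ?B = "Pi\<^sub>E {..<gdim T} (\<lambda>j. {y \<in> carrier K. cval_ge P n (y \<ominus>\<^bsub>K\<^esub> x j)})"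
  have "openin (product_topology (\<lambda>_. adic_topology P) {..<gdim T}) ?B"
    using xK adic_ball_open by (subst openin_PiE) auto
  moreover have "y \<in> extensional {..<gdim T} \<and> (\<forall>j<gdim T. y j \<in> carrier K)" if "y \<in> local_points T P" for y
    using local_pointsD[OF that] by (auto simp: PiE_iff)
  then have "local_ball T n x = ?B \<inter> local_points T P"
    unfolding local_ball_def set_eq_iff Int_iff mem_Collect_eq PiE_iff lessThan_iff by blast
  ultimately show "openin (local_topology T P) (local_ball T n x)"
    unfolding local_topology_def openin_subtopology by blast
  show "x \<in> local_ball T n x" unfolding local_ball_def using x ball_center xK by blast
qed

text \<open>The centre \<open>x\<close> need not be rational, but it cancels: both estimates involve
  the same sequence \<open>s\<close> representing \<open>x j\<close>, and their difference no longer
  depends on the index of the sequence.\<close>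

lemma local_ball_rational:
  assumes x: "x \<in> local_points T P"
    and a: "(\<lambda>i\<in>{..<gdim T}. to_completion P (a i)) \<in> local_ball T n x"
    and b: "(\<lambda>i\<in>{..<gdim T}. to_completion P (b i)) \<in> local_ball T n x" and j: "j < gdim T"
  shows "val_ge P n (a j - b j)"
proof -
  have "x j \<in> carrier K" using local_pointsD[OF x] j by auto
  then obtain s where s: "s \<in> carrier R" "x j = cl s" using K_carrier by blast
  have ev: "\<forall>\<^sub>F i in sequentially. val_ge P n (c j - s i)"
    if "(\<lambda>i\<in>{..<gdim T}. to_completion P (c i)) \<in> local_ball T n x" for c
  proof -
    have "cval_ge P n (to_completion P (c j) \<ominus>\<^bsub>K\<^esub> x j)" using that j unfolding local_ball_def by auto
    then show ?thesis
      unfolding s(2) to_completion_eq cl_minus[OF R_const s(1)] cval_ge_cl[OF R_diff[OF R_const s(1)]] .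
  qed
  have "\<forall>\<^sub>F i in sequentially. val_ge P n (a j - b j)"
    using ev[OF a] ev[OF b] by eventually_elim (metis vg_diff diff_diff_eq2 diff_add_cancel)
  then show ?thesis by simp
qed

lemma local_ball_separates:
  assumes x: "x \<in> local_points T P" and y: "y \<in> local_points T P" and "x \<noteq> y"
  obtains n where "y \<notin> local_ball T n x"
proof -
  have E: "x \<in> {..<gdim T} \<rightarrow>\<^sub>E carrier K" "y \<in> {..<gdim T} \<rightarrow>\<^sub>E carrier K" using local_pointsD x y by auto
  then obtain j where j: "j < gdim T" "x j \<noteq> y j" using \<open>x \<noteq> y\<close> by (metis PiE_ext lessThan_iff)
  have "x j \<in> carrier K" "y j \<in> carrier K" using E j by auto
  then obtain s t where s: "s \<in> carrier R" "x j = cl s" and t: "t \<in> carrier R" "y j = cl t"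
    using K_carrier by meson
  have "(\<lambda>i. t i - s i) \<notin> N" using cl_eq_iff[OF t(1) s(1)] j s t by auto
  then obtain n where n: "\<not> (\<forall>\<^sub>F i in sequentially. val_ge P n (t i - s i))" unfolding null_seqs_def by blast
  have "y \<notin> local_ball T n x"
  proof
    assume "y \<in> local_ball T n x"
    then have "cval_ge P n (y j \<ominus>\<^bsub>K\<^esub> x j)" using j unfolding local_ball_def by blast
    then show False using n unfolding s(2) t(2) cl_minus[OF t(1) s(1)] cval_ge_cl[OF R_diff[OF t(1) s(1)]] by blast
  qed
  then show ?thesis using that by blast
qed

end

subsection \<open>Isomorphisms on points\<close>

lemma mpolys_add:
  assumes "p \<in> mpolys n UNIV" "q \<in> mpolys n UNIV" shows "p + q \<in> mpolys n UNIV"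
proof -
  have "Poly_Mapping.keys (p + q) \<subseteq> Poly_Mapping.keys p \<union> Poly_Mapping.keys q" by (rule keys_add)
  then show ?thesis using assms unfolding mpolys_def by blast
qed

lemma mpolys_0: "0 \<in> mpolys n UNIV" by (simp add: mpolys_def)

lemma mpolys_sum: "(\<And>i. i \<in> I \<Longrightarrow> f i \<in> mpolys n UNIV) \<Longrightarrow> sum f I \<in> mpolys n UNIV"
  by (induction I rule: infinite_finite_induct) (auto intro: mpolys_add mpolys_0)

lemma mpolys_power: "p \<in> mpolys n UNIV \<Longrightarrow> p ^ l \<in> mpolys n UNIV"
  by (induction l) (auto intro: mpolys_closed)

lemma mpolys_prod: "(\<And>i. i \<in> I \<Longrightarrow> f i \<in> mpolys n UNIV) \<Longrightarrow> prod f I \<in> mpolys n UNIV"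
  by (induction I rule: infinite_finite_induct) (auto intro: mpolys_closed)

lemma msubst_mpolys:
  assumes "e \<in> mpolys n UNIV" "\<And>i. i < n \<Longrightarrow> g i \<in> mpolys l UNIV"
  shows "msubst e g \<in> mpolys l UNIV"
  unfolding msubst_def mev_def
proof (intro mpolys_sum mpolys_closed(3) mconst_mpolys mpolys_prod mpolys_power)
  fix m i assume "m \<in> Poly_Mapping.keys e" "i \<in> Poly_Mapping.keys m"
  then have "i < n" using assms(1) unfolding mpolys_def by blast
  then show "g i \<in> mpolys l UNIV" by (rule assms(2))
qed

lemma gideal_1_gens:
  assumes "geqs T \<subseteq> mpolys (gdim T) UNIV"
  shows "{msubst e (block T c) | e c. e \<in> geqs T \<and> c < 1} \<subseteq> mpolys (1 * gdim T) UNIV"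
  using assms by (auto intro!: msubst_mpolys mvar_mpolys simp: block_def)

lemma gideal_1_vanish:
  fixes T :: "'b::field gscheme"
  assumes T: "geqs T \<subseteq> mpolys (gdim T) UNIV" and p: "p \<in> gideal 1 UNIV T"
    and x: "\<And>q. q \<in> geqs T \<Longrightarrow> mev id q x = 0"
  shows "mev id p x = 0"
proof -
  interpret i: comm_ring_hom "id :: 'b \<Rightarrow> 'b" by (rule comm_ring_hom_id)
  show ?thesis
  proof (rule mideal_induct[OF p[unfolded gideal_def] gideal_1_gens[OF T]])
    show "mev id 0 x = 0" by (rule i.mev_0)
    show "mev id (y + z) x = 0" if "mev id y x = 0" "mev id z x = 0" for y z
      by (simp only: i.mev_add that add_0)
    show "mev id (a * y) x = 0" if "mev id y x = 0" for a y
      by (simp only: i.mev_mult that mult_zero_right)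
    show "mev id f x = 0" if f: "f \<in> {msubst e (block T c) | e c. e \<in> geqs T \<and> c < 1}" for f
    proof -
      obtain e where e: "f = msubst e (block T 0)" "e \<in> geqs T" using f by auto
      show ?thesis unfolding e(1) i.mev_msubst block_def i.mev_mvar using x[OF e(2)] by (simp only: mult_0 add_0)
    qed
  qed
qed

lemma gs_hom_point:
  fixes T :: "'b::field gscheme"
  assumes T: "geqs T \<subseteq> mpolys (gdim T) UNIV" and f: "gs_hom UNIV T T' f"
    and x: "\<And>q. q \<in> geqs T \<Longrightarrow> mev id q x = 0" and q: "q \<in> geqs T'"
  shows "mev id q (\<lambda>j. mev id (f j) x) = 0"
proof -
  interpret i: comm_ring_hom "id :: 'b \<Rightarrow> 'b" by (rule comm_ring_hom_id)
  have "msubst q f \<in> gideal 1 UNIV T" using f q unfolding gs_hom_def by blast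
  from gideal_1_vanish[OF T this x] show ?thesis unfolding i.mev_msubst .
qed

lemma gs_inverse_point:
  fixes T :: "'b::field gscheme"
  assumes T: "geqs T \<subseteq> mpolys (gdim T) UNIV" and g: "msubst h f - mvar i \<in> gideal 1 UNIV T"
    and x: "\<And>q. q \<in> geqs T \<Longrightarrow> mev id q x = 0"
  shows "mev id h (\<lambda>j. mev id (f j) x) = x i"
proof -
  interpret i: comm_ring_hom "id :: 'b \<Rightarrow> 'b" by (rule comm_ring_hom_id)
  show ?thesis using gideal_1_vanish[OF T g x] by (simp add: i.mev_diff i.mev_msubst i.mev_mvar)
qed

lemma rational_points_iff:
  "a \<in> rational_points T \<longleftrightarrow> a \<in> extensional {..<gdim T} \<and> (\<forall>q\<in>geqs T. mev id q a = 0)"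
  unfolding rational_points_def by (simp add: PiE_def)

context valued
begin

lemma seq_eval_R:
  assumes "q \<in> mpolys n UNIV" "\<And>i. s i \<in> carrier R" shows "seq_eval s q \<in> carrier R"
  by (rule mev_ring_cl(2)[OF assms, where y = "\<lambda>i. cl (s i)"]) auto

text \<open>Representatives of a local point satisfy the equations only up to null sequences. These
  form an ideal, so the property passes to everything the equations generate.\<close>

lemma gideal_1_null:
  assumes T: "geqs T \<subseteq> mpolys (gdim T) UNIV" and p: "p \<in> gideal 1 UNIV T"
    and s: "\<And>i. s i \<in> carrier R" "\<And>q. q \<in> geqs T \<Longrightarrow> seq_eval s q \<in> N"
  shows "seq_eval s p \<in> N"
proof -
  interpret i: comm_ring_hom "id :: 'a \<Rightarrow> 'a" by (rule comm_ring_hom_id)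
  show ?thesis
  proof (rule mideal_induct[OF p[unfolded gideal_def] gideal_1_gens[OF T]])
    show "seq_eval s 0 \<in> N" unfolding seq_eval_def using N_0 by simp
    show "seq_eval s (x + y) \<in> N" if "seq_eval s x \<in> N" "seq_eval s y \<in> N" for x y
      using N_add[OF that] unfolding seq_eval_def i.mev_add .
    show "seq_eval s (a * x) \<in> N" if "a \<in> mpolys (1 * gdim T) UNIV" "seq_eval s x \<in> N" for a x
      using N_mult[OF that(2) seq_eval_R[OF that(1) s(1)]] unfolding seq_eval_def i.mev_mult .
    show "seq_eval s f \<in> N" if f: "f \<in> {msubst e (block T c) | e c. e \<in> geqs T \<and> c < 1}" for f
    proof -
      obtain e where e: "f = msubst e (block T 0)" "e \<in> geqs T" using f by auto
      show ?thesis unfolding e(1) seq_eval_def i.mev_msubst block_def i.mev_mvar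
        using s(2)[OF e(2)] by (simp only: mult_0 add_0 seq_eval_def)
    qed
  qed
qed

text \<open>Components from \<open>n\<close> on are set to 0 because the evaluation lemmas ask for a
  Cauchy sequence at every index.\<close>

definition seq_map :: "nat \<Rightarrow> (nat \<Rightarrow> 'a mpoly) \<Rightarrow> (nat \<Rightarrow> nat \<Rightarrow> 'a) \<Rightarrow> nat \<Rightarrow> nat \<Rightarrow> 'a" where
  "seq_map n f s = (\<lambda>j. if j < n then seq_eval s (f j) else (\<lambda>_. 0))"

lemma seq_map_R:
  assumes "\<And>j. j < n \<Longrightarrow> f j \<in> mpolys m UNIV" "\<And>i. s i \<in> carrier R"
  shows "seq_map n f s j \<in> carrier R"
  unfolding seq_map_def using seq_eval_R[OF assms] R_const by simp

lemma seq_eval_seq_map: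
  assumes "q \<in> mpolys n UNIV" shows "seq_eval (seq_map n f s) q = seq_eval s (msubst q f)"
proof -
  interpret i: comm_ring_hom "id :: 'a \<Rightarrow> 'a" by (rule comm_ring_hom_id)
  have "mev id q (\<lambda>j. seq_map n f s j l) = mev id q (\<lambda>j. mev id (f j) (\<lambda>i. s i l))" for l
    by (rule mev_cong[OF assms]) (simp add: seq_map_def seq_eval_def)
  then show ?thesis unfolding seq_eval_def i.mev_msubst by simp
qed

text \<open>The equations of \<open>T\<close> pull back into the ideal of \<open>G V\<close>, so
  representatives of a point of \<open>G V\<close> are mapped to sequences that satisfy them up to
  null sequences.\<close>

lemma integral_points_local:
  assumes T: "geqs T \<subseteq> mpolys (gdim T) UNIV"
    and C: "\<And>V. V \<in> C \<Longrightarrow> geqs (G V) \<subseteq> mpolys (gdim (G V)) UNIV \<and> gs_hom UNIV (G V) T (\<phi> V)"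
  shows "integral_points T C G \<phi> P \<subseteq> local_points T P"
proof
  fix x assume "x \<in> integral_points T C G \<phi> P"
  then obtain V y where V: "V \<in> C" and y: "y \<in> gpoints K (to_completion P) (completion_integers P) (G V)"
    and x: "x = (\<lambda>j\<in>{..<gdim T}. mev_ring K (to_completion P) (\<phi> V j) y)"
    unfolding integral_points_def by blast
  have GV: "geqs (G V) \<subseteq> mpolys (gdim (G V)) UNIV" and hom: "gs_hom UNIV (G V) T (\<phi> V)" using C[OF V] by auto
  have fm: "\<phi> V j \<in> mpolys (gdim (G V)) UNIV" if "j < gdim T" for j using hom that unfolding gs_hom_def by blast
  have sub: "completion_integers P \<subseteq> carrier K" unfolding completion_integers_def by blast
  have "y i \<in> carrier K" if "i < gdim (G V)" for i using y sub that unfolding gpoints_def by auto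
  then obtain s where s: "\<And>i. s i \<in> carrier R" "\<And>i. i < gdim (G V) \<Longrightarrow> y i = cl (s i)" using seq_reps by metis
  have N: "\<And>q. q \<in> geqs (G V) \<Longrightarrow> seq_eval s q \<in> N" using y gpoints_iff[OF GV, of s y, OF s sub] by blast
  let ?s = "seq_map (gdim T) (\<phi> V) s"
  have xs: "x j = cl (?s j)" if "j < gdim T" for j
    unfolding x seq_map_def using mev_ring_cl(1)[OF fm[OF that] s] that by simp
  have "x \<in> {..<gdim T} \<rightarrow>\<^sub>E carrier K"
    using xs cl_in[OF seq_map_R[OF fm s(1)]] by (auto simp: x PiE_iff)
  moreover have "seq_eval ?s q \<in> N" if q: "q \<in> geqs T" for q
  proof -
    have "q \<in> mpolys (gdim T) UNIV" using q T by blast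
    moreover have "msubst q (\<phi> V) \<in> gideal 1 UNIV (G V)" using hom q unfolding gs_hom_def by blast
    ultimately show ?thesis using gideal_1_null[OF GV _ s(1) N] seq_eval_seq_map by metis
  qed
  ultimately show "x \<in> local_points T P"
    unfolding local_points_def by (subst gpoints_iff[OF T seq_map_R[OF fm s(1)] xs]) auto
qed

text \<open>The integral point \<open>y\<close> is the image of the rational point \<open>a\<close>
  under the inverse isomorphism. So it is rational itself, \<open>y i\<close> being the image of
  \<open>\<alpha> i\<close>, and elements of the field that are integral in the completion lie in
  \<open>P\<close>.\<close>

lemma rational_integral_point:
  assumes T: "geqs T \<subseteq> mpolys (gdim T) UNIV"
    and C: "\<And>V. V \<in> C \<Longrightarrow> geqs (G V) \<subseteq> mpolys (gdim (G V)) UNIV \<and> gs_iso UNIV (G V) T (\<phi> V)"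
    and a: "(\<lambda>i\<in>{..<gdim T}. to_completion P (a i)) \<in> integral_points T C G \<phi> P"
    and dvr: "dvr P t"
  obtains V \<alpha> where "V \<in> C" "\<And>i. i < gdim (G V) \<Longrightarrow> \<alpha> i \<in> P" "\<And>j. j < gdim T \<Longrightarrow> a j = mev id (\<phi> V j) \<alpha>"
proof -
  obtain V y where V: "V \<in> C" and y: "y \<in> gpoints K (to_completion P) (completion_integers P) (G V)"
    and x: "(\<lambda>i\<in>{..<gdim T}. to_completion P (a i)) = (\<lambda>j\<in>{..<gdim T}. mev_ring K (to_completion P) (\<phi> V j) y)"
    using a unfolding integral_points_def by blast
  have GV: "geqs (G V) \<subseteq> mpolys (gdim (G V)) UNIV" and hom: "gs_hom UNIV (G V) T (\<phi> V)"
    using C[OF V] unfolding gs_iso_def by auto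
  obtain g where g: "gs_hom UNIV T (G V) g"
      "\<And>i. i < gdim (G V) \<Longrightarrow> msubst (g i) (\<phi> V) - mvar i \<in> gideal 1 UNIV (G V)"
    using C[OF V] unfolding gs_iso_def by blast
  have fm: "\<phi> V j \<in> mpolys (gdim (G V)) UNIV" if "j < gdim T" for j using hom that unfolding gs_hom_def by blast
  have gm: "g i \<in> mpolys (gdim T) UNIV" if "i < gdim (G V)" for i using g(1) that unfolding gs_hom_def by blast
  have sub: "completion_integers P \<subseteq> carrier K" unfolding completion_integers_def by blast
  have yO: "y i \<in> completion_integers P" if "i < gdim (G V)" for i using y that unfolding gpoints_def by auto
  then have "y i \<in> carrier K" if "i < gdim (G V)" for i using sub that by blast
  then obtain s where s: "\<And>i. s i \<in> carrier R" "\<And>i. i < gdim (G V) \<Longrightarrow> y i = cl (s i)"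
    using seq_reps by metis
  have N: "\<And>q. q \<in> geqs (G V) \<Longrightarrow> seq_eval s q \<in> N" using y gpoints_iff[OF GV, of s y, OF s sub] by blast
  let ?s = "seq_map (gdim T) (\<phi> V) s"
  have xs: "to_completion P (a j) = cl (?s j)" if "j < gdim T" for j
    using fun_cong[OF x, of j] that mev_ring_cl(1)[OF fm[OF that] s] by (simp add: seq_map_def)
  define \<alpha> where "\<alpha> i = mev id (g i) a" for i
  interpret i: comm_ring_hom "id :: 'a \<Rightarrow> 'a" by (rule comm_ring_hom_id)
  have y\<alpha>: "y i = to_completion P (\<alpha> i)" if i: "i < gdim (G V)" for i
  proof -
    have "to_completion P (\<alpha> i) = mev_ring K (to_completion P) (g i) (\<lambda>j. cl (?s j))"
      unfolding \<alpha>_def using mev_ring_to_completion[OF gm[OF i], of "\<lambda>j. cl (?s j)" a] xs by simp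
    also have "\<dots> = cl (seq_eval ?s (g i))"
      by (rule mev_ring_cl(1)[OF gm[OF i] seq_map_R[OF fm s(1)]]) auto
    also have "seq_eval ?s (g i) = seq_eval s (msubst (g i) (\<phi> V))" by (rule seq_eval_seq_map[OF gm[OF i]])
    also have "cl \<dots> = cl (s i)"
    proof -
      have "seq_eval s (msubst (g i) (\<phi> V) - mvar i) \<in> N" by (rule gideal_1_null[OF GV g(2)[OF i] s(1) N])
      then have "(\<lambda>l. seq_eval s (msubst (g i) (\<phi> V)) l - s i l) \<in> N"
        unfolding seq_eval_def by (simp add: i.mev_diff i.mev_mvar)
      moreover have "seq_eval s (msubst (g i) (\<phi> V)) \<in> carrier R"
        unfolding seq_eval_seq_map[OF gm[OF i], symmetric]
        by (rule seq_eval_R[OF gm[OF i] seq_map_R[OF fm s(1)]])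
      ultimately show ?thesis using cl_eq_iff s(1) by blast
    qed
    finally show ?thesis using s(2)[OF i] by simp
  qed
  have "\<alpha> i \<in> P" if i: "i < gdim (G V)" for i
  proof -
    have "cval_ge P 0 (to_completion P (\<alpha> i))"
      using yO[OF i] y\<alpha>[OF i] unfolding completion_integers_def by simp
    then show ?thesis using dvr_val_ge_iff[OF dvr, of 0] by (simp add: cval_ge_to_completion)
  qed
  moreover have "a j = mev id (\<phi> V j) \<alpha>" if j: "j < gdim T" for j
  proof -
    have "to_completion P (a j) = mev_ring K (to_completion P) (\<phi> V j) y"
      using fun_cong[OF x, of j] j by simp
    also have "\<dots> = to_completion P (mev id (\<phi> V j) \<alpha>)" by (rule mev_ring_to_completion[OF fm[OF j] y\<alpha>])
    finally show ?thesis by (rule to_completion_inj)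
  qed
  ultimately show ?thesis using that V by blast
qed

lemma integral_pointI:
  assumes GV: "geqs (G V) \<subseteq> mpolys (gdim (G V)) UNIV" and fm: "\<And>j. j < gdim T \<Longrightarrow> \<phi> V j \<in> mpolys (gdim (G V)) UNIV"
    and V: "V \<in> C" "P \<in> V" and dvr: "dvr P t"
    and \<alpha>: "\<And>i. i < gdim (G V) \<Longrightarrow> \<alpha> i \<in> P" "\<And>q. q \<in> geqs (G V) \<Longrightarrow> mev id q \<alpha> = 0"
    and a: "\<And>j. j < gdim T \<Longrightarrow> a j = mev id (\<phi> V j) \<alpha>"
  shows "(\<lambda>i\<in>{..<gdim T}. to_completion P (a i)) \<in> integral_points T C G \<phi> P"
proof -
  let ?y = "\<lambda>i\<in>{..<gdim (G V)}. to_completion P (\<alpha> i)"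
  have sub: "completion_integers P \<subseteq> carrier K" unfolding completion_integers_def by blast
  have "to_completion P (\<alpha> i) \<in> completion_integers P" if "i < gdim (G V)" for i
    unfolding completion_integers_def using cl_in[OF R_const] \<alpha>(1)[OF that] dvr_val_ge_iff[OF dvr, of 0]
    by (simp add: to_completion_eq cval_ge_to_completion[unfolded to_completion_eq])
  moreover have "seq_eval (\<lambda>i _. \<alpha> i) q \<in> N" if "q \<in> geqs (G V)" for q
    using \<alpha>(2)[OF that] N_0 unfolding seq_eval_def by simp
  ultimately have "?y \<in> gpoints K (to_completion P) (completion_integers P) (G V)"
    by (subst gpoints_iff[OF GV _ _ sub, of "\<lambda>i _. \<alpha> i"]) (auto simp: R_const to_completion_eq)
  moreover have "(\<lambda>i\<in>{..<gdim T}. to_completion P (a i)) = (\<lambda>j\<in>{..<gdim T}. mev_ring K (to_completion P) (\<phi> V j) ?y)"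
    using mev_ring_to_completion[OF fm, of _ ?y \<alpha>] a by (intro restrict_ext) simp
  ultimately show ?thesis unfolding integral_points_def using V by blast
qed

end

subsection \<open>Splitting a torus\<close>

text \<open>\<open>f\<close> gives the coordinates of an isomorphism onto a power of the
  multiplicative group over the algebraic closure: \<open>r\<close> characters followed by their
  inverses. The inverse isomorphism recovers a point from these values.\<close>

lemma torus_characters:
  fixes T :: "'a::field gscheme"
  assumes T: "torus_over_field T"
  obtains r :: nat and f where "\<And>i. i < 2 * r \<Longrightarrow> f i \<in> mpolys (gdim T) UNIV"
    "\<And>a i. a \<in> rational_points T \<Longrightarrow> i < r \<Longrightarrow>
       mev id (f i) (\<lambda>j. to_ac (a j)) * mev id (f (r + i)) (\<lambda>j. to_ac (a j)) = 1"
    "\<And>a b. a \<in> rational_points T \<Longrightarrow> b \<in> rational_points T \<Longrightarrow>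
       (\<And>i. i < 2 * r \<Longrightarrow> mev id (f i) (\<lambda>j. to_ac (a j)) = mev id (f i) (\<lambda>j. to_ac (b j))) \<Longrightarrow> a = b"
proof -
  let ?T = "base_change to_ac T"
  obtain r f where f: "gs_iso UNIV ?T (Gm_power r) f" using T unfolding torus_over_field_def splits_over_def by blast
  then obtain g where g: "gs_hom UNIV (Gm_power r) ?T g" "\<And>i. i < gdim ?T \<Longrightarrow> msubst (g i) f - mvar i \<in> gideal 1 UNIV ?T"
    and fh: "gs_hom UNIV ?T (Gm_power r) f" unfolding gs_iso_def by blast
  have dim: "gdim ?T = gdim T" "gdim (Gm_power r :: 'a alg_closure gscheme) = 2 * r"
    by (simp_all add: base_change_def Gm_power_def)
  have TM: "geqs T \<subseteq> mpolys (gdim T) UNIV"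
    using T unfolding torus_over_field_def group_scheme_def by (simp add: Let_def)
  interpret h: comm_ring_hom "to_ac :: 'a \<Rightarrow> 'a alg_closure" by (rule comm_ring_hom_to_ac)
  interpret i: comm_ring_hom "id :: 'a alg_closure \<Rightarrow> 'a alg_closure" by (rule comm_ring_hom_id)
  have keys: "Poly_Mapping.keys (Poly_Mapping.map to_ac q) \<subseteq> Poly_Mapping.keys q" for q :: "'a mpoly"
    by (auto simp: in_keys_iff Poly_Mapping.map.rep_eq when_def split: if_splits)
  have T'M: "geqs ?T \<subseteq> mpolys (gdim ?T) UNIV"
    using TM keys unfolding dim base_change_def mpolys_def by fastforce
  have pt: "mev id q (\<lambda>j. to_ac (a j)) = 0" if a: "a \<in> rational_points T" and q: "q \<in> geqs ?T" for a q
  proof -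
    obtain q0 where q0: "q0 \<in> geqs T" "q = Poly_Mapping.map to_ac q0" using q unfolding base_change_def by auto
    have "mev id q0 a = 0" using a q0(1) unfolding rational_points_iff by blast
    then show ?thesis unfolding q0(2) h.mev_map h.mev_hom_comp by simp
  qed
  show ?thesis
  proof (rule that[of r f])
    show "f i \<in> mpolys (gdim T) UNIV" if "i < 2 * r" for i using fh that unfolding gs_hom_def dim by blast
    show "mev id (f i) (\<lambda>j. to_ac (a j)) * mev id (f (r + i)) (\<lambda>j. to_ac (a j)) = 1"
      if "a \<in> rational_points T" "i < r" for a i
    proof -
      have "mvar i * mvar (r + i) - 1 \<in> geqs (Gm_power r :: 'a alg_closure gscheme)"
        using that(2) unfolding Gm_power_def by auto
      from gs_hom_point[OF T'M fh pt[OF that(1)] this] show ?thesis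
        by (simp add: i.mev_diff i.mev_mult i.mev_mvar)
    qed
    show "a = b" if a: "a \<in> rational_points T" and b: "b \<in> rational_points T"
      and eq: "\<And>i. i < 2 * r \<Longrightarrow> mev id (f i) (\<lambda>j. to_ac (a j)) = mev id (f i) (\<lambda>j. to_ac (b j))" for a b
    proof (rule extensionalityI)
      show "a \<in> extensional {..<gdim T}" "b \<in> extensional {..<gdim T}" using a b rational_points_iff by blast+
      fix j assume "j \<in> {..<gdim T}"
      then have j: "j < gdim ?T" by (simp add: dim)
      have gj: "g j \<in> mpolys (2 * r) UNIV" using g(1) j unfolding gs_hom_def dim by blast
      have "to_ac (c j) = mev id (g j) (\<lambda>i. mev id (f i) (\<lambda>j. to_ac (c j)))" if "c \<in> rational_points T" for c
        using gs_inverse_point[OF T'M g(2)[OF j] pt[OF that]] by simp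
      then have "to_ac (a j) = to_ac (b j)" using a b mev_cong[OF gj eq, of id] by simp
      then show "a j = b j" by simp
    qed
  qed
qed

subsection \<open>Estimates\<close>

text \<open>A bound \<open>t ^ E\<close> for the denominators of a polynomial function and of its Lipschitz constant,
  uniform over the valuation rings above \<open>P\<close>.\<close>

definition lipschitz_bound ::
  "'a::field set \<Rightarrow> 'a \<Rightarrow> nat \<Rightarrow> (nat \<Rightarrow> 'a) \<Rightarrow> ((nat \<Rightarrow> 'a) \<Rightarrow> 'a alg_closure) \<Rightarrow> nat \<Rightarrow> bool" where
  "lipschitz_bound P t n c \<Psi> E \<longleftrightarrow> (\<forall>W. valuation_set W \<longrightarrow> to_ac ` P \<subseteq> W \<longrightarrow>
     (\<forall>a. (\<forall>j<n. a j - c j \<in> P) \<longrightarrow> to_ac t ^ E * \<Psi> a \<in> W) \<and>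
     (\<forall>a b l. (\<forall>j<n. a j - c j \<in> P) \<longrightarrow> (\<forall>j<n. b j - c j \<in> P) \<longrightarrow>
        (\<forall>j<n. (a j - b j) / t ^ l \<in> P) \<longrightarrow> to_ac t ^ E * (\<Psi> a - \<Psi> b) / to_ac t ^ l \<in> W))"

definition lipschitz :: "'a::field set \<Rightarrow> 'a \<Rightarrow> nat \<Rightarrow> (nat \<Rightarrow> 'a) \<Rightarrow> ((nat \<Rightarrow> 'a) \<Rightarrow> 'a alg_closure) \<Rightarrow> bool" where
  "lipschitz P t n c \<Psi> \<longleftrightarrow> (\<exists>E. lipschitz_bound P t n c \<Psi> E)"

lemma lipschitz_boundD:
  assumes "lipschitz_bound P t n c \<Psi> E" "valuation_set W" "to_ac ` P \<subseteq> W"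
  shows "\<forall>j<n. a j - c j \<in> P \<Longrightarrow> to_ac t ^ E * \<Psi> a \<in> W"
    "\<forall>j<n. a j - c j \<in> P \<Longrightarrow> \<forall>j<n. b j - c j \<in> P \<Longrightarrow> \<forall>j<n. (a j - b j) / t ^ l \<in> P \<Longrightarrow>
       to_ac t ^ E * (\<Psi> a - \<Psi> b) / to_ac t ^ l \<in> W"
  using assms unfolding lipschitz_bound_def by blast+

context
  fixes P :: "'a::field set" and t :: 'a and n :: nat and c :: "nat \<Rightarrow> 'a"
  assumes P: "dvr P t"
begin

lemma lipschitz_add:
  assumes "lipschitz P t n c \<Psi>" "lipschitz P t n c \<Theta>"
  shows "lipschitz P t n c (\<lambda>a. \<Psi> a + \<Theta> a)"
proof -
  obtain D where D: "lipschitz_bound P t n c \<Psi> D" using assms(1) unfolding lipschitz_def by blast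
  obtain E where E: "lipschitz_bound P t n c \<Theta> E" using assms(2) unfolding lipschitz_def by blast
  show ?thesis unfolding lipschitz_def lipschitz_bound_def
  proof (intro exI[of _ "D + E"] allI impI conjI)
    fix W assume W: "valuation_set W" "to_ac ` P \<subseteq> W"
    note R = valuation_setD[OF W(1)]
    have tW: "to_ac t ^ m \<in> W" for m using W(2) dvrD(5)[OF P] R by (auto intro: ring_set_power)
    fix a assume a: "\<forall>j<n. a j - c j \<in> P"
    have "to_ac t ^ E * (to_ac t ^ D * \<Psi> a) + to_ac t ^ D * (to_ac t ^ E * \<Theta> a) \<in> W"
      by (rule ring_set_add[OF R ring_set_mult[OF R tW lipschitz_boundD(1)[OF D W]] ring_set_mult[OF R tW lipschitz_boundD(1)[OF E W]]])
        (use a in auto)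
    then show "to_ac t ^ (D + E) * (\<Psi> a + \<Theta> a) \<in> W" by (simp add: power_add algebra_simps)
    fix b l assume b: "\<forall>j<n. b j - c j \<in> P" and ab: "\<forall>j<n. (a j - b j) / t ^ l \<in> P"
    have "to_ac t ^ E * (to_ac t ^ D * (\<Psi> a - \<Psi> b) / to_ac t ^ l) + to_ac t ^ D * (to_ac t ^ E * (\<Theta> a - \<Theta> b) / to_ac t ^ l) \<in> W"
      by (rule ring_set_add[OF R ring_set_mult[OF R tW lipschitz_boundD(2)[OF D W]] ring_set_mult[OF R tW lipschitz_boundD(2)[OF E W]]])
        (use a b ab in auto)
    also have "to_ac t ^ E * (to_ac t ^ D * (\<Psi> a - \<Psi> b) / to_ac t ^ l) + to_ac t ^ D * (to_ac t ^ E * (\<Theta> a - \<Theta> b) / to_ac t ^ l)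
      = (to_ac t ^ E * (to_ac t ^ D * (\<Psi> a - \<Psi> b)) + to_ac t ^ D * (to_ac t ^ E * (\<Theta> a - \<Theta> b))) / to_ac t ^ l"
      by (simp add: add_divide_distrib)
    also have "to_ac t ^ E * (to_ac t ^ D * (\<Psi> a - \<Psi> b)) + to_ac t ^ D * (to_ac t ^ E * (\<Theta> a - \<Theta> b))
      = to_ac t ^ (D + E) * (\<Psi> a + \<Theta> a - (\<Psi> b + \<Theta> b))" by (simp add: power_add algebra_simps)
    finally show "to_ac t ^ (D + E) * (\<Psi> a + \<Theta> a - (\<Psi> b + \<Theta> b)) / to_ac t ^ l \<in> W" .
  qed
qed

text \<open>The product rule: the difference of products is \<open>(\<Psi> a - \<Psi> b) * \<Theta>
  a + \<Psi> b * (\<Theta> a - \<Theta> b)\<close>. Each term uses one bound for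
  \<open>\<Psi>\<close> and one for \<open>\<Theta>\<close>, so the exponents add.\<close>

lemma lipschitz_mult:
  assumes "lipschitz P t n c \<Psi>" "lipschitz P t n c \<Theta>"
  shows "lipschitz P t n c (\<lambda>a. \<Psi> a * \<Theta> a)"
proof -
  obtain D where D: "lipschitz_bound P t n c \<Psi> D" using assms(1) unfolding lipschitz_def by blast
  obtain E where E: "lipschitz_bound P t n c \<Theta> E" using assms(2) unfolding lipschitz_def by blast
  show ?thesis unfolding lipschitz_def lipschitz_bound_def
  proof (intro exI[of _ "D + E"] allI impI conjI)
    fix W assume W: "valuation_set W" "to_ac ` P \<subseteq> W"
    note R = valuation_setD[OF W(1)]
    fix a assume a: "\<forall>j<n. a j - c j \<in> P"
    have "(to_ac t ^ D * \<Psi> a) * (to_ac t ^ E * \<Theta> a) \<in> W"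
      by (rule ring_set_mult[OF R lipschitz_boundD(1)[OF D W] lipschitz_boundD(1)[OF E W]]) (use a in auto)
    then show "to_ac t ^ (D + E) * (\<Psi> a * \<Theta> a) \<in> W" by (simp add: power_add mult_ac)
    fix b l assume b: "\<forall>j<n. b j - c j \<in> P" and ab: "\<forall>j<n. (a j - b j) / t ^ l \<in> P"
    have "(to_ac t ^ E * \<Theta> a) * (to_ac t ^ D * (\<Psi> a - \<Psi> b) / to_ac t ^ l)
      + (to_ac t ^ D * \<Psi> b) * (to_ac t ^ E * (\<Theta> a - \<Theta> b) / to_ac t ^ l) \<in> W"
      by (rule ring_set_add[OF R ring_set_mult[OF R lipschitz_boundD(1)[OF E W] lipschitz_boundD(2)[OF D W]] ring_set_mult[OF R lipschitz_boundD(1)[OF D W] lipschitz_boundD(2)[OF E W]]])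
        (use a b ab in auto)
    also have "(to_ac t ^ E * \<Theta> a) * (to_ac t ^ D * (\<Psi> a - \<Psi> b) / to_ac t ^ l)
      + (to_ac t ^ D * \<Psi> b) * (to_ac t ^ E * (\<Theta> a - \<Theta> b) / to_ac t ^ l)
      = ((to_ac t ^ E * \<Theta> a) * (to_ac t ^ D * (\<Psi> a - \<Psi> b)) + (to_ac t ^ D * \<Psi> b) * (to_ac t ^ E * (\<Theta> a - \<Theta> b))) / to_ac t ^ l"
      by (simp add: add_divide_distrib)
    also have "(to_ac t ^ E * \<Theta> a) * (to_ac t ^ D * (\<Psi> a - \<Psi> b)) + (to_ac t ^ D * \<Psi> b) * (to_ac t ^ E * (\<Theta> a - \<Theta> b))
      = to_ac t ^ (D + E) * (\<Psi> a * \<Theta> a - \<Psi> b * \<Theta> b)" by (simp add: power_add algebra_simps)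
    finally show "to_ac t ^ (D + E) * (\<Psi> a * \<Theta> a - \<Psi> b * \<Theta> b) / to_ac t ^ l \<in> W" .
  qed
qed

lemma dvr_clear_denominator: "\<exists>E. t ^ E * x \<in> P"
proof (cases "x = 0")
  case False
  then obtain l u where u: "u \<in> units_of_set P" "x = u * t powi l" using P unfolding dvr_def by blast
  define m where "m = nat (- l)"
  have "t ^ m * x = u * t powi (int m + l)"
    unfolding u(2) using dvrD(3)[OF P] by (simp add: power_int_add)
  moreover have "int m + l \<ge> 0" unfolding m_def by simp
  ultimately have "t ^ m * x \<in> P" using dvr_powi_in_iff[OF P u(1)] by simp
  then show ?thesis by blast
qed (use dvrD(1)[OF P] in auto)

text \<open>\<open>d\<close> is algebraic over the fraction field of \<open>P\<close>, so one
  denominator from \<open>P\<close> works in all valuation rings above \<open>P\<close>, and this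
  denominator divides a power of \<open>t\<close>.\<close>

lemma lipschitz_const: "lipschitz P t n c (\<lambda>_. d)"
proof -
  note D = dvrD[OF P]
  interpret h: comm_ring_hom "to_ac :: 'a \<Rightarrow> 'a alg_closure" by (rule comm_ring_hom_to_ac)
  have R': "ring_set (to_ac ` P)" unfolding ring_set_def
    using D(1) by (auto simp: image_iff simp flip: to_ac_diff to_ac_mult intro: bexI[of _ 1] ring_set_diff ring_set_mult)
  have "alg_over (fracs (to_ac ` P)) d"
  proof -
    obtain p where p: "p \<noteq> 0" "poly (map_poly to_ac p) d = 0" by (rule alg_closure_algebraic)
    have "to_ac x \<in> fracs (to_ac ` P)" for x
    proof -
      obtain E where E: "t ^ E * x \<in> P" using dvr_clear_denominator by blast
      have eq: "to_ac x = to_ac (t ^ E * x) / to_ac (t ^ E)" using D(3) by simp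
      have tE: "t ^ E \<in> P" using D by (intro ring_set_power)
      have nz: "to_ac (t ^ E) \<noteq> 0" using D(3) by simp
      show ?thesis unfolding fracs_def
        by (rule CollectI, rule exI, rule exI, rule conjI[OF eq conjI[OF imageI[OF E] conjI[OF imageI[OF tE] nz]]])
    qed
    moreover have "map_poly to_ac p \<noteq> 0" using p(1) by (simp add: map_poly_eq_0_iff)
    ultimately show ?thesis unfolding alg_over_def using p(2)
      by (intro exI[of _ "map_poly to_ac p"]) (simp add: coeff_map_poly)
  qed
  then obtain e where e: "e \<in> to_ac ` P" "e \<noteq> 0" "\<And>W. valuation_set W \<Longrightarrow> to_ac ` P \<subseteq> W \<Longrightarrow> e * d \<in> W"
    using alg_over_denominator[OF R' alg_over_fracs[OF R']] by metis
  obtain e0 where e0: "e0 \<in> P" "e = to_ac e0" using e(1) by blast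
  obtain E where E: "t ^ E * inverse e0 \<in> P" using dvr_clear_denominator by blast
  have "to_ac t ^ E * d \<in> W" if W: "valuation_set W" "to_ac ` P \<subseteq> W" for W
  proof -
    have "to_ac (t ^ E * inverse e0) * (e * d) \<in> W"
      by (rule ring_set_mult[OF valuation_setD[OF W(1)] subsetD[OF W(2) imageI[OF E]] e(3)[OF W]])
    also have "to_ac (t ^ E * inverse e0) * (e * d) = to_ac t ^ E * d" using e(2) unfolding e0(2) by (simp add: field_simps)
    finally show ?thesis .
  qed
  then show ?thesis unfolding lipschitz_def lipschitz_bound_def using valuation_setD ring_set_0 by (intro exI[of _ E]) auto
qed

text \<open>The exponent clears the denominator of \<open>c j\<close>; a point congruent to
  \<open>c\<close> modulo \<open>P\<close> has no worse denominators.\<close>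

lemma lipschitz_coord:
  assumes j: "j < n" shows "lipschitz P t n c (\<lambda>a. to_ac (a j))"
proof -
  note D = dvrD[OF P]
  obtain E where E: "t ^ E * c j \<in> P" using dvr_clear_denominator by blast
  have tE: "t ^ E \<in> P" using D by (intro ring_set_power)
  show ?thesis unfolding lipschitz_def lipschitz_bound_def
  proof (intro exI[of _ E] allI impI conjI)
    fix W assume W: "valuation_set W" "to_ac ` P \<subseteq> W"
    fix a assume a: "\<forall>j<n. a j - c j \<in> P"
    have "t ^ E * (a j - c j) + t ^ E * c j \<in> P"
      by (rule ring_set_add[OF D(1) ring_set_mult[OF D(1) tE] E]) (use a j in auto)
    then have "t ^ E * a j \<in> P" by (simp add: algebra_simps)
    then have "to_ac (t ^ E * a j) \<in> W" using W by blast
    then show "to_ac t ^ E * to_ac (a j) \<in> W" by simp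
    fix b l assume "\<forall>j<n. (a j - b j) / t ^ l \<in> P"
    then have "t ^ E * ((a j - b j) / t ^ l) \<in> P" using j by (intro ring_set_mult[OF D(1) tE]) auto
    then have "to_ac (t ^ E * ((a j - b j) / t ^ l)) \<in> W" using W by blast
    then show "to_ac t ^ E * (to_ac (a j) - to_ac (b j)) / to_ac t ^ l \<in> W" by simp
  qed
qed

lemma lipschitz_sum:
  "(\<And>i. i \<in> I \<Longrightarrow> lipschitz P t n c (\<Psi> i)) \<Longrightarrow> lipschitz P t n c (\<lambda>a. \<Sum>i\<in>I. \<Psi> i a)"
  by (induction I rule: infinite_finite_induct) (auto intro: lipschitz_add lipschitz_const)

lemma lipschitz_prod:
  "(\<And>i. i \<in> I \<Longrightarrow> lipschitz P t n c (\<Psi> i)) \<Longrightarrow> lipschitz P t n c (\<lambda>a. \<Prod>i\<in>I. \<Psi> i a)"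
  by (induction I rule: infinite_finite_induct) (auto intro: lipschitz_mult lipschitz_const)

lemma lipschitz_power: "lipschitz P t n c \<Psi> \<Longrightarrow> lipschitz P t n c (\<lambda>a. \<Psi> a ^ l)"
  by (induction l) (auto intro: lipschitz_mult lipschitz_const)

lemma lipschitz_mev:
  assumes p: "p \<in> mpolys n UNIV" shows "lipschitz P t n c (\<lambda>a. mev id p (\<lambda>j. to_ac (a j)))"
  unfolding mev_def
proof (intro lipschitz_sum lipschitz_mult lipschitz_const lipschitz_prod lipschitz_power lipschitz_coord)
  fix m i assume "m \<in> Poly_Mapping.keys p" "i \<in> Poly_Mapping.keys m"
  then show "i < n" using p unfolding mpolys_def by blast
qed

end

section \<open>Discreteness\<close>

subsection \<open>Passing to the algebraic closure\<close>

lemma ring_set_to_ac: "ring_set R \<Longrightarrow> ring_set (to_ac ` R)"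
  unfolding ring_set_def by (auto simp: image_iff simp flip: to_ac_diff to_ac_mult intro: bexI[of _ 1])

lemma field_set_to_ac:
  assumes "field_set F" shows "field_set (to_ac ` F)"
  unfolding field_set_def
  using ring_set_to_ac[OF field_setD[OF assms]] field_set_inverse[OF assms] by (auto simp flip: to_ac_inverse)

lemma valuation_set_vimage:
  fixes W :: "'a::field alg_closure set"
  assumes "valuation_set W" shows "valuation_set (to_ac -` W)"
  using assms unfolding valuation_set_def ring_set_def by simp

lemma max_ideal_vimage: "max_ideal (to_ac -` W) = to_ac -` max_ideal W"
  unfolding max_ideal_def by auto

lemma alg_over_to_ac:
  assumes "alg_over R x" shows "alg_over (to_ac ` R) (to_ac x)"
proof -
  obtain p where p: "p \<noteq> 0" "\<forall>i. coeff p i \<in> R" "poly p x = 0" using assms unfolding alg_over_def by blast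
  have "poly (map_poly to_ac p) (to_ac x) = to_ac (poly p x)"
    unfolding poly_altdef by (simp add: to_ac_sum coeff_map_poly degree_map_poly)
  moreover have "map_poly to_ac p \<noteq> 0" using p(1) by (simp add: map_poly_eq_0_iff)
  ultimately show ?thesis unfolding alg_over_def using p
    by (intro exI[of _ "map_poly to_ac p"]) (simp add: coeff_map_poly)
qed

lemma alg_over_range_to_ac: "alg_over (range to_ac) (d :: 'a::field alg_closure)"
proof -
  obtain p where "p \<noteq> 0" "poly (map_poly to_ac p) d = 0" by (rule alg_closure_algebraic)
  then show ?thesis unfolding alg_over_def
    by (intro exI[of _ "map_poly to_ac p"]) (simp add: coeff_map_poly map_poly_eq_0_iff)
qed

lemma field_set_range_to_ac: "field_set (range (to_ac :: 'a::field \<Rightarrow> _))"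
  by (rule field_set_to_ac) (simp add: field_set_def ring_set_def)

text \<open>\<open>Z\<close> holds the coefficients of an equation for \<open>c\<close> and the
  inverse of the leading one, so \<open>c\<close> is integral wherever \<open>Z\<close> is. The
  element 0 covers the coefficients beyond the degree.\<close>

lemma integral_over_subset:
  fixes c :: "'a::field alg_closure"
  obtains Z where "finite Z" "\<And>P W. Z \<subseteq> P \<Longrightarrow> valuation_set W \<Longrightarrow> to_ac ` P \<subseteq> W \<Longrightarrow> c \<in> W"
proof -
  obtain p where p: "p \<noteq> 0" "poly (map_poly to_ac p) c = 0" by (rule alg_closure_algebraic)
  let ?Z = "insert 0 (insert (inverse (lead_coeff p)) (coeff p ` {..degree p}))"
  have "c \<in> W" if P: "?Z \<subseteq> P" and W: "valuation_set W" "to_ac ` P \<subseteq> W" for P W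
  proof (rule root_in_valuation_set[OF W(1) _ _ p(2)])
    have cP: "coeff p i \<in> P" for i using P by (cases "i \<le> degree p") (auto simp: coeff_eq_0)
    then show "coeff (map_poly to_ac p) i \<in> W" for i using W(2) by (auto simp: coeff_map_poly)
    have "to_ac (inverse (lead_coeff p)) \<in> W" "to_ac (lead_coeff p) \<in> W" using P cP W(2) by blast+
    moreover have "lead_coeff (map_poly to_ac p) = to_ac (lead_coeff p)"
      using p(1) by (simp add: coeff_map_poly degree_map_poly)
    ultimately show "lead_coeff (map_poly to_ac p) \<in> units_of_set W"
      using p(1) by (simp add: units_of_set_def)
  qed
  then show ?thesis using that[of ?Z] by blast
qed

lemma mev_mem:
  assumes S: "ring_set S" and p: "p \<in> mpolys n UNIV" "\<And>m. m \<in> Poly_Mapping.keys p \<Longrightarrow> Poly_Mapping.lookup p m \<in> S"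
    and x: "\<And>i. i < n \<Longrightarrow> x i \<in> S"
  shows "mev id p x \<in> S"
  unfolding mev_def
proof (intro ring_set_sum[OF S] ring_set_mult[OF S] ring_set_prod[OF S] ring_set_power[OF S])
  fix m i assume "m \<in> Poly_Mapping.keys p" "i \<in> Poly_Mapping.keys m"
  then show "x i \<in> S" using p(1) x unfolding mpolys_def by blast
qed (use p in auto)

definition mcoeffs :: "'a::zero mpoly \<Rightarrow> 'a set" where
  "mcoeffs p = Poly_Mapping.lookup p ` Poly_Mapping.keys p"

lemma finite_mcoeffs: "finite (mcoeffs p)" unfolding mcoeffs_def by simp

context curve
begin

lemma closed_pointsD:
  assumes U: "openin (zariski \<X>) U" and P: "P \<in> closed_points \<X> U"
  shows "P \<in> U" "\<exists>i p. is_point i p P"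
proof -
  show 1: "P \<in> U" using P unfolding closed_points_def by blast
  obtain i p where "is_point i p P" using open_point[OF U 1] by blast
  then show "\<exists>i p. is_point i p P" by blast
qed

text \<open>\<open>L\<close> is the function field with the elements of \<open>c\<close> adjoined.
  Finiteness is needed over \<open>k(g)\<close> for several \<open>g\<close> with one and the same
  \<open>L\<close>, namely for a parameter at a point of \<open>U\<close> and for the functions that
  detect the points outside \<open>U\<close>.\<close>

lemma exists_splitting_field:
  fixes c :: "'a alg_closure set"
  assumes c: "finite c"
  obtains L where "field_set L" "range to_ac \<subseteq> L" "c \<subseteq> L"
    "\<And>g. \<not> alg_over (to_ac ` k) (to_ac g) \<Longrightarrow> finite_over (ratfuns (to_ac ` k) (to_ac g)) L"
proof -
  obtain i where i: "i \<in> chart_index \<X>" using chart_index_ex .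
  then obtain z where z: "curve_chart k (chart \<X> i) (chart_gens \<X> i) z" using chart_curve by blast
  interpret cc: curve_chart k "chart \<X> i" "chart_gens \<X> i" z by (rule z)
  let ?k = "to_ac ` k" and ?z = "to_ac z"
  note k' = field_set_to_ac[OF k]
  have sub: "to_ac ` ratfuns k z \<subseteq> ratfuns ?k ?z"
  proof -
    have "ratfuns k z \<subseteq> to_ac -` ratfuns ?k ?z"
    proof (rule ratfuns_subset)
      show "field_set (to_ac -` ratfuns ?k ?z)"
        using field_set_ratfuns[OF k', of ?z] unfolding field_set_def ring_set_def by simp
      show "k \<subseteq> to_ac -` ratfuns ?k ?z" "z \<in> to_ac -` ratfuns ?k ?z" using ratfuns_superset[OF k'] by auto
    qed
    then show ?thesis by blast
  qed
  have algz: "alg_over (ratfuns ?k ?z) (to_ac x)" for x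
    using alg_over_mono[OF alg_over_to_ac[OF cc.alg_over_z] sub] .
  have finY: "finite (to_ac ` chart_gens \<X> i)" using cc.Y(1) by blast
  obtain L0 where L0: "field_set L0" "ratfuns ?k ?z \<subseteq> L0" "to_ac ` chart_gens \<X> i \<subseteq> L0" "finite_over (ratfuns ?k ?z) L0"
    by (rule finite_alg_extension[OF field_set_ratfuns[OF k', of ?z] finY]) (use algz in auto)
  have ran: "range to_ac \<subseteq> S" if S: "field_set S" "?k \<subseteq> S" "to_ac ` chart_gens \<X> i \<subseteq> S" for S
  proof -
    have "UNIV \<subseteq> to_ac -` S"
    proof (rule cc.field_superset_UNIV)
      show "field_set (to_ac -` S)" using S(1) unfolding field_set_def ring_set_def by simp
    qed (use S in auto)
    then show ?thesis by blast
  qed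
  have "range to_ac \<subseteq> L0" using L0 ratfuns_superset(1)[OF k'] by (intro ran) blast+
  \<comment> \<open>Every element of \<Omega> is algebraic over the function field, and the latter
    lies in a finite extension of \<open>k(z)\<close>.\<close>
  then have algc: "alg_over (ratfuns ?k ?z) x" for x
    using alg_over_tower[OF field_set_ratfuns[OF k'] L0(1,4) alg_over_mono[OF alg_over_range_to_ac]] by blast
  let ?Y = "to_ac ` chart_gens \<X> i \<union> c"
  have Y: "finite ?Y" using finY c by blast
  obtain L where L: "field_set L" "ratfuns ?k ?z \<subseteq> L" "?Y \<subseteq> L"
    "\<And>S. ring_set S \<Longrightarrow> ratfuns ?k ?z \<subseteq> S \<Longrightarrow> ?Y \<subseteq> S \<Longrightarrow> L \<subseteq> S"
    by (rule finite_alg_extension[OF field_set_ratfuns[OF k', of ?z] Y algc]) auto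
  have "finite_over (ratfuns ?k (to_ac g)) L" if g: "\<not> alg_over ?k (to_ac g)" for g
  proof (rule finite_over_ratfuns_change[OF k' Y algc g algc])
    fix S assume S: "field_set S" "?k \<subseteq> S" "?z \<in> S" "?Y \<subseteq> S"
    then show "L \<subseteq> S" by (intro L(4) field_setD ratfuns_subset)
  qed
  moreover have "range to_ac \<subseteq> L" using L ratfuns_superset(1)[OF k'] by (intro ran) blast+
  ultimately show ?thesis using that L(1,3) by blast
qed

end

subsection \<open>The restricted product\<close>

lemma restricted_product_basic_open:
  assumes "finite S" "S \<subseteq> I" "I - J \<subseteq> S" "\<And>i. i \<in> S \<Longrightarrow> openin (Y i) (B i)"
  shows "openin (restricted_product I Y J M) (Pi\<^sub>E I (\<lambda>i. if i \<in> S then B i else M i))"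
  unfolding restricted_product_def
  by (intro topology_generated_by_Basis CollectI exI[of _ "\<lambda>i. if i \<in> S then B i else M i"] conjI refl exI[of _ S])
    (use assms in auto)

text \<open>A point outside \<open>D\<close> has a neighbourhood with at most one point
  \<open>e\<close> of \<open>D\<close>, and separation removes \<open>e\<close>. At a point of
  \<open>D\<close> such a neighbourhood isolates it.\<close>

lemma closed_discrete_if_locally_subsingleton:
  assumes D: "D \<subseteq> topspace Y"
    and loc: "\<And>x. x \<in> topspace Y \<Longrightarrow> \<exists>N e. openin Y N \<and> x \<in> N \<and> D \<inter> N \<subseteq> {e}"
    and sep: "\<And>x d. x \<in> topspace Y \<Longrightarrow> d \<in> D \<Longrightarrow> x \<noteq> d \<Longrightarrow> \<exists>N. openin Y N \<and> x \<in> N \<and> d \<notin> N"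
  shows "closedin Y D \<and> subtopology Y D = discrete_topology D"
proof
  have "openin Y (topspace Y - D)"
  proof (subst openin_subopen, intro ballI)
    fix x assume x: "x \<in> topspace Y - D"
    then obtain N e where N: "openin Y N" "x \<in> N" "D \<inter> N \<subseteq> {e}" using loc by blast
    show "\<exists>N. openin Y N \<and> x \<in> N \<and> N \<subseteq> topspace Y - D"
    proof (cases "e \<in> D")
      case True
      then obtain V where V: "openin Y V" "x \<in> V" "e \<notin> V" using sep[of x e] x by blast
      have "openin Y (N \<inter> V)" using N(1) V(1) by blast
      moreover have "N \<inter> V \<subseteq> topspace Y - D" using N(3) V(3) openin_subset[OF N(1)] by blast
      ultimately show ?thesis using N(2) V(2) by blast
    next
      case False
      then show ?thesis using N openin_subset[OF N(1)] by blast
    qed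
  qed
  then show "closedin Y D" using D unfolding closedin_def by blast
  have "openin (subtopology Y D) {d}" if d: "d \<in> D" for d
  proof -
    obtain N e where N: "openin Y N" "d \<in> N" "D \<inter> N \<subseteq> {e}" using loc[of d] d D by blast
    then have "{d} = N \<inter> D" using d by blast
    then show ?thesis unfolding openin_subtopology using N(1) by blast
  qed
  moreover have "topspace (subtopology Y D) = D" using D by auto
  ultimately show "subtopology Y D = discrete_topology D"
    by (metis discrete_topology_unique)
qed

subsection \<open>Congruent rational points\<close>

text \<open>As \<open>\<Psi> b * \<Theta> b = 1\<close>, the numerator is
  \<open>(\<Psi> a - \<Psi> b) * \<Theta> b\<close>. The surplus \<open>D\<close> in the congruence
  pays for the denominators of both factors.\<close>

lemma lipschitz_product_close:
  assumes P: "dvr P t" and W: "valuation_set W" "to_ac ` P \<subseteq> W"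
    and b1: "lipschitz_bound P t n c \<Psi> E" and b2: "lipschitz_bound P t n c \<Theta> E'" and D: "E + E' \<le> D"
    and a: "\<forall>j<n. a j - c j \<in> P" and b: "\<forall>j<n. b j - c j \<in> P" and ab: "\<forall>j<n. (a j - b j) / t ^ (D + l) \<in> P"
    and inv: "\<Psi> b * \<Theta> b = 1"
  shows "(\<Psi> a * \<Theta> b - 1) / to_ac t ^ l \<in> W"
proof -
  note R = valuation_setD[OF W(1)]
  define s where "s = to_ac t"
  have s: "s \<noteq> 0" "s \<in> W" using dvrD[OF P] W(2) unfolding s_def by auto
  have 1: "s ^ E * (\<Psi> a - \<Psi> b) / s ^ (D + l) \<in> W"
    unfolding s_def by (rule lipschitz_boundD(2)[OF b1 W a b ab])
  have 2: "s ^ E' * \<Theta> b \<in> W" unfolding s_def by (rule lipschitz_boundD(1)[OF b2 W b])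
  have 3: "s ^ (D - (E + E')) * ((s ^ E * (\<Psi> a - \<Psi> b) / s ^ (D + l)) * (s ^ E' * \<Theta> b)) \<in> W"
    by (intro ring_set_mult[OF R ring_set_power[OF R s(2)] ring_set_mult[OF R 1 2]])
  have D': "s ^ D = s ^ (D - (E + E')) * s ^ E * s ^ E'" using D by (simp flip: power_add)
  have "s ^ (D - (E + E')) * ((s ^ E * (\<Psi> a - \<Psi> b) / s ^ (D + l)) * (s ^ E' * \<Theta> b))
    = (s ^ (D - (E + E')) * s ^ E * s ^ E') * ((\<Psi> a - \<Psi> b) * \<Theta> b) / (s ^ D * s ^ l)"
    by (simp add: power_add)
  also have "\<dots> = ((\<Psi> a - \<Psi> b) * \<Theta> b) / s ^ l" unfolding D'[symmetric] using s(1) by simp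
  also have "(\<Psi> a - \<Psi> b) * \<Theta> b = \<Psi> a * \<Theta> b - 1" using inv by (simp add: algebra_simps)
  finally show ?thesis using 3 unfolding s_def by simp
qed

section \<open>Rational points and a fixed model of the torus\<close>

locale torus_model = curve \<X> for \<X> :: "('k::field_char_0, 'a::field) pscheme" +
  fixes U U0 :: "'a set set" and T :: "'a gscheme" and C :: "'a set set set"
    and G :: "'a set set \<Rightarrow> 'a gscheme" and \<phi> :: "'a set set \<Rightarrow> nat \<Rightarrow> 'a mpoly"
  assumes U: "openin (zariski \<X>) U" "U \<noteq> {}"
    and U0: "openin (zariski \<X>) U0" "U0 \<noteq> {}" "U0 \<subseteq> U"
    and T: "torus_over_field T" and ext: "torus_extending \<X> U0 T C G \<phi>"
begin

abbreviation "I \<equiv> closed_points \<X> U"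
abbreviation "J \<equiv> closed_points \<X> U0"
abbreviation "M \<equiv> integral_points T C G \<phi>"
abbreviation diag :: "(nat \<Rightarrow> 'a) \<Rightarrow> 'a set \<Rightarrow> nat \<Rightarrow> (nat \<Rightarrow> 'a) set" where
  "diag a P \<equiv> \<lambda>i\<in>{..<gdim T}. to_completion P (a i)"

lemma TM: "geqs T \<subseteq> mpolys (gdim T) UNIV"
  using T unfolding torus_over_field_def group_scheme_def by (simp add: Let_def)

lemma C_props: "finite C" "\<Union>C = U0"
  and GM: "V \<in> C \<Longrightarrow> geqs (G V) \<subseteq> mpolys (gdim (G V)) UNIV \<and> gs_iso UNIV (G V) T (\<phi> V)"
proof -
  show "finite C" "\<Union>C = U0" using ext unfolding torus_extending_def by blast+
  assume V: "V \<in> C"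
  have "geqs (G V) \<subseteq> mpolys (gdim (G V)) (sections V)"
    using ext V unfolding torus_extending_def torus_over_ring_def group_scheme_def by (simp add: Let_def)
  also have "\<dots> \<subseteq> mpolys (gdim (G V)) UNIV" by (intro mpolys_mono) simp
  finally show "geqs (G V) \<subseteq> mpolys (gdim (G V)) UNIV \<and> gs_iso UNIV (G V) T (\<phi> V)"
    using ext V unfolding torus_extending_def by blast
qed

lemma \<phi>M: "V \<in> C \<Longrightarrow> j < gdim T \<Longrightarrow> \<phi> V j \<in> mpolys (gdim (G V)) UNIV"
  using GM unfolding gs_iso_def gs_hom_def by blast

lemma I_point: "P \<in> I \<Longrightarrow> \<exists>i p. is_point i p P" by (rule closed_pointsD(2)[OF U(1)])

lemma I_valued: "P \<in> I \<Longrightarrow> valued P" using I_point point_valued by blast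

lemma I_dvr: "P \<in> I \<Longrightarrow> uniformizer P t \<Longrightarrow> dvr P t" using I_point point_dvr by blast

text \<open>The order of the quantifiers matters. \<open>S\<close> is fixed before \<open>c\<close>,
  since the neighbourhood in which \<open>c\<close> is found already refers to \<open>S\<close>; the
  exponents \<open>n\<close> depend on \<open>c\<close> through the denominators of the characters
  near \<open>c\<close>.\<close>

lemma congruent_rational_points_eq:
  assumes unif: "\<And>P. P \<in> I \<Longrightarrow> \<exists>t. uniformizer P t" and v0: "v0 \<in> I" and S0: "finite S0" "S0 \<subseteq> I"
  obtains S where "finite S" "S0 \<subseteq> S" "S \<subseteq> I"
    "\<And>c. \<exists>n. \<forall>a\<in>rational_points T. \<forall>b\<in>rational_points T.
      (\<forall>P\<in>S. \<forall>j<gdim T. val_ge P 0 (a j - c j) \<and> val_ge P 0 (b j - c j) \<and> val_ge P (n P) (a j - b j)) \<longrightarrow>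
      (\<forall>P\<in>I - S. diag a P \<in> M P \<and> diag b P \<in> M P) \<longrightarrow> a = b"
proof -
  obtain tt where tt: "\<And>P. P \<in> I \<Longrightarrow> dvr P (tt P)" using unif I_dvr by metis
  obtain r :: nat and f where f: "\<And>i. i < 2 * r \<Longrightarrow> f i \<in> mpolys (gdim T) UNIV"
    and f_inv: "\<And>a i. a \<in> rational_points T \<Longrightarrow> i < r \<Longrightarrow>
       mev id (f i) (\<lambda>j. to_ac (a j)) * mev id (f (r + i)) (\<lambda>j. to_ac (a j)) = 1"
    and f_inj: "\<And>a b. a \<in> rational_points T \<Longrightarrow> b \<in> rational_points T \<Longrightarrow>
       (\<And>i. i < 2 * r \<Longrightarrow> mev id (f i) (\<lambda>j. to_ac (a j)) = mev id (f i) (\<lambda>j. to_ac (b j))) \<Longrightarrow> a = b"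
    by (rule torus_characters[OF T]) blast
  define \<chi> where "\<chi> i a = mev id (f i) (\<lambda>j. to_ac (a j))" for i and a :: "nat \<Rightarrow> 'a"
  \<comment> \<open>the character inverse to \<open>\<chi> i\<close> is \<open>\<chi> (dual i)\<close>\<close>
  define dual where "dual i = (if i < r then r + i else i - r)" for i
  have dual: "dual i < 2 * r" if "i < 2 * r" for i using that unfolding dual_def by auto
  have \<chi>_dual: "\<chi> i a * \<chi> (dual i) a = 1" if "i < 2 * r" "a \<in> rational_points T" for i a
  proof (cases "i < r")
    case True
    then show ?thesis using f_inv[OF that(2) True] unfolding \<chi>_def dual_def by simp
  next
    case False
    then have "i - r < r" "r + (i - r) = i" using that(1) by auto
    then show ?thesis using f_inv[OF that(2), of "i - r"] False unfolding \<chi>_def dual_def by (simp add: mult.commute)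
  qed
  \<comment> \<open>The coefficients of the characters lie in \<Omega>. They determine the field
    \<open>L\<close> and, through the equations they satisfy, finitely many points to be put into
    \<open>S\<close>.\<close>
  define co where "co = (\<Union>i<2*r. mcoeffs (f i))"
  have fin_co: "finite co" unfolding co_def using finite_mcoeffs by blast
  have \<chi>_mem: "\<chi> i a \<in> S" if "ring_set S" "co \<subseteq> S" "i < 2 * r" "\<And>j. j < gdim T \<Longrightarrow> to_ac (a j) \<in> S" for i a S
    unfolding \<chi>_def using that by (intro mev_mem[OF _ f]) (auto simp: co_def mcoeffs_def)
  obtain L where L: "field_set L" "range to_ac \<subseteq> L" "co \<subseteq> L"
    "\<And>g. \<not> alg_over (to_ac ` k) (to_ac g) \<Longrightarrow> finite_over (ratfuns (to_ac ` k) (to_ac g)) L"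
    by (rule exists_splitting_field[OF fin_co]) blast
  obtain H0 where H0: "finite H0" "0 \<notin> H0"
    "\<And>V i p P. valuation_set V \<Longrightarrow> k \<subseteq> V \<Longrightarrow> H0 \<subseteq> V \<Longrightarrow> is_point i p P \<Longrightarrow> dominated V P \<Longrightarrow> P \<in> U"
    by (rule open_contains_centers[OF U]) blast
  \<comment> \<open>Inverses are taken so that a centre outside \<open>U\<close> shows up as a zero
    of some member of \<open>H\<close>.\<close>
  define H where "H = to_ac ` inverse ` H0"
  note k' = field_set_to_ac[OF k]
  define t0 where "t0 = tt v0"
  have dvr0: "dvr v0 t0" unfolding t0_def by (rule tt[OF v0])
  note D0 = dvrD[OF dvr0]
  \<comment> \<open>A place of \<Omega> above \<open>v0\<close>, at which closeness to 1 is
    measured.\<close>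
  obtain W0 where W0: "valuation_set W0" "to_ac ` v0 \<subseteq> W0" "to_ac t0 \<in> max_ideal W0"
  proof (rule exists_valuation_set[OF ring_set_to_ac[OF D0(1)]])
    show "to_ac t0 \<in> to_ac ` v0" using D0(5) by blast
    show "1 \<notin> (\<lambda>a. to_ac t0 * a) ` to_ac ` v0"
    proof
      assume "1 \<in> (\<lambda>a. to_ac t0 * a) ` to_ac ` v0"
      then obtain x where x: "x \<in> v0" "to_ac t0 * to_ac x = 1" by auto
      then have "to_ac (t0 * x) = to_ac 1" by simp
      then have "t0 * x = 1" by (simp only: to_ac_eq_iff)
      then have "inverse t0 \<in> v0" using x(1) by (metis inverse_unique)
      then show False using D0(3,4) unfolding max_ideal_def by simp
    qed
  qed blast
  have place0: "place (to_ac ` k) (to_ac t0) W0"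
    unfolding place_def using W0 I_point[OF v0] point_const_subset(3) by blast
  obtain n0 where n0: "\<And>f. f \<in> L \<Longrightarrow> (f - 1) / to_ac t0 ^ n0 \<in> W0 \<Longrightarrow>
    (\<And>W. valuation_set W \<Longrightarrow> to_ac ` k \<subseteq> W \<Longrightarrow> (\<forall>h\<in>H. h \<notin> max_ideal W) \<Longrightarrow> f \<in> units_of_set W) \<Longrightarrow> f = 1"
  proof (rule units_close_to_one_trivial[OF _ k' L(1) _ _ _ _ _ place0])
    show "CHAR('a alg_closure) = 0" using CHAR_function_field[OF ip] by simp
    show "to_ac ` k \<subseteq> L" "H \<subseteq> L" "to_ac t0 \<in> L" using L(2) unfolding H_def by blast+
    show "finite H" "0 \<notin> H" using H0(1,2) unfolding H_def by auto
    show "to_ac t0 \<noteq> 0" using D0(3) by simp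
    show "finite_over (ratfuns (to_ac ` k) g) L" if "g \<in> insert (to_ac t0) H" "\<not> alg_over (to_ac ` k) g" for g
      using that L(4) unfolding H_def by blast
  qed blast
  have "\<exists>Z. finite Z \<and> (\<forall>P W. Z \<subseteq> P \<longrightarrow> valuation_set W \<longrightarrow> to_ac ` P \<subseteq> W \<longrightarrow> d \<in> W)" for d :: "'a alg_closure"
    by (rule integral_over_subset[of d]) blast
  then obtain Zc where Zc: "\<And>d :: 'a alg_closure. finite (Zc d)"
    "\<And>d P W. Zc d \<subseteq> P \<Longrightarrow> valuation_set W \<Longrightarrow> to_ac ` P \<subseteq> W \<Longrightarrow> d \<in> W"
    by metis
  \<comment> \<open>Where these elements are integral, so are the coefficients of the characters and
    of the maps from the models to \<open>T\<close>.\<close>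
  define Z where "Z = (\<Union>d\<in>co. Zc d) \<union> (\<Union>V\<in>C. \<Union>j<gdim T. mcoeffs (\<phi> V j))"
  have fin_Z: "finite Z" unfolding Z_def using fin_co Zc(1) C_props(1) finite_mcoeffs by blast
  define S where "S = S0 \<union> {v0} \<union> {P \<in> I. \<not> Z \<subseteq> P}"
  have "{P \<in> I. \<not> Z \<subseteq> P} \<subseteq> {P. (\<exists>i p. is_point i p P) \<and> P \<noteq> UNIV \<and> \<not> (Z \<subseteq> P \<and> (\<exists>t. uniformizer P t))}"
    using I_point by blast
  then have "finite {P \<in> I. \<not> Z \<subseteq> P}" using finite_bad_points[OF fin_Z] finite_subset by blast
  then have fin_S: "finite S" unfolding S_def using S0 by blast
  have S_I: "S \<subseteq> I" unfolding S_def using S0 v0 by blast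
  show ?thesis
  proof (rule that[OF fin_S _ S_I])
    show "S0 \<subseteq> S" unfolding S_def by blast
    fix c :: "nat \<Rightarrow> 'a"
    have "\<exists>E. lipschitz_bound P (tt P) (gdim T) c (\<chi> i) E" if "P \<in> I" "i < 2 * r" for P i
      using lipschitz_mev[OF tt[OF that(1)] f[OF that(2)], of c] unfolding \<chi>_def[abs_def] lipschitz_def by blast
    then obtain E where E: "\<And>P i. P \<in> I \<Longrightarrow> i < 2 * r \<Longrightarrow> lipschitz_bound P (tt P) (gdim T) c (\<chi> i) (E P i)"
      by metis
    \<comment> \<open>A crude bound for the sum of any two of the exponents.\<close>
    define D where "D P = 2 * (\<Sum>i<2*r. E P i)" for P
    have ED: "E P i + E P (dual i) \<le> D P" if "i < 2 * r" for P i
    proof -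
      have "E P j \<le> (\<Sum>i<2*r. E P i)" if "j < 2 * r" for j using that by (intro member_le_sum) auto
      then show ?thesis using that dual unfolding D_def by (metis add_mono mult_2)
    qed
    show "\<exists>n. \<forall>a\<in>rational_points T. \<forall>b\<in>rational_points T.
      (\<forall>P\<in>S. \<forall>j<gdim T. val_ge P 0 (a j - c j) \<and> val_ge P 0 (b j - c j) \<and> val_ge P (n P) (a j - b j)) \<longrightarrow>
      (\<forall>P\<in>I - S. diag a P \<in> M P \<and> diag b P \<in> M P) \<longrightarrow> a = b"
    \<comment> \<open>One more than \<open>n0\<close>: at \<open>v0\<close> the exponent
      \<open>n0\<close> is enough, but at every point of \<open>S\<close> at least one factor
      \<open>tt P\<close> must remain, also when \<open>n0 = 0\<close>, to force the quotient of
      characters to be congruent to 1.\<close>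
    proof (intro exI[of _ "\<lambda>P. int (D P + Suc n0)"] ballI impI)
      fix a b assume a: "a \<in> rational_points T" and b: "b \<in> rational_points T"
        and close: "\<forall>P\<in>S. \<forall>j<gdim T. val_ge P 0 (a j - c j) \<and> val_ge P 0 (b j - c j) \<and>
          val_ge P (int (D P + Suc n0)) (a j - b j)"
        and integral: "\<forall>P\<in>I - S. diag a P \<in> M P \<and> diag b P \<in> M P"
      have near: "(\<chi> i a * \<chi> (dual i) b - 1) / to_ac (tt P) ^ Suc n0 \<in> W"
        if i: "i < 2 * r" and P: "P \<in> S" and W: "valuation_set W" "to_ac ` P \<subseteq> W" for i P W
      proof -
        have PI: "P \<in> I" using P S_I by blast
        note vge = dvr_val_ge_iff[OF tt[OF PI]]
        have ac: "\<forall>j<gdim T. a j - c j \<in> P" and bc: "\<forall>j<gdim T. b j - c j \<in> P"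
          using close P vge[of 0] by auto
        have ab: "\<forall>j<gdim T. (a j - b j) / tt P ^ (D P + Suc n0) \<in> P"
        proof (intro allI impI)
          fix j assume "j < gdim T"
          then have "val_ge P (int (D P + Suc n0)) (a j - b j)" using close P by blast
          then have "(a j - b j) * tt P powi - int (D P + Suc n0) \<in> P" unfolding vge .
          then show "(a j - b j) / tt P ^ (D P + Suc n0) \<in> P"
            unfolding power_int_minus power_int_of_nat divide_inverse .
        qed
        show ?thesis
          by (rule lipschitz_product_close[OF tt[OF PI] W E[OF PI i] E[OF PI dual[OF i]] ED[OF i] ac bc ab \<chi>_dual[OF i b]])
      qed
      have close_max: "x \<in> max_ideal W" if x: "x / s ^ Suc n0 \<in> W" and s: "s \<in> max_ideal W" "s \<noteq> 0" and W: "valuation_set W"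
        for x s W
      proof -
        note R = valuation_setD[OF W]
        have "s \<in> W" using s(1) max_ideal_subset by blast
        then have "(s ^ n0 * (x / s ^ Suc n0)) * s \<in> max_ideal W"
          by (intro max_ideal_mult_left[OF R ring_set_mult[OF R ring_set_power[OF R] x] s(1)])
        then show ?thesis using s(2) by simp
      qed
      have "\<chi> i a * \<chi> (dual i) b = 1" if i: "i < 2 * r" for i
      proof (rule n0)
        note RL = field_setD[OF L(1)]
        have L\<chi>: "\<chi> i x \<in> L" if "i < 2 * r" for i x using L(2,3) that by (intro \<chi>_mem[OF RL]) auto
        show "\<chi> i a * \<chi> (dual i) b \<in> L" using i dual by (intro ring_set_mult[OF RL] L\<chi>)
        have v0S: "v0 \<in> S" unfolding S_def by blast
        note RW0 = valuation_setD[OF W0(1)]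
        have "to_ac t0 * ((\<chi> i a * \<chi> (dual i) b - 1) / to_ac t0 ^ Suc n0) \<in> W0"
          using W0(3) max_ideal_subset by (intro ring_set_mult[OF RW0 _ near[OF i v0S W0(1,2), folded t0_def]]) blast
        then show "(\<chi> i a * \<chi> (dual i) b - 1) / to_ac t0 ^ n0 \<in> W0" using D0(3) by simp
        fix W assume W: "valuation_set W" "to_ac ` k \<subseteq> W" "\<forall>h\<in>H. h \<notin> max_ideal W"
        note RW = valuation_setD[OF W(1)]
        \<comment> \<open>The trace of \<open>W\<close> on the function field has a centre on the
          curve, and the condition on \<open>H\<close> places this centre in
          \<open>U\<close>.\<close>
        define V where "V = to_ac -` W"
        have V: "valuation_set V" "k \<subseteq> V" unfolding V_def using valuation_set_vimage[OF W(1)] W(2) by blast+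
        have HV: "H0 \<subseteq> V"
        proof
          fix h assume h: "h \<in> H0"
          then have "to_ac (inverse h) \<notin> max_ideal W" using W(3) unfolding H_def by blast
          then have "inverse (to_ac h) \<notin> max_ideal W" by simp
          then show "h \<in> V" unfolding V_def using valuation_inverse_max_ideal[OF W(1)] by blast
        qed
        obtain ip p P where P: "is_point ip p P" "dominated V P" by (rule exists_center[OF V])
        have PU: "P \<in> U" by (rule H0(3)[OF V HV P])
        have PW: "to_ac ` P \<subseteq> W" using P(2) unfolding dominated_def V_def by blast
        \<comment> \<open>Exchanging \<open>a\<close> and \<open>b\<close> gives the inverse of
          \<open>?g\<close>, so integrality of both expressions makes \<open>?g\<close> a
          unit.\<close>
        let ?g = "\<chi> i a * \<chi> (dual i) b" and ?h = "\<chi> i b * \<chi> (dual i) a"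
        have gh: "?g * ?h = 1"
        proof -
          have "?g * ?h = (\<chi> i a * \<chi> (dual i) a) * (\<chi> i b * \<chi> (dual i) b)" by (simp only: mult_ac)
          then show ?thesis using \<chi>_dual[OF i] a b by simp
        qed
        show "?g \<in> units_of_set W"
        proof (cases "P = UNIV")
          case True
          have "?g \<noteq> 0" using gh by auto
          moreover have "range to_ac \<subseteq> W" using PW unfolding True .
          ultimately show ?thesis by (intro alg_over_unit[OF field_set_range_to_ac _ W(1) alg_over_range_to_ac])
        next
          case False
          then have PI: "P \<in> I" by (rule point_closed[OF U(1) PU])
          show ?thesis
          proof (cases "P \<in> S")
            case True
            note DP = dvrD[OF tt[OF PI]]
            have "tt P \<in> max_ideal V" using DP(4) P(2) unfolding dominated_def by blast
            then have "to_ac (tt P) \<in> max_ideal W" unfolding V_def max_ideal_vimage by blast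
            then have "?g - 1 \<in> max_ideal W" using DP(3) by (intro close_max[OF near[OF i True W(1) PW] _ _ W(1)]) auto
            moreover have "1 \<in> units_of_set W" using RW by (simp add: units_of_set_def)
            ultimately show ?thesis using valuation_add_max_unit[OF W(1)] by blast
          next
            case False
            then have ZP: "Z \<subseteq> P" using PI unfolding S_def by blast
            have coW: "co \<subseteq> W" using ZP Zc(2)[OF _ W(1) PW] unfolding Z_def by blast
            have RP: "ring_set P" by (rule point_const_subset(1)[OF P(1)])
            interpret valued P by (rule I_valued[OF PI])
            have xW: "to_ac (x j) \<in> W" if x: "diag x P \<in> M P" and j: "j < gdim T" for x j
            proof -
              \<comment> \<open>Outside \<open>S\<close> the coordinates of \<open>x\<close> are
                values at a point \<open>\<alpha>\<close> with coordinates in \<open>P\<close>,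
                under polynomials with coefficients in \<open>P\<close>.\<close>
              obtain V' \<alpha> where V': "V' \<in> C" "\<And>i. i < gdim (G V') \<Longrightarrow> \<alpha> i \<in> P" "\<And>j. j < gdim T \<Longrightarrow> x j = mev id (\<phi> V' j) \<alpha>"
                by (rule rational_integral_point[OF TM GM x tt[OF PI]]) metis+
              have "Poly_Mapping.lookup (\<phi> V' j) m \<in> P" if "m \<in> Poly_Mapping.keys (\<phi> V' j)" for m
                using ZP V'(1) j that unfolding Z_def mcoeffs_def by blast
              then have "mev id (\<phi> V' j) \<alpha> \<in> P" by (rule mev_mem[OF RP \<phi>M[OF V'(1) j] _ V'(2)])
              then show ?thesis using V'(3)[OF j] PW by auto
            qed
            have "\<chi> i' x \<in> W" if "i' < 2 * r" "x = a \<or> x = b" for i' x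
              by (rule \<chi>_mem[OF RW coW that(1) xW]) (use integral PI False that(2) in auto)
            then have "?g \<in> W" "?h \<in> W" using i dual[OF i] by (auto intro: ring_set_mult[OF RW])
            moreover have "?h = inverse ?g" using gh by (metis inverse_unique)
            moreover have "?g \<noteq> 0" using gh by auto
            ultimately show ?thesis unfolding units_of_set_def by simp
          qed
        qed
      qed
      then have "\<chi> i a = \<chi> i b" if "i < 2 * r" for i
      proof -
        have "\<chi> i a = \<chi> i a * (\<chi> i b * \<chi> (dual i) b)" using \<chi>_dual[OF that b] by simp
        also have "\<dots> = (\<chi> i a * \<chi> (dual i) b) * \<chi> i b" by (simp only: mult_ac)
        finally show ?thesis using \<open>\<And>i. i < 2 * r \<Longrightarrow> \<chi> i a * \<chi> (dual i) b = 1\<close>[OF that] by simp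
      qed
      then show "a = b" using f_inj[OF a b] unfolding \<chi>_def by blast
    qed
  qed
qed

subsection \<open>The diagonal image\<close>

abbreviation "adelic \<equiv> adelic_points \<X> U U0 T C G \<phi>"

lemma integral_local: assumes "P \<in> I" shows "M P \<subseteq> local_points T P"
  using valued.integral_points_local[OF I_valued[OF assms] TM] GM unfolding gs_iso_def by blast

lemma topspace_local_topology: "P \<in> I \<Longrightarrow> topspace (local_topology T P) = local_points T P"
  using valued.topspace_local I_valued by blast

text \<open>A non-generic point of \<open>U0\<close> is closed in \<open>U0\<close>, so the
  difference consists of points outside \<open>U0\<close>. The generic point is added to the finite
  exceptional set instead of being excluded.\<close>

lemma finite_closed_points_diff: "finite (I - J)"
proof -
  have "I - J \<subseteq> insert UNIV {P. (\<exists>i p. is_point i p P) \<and> P \<noteq> UNIV \<and> P \<notin> U0}"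
    using I_point point_closed[OF U0(1)] by blast
  then show ?thesis using finite_points_outside[OF U0(1,2)] finite_subset by blast
qed

lemma topspace_adelic:
  "topspace adelic = {x \<in> Pi\<^sub>E I (local_points T). finite {P \<in> I \<inter> J. x P \<notin> M P}}"
proof -
  have "Pi\<^sub>E I (\<lambda>P. topspace (local_topology T P)) = Pi\<^sub>E I (local_points T)"
    using topspace_local_topology by (intro PiE_cong)
  then show ?thesis unfolding adelic_points_def
    using topspace_restricted_product[OF finite_closed_points_diff, of M "local_topology T"]
      integral_local topspace_local_topology by simp
qed

text \<open>The points \<open>\<alpha> V\<close> of the models that correspond to \<open>a\<close>
  have finitely many coordinates in all. These lie in \<open>P\<close> for all but finitely many
  \<open>P\<close>, and there they give integral points.\<close>

lemma diagonal_in_adelic: assumes a: "a \<in> rational_points T" shows "diagonal T I a \<in> topspace adelic"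
proof -
  have a0: "mev id q a = 0" if "q \<in> geqs T" for q using a that unfolding rational_points_iff by blast
  have "\<forall>V\<in>C. \<exists>g. gs_hom UNIV T (G V) g \<and> (\<forall>j<gdim T. msubst (\<phi> V j) g - mvar j \<in> gideal 1 UNIV T)"
    using GM unfolding gs_iso_def by blast
  then obtain \<psi> where \<psi>: "\<And>V. V \<in> C \<Longrightarrow> gs_hom UNIV T (G V) (\<psi> V)"
    "\<And>V j. V \<in> C \<Longrightarrow> j < gdim T \<Longrightarrow> msubst (\<phi> V j) (\<psi> V) - mvar j \<in> gideal 1 UNIV T"
    by metis
  define \<alpha> where "\<alpha> V = (\<lambda>i. mev id (\<psi> V i) a)" for V
  define Z where "Z = (\<Union>V\<in>C. \<alpha> V ` {..<gdim (G V)})"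
  have fin_Z: "finite Z" unfolding Z_def using C_props(1) by blast
  have "diag a P \<in> M P" if P: "P \<in> I \<inter> J" "Z \<subseteq> P" "uniformizer P t" for P t
  proof -
    have PI: "P \<in> I" using P(1) by blast
    have "P \<in> U0" using P(1) unfolding closed_points_def by blast
    then obtain V where V: "V \<in> C" "P \<in> V" using C_props(2) by blast
    have GV: "geqs (G V) \<subseteq> mpolys (gdim (G V)) UNIV" using GM[OF V(1)] by blast
    show ?thesis
    proof (rule valued.integral_pointI[where T = T and G = G and \<phi> = \<phi> and V = V and \<alpha> = "\<alpha> V" and a = a, OF I_valued[OF PI] GV \<phi>M[OF V(1)] V I_dvr[OF PI P(3)]])
      show "\<alpha> V i \<in> P" if "i < gdim (G V)" for i using P(2) V(1) that unfolding Z_def by blast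
      show "mev id q (\<alpha> V) = 0" if "q \<in> geqs (G V)" for q
        unfolding \<alpha>_def by (rule gs_hom_point[OF TM \<psi>(1)[OF V(1)] a0 that])
      show "a j = mev id (\<phi> V j) (\<alpha> V)" if "j < gdim T" for j
        unfolding \<alpha>_def by (rule gs_inverse_point[OF TM \<psi>(2)[OF V(1) that] a0, symmetric])
    qed
  qed
  then have "{P \<in> I \<inter> J. diag a P \<notin> M P} \<subseteq>
    insert UNIV {P. (\<exists>i p. is_point i p P) \<and> P \<noteq> UNIV \<and> \<not> (Z \<subseteq> P \<and> (\<exists>t. uniformizer P t))}"
    using I_point by blast
  then have fin: "finite {P \<in> I \<inter> J. diag a P \<notin> M P}"
    using finite_bad_points[OF fin_Z] finite_subset by blast
  have "{P \<in> I \<inter> J. diagonal T I a P \<notin> M P} = {P \<in> I \<inter> J. diag a P \<notin> M P}"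
    unfolding diagonal_def by auto
  moreover have "diagonal T I a \<in> Pi\<^sub>E I (local_points T)"
    unfolding diagonal_def using valued.rational_local_point[OF I_valued TM a] by (intro restrict_PiE_iff[THEN iffD2]) blast
  ultimately show ?thesis unfolding topspace_adelic using fin by simp
qed

section \<open>Neighbourhoods in the restricted product\<close>

definition nbhd :: "('a set \<Rightarrow> nat \<Rightarrow> (nat \<Rightarrow> 'a) set) \<Rightarrow> 'a set set \<Rightarrow> ('a set \<Rightarrow> int) \<Rightarrow> ('a set \<Rightarrow> nat \<Rightarrow> (nat \<Rightarrow> 'a) set) set" where
  "nbhd x S n = Pi\<^sub>E I (\<lambda>P. if P \<in> S then valued.local_ball P T (n P) (x P) else M P)"

text \<open>\<open>S1\<close> collects the closed points without prescribed integral points and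
  those at which \<open>x\<close> is not integral. Any larger finite \<open>S\<close> is allowed,
  which leaves room for further conditions.\<close>

lemma adelic_nbhd:
  assumes x: "x \<in> topspace adelic"
  obtains S1 where "finite S1" "S1 \<subseteq> I"
    "\<And>S n. finite S \<Longrightarrow> S1 \<subseteq> S \<Longrightarrow> S \<subseteq> I \<Longrightarrow> openin adelic (nbhd x S n) \<and> x \<in> nbhd x S n"
proof
  let ?S1 = "(I - J) \<union> {P \<in> I \<inter> J. x P \<notin> M P}"
  show "finite ?S1" using x finite_closed_points_diff unfolding topspace_adelic by blast
  show "?S1 \<subseteq> I" by blast
  fix S n assume S: "finite S" "?S1 \<subseteq> S" "S \<subseteq> I"
  have xP: "x P \<in> local_points T P" if "P \<in> I" for P using x that unfolding topspace_adelic by blast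
  show "openin adelic (nbhd x S n) \<and> x \<in> nbhd x S n"
  proof
    show "openin adelic (nbhd x S n)" unfolding adelic_points_def nbhd_def
      by (rule restricted_product_basic_open[OF S(1,3)])
        (use S xP valued.local_ball_open(1)[OF I_valued] in auto)
    show "x \<in> nbhd x S n" unfolding nbhd_def
    proof (rule PiE_I)
      show "x P \<in> (if P \<in> S then valued.local_ball P T (n P) (x P) else M P)" if "P \<in> I" for P
        using S that valued.local_ball_open(2)[OF I_valued[OF that] xP[OF that]] by auto
      show "x P = undefined" if "P \<notin> I" for P using x that unfolding topspace_adelic by (blast intro: PiE_arb)
    qed
  qed
qed

lemma diagonal_nbhdD:
  assumes "diagonal T I a \<in> nbhd x S n" "P \<in> I"
  shows "P \<in> S \<Longrightarrow> diag a P \<in> valued.local_ball P T (n P) (x P)" "P \<notin> S \<Longrightarrow> diag a P \<in> M P"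
  using PiE_mem[OF assms(1)[unfolded nbhd_def] assms(2)] assms(2) unfolding diagonal_def by simp_all

lemma adelic_separated:
  assumes x: "x \<in> topspace adelic" and d: "d \<in> topspace adelic" and "x \<noteq> d"
  shows "\<exists>N. openin adelic N \<and> x \<in> N \<and> d \<notin> N"
proof -
  have E: "x \<in> Pi\<^sub>E I (local_points T)" "d \<in> Pi\<^sub>E I (local_points T)" using x d unfolding topspace_adelic by blast+
  then obtain P where P: "P \<in> I" "x P \<noteq> d P" using \<open>x \<noteq> d\<close> PiE_ext by metis
  obtain m where m: "d P \<notin> valued.local_ball P T m (x P)"
    by (rule valued.local_ball_separates[OF I_valued[OF P(1)] PiE_mem[OF E(1) P(1)] PiE_mem[OF E(2) P(1)] P(2)])
  obtain S1 where S1: "finite S1" "S1 \<subseteq> I"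
    "\<And>S n. finite S \<Longrightarrow> S1 \<subseteq> S \<Longrightarrow> S \<subseteq> I \<Longrightarrow> openin adelic (nbhd x S n) \<and> x \<in> nbhd x S n"
    by (rule adelic_nbhd[OF x]) blast
  have "openin adelic (nbhd x (insert P S1) (\<lambda>_. m)) \<and> x \<in> nbhd x (insert P S1) (\<lambda>_. m)"
    by (rule S1(3)) (use S1 P in auto)
  moreover have "d \<notin> nbhd x (insert P S1) (\<lambda>_. m)"
  proof
    assume "d \<in> nbhd x (insert P S1) (\<lambda>_. m)"
    from PiE_mem[OF this[unfolded nbhd_def] P(1)] m show False by simp
  qed
  ultimately show ?thesis by blast
qed

text \<open>It suffices to find a neighbourhood in which any two diagonal points coincide. If a
  first neighbourhood contains no diagonal point, it does; otherwise one of them provides the centre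
  \<open>c\<close> on which the exponents of the second neighbourhood depend.\<close>

lemma diagonal_locally_subsingleton:
  assumes x: "x \<in> topspace adelic"
  shows "\<exists>N e. openin adelic N \<and> x \<in> N \<and> diagonal T I ` rational_points T \<inter> N \<subseteq> {e}"
proof -
  obtain S1 where S1: "finite S1" "S1 \<subseteq> I"
    "\<And>S n. finite S \<Longrightarrow> S1 \<subseteq> S \<Longrightarrow> S \<subseteq> I \<Longrightarrow> openin adelic (nbhd x S n) \<and> x \<in> nbhd x S n"
    by (rule adelic_nbhd[OF x]) blast
  have xP: "x P \<in> local_points T P" if "P \<in> I" for P using x that unfolding topspace_adelic by blast
  have ball: "val_ge P (n P) (a j - b j)"
    if "P \<in> S" "S \<subseteq> I" "diagonal T I a \<in> nbhd x S n" "diagonal T I b \<in> nbhd x S n" "j < gdim T" for P S n a b j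
    using that valued.local_ball_rational[OF I_valued xP] diagonal_nbhdD(1) by blast
  have ex: "\<exists>N e. openin adelic N \<and> x \<in> N \<and> diagonal T I ` rational_points T \<inter> N \<subseteq> {e}"
    if N: "openin adelic N" "x \<in> N"
      and eq: "\<And>a b. a \<in> rational_points T \<Longrightarrow> b \<in> rational_points T \<Longrightarrow> diagonal T I a \<in> N \<Longrightarrow> diagonal T I b \<in> N \<Longrightarrow> a = b"
    for N
  proof (cases "diagonal T I ` rational_points T \<inter> N = {}")
    case False
    then obtain b where b: "b \<in> rational_points T" "diagonal T I b \<in> N" by blast
    then have "diagonal T I ` rational_points T \<inter> N \<subseteq> {diagonal T I b}" using eq by blast
    then show ?thesis using N by blast
  qed (use N in blast)
  \<comment> \<open>Either one local factor alone separates rational points, or there are no factors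
    and the diagonal image is a single point, or all points have uniformizers and the argument with
    characters applies.\<close>
  consider P0 where "P0 \<in> I" "\<nexists>t. uniformizer P0 t" | "I = {}"
    | v0 where "v0 \<in> I" "\<And>P. P \<in> I \<Longrightarrow> \<exists>t. uniformizer P t" by blast
  then show ?thesis
  proof cases
    case 1 \<comment> \<open>the topology at \<open>P0\<close> is discrete\<close>
    obtain c where c: "\<And>n y. val_ge P0 n y \<longleftrightarrow> y = 0 \<or> n \<le> c" by (rule val_ge_junk[OF 1(2)]) blast
    let ?N = "nbhd x (insert P0 S1) (\<lambda>_. c + 1)"
    have N: "openin adelic ?N \<and> x \<in> ?N" by (rule S1(3)) (use S1 1 in auto)
    show ?thesis
    proof (rule ex[of ?N])
      fix a b assume a: "a \<in> rational_points T" "diagonal T I a \<in> ?N" and b: "b \<in> rational_points T" "diagonal T I b \<in> ?N"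
      show "a = b"
      proof (rule extensionalityI)
        show "a \<in> extensional {..<gdim T}" "b \<in> extensional {..<gdim T}" using a(1) b(1) rational_points_iff by blast+
        show "a j = b j" if "j \<in> {..<gdim T}" for j
          using ball[OF _ _ a(2) b(2), of P0 j] c 1(1) S1(2) that by auto
      qed
    qed (use N in blast)+
  next
    case 2
    have "diagonal T I ` rational_points T \<subseteq> {\<lambda>_. undefined}" unfolding diagonal_def 2 by auto
    then show ?thesis using x by blast
  next
    case 3
    obtain S where S: "finite S" "S1 \<subseteq> S" "S \<subseteq> I"
      "\<And>c. \<exists>n. \<forall>a\<in>rational_points T. \<forall>b\<in>rational_points T.
        (\<forall>P\<in>S. \<forall>j<gdim T. val_ge P 0 (a j - c j) \<and> val_ge P 0 (b j - c j) \<and> val_ge P (n P) (a j - b j)) \<longrightarrow>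
        (\<forall>P\<in>I - S. diag a P \<in> M P \<and> diag b P \<in> M P) \<longrightarrow> a = b"
      by (rule congruent_rational_points_eq[OF 3(2,1) S1(1,2)]) metis+
    \<comment> \<open>Level 0 makes all rational points of \<open>?N1\<close> congruent to each
      other modulo the local rings at \<open>S\<close>, which bounds their denominators in terms of
      any one of them.\<close>
    let ?N1 = "nbhd x S (\<lambda>_. 0)"
    have N1: "openin adelic ?N1 \<and> x \<in> ?N1" by (rule S1(3)[OF S(1-3)])
    show ?thesis
    proof (cases "\<exists>c\<in>rational_points T. diagonal T I c \<in> ?N1")
      case False
      then show ?thesis using ex[of ?N1] N1 by blast
    next
      case True
      then obtain c where c: "diagonal T I c \<in> ?N1" by blast
      obtain n where n: "\<forall>a\<in>rational_points T. \<forall>b\<in>rational_points T.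
        (\<forall>P\<in>S. \<forall>j<gdim T. val_ge P 0 (a j - c j) \<and> val_ge P 0 (b j - c j) \<and> val_ge P (n P) (a j - b j)) \<longrightarrow>
        (\<forall>P\<in>I - S. diag a P \<in> M P \<and> diag b P \<in> M P) \<longrightarrow> a = b" using S(4)[of c] by blast
      let ?N2 = "nbhd x S n"
      have N2: "openin adelic ?N2 \<and> x \<in> ?N2" by (rule S1(3)[OF S(1-3)])
      show ?thesis
      proof (rule ex[of "?N1 \<inter> ?N2"])
        show "openin adelic (?N1 \<inter> ?N2)" "x \<in> ?N1 \<inter> ?N2" using N1 N2 by auto
        fix a b assume a: "a \<in> rational_points T" "diagonal T I a \<in> ?N1 \<inter> ?N2"
          and b: "b \<in> rational_points T" "diagonal T I b \<in> ?N1 \<inter> ?N2"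
        have "\<forall>P\<in>S. \<forall>j<gdim T. val_ge P 0 (a j - c j) \<and> val_ge P 0 (b j - c j) \<and> val_ge P (n P) (a j - b j)"
          using ball[OF _ S(3) _ c] ball[OF _ S(3), of _ a n b] a(2) b(2) by simp
        moreover have "\<forall>P\<in>I - S. diag a P \<in> M P \<and> diag b P \<in> M P"
          using diagonal_nbhdD(2) a(2) b(2) by blast
        ultimately show "a = b" using n a(1) b(1) by blast
      qed
    qed
  qed
qed

lemma diagonal_closed_discrete:
  "closedin adelic (diagonal T I ` rational_points T) \<and>
   subtopology adelic (diagonal T I ` rational_points T) = discrete_topology (diagonal T I ` rational_points T)"
proof (rule closed_discrete_if_locally_subsingleton)
  show sub: "diagonal T I ` rational_points T \<subseteq> topspace adelic" using diagonal_in_adelic by blast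
  show "\<exists>N. openin adelic N \<and> x \<in> N \<and> d \<notin> N"
    if "x \<in> topspace adelic" "d \<in> diagonal T I ` rational_points T" "x \<noteq> d" for x d
    using adelic_separated[OF that(1) _ that(3)] that(2) sub by blast
qed (rule diagonal_locally_subsingleton)

end

theorem mainTheorem1:
  fixes \<X> :: "('k::field_char_0, 'a::field) pscheme"
    and T :: "'a gscheme"
    and U U0 :: "'a set set"
    and C :: "'a set set set"
    and G :: "'a set set \<Rightarrow> 'a gscheme"
    and \<phi> :: "'a set set \<Rightarrow> nat \<Rightarrow> 'a mpoly"
  assumes "smooth_projective_curve \<X>" and "geometrically_integral \<X>"
    and "openin (zariski \<X>) U" and "U \<noteq> {}"
    and "torus_over_field T"
    and "openin (zariski \<X>) U0" and "U0 \<noteq> {}" and "U0 \<subseteq> U"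
    and "torus_extending \<X> U0 T C G \<phi>"
  shows "closedin (adelic_points \<X> U U0 T C G \<phi>)
             (diagonal T (closed_points \<X> U) ` rational_points T) \<and>
         subtopology (adelic_points \<X> U U0 T C G \<phi>)
             (diagonal T (closed_points \<X> U) ` rational_points T)
           = discrete_topology (diagonal T (closed_points \<X> U) ` rational_points T)"
  by (rule torus_model.diagonal_closed_discrete)
    (use assms in \<open>simp add: torus_model_def torus_model_axioms_def curve_def\<close>)

end
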